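(* For every fixed positive integer $m$, $$|\mathrm{Sk}_{<E_3(x^m)}|<\omega_{10}.$$
   Context: $\mathrm{Sk}$ (the Skolem functions) is the smallest set of germs at $+\infty$ of positive real functions containing the constant $1$ and the identity $x$ and closed under addition, multiplication and exponentiation $(f,g)\mapsto f^g$. Germs are compared by eventual order: $f<g$ means $f(x)<g(x)$ for all sufficiently large $x$; functions that agree eventually are identified. It is known that this is a well-order on $\mathrm{Sk}$. For a positive germ $R$, $\mathrm{Sk}_{<R}=\{f\in\mathrm{Sk}: f<R\}$. $|A|$ denotes the order type (not cardinality) of a well-ordered set $A$. $E_0(u)=u$, $E_{n+1}(u)=2^{E_n(u)}$, so $E_3(x^m)=2^{2^{2^{x^m}}}$. Ordinals: $\omega_0=1$ and $\omega_{k+1}=\omega^{\omega_k}$ (finite towers of ordinal exponentials, not cardinals). *)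

theory Defs
  imports Complex_Main "HOL-Library.Multiset"
begin

section \<open>Germs at infinity and the Skolem functions\<close>

quotient_type germ =
  "real \<Rightarrow> real" / "\<lambda>f g. eventually (\<lambda>x. f x = g x) at_top"
  morphisms rep_germ germ_of
proof (rule equivpI)
  show "reflp (\<lambda>f g :: real \<Rightarrow> real. eventually (\<lambda>x. f x = g x) at_top)"
    by (simp add: reflp_def)
  show "symp (\<lambda>f g :: real \<Rightarrow> real. eventually (\<lambda>x. f x = g x) at_top)"
    by (auto simp: symp_def elim: eventually_mono)
  show "transp (\<lambda>f g :: real \<Rightarrow> real. eventually (\<lambda>x. f x = g x) at_top)"
    by (auto simp: transp_def elim: eventually_elim2)
qed

text \<open>
  On all germs the order below is only partial; \<open>f \<le> g\<close> means that \<open>f\<close> is eventually strictly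
  below \<open>g\<close> or that the two germs coincide.
\<close>

instantiation germ :: "{one, plus, times, order}"
begin

lift_definition one_germ :: germ is "\<lambda>_. 1" .

lift_definition plus_germ :: "germ \<Rightarrow> germ \<Rightarrow> germ" is "\<lambda>f g x. f x + g x"
  by (auto elim: eventually_elim2)

lift_definition times_germ :: "germ \<Rightarrow> germ \<Rightarrow> germ" is "\<lambda>f g x. f x * g x"
  by (auto elim: eventually_elim2)

lift_definition less_germ :: "germ \<Rightarrow> germ \<Rightarrow> bool"
  is "\<lambda>f g. eventually (\<lambda>x. f x < g x) at_top"
proof (intro iffI)
  fix f f' g g' :: "real \<Rightarrow> real"
  assume eq: "eventually (\<lambda>x. f x = f' x) at_top" "eventually (\<lambda>x. g x = g' x) at_top"
  show "eventually (\<lambda>x. f' x < g' x) at_top" if "eventually (\<lambda>x. f x < g x) at_top"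
    using eq that by eventually_elim simp
  show "eventually (\<lambda>x. f x < g x) at_top" if "eventually (\<lambda>x. f' x < g' x) at_top"
    using eq that by eventually_elim simp
qed

definition less_eq_germ :: "germ \<Rightarrow> germ \<Rightarrow> bool" where
  "f \<le> g \<longleftrightarrow> f < g \<or> f = (g :: germ)"

instance
proof
  have irr: "\<not> f < f" for f :: germ
    by transfer simp
  have tr: "f < h" if "f < g" "g < h" for f g h :: germ
    using that by transfer (auto elim: eventually_elim2)
  fix f g h :: germ
  show "f < g \<longleftrightarrow> f \<le> g \<and> \<not> g \<le> f"
    unfolding less_eq_germ_def by (metis irr tr)
  show "f \<le> f" by (simp add: less_eq_germ_def)
  show "f \<le> h" if "f \<le> g" "g \<le> h"
    using that unfolding less_eq_germ_def by (metis tr)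
  show "f = g" if "f \<le> g" "g \<le> f"
    using that unfolding less_eq_germ_def by (metis irr tr)
qed

end

text \<open>
  Real exponentiation \<^const>\<open>powr\<close> has its usual meaning only for positive bases; all Skolem
  functions are eventually positive.
\<close>

lift_definition germ_powr :: "germ \<Rightarrow> germ \<Rightarrow> germ" is "\<lambda>f g x. f x powr g x"
  by (auto elim: eventually_elim2)

inductive_set Sk :: "germ set" where
  one: "1 \<in> Sk"
| ident: "germ_of (\<lambda>x. x) \<in> Sk"
| add: "f \<in> Sk \<Longrightarrow> g \<in> Sk \<Longrightarrow> f + g \<in> Sk"
| mult: "f \<in> Sk \<Longrightarrow> g \<in> Sk \<Longrightarrow> f * g \<in> Sk"
| powr: "f \<in> Sk \<Longrightarrow> g \<in> Sk \<Longrightarrow> germ_powr f g \<in> Sk"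

definition Sk_below :: "germ \<Rightarrow> germ set" where
  "Sk_below R = {f \<in> Sk. f < R}"

primrec iter_exp2 :: "nat \<Rightarrow> real \<Rightarrow> real" where
  "iter_exp2 0 u = u"
| "iter_exp2 (Suc n) u = 2 powr iter_exp2 n u"


section \<open>Order types\<close>

text \<open>
  As in the library's theory of well-orders, the ordinals are the well-order relations up to
  \<^const>\<open>ordIso\<close>, and \<^const>\<open>ordLess\<close> is the strict order between them (it includes that
  both relations are well-orders).
\<close>

notation ordLess2 (infix \<open><o\<close> 50)

definition order_type :: "'a::order set \<Rightarrow> 'a rel" where
  "order_type A = {(a, b). a \<in> A \<and> b \<in> A \<and> a \<le> b}"

text \<open>
  The ordinal power \<open>\<omega>\<^sup>r\<close>, realized in the standard way as the finitely supported functions from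
  the field of \<open>r\<close> to the natural numbers, compared at the largest argument where they differ. A
  finitely supported function is represented by a multiset \<open>M\<close>, via its multiplicity function; it
  stands for the Cantor normal form in which \<open>\<omega>\<^sup>a\<close> has coefficient \<open>count M a\<close>.
\<close>

definition omega_power :: "'a rel \<Rightarrow> 'a multiset rel" where
  "omega_power r = {(M, N). set_mset M \<subseteq> Field r \<and> set_mset N \<subseteq> Field r \<and>
     (M = N \<or> (\<exists>a \<in> Field r. count M a < count N a \<and>
        (\<forall>b. (a, b) \<in> r \<and> b \<noteq> a \<longrightarrow> count M b = count N b)))}"

text \<open>
  All finite towers \<open>\<omega>\<^sub>0 = 1\<close>, \<open>\<omega>\<^sub>k\<^sub>+\<^sub>1 = \<omega>\<^bsup>\<omega>\<^sub>k\<^esup>\<close> are to be relations on a single type. Since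
  \<open>Node\<close> is injective, the image under \<open>Node\<close> is just an isomorphic copy.
\<close>

datatype tree = Node "tree multiset"

primrec omega_tower :: "nat \<Rightarrow> tree rel" where
  "omega_tower 0 = {(Node {#}, Node {#})}"
| "omega_tower (Suc k) = dir_image (omega_power (omega_tower k)) Node"

end

theory Submission
  imports Defs "HOL-Library.Multiset_Order" "HOL-Computational_Algebra.Polynomial"
    "HOL-Computational_Algebra.Fundamental_Theorem_Algebra" "HOL-Library.Landau_Symbols"
begin

text \<open>
  Every Skolem function is a finite sum of products of \<open>x\<close> and of powers \<open>f^g\<close> with \<open>f \<ge> 2\<close> and
  \<open>g\<close> infinite, and it grows like the largest of these products. Sets of Skolem functions are
  therefore measured in two stages: first the growth classes of products between two bounds are
  counted, then the functions themselves in terms of these classes. A set of sums \<open>c + r\<close> of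
  bounded range, with \<open>c\<close> and \<open>r\<close> from well-ordered sets, splits into finitely many boxes
  (\<open>box_cover\<close>). In a box a difference of two sums can be charged to the leading products or to
  the rests, and the natural product of ordinals adds up the two charges (\<open>sm_product\<close>). The
  logarithm turns a leading product into a sum of terms \<open>g \<cdot> ln f\<close>, where differences of smaller
  functions \<open>f\<close> and \<open>g\<close> appear; so everything goes by well-founded induction.

  Two estimates come out. If the products whose growth lies between \<open>\<sigma>\<close> and \<open>\<rho>\<close> have fewer than
  \<open>b\<close> classes, then a set of Skolem functions with differences at most of order \<open>\<rho>\<close>, compared at
  resolution \<open>\<sigma>\<close>, has type below \<open>\<omega>^(\<omega>^b)\<close> (\<open>claims\<close>). The products whose logarithms differ by at
  most the order of \<open>\<eta>\<close> have fewer than \<open>\<omega>^(\<omega>^b)\<close> classes, where \<open>b\<close> is essentially the number of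
  classes in an interval of ratio \<open>\<eta>\<close> (\<open>claimC_all\<close>). The logarithm of a product grows like \<open>v\<close> or
  like \<open>v \<cdot> ln x\<close> for a product \<open>v\<close> (\<open>lg_Q_asy\<close>), so the logarithms of products are again counted
  by products. Consequently each exponential in the ratio costs two exponentials of \<open>\<omega>\<close>
  (\<open>few_step\<close>). An interval of ratio \<open>x^M\<close> contains fewer than \<open>\<omega>_2\<close> classes, because there is
  nothing between bounded quotients and quotients above \<open>ln x\<close> (\<open>few_base\<close>). Three exponentials
  lead to \<open>\<omega>_8\<close>, and the passage from classes to functions to \<open>\<omega>_10\<close> (\<open>skolem_tower_bound\<close>).

  This argument takes place in an ordered field that contains the Skolem functions and enough
  logarithms, and in which no positive element that has a logarithm grows strictly between all
  constants and \<open>ln x\<close>, or exactly like \<open>ln x\<close>. Such a field is obtained in the variable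
  \<open>\<tau> = ln (ln x)\<close>, as a maximal Hardy field among those whose nonzero elements are bounded and
  bounded away from zero, or at least exponentially large, or at most exponentially small in \<open>\<tau>\<close>.
  By maximality it contains the roots of its polynomials (\<open>roots_in_hf\<close>), the exponentials of its
  elements (\<open>In_exp\<close>) and the logarithms of its bounded positive elements that stay away from zero
  (\<open>In_ln_unit\<close>). In view of \<open>ln (a + b) = ln a + ln (1 + b / a)\<close> these logarithms suffice to
  close the Skolem functions under sums. An infinite element with a logarithm has an exponentially
  large one, hence exceeds \<open>exp (2 \<tau>) = (ln x)^2\<close>; this is the gap (\<open>hf_gap\<close>).
\<close>

section \<open>Ordinals below epsilon-zero\<close>

text \<open>
  A tree stands for the ordinal \<open>\<omega>^a_1 + \<dots> + \<omega>^a_n\<close> in Cantor normal form whose exponents are its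
  children, with repetition. Two such ordinals compare like the multisets of their exponents,
  under the multiset extension of the order of ordinals. This circular description becomes a
  recursion on the height of the trees.
\<close>

primrec tree_less_upto :: "nat => tree rel" where
  "tree_less_upto 0 = {}"
| "tree_less_upto (Suc n) = {(Node M, Node N) |M N. (M, N) \<in> mult (tree_less_upto n)}"

primrec trees_upto :: "nat => tree set" where
  "trees_upto 0 = {}"
| "trees_upto (Suc n) = {Node M |M. set_mset M \<subseteq> trees_upto n}"

lemma tree_less_upto_Suc_mono: "tree_less_upto n \<subseteq> tree_less_upto (Suc n)"
proof (induction n)
  case (Suc n)
  then show ?case using mono_mult[OF Suc] by auto
qed simp

lemma tree_less_upto_mono: "n <= m ==> tree_less_upto n \<subseteq> tree_less_upto m"
  by (induction rule: dec_induct) (use tree_less_upto_Suc_mono in blast)+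

lemma trees_upto_Suc_mono: "trees_upto n \<subseteq> trees_upto (Suc n)"
  by (induction n) auto

lemma trees_upto_mono: "n <= m ==> trees_upto n \<subseteq> trees_upto m"
  by (induction rule: dec_induct) (use trees_upto_Suc_mono in blast)+

lemma trees_upto_cover: "\<exists>n. t \<in> trees_upto n"
proof (induction t)
  case (Node M)
  have "\<exists>n. set_mset M \<subseteq> trees_upto n"
  proof -
    have "\<forall>x\<in>#M. \<exists>n. x \<in> trees_upto n" using Node by blast
    then obtain f where f: "\<And>x. x \<in># M ==> x \<in> trees_upto (f x)" by metis
    have "x \<in> trees_upto (Max (f ` set_mset M))" if "x \<in># M" for x
      using f[OF that] trees_upto_mono[of "f x" "Max (f ` set_mset M)"] that by auto
    then show ?thesis by blast
  qed
  then obtain n where "set_mset M \<subseteq> trees_upto n" by blast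
  then have "Node M \<in> trees_upto (Suc n)" by auto
  then show ?case by blast
qed

lemma wf_tree_less_upto: "wf (tree_less_upto n)"
proof (induction n)
  case (Suc n)
  have "tree_less_upto (Suc n) = inv_image (mult (tree_less_upto n)) (\<lambda>t. case t of Node M => M)"
    by (auto simp: inv_image_def split: tree.splits) (metis tree.exhaust)
  then show ?case using wf_mult[OF Suc] by (simp add: wf_inv_image)
qed simp

lemma trans_tree_less_upto: "trans (tree_less_upto n)"
proof (cases n)
  case (Suc m)
  have "trans (mult (tree_less_upto m))" by (simp add: mult_def)
  then show ?thesis unfolding Suc by (auto simp: trans_def)
qed simp

instantiation tree :: wellorder
begin

definition less_tree :: "tree => tree => bool" where
  "s < t \<longleftrightarrow> (\<exists>n. (s, t) \<in> tree_less_upto n)"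

definition less_eq_tree :: "tree => tree => bool" where
  "s <= t \<longleftrightarrow> s < t \<or> s = (t :: tree)"

lemma trans_tree_less: "trans {(s, t :: tree). s < t}"
proof (rule transI)
  fix a b c :: tree
  assume "(a, b) \<in> {(s, t). s < t}" "(b, c) \<in> {(s, t). s < t}"
  then obtain m n where "(a, b) \<in> tree_less_upto m" "(b, c) \<in> tree_less_upto n"
    by (auto simp: less_tree_def)
  then have "(a, b) \<in> tree_less_upto (max m n)" "(b, c) \<in> tree_less_upto (max m n)"
    using tree_less_upto_mono[of m "max m n"] tree_less_upto_mono[of n "max m n"] by auto
  then have "(a, c) \<in> tree_less_upto (max m n)" using trans_tree_less_upto by (meson transD)
  then show "(a, c) \<in> {(s, t). s < t}" by (auto simp: less_tree_def)
qed

lemma Node_less_Node_mult: "Node M < Node N \<longleftrightarrow> (M, N) \<in> mult {(s, t). s < t}"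
proof
  assume "Node M < Node N"
  then obtain n where "(Node M, Node N) \<in> tree_less_upto n" by (auto simp: less_tree_def)
  then obtain m where "(M, N) \<in> mult (tree_less_upto m)" by (cases n) auto
  moreover have "tree_less_upto m \<subseteq> {(s, t). s < t}" by (auto simp: less_tree_def)
  ultimately show "(M, N) \<in> mult {(s, t). s < t}" using mono_mult by blast
next
  assume "(M, N) \<in> mult {(s, t). s < t}"
  from mult_implies_one_step[OF trans_tree_less this] obtain I J K where
    *: "N = I + J" "M = I + K" "J ~= {#}" "\<forall>k\<in>#K. \<exists>j\<in>#J. k < j" by auto
  then have "\<forall>k\<in>#K. \<exists>j\<in>#J. \<exists>n. (k, j) \<in> tree_less_upto n" by (simp add: less_tree_def)
  then obtain j n where jn: "\<And>k. k \<in># K ==> j k \<in># J \<and> (k, j k) \<in> tree_less_upto (n k)" by metis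
  define m where "m = Max (n ` set_mset K)"
  have "(k, j k) \<in> tree_less_upto m" if "k \<in># K" for k
    using jn[OF that] tree_less_upto_mono[of "n k" m] that by (auto simp: m_def)
  then have "(M, N) \<in> mult (tree_less_upto m)"
    unfolding * using jn *(3) by (intro one_step_implies_mult) auto
  then have "(Node M, Node N) \<in> tree_less_upto (Suc m)" by simp
  then show "Node M < Node N" unfolding less_tree_def by blast
qed

lemma Node_less_Node_one_step:
  assumes "Node M < Node N"
  obtains I J K where "N = I + J" "M = I + K" "J ~= {#}" "\<forall>k\<in>#K. \<exists>j\<in>#J. k < j"
  using mult_implies_one_step[OF trans_tree_less assms[unfolded Node_less_Node_mult]] by auto

lemma trees_upto_downward: "s < t ==> t \<in> trees_upto n ==> s \<in> trees_upto n"
proof (induction n arbitrary: s t)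
  case (Suc n)
  from Suc.prems(2) obtain N where N: "t = Node N" "set_mset N \<subseteq> trees_upto n" by auto
  obtain M where M: "s = Node M" by (cases s)
  from Suc.prems(1)[unfolded N M] obtain I J K where
    *: "N = I + J" "M = I + K" "\<forall>k\<in>#K. \<exists>j\<in>#J. k < j"
    by (rule Node_less_Node_one_step)
  have "x \<in> trees_upto n" if "x \<in># M" for x
  proof (cases "x \<in># I")
    case True
    then show ?thesis using * N by auto
  next
    case False
    then have "x \<in># K" using * that by simp
    then obtain j where "j \<in># J" "x < j" using * by blast
    then show ?thesis using Suc.IH[of x j] * N by auto
  qed
  then show ?case using M by auto
qed simp

lemma tree_less_upto_complete:
  "s < t ==> s \<in> trees_upto n ==> t \<in> trees_upto n ==> (s, t) \<in> tree_less_upto n"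
proof (induction n arbitrary: s t)
  case (Suc n)
  from Suc.prems(2,3) obtain M N where N: "t = Node N" "set_mset N \<subseteq> trees_upto n"
    "s = Node M" "set_mset M \<subseteq> trees_upto n" by auto
  from Suc.prems(1)[unfolded N] obtain I J K where
    *: "N = I + J" "M = I + K" "J ~= {#}" "\<forall>k\<in>#K. \<exists>j\<in>#J. k < j"
    by (rule Node_less_Node_one_step)
  have "(M, N) \<in> mult (tree_less_upto n)"
    unfolding * using * N Suc.IH by (intro one_step_implies_mult) (auto, blast)
  then show ?case using N by auto
qed simp

lemma wf_tree_less: "wf {(s, t :: tree). s < t}"
proof (rule wfI_min)
  fix x :: tree and Q assume "x \<in> Q"
  obtain n where n: "x \<in> trees_upto n" using trees_upto_cover by blast
  obtain z where z: "z \<in> Q \<inter> trees_upto n" "\<And>y. (y, z) \<in> tree_less_upto n ==> y \<notin> Q \<inter> trees_upto n"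
    using wfE_min[OF wf_tree_less_upto, of x "Q \<inter> trees_upto n"] \<open>x \<in> Q\<close> n by blast
  have "y \<notin> Q" if "y < z" for y
    using z tree_less_upto_complete[OF that] trees_upto_downward[OF that] by blast
  then show "\<exists>z\<in>Q. \<forall>y. (y, z) \<in> {(s, t). s < t} --> y \<notin> Q" using z by blast
qed

lemma total_tree_less_upto: "total_on (trees_upto n) {(s, t :: tree). s < t}"
proof (induction n)
  case (Suc n)
  show ?case
  proof (rule total_onI)
    fix s t assume "s \<in> trees_upto (Suc n)" "t \<in> trees_upto (Suc n)" "s ~= t"
    then obtain M N where "s = Node M" "t = Node N" "M ~= N"
      "set_mset M \<subseteq> trees_upto n" "set_mset N \<subseteq> trees_upto n" by auto
    moreover have "total_on {M. set_mset M \<subseteq> trees_upto n} (mult {(s, t :: tree). s < t})"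
      by (rule total_on_mult[OF Suc trans_tree_less]) auto
    ultimately show "(s, t) \<in> {(s, t). s < t} \<or> (t, s) \<in> {(s, t). s < t}"
      by (simp add: Node_less_Node_mult total_on_def)
  qed
qed simp

instance
proof
  have irr: "\<not> s < s" for s :: tree using wf_not_refl[OF wf_tree_less, of s] by simp
  have tr: "a < c" if "a < b" "b < c" for a b c :: tree
    using transD[OF trans_tree_less, of a b c] that by simp
  fix s t u :: tree
  show "s < t \<longleftrightarrow> s <= t \<and> \<not> t <= s" unfolding less_eq_tree_def by (metis irr tr)
  show "s <= s" by (simp add: less_eq_tree_def)
  show "s <= u" if "s <= t" "t <= u" using that unfolding less_eq_tree_def by (metis tr)
  show "s = t" if "s <= t" "t <= s" using that unfolding less_eq_tree_def by (metis irr tr)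
  obtain m n where "s \<in> trees_upto m" "t \<in> trees_upto n" using trees_upto_cover by metis
  then have "s \<in> trees_upto (max m n)" "t \<in> trees_upto (max m n)"
    using trees_upto_mono[of m "max m n"] trees_upto_mono[of n "max m n"] by auto
  then have "s < t \<or> t < s \<or> s = t" using total_tree_less_upto[of "max m n"] by (auto simp: total_on_def)
  then show "s <= t \<or> t <= s" by (auto simp: less_eq_tree_def)
  fix P :: "tree => bool"
  show "P s" if "\<And>s. (\<And>t. t < s ==> P t) ==> P s"
    using wf_induct[OF wf_tree_less, of P s] that by blast
qed

end

lemma Node_less_Node [simp]: "Node M < Node N \<longleftrightarrow> M < N"
  by (simp add: Node_less_Node_mult less_multiset_def multp_def)

lemma Node_le_Node [simp]: "Node M <= Node N \<longleftrightarrow> M <= N"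
  unfolding less_eq_tree_def le_less[of M N] by auto

primrec cnf :: "tree => tree multiset" where
  "cnf (Node M) = M"

lemma Node_cnf [simp]: "Node (cnf t) = t"
  by (cases t) simp

lemma cnf_less: "cnf s < cnf t \<longleftrightarrow> s < t"
  by (cases s; cases t) simp

text \<open>
  Union of multisets is the natural (Hessenberg) sum. It is commutative and strictly monotone in
  both arguments, which the ordinary sum of ordinals is not.
\<close>

instantiation tree :: cancel_comm_monoid_add
begin

definition zero_tree :: tree where
  "0 = Node {#}"

definition plus_tree :: "tree => tree => tree" where
  "s + t = Node (cnf s + cnf t)"

definition minus_tree :: "tree => tree => tree" where
  "s - t = Node (cnf s - cnf t)"

instance
  by standard (simp_all add: zero_tree_def plus_tree_def minus_tree_def ac_simps)

end

instance tree :: linordered_cancel_ab_semigroup_add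
proof
  fix a b c :: tree
  show "a <= b ==> c + a <= c + b"
    by (cases a; cases b; cases c) (simp add: plus_tree_def)
qed

lemma zero_le_tree [simp]: "0 <= (t :: tree)"
  by (cases t) (simp add: zero_tree_def)

lemma not_less_zero_tree [simp]: "\<not> t < (0 :: tree)"
  by (simp add: not_less)

lemma cnf_zero [simp]: "cnf 0 = {#}"
  by (simp add: zero_tree_def)

lemma cnf_plus [simp]: "cnf (s + t) = cnf s + cnf t"
  by (simp add: plus_tree_def)

text \<open>
  The ordinal power \<open>\<omega>^a\<close>; in particular \<open>om 0\<close> is the ordinal one.
\<close>

definition om :: "tree => tree" where
  "om a = Node {#a#}"

lemma cnf_om [simp]: "cnf (om a) = {#a#}"
  by (simp add: om_def)

lemma om_less_om [simp]: "om a < om b \<longleftrightarrow> a < b"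
  by (simp add: om_def)

lemma om_le_om [simp]: "om a <= om b \<longleftrightarrow> a <= b"
  by (metis linorder_not_less om_less_om)

lemma less_om_iff: "t < om b \<longleftrightarrow> (\<forall>x\<in>#cnf t. x < b)"
  by (cases t) (simp add: om_def)

lemma zero_less_om [simp]: "0 < om b"
  by (simp add: less_om_iff zero_tree_def)

lemma plus_less_om: "s < om b ==> t < om b ==> s + t < om b"
  by (auto simp: less_om_iff)

lemma less_plus_om_zero: "(t :: tree) < t + om 0"
  using add_strict_left_mono[OF zero_less_om[of 0], of t] by simp

lemma less_om_zero_iff: "t < om 0 \<longleftrightarrow> t = 0"
proof -
  have "t < om 0 \<longleftrightarrow> cnf t = {#}" by (simp add: less_om_iff)
  then show ?thesis by (cases t) (simp add: zero_tree_def)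
qed

text \<open>
  Natural addition of one is the successor operation. In passing from \<open>t\<close> down to \<open>s\<close> some
  exponents are replaced by smaller ones. If there are any replacements, an exponent zero may be
  added to them; otherwise an exponent is dropped, and zero does not exceed it.
\<close>

lemma plus_one_le_tree: "s < t ==> s + om 0 <= (t :: tree)"
proof -
  assume "s < t"
  obtain M N where MN: "s = Node M" "t = Node N" by (cases s; cases t)
  from \<open>s < t\<close>[unfolded MN] obtain I J K where
    *: "N = I + J" "M = I + K" "J ~= {#}" "\<forall>k\<in>#K. \<exists>j\<in>#J. k < j"
    by (rule Node_less_Node_one_step)
  have "M + {#0#} <= N"
  proof (cases "K = {#}")
    case True
    obtain j where "j \<in># J" using *(3) by auto
    then have "{#j#} <= J" by (intro subset_eq_imp_le_multiset) simp
    moreover have "{#0#} <= {#j#}" using zero_le_tree[of j] by (simp add: le_less del: zero_le_tree)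
    ultimately have "{#0#} <= J" by (rule order_trans[rotated])
    then show ?thesis using * True by simp
  next
    case False
    then obtain k j where "j \<in># J" "k < j" using *(4) by fastforce
    then have "0 < j" using zero_le_tree[of k] by (meson le_less_trans)
    then have "\<forall>k\<in>#K + {#0#}. \<exists>j\<in>#J. k < j" using *(4) \<open>j \<in># J\<close> by auto
    then have "(I + (K + {#0#}), I + J) \<in> mult {(s, t). s < t}" using *(3) by (intro one_step_implies_mult) auto
    then show ?thesis by (simp add: * less_multiset_def multp_def ac_simps less_imp_le)
  qed
  then show ?thesis by (simp add: MN plus_tree_def om_def)
qed

section \<open>Bounding heights of relations\<close>

text \<open>
  The height of \<open>R\<close> on \<open>X\<close> is at most \<open>t\<close>. For a linear order this says that the order type of \<open>X\<close>
  is at most \<open>t\<close>, but partial relations such as "much smaller than" are measured in the same way.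
\<close>

definition tp :: "('a => 'a => bool) => 'a set => tree => bool" where
  "tp R X t \<longleftrightarrow> (\<exists>\<phi>. (\<forall>a\<in>X. \<forall>b\<in>X. R a b --> \<phi> a < \<phi> b) \<and> (\<forall>a\<in>X. \<phi> a < t))"

lemma tpI: "(\<And>a b. a \<in> X ==> b \<in> X ==> R a b ==> \<phi> a < \<phi> b) ==> (\<And>a. a \<in> X ==> \<phi> a < t) ==> tp R X t"
  by (auto simp: tp_def)

lemma tp_image:
  assumes "tp R' Y t" "\<And>a. a \<in> X ==> g a \<in> Y"
    "\<And>a b. a \<in> X ==> b \<in> X ==> R a b ==> R' (g a) (g b)" "t <= u"
  shows "tp R X u"
proof -
  obtain \<phi> where "\<forall>a\<in>Y. \<forall>b\<in>Y. R' a b --> \<phi> a < \<phi> b" "\<forall>a\<in>Y. \<phi> a < t"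
    using assms(1) by (auto simp: tp_def)
  then show ?thesis
    using assms by (intro tpI[of X R "\<phi> \<circ> g"]) (auto intro: less_le_trans)
qed

lemma tp_mono:
  assumes "tp R' Y t" "X \<subseteq> Y" "\<And>a b. a \<in> X ==> b \<in> X ==> R a b ==> R' a b" "t <= u"
  shows "tp R X u"
  using tp_image[of R' Y t X "\<lambda>a. a"] assms by blast

text \<open>
  The least bound for the predecessors of \<open>b\<close> is a rank: a function that witnesses a bound for the
  predecessors of \<open>b\<close>, evaluated at \<open>a\<close>, bounds the predecessors of \<open>a\<close>.
\<close>

lemma tp_residual:
  assumes tr: "transp_on X R"
    and res: "\<And>b. b \<in> X ==> \<exists>s<t. tp R {a \<in> X. R a b} s"
  shows "tp R X t"
proof (rule tpI)
  define \<phi> where "\<phi> b = (LEAST s. tp R {a \<in> X. R a b} s)" for b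
  have \<phi>: "tp R {a \<in> X. R a b} (\<phi> b)" if "b \<in> X" for b
    using res[OF that] unfolding \<phi>_def by (metis LeastI)
  show "\<phi> b < t" if "b \<in> X" for b
    using res[OF that] unfolding \<phi>_def by (meson Least_le le_less_trans)
  show "\<phi> a < \<phi> b" if ab: "a \<in> X" "b \<in> X" "R a b" for a b
  proof -
    obtain \<psi> where \<psi>: "\<And>x y. x \<in> X ==> y \<in> X ==> R x b ==> R y b ==> R x y ==> \<psi> x < \<psi> y"
      "\<And>x. x \<in> X ==> R x b ==> \<psi> x < \<phi> b"
      using \<phi>[OF ab(2)] unfolding tp_def by auto
    have Rb: "R x b" if "x \<in> X" "R x a" for x
      using tr that ab unfolding transp_on_def by blast
    have "tp R {x \<in> X. R x a} (\<psi> a)"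
      using \<psi> Rb ab by (intro tpI[of _ _ \<psi>]) auto
    then have "\<phi> a <= \<psi> a" unfolding \<phi>_def by (rule Least_le)
    also have "\<dots> < \<phi> b" using \<psi>(2) ab by blast
    finally show ?thesis .
  qed
qed

lemma tp_empty [simp]: "tp R {} t"
  by (simp add: tp_def)

text \<open>
  Ranking an element by the predecessors that it has in \<open>C\<close> extends a height function from \<open>C\<close> to
  \<open>X\<close>, at the price of strictness: only steps that start in \<open>C\<close> still increase the rank.
\<close>

lemma tp_rank:
  assumes tr: "transp_on X R" and C: "C \<subseteq> X" and "tp R C u"
  shows "\<exists>\<rho>. (\<forall>a\<in>X. \<forall>b\<in>X. R a b --> \<rho> a <= \<rho> b) \<and> (\<forall>a\<in>C. \<forall>b\<in>X. R a b --> \<rho> a < \<rho> b) \<and>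
    (\<forall>a\<in>X. \<rho> a <= u) \<and> (\<forall>a\<in>C. \<rho> a < u)"
proof -
  obtain \<phi> where \<phi>: "\<And>a b. a \<in> C ==> b \<in> C ==> R a b ==> \<phi> a < \<phi> b" "\<And>a. a \<in> C ==> \<phi> a < u"
    using assms(3) by (auto simp: tp_def)
  define \<rho> where "\<rho> b = (LEAST s. \<forall>a\<in>C. R a b --> \<phi> a < s)" for b
  have ub: "\<forall>a\<in>C. R a b --> \<phi> a < \<rho> b" for b
    unfolding \<rho>_def by (rule LeastI[of _ u]) (use \<phi>(2) in blast)
  have least: "\<rho> b <= s" if "\<And>a. a \<in> C ==> R a b ==> \<phi> a < s" for b s
    unfolding \<rho>_def by (rule Least_le) (use that in blast)
  have trans: "R a c" if "a \<in> C" "b \<in> X" "c \<in> X" "R a b" "R b c" for a b c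
    using tr that C unfolding transp_on_def by blast
  have le: "\<rho> a <= \<phi> a" if "a \<in> C" for a using \<phi>(1) that by (intro least)
  show ?thesis
  proof (intro exI[of _ \<rho>] conjI ballI impI)
    show "\<rho> a <= \<rho> b" if "a \<in> X" "b \<in> X" "R a b" for a b
      using ub[of b] trans that by (intro least) blast
    show "\<rho> a < \<rho> b" if "a \<in> C" "b \<in> X" "R a b" for a b
      using ub[of b] le[OF that(1)] that by (meson le_less_trans)
    show "\<rho> a <= u" for a using \<phi>(2) by (intro least)
    show "\<rho> a < u" if "a \<in> C" for a using le[OF that] \<phi>(2)[OF that] by simp
  qed
qed

text \<open>
  The natural sum of the ranks relative to \<open>A\<close> and to \<open>B\<close> increases along every step, because a
  step starts in \<open>A\<close> or in \<open>B\<close> and the other rank does not decrease.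
\<close>

lemma tp_union:
  assumes tr: "transp_on (A \<union> B) R" and "tp R A s" "tp R B t"
  shows "tp R (A \<union> B) (s + t)"
proof -
  obtain \<rho> where \<rho>: "\<forall>a\<in>A \<union> B. \<forall>b\<in>A \<union> B. R a b --> \<rho> a <= \<rho> b"
    "\<forall>a\<in>A. \<forall>b\<in>A \<union> B. R a b --> \<rho> a < \<rho> b" "\<forall>a\<in>A \<union> B. \<rho> a <= s" "\<forall>a\<in>A. \<rho> a < s"
    using tp_rank[OF tr Un_upper1 assms(2)] by blast
  obtain \<sigma> where \<sigma>: "\<forall>a\<in>A \<union> B. \<forall>b\<in>A \<union> B. R a b --> \<sigma> a <= \<sigma> b"
    "\<forall>a\<in>B. \<forall>b\<in>A \<union> B. R a b --> \<sigma> a < \<sigma> b" "\<forall>a\<in>A \<union> B. \<sigma> a <= t" "\<forall>a\<in>B. \<sigma> a < t"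
    using tp_rank[OF tr Un_upper2 assms(3)] by blast
  show ?thesis
  proof (rule tpI[of _ _ "\<lambda>a. \<rho> a + \<sigma> a"])
    show "\<rho> a + \<sigma> a < \<rho> b + \<sigma> b" if h: "a \<in> A \<union> B" "b \<in> A \<union> B" "R a b" for a b
      using \<rho>(1,2) \<sigma>(1,2) h by (cases "a \<in> A") (auto intro: add_less_le_mono add_le_less_mono)
    show "\<rho> a + \<sigma> a < s + t" if "a \<in> A \<union> B" for a
      using \<rho>(3,4) \<sigma>(3,4) that by (cases "a \<in> A") (auto intro: add_less_le_mono add_le_less_mono)
  qed
qed

lemma tp_finite_Union:
  assumes "finite F" "transp_on (\<Union>F) R" "\<And>Y. Y \<in> F ==> \<exists>s < om g. tp R Y s"
  shows "\<exists>s < om g. tp R (\<Union>F) s"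
  using assms
proof (induction rule: finite_induct)
  case empty
  then show ?case by (auto intro!: exI[of _ 0])
next
  case (insert Y F)
  have "transp_on (\<Union>F) R" using insert.prems(1) by (rule transp_on_subset) auto
  then obtain s where "s < om g" "tp R (\<Union>F) s" using insert by auto
  moreover obtain t where "t < om g" "tp R Y t" using insert.prems by auto
  ultimately show ?case
    using tp_union[of Y "\<Union>F" R t s] insert.prems(1) plus_less_om[of t g s] by (auto simp: ac_simps)
qed

text \<open>
  The values below \<open>\<omega>^a_1 + \<dots> + \<omega>^a_n\<close> are split one summand at a time: either a value is below
  the largest \<open>\<omega>^a_i\<close>, or this power is its leading term and can be cancelled.
\<close>

lemma tp_split:
  assumes "tp R X t"
  shows "\<exists>F. finite F \<and> X = \<Union>F \<and> (\<forall>Y\<in>F. \<exists>g\<in>#cnf t. tp R Y (om g))"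
  using assms
proof (induction "size (cnf t)" arbitrary: X t)
  case 0
  then have "t = 0" by (cases t) (simp add: zero_tree_def)
  then have "X = {}" using 0 by (auto simp: tp_def)
  then show ?case by (intro exI[of _ "{}"]) auto
next
  case (Suc n)
  define M where "M = cnf t"
  have "M ~= {#}" using Suc(2) by (auto simp: M_def)
  define g where "g = Max_mset M"
  have g: "g \<in># M" "\<And>x. x \<in># M ==> x <= g" using \<open>M ~= {#}\<close> by (auto simp: g_def)
  define M' where "M' = M - {#g#}"
  have MM': "M = add_mset g M'" using g by (simp add: M'_def)
  obtain \<phi> where \<phi>: "\<And>a b. a \<in> X ==> b \<in> X ==> R a b ==> \<phi> a < \<phi> b" "\<And>a. a \<in> X ==> \<phi> a < t"
    using Suc.prems by (auto simp: tp_def)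
  define Y where "Y = {a \<in> X. \<phi> a < om g}"
  have 1: "tp R Y (om g)" using \<phi> by (intro tpI[of _ _ \<phi>]) (auto simp: Y_def)
  have N: "cnf (\<phi> a) = add_mset g (cnf (\<phi> a) - {#g#})" if h: "a \<in> X - Y" for a
  proof -
    have lt: "cnf (\<phi> a) < M" using \<phi>(2)[of a] h by (simp add: M_def cnf_less)
    have le: "x <= g" if "x \<in># cnf (\<phi> a)" for x
    proof (rule ccontr)
      assume "\<not> x <= g"
      then have "M < {#x#}" using g(2) by (auto simp: not_le intro: le_less_trans)
      also have "\<dots> <= cnf (\<phi> a)" using that by (intro subset_eq_imp_le_multiset) simp
      finally show False using lt by simp
    qed
    obtain x where "x \<in># cnf (\<phi> a)" "\<not> x < g"
      using h by (auto simp: Y_def less_om_iff)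
    then have "g \<in># cnf (\<phi> a)" using le[of x] by auto
    then show ?thesis by simp
  qed
  have 2: "tp R (X - Y) (Node M')"
  proof (rule tpI[of _ _ "\<lambda>a. Node (cnf (\<phi> a) - {#g#})"])
    fix a b assume ab: "a \<in> X - Y" "b \<in> X - Y" "R a b"
    then have "cnf (\<phi> a) < cnf (\<phi> b)" using \<phi> by (simp add: cnf_less)
    then show "Node (cnf (\<phi> a) - {#g#}) < Node (cnf (\<phi> b) - {#g#})"
      using N[OF ab(1)] N[OF ab(2)] by (metis Node_less_Node add_less_cancel_right add_mset_add_single)
  next
    fix a assume a: "a \<in> X - Y"
    have "cnf (\<phi> a) < M" using \<phi>(2)[of a] a by (simp add: M_def cnf_less)
    then show "Node (cnf (\<phi> a) - {#g#}) < Node M'"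
      using N[OF a] MM' by (metis Node_less_Node add_less_cancel_right add_mset_add_single)
  qed
  have "n = size (cnf (Node M'))" using Suc(2) MM' by (simp add: M_def[symmetric])
  from Suc(1)[OF this 2] obtain F where F: "finite F" "X - Y = \<Union>F" "\<forall>Y\<in>F. \<exists>g\<in>#M'. tp R Y (om g)"
    by auto
  have "X = \<Union>(insert Y F)" using F(2) by (auto simp: Y_def)
  then show ?case
    using F 1 g(1) MM' by (intro exI[of _ "insert Y F"]) (auto simp: M_def[symmetric])
qed

text \<open>
  The predecessors of \<open>b\<close> along \<open>R\<close> are those along \<open>R1\<close> or \<open>R2\<close>. The first kind has a smaller
  height for \<open>R1\<close>, so it splits into finitely many parts with heights \<open>\<omega>^g'\<close>, \<open>g' < g\<close>, to which
  the induction hypothesis applies; likewise for the second kind.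
\<close>

lemma tp_product_om:
  assumes "transp_on X R" "\<And>a b. a \<in> X ==> b \<in> X ==> R a b ==> R1 a b \<or> R2 a b"
    "tp R1 X (om g)" "tp R2 X (om d)"
  shows "tp R X (om (g + d))"
  using assms
proof (induction "g + d" arbitrary: g d X rule: less_induct)
  case less
  obtain \<phi>1 where \<phi>1: "\<And>a b. a \<in> X ==> b \<in> X ==> R1 a b ==> \<phi>1 a < \<phi>1 b" "\<And>a. a \<in> X ==> \<phi>1 a < om g"
    using less.prems(3) by (auto simp: tp_def)
  obtain \<phi>2 where \<phi>2: "\<And>a b. a \<in> X ==> b \<in> X ==> R2 a b ==> \<phi>2 a < \<phi>2 b" "\<And>a. a \<in> X ==> \<phi>2 a < om d"
    using less.prems(4) by (auto simp: tp_def)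
  show ?case
  proof (rule tp_residual[OF less.prems(1)])
    fix b assume b: "b \<in> X"
    define X1 where "X1 = {a \<in> X. R1 a b}"
    define X2 where "X2 = {a \<in> X. R2 a b}"
    have part: "\<exists>s < om (g + d). tp R Z s"
      if Z: "Z \<subseteq> X" "tp R' Z u" and smaller: "\<And>Y e. Y \<subseteq> Z ==> tp R' Y (om e) ==> e \<in># cnf u ==>
        \<exists>c < g + d. tp R Y (om c)" for Z R' u
    proof -
      from tp_split[OF Z(2)] obtain F where F: "finite F" "Z = \<Union>F" "\<forall>Y\<in>F. \<exists>e\<in>#cnf u. tp R' Y (om e)" by auto
      have "\<exists>s < om (g + d). tp R Y s" if Y: "Y \<in> F" for Y
      proof -
        obtain e where "e \<in># cnf u" "tp R' Y (om e)" using F(3) Y by auto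
        then obtain c where "c < g + d" "tp R Y (om c)" using smaller[of Y e] F(2) Y by auto
        then show ?thesis by (intro exI[of _ "om c"]) simp
      qed
      moreover have "transp_on (\<Union>F) R" using less.prems(1) by (rule transp_on_subset) (use F(2) Z(1) in auto)
      ultimately show ?thesis using tp_finite_Union[OF F(1)] F(2) by simp
    qed
    have "\<exists>s < om (g + d). tp R X1 s"
    proof (rule part)
      show "X1 \<subseteq> X" by (auto simp: X1_def)
      show "tp R1 X1 (\<phi>1 b)" using \<phi>1 b by (intro tpI[of _ _ \<phi>1]) (auto simp: X1_def)
      fix Y e assume Y: "Y \<subseteq> X1" "tp R1 Y (om e)" "e \<in># cnf (\<phi>1 b)"
      then have lt: "e + d < g + d" using \<phi>1(2)[OF b] by (simp add: less_om_iff)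
      have "Y \<subseteq> X" using Y by (auto simp: X1_def)
      then have "tp R Y (om (e + d))"
        using less.prems Y(2) by (intro less.hyps[OF lt]) (auto intro: transp_on_subset tp_mono)
      then show "\<exists>c < g + d. tp R Y (om c)" using lt by blast
    qed
    then obtain s1 where s1: "s1 < om (g + d)" "tp R X1 s1" by auto
    have "\<exists>s < om (g + d). tp R X2 s"
    proof (rule part)
      show "X2 \<subseteq> X" by (auto simp: X2_def)
      show "tp R2 X2 (\<phi>2 b)" using \<phi>2 b by (intro tpI[of _ _ \<phi>2]) (auto simp: X2_def)
      fix Y e assume Y: "Y \<subseteq> X2" "tp R2 Y (om e)" "e \<in># cnf (\<phi>2 b)"
      then have lt: "g + e < g + d" using \<phi>2(2)[OF b] by (simp add: less_om_iff)
      have "Y \<subseteq> X" using Y by (auto simp: X2_def)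
      then have "tp R Y (om (g + e))"
        using less.prems Y(2) by (intro less.hyps[OF lt]) (auto intro: transp_on_subset tp_mono)
      then show "\<exists>c < g + d. tp R Y (om c)" using lt by blast
    qed
    then obtain s2 where s2: "s2 < om (g + d)" "tp R X2 s2" by auto
    have "transp_on (X1 \<union> X2) R" using less.prems(1) by (rule transp_on_subset) (auto simp: X1_def X2_def)
    then have "tp R (X1 \<union> X2) (s1 + s2)" using s1(2) s2(2) by (rule tp_union)
    then have "tp R {a \<in> X. R a b} (s1 + s2)"
      by (rule tp_mono) (use less.prems(2) b in \<open>auto simp: X1_def X2_def\<close>)
    then show "\<exists>s < om (g + d). tp R {a \<in> X. R a b} s" using plus_less_om s1 s2 by blast
  qed
qed

text \<open>
  The bounds \<open>\<omega>^(\<omega>^b)\<close> are closed under natural products, since \<open>\<omega>^b\<close> is closed under natural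
  sums.
\<close>

definition sm :: "tree => ('a => 'a => bool) => 'a set => bool" where
  "sm b R X \<longleftrightarrow> (\<exists>t < om (om b). tp R X t)"

lemma sm_empty [simp]: "sm b R {}"
  by (auto simp: sm_def intro: exI[of _ 0])

lemma sm_image:
  assumes "sm b R' Y" "\<And>a. a \<in> X ==> g a \<in> Y"
    "\<And>a b. a \<in> X ==> b \<in> X ==> R a b ==> R' (g a) (g b)" "b <= b'"
  shows "sm b' R X"
proof -
  obtain t where "t < om (om b)" "tp R' Y t" using assms(1) by (auto simp: sm_def)
  moreover have "om (om b) <= om (om b')" using assms(4) by simp
  ultimately show ?thesis
    using tp_image[of R' Y t X g R t] assms unfolding sm_def by (meson less_le_trans order_refl)
qed

lemma sm_mono:
  assumes "sm b R' Y" "X \<subseteq> Y" "\<And>a b. a \<in> X ==> b \<in> X ==> R a b ==> R' a b" "b <= b'"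
  shows "sm b' R X"
  using sm_image[of b R' Y X "\<lambda>a. a"] assms by blast

lemma sm_finite_Union:
  assumes "finite F" "transp_on (\<Union>F) R" "\<And>Y. Y \<in> F ==> sm b R Y"
  shows "sm b R (\<Union>F)"
  using tp_finite_Union[of F R "om b"] assms by (auto simp: sm_def)

lemma sm_Un:
  assumes "transp_on (A \<union> B) R" "sm b R A" "sm b R B"
  shows "sm b R (A \<union> B)"
  using sm_finite_Union[of "{A, B}" R b] assms by auto

lemma sm_trivial: "(\<And>a b. a \<in> X ==> b \<in> X ==> \<not> R a b) ==> sm b R X"
  unfolding sm_def
  by (intro exI[of _ "om 0"] conjI tpI[of _ _ "\<lambda>_. 0"]) (auto simp: less_om_iff)

lemma sm_finite:
  assumes "finite X" "transp_on X R" "\<And>a. a \<in> X ==> \<not> R a a"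
  shows "sm b R X"
  using sm_finite_Union[of "(\<lambda>a. {a}) ` X" R b] assms by (auto intro: sm_trivial)

lemma sm_product:
  assumes tr: "transp_on X R" and R: "\<And>a b. a \<in> X ==> b \<in> X ==> R a b ==> R1 a b \<or> R2 a b"
    and "sm b R1 X" "sm b R2 X"
  shows "sm b R X"
proof -
  obtain s t where st: "s < om (om b)" "tp R1 X s" "t < om (om b)" "tp R2 X t"
    using assms by (auto simp: sm_def)
  from tp_split[OF st(2)] obtain F1 where F1: "finite F1" "X = \<Union>F1"
    "\<And>Y. Y \<in> F1 ==> \<exists>g\<in>#cnf s. tp R1 Y (om g)" by auto
  from tp_split[OF st(4)] obtain F2 where F2: "finite F2" "X = \<Union>F2"
    "\<And>Y. Y \<in> F2 ==> \<exists>g\<in>#cnf t. tp R2 Y (om g)" by auto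
  define F where "F = (\<lambda>(Y, Z). Y \<inter> Z) ` (F1 \<times> F2)"
  have "X = \<Union>F" using F1(2) F2(2) by (auto simp: F_def)
  moreover have "sm b R (\<Union>F)"
  proof (rule sm_finite_Union)
    show "finite F" using F1 F2 by (simp add: F_def)
    show "transp_on (\<Union>F) R" using tr \<open>X = \<Union>F\<close> by simp
    fix V assume "V \<in> F"
    then obtain Y Z where YZ: "Y \<in> F1" "Z \<in> F2" "V = Y \<inter> Z" by (auto simp: F_def)
    then have VX: "V \<subseteq> X" using F1(2) by auto
    obtain g d where gd: "g \<in># cnf s" "tp R1 Y (om g)" "d \<in># cnf t" "tp R2 Z (om d)"
      using F1(3) F2(3) YZ by blast
    have "tp R V (om (g + d))"
    proof (rule tp_product_om)
      show "transp_on V R" using tr VX by (rule transp_on_subset)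
      show "R1 a b \<or> R2 a b" if "a \<in> V" "b \<in> V" "R a b" for a b
        using R that VX by blast
      show "tp R1 V (om g)" by (rule tp_mono[OF gd(2)]) (auto simp: YZ)
      show "tp R2 V (om d)" by (rule tp_mono[OF gd(4)]) (auto simp: YZ)
    qed
    moreover have "om (g + d) < om (om b)"
      using gd st plus_less_om[of g b d] by (simp add: less_om_iff[of _ "om b"])
    ultimately show "sm b R V" unfolding sm_def by blast
  qed
  ultimately show ?thesis by simp
qed

section \<open>The towers of omegas\<close>

primrec tower :: "nat => tree" where
  "tower 0 = om 0"
| "tower (Suc k) = om (tower k)"

lemma Field_refl_rel: "Field {(s, t :: tree). s <= t \<and> t < u} = {t. t < u}"
  by (auto simp: Field_def)

text \<open>
  A strict comparison at the largest exponent where two multisets over a linear order differ is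
  the same as the multiset extension of the order.
\<close>

lemma omega_power_eq:
  "omega_power {(s, t :: tree). s <= t \<and> t < u} =
     {(M, N). M <= N \<and> (\<forall>x\<in>#N. x < u)}" (is "?L = ?R")
proof -
  have "(M, N) \<in> ?L \<longleftrightarrow> (M, N) \<in> ?R" for M N
  proof
    assume "(M, N) \<in> ?L"
    then have sub: "\<forall>x\<in>#M. x < u" "\<forall>x\<in>#N. x < u"
      and ex: "M = N \<or> (\<exists>a<u. count M a < count N a \<and> (\<forall>b. a <= b \<and> b < u \<and> b ~= a --> count M b = count N b))"
      by (auto simp: omega_power_def Field_refl_rel)
    have "M <= N"
    proof (cases "M = N")
      case False
      then obtain a where a: "a < u" "count M a < count N a"
        and a': "\<forall>b. a <= b \<and> b < u \<and> b ~= a --> count M b = count N b" using ex by blast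
      have eq: "count M b = count N b" if "a < b" "b < u" for b
        using a'[rule_format, of b] that by (simp add: less_imp_le)
      have "M < N" unfolding less_multiset\<^sub>H\<^sub>O
      proof (intro conjI False allI impI)
        fix y assume y: "count N y < count M y"
        then have "y < u" using sub by (metis count_inI not_less_zero)
        then have "y < a" using a y eq[of y] by (metis linorder_neqE less_asym less_irrefl)
        then show "\<exists>x>y. count M x < count N x" using a by auto
      qed
      then show ?thesis by simp
    qed simp
    then show "(M, N) \<in> ?R" using sub by simp
  next
    assume "(M, N) \<in> ?R"
    then have le: "M <= N" and N: "\<forall>x\<in>#N. x < u" by auto
    then have "N < {#u#}" by simp
    then have "M < {#u#}" using le by (rule le_less_trans[rotated])
    then have M: "\<forall>x\<in>#M. x < u" by simp
    have "\<exists>a<u. count M a < count N a \<and> (\<forall>b. a <= b \<and> b < u \<and> b ~= a --> count M b = count N b)" if "M ~= N"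
    proof -
      have "M < N" using le that by simp
      then have *: "\<And>y. count N y < count M y ==> \<exists>x>y. count M x < count N x"
        by (auto simp: less_multiset\<^sub>H\<^sub>O)
      define D where "D = {y. count M y ~= count N y}"
      have fin: "finite D"
        by (rule finite_subset[of _ "set_mset M \<union> set_mset N"]) (auto simp: D_def not_in_iff)
      have "D ~= {}" using that by (auto simp: D_def intro: multiset_eqI)
      then have mD: "Max D \<in> D" using fin by simp
      have max: "count M b = count N b" if "Max D < b" for b
        using that Max_ge[OF fin, of b] by (force simp: D_def)
      have "\<not> count N (Max D) < count M (Max D)" using *[of "Max D"] max by force
      then have lt: "count M (Max D) < count N (Max D)" using mD by (auto simp: D_def)
      then have "Max D < u" using N by (metis count_inI not_less_zero)
      then show ?thesis using lt max by (intro exI[of _ "Max D"]) auto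
    qed
    then show "(M, N) \<in> ?L" using M N by (auto simp: omega_power_def Field_refl_rel)
  qed
  then show ?thesis by auto
qed

lemma omega_tower_eq: "omega_tower k = {(s, t). s <= t \<and> t < tower k}"
proof (induction k)
  case 0
  have "(s, t) \<in> omega_tower 0 \<longleftrightarrow> s <= t \<and> t < tower 0" for s t
    using zero_le_tree[of s] by (auto simp: less_om_zero_iff zero_tree_def[symmetric] simp del: zero_le_tree)
  then show ?case by auto
next
  case (Suc k)
  have "(s, t) \<in> omega_tower (Suc k) \<longleftrightarrow> s <= t \<and> t < tower (Suc k)" for s t
  proof -
    obtain M N where "s = Node M" "t = Node N" by (cases s; cases t)
    then show ?thesis
      by (simp add: Suc omega_power_eq dir_image_def less_om_iff)
  qed
  then show ?case by auto
qed

text \<open>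
  Otherwise the tower would embed into \<open>A\<close>, and composing with the height function gives a
  strictly increasing map on the ordinals below the tower with values below \<open>t\<close>. Such a map
  satisfies \<open>s \<le> f s\<close>, which fails at \<open>s = t\<close>.
\<close>

lemma tp_imp_ordLess:
  fixes A :: "'a :: order set"
  assumes total: "\<And>a b. a \<in> A ==> b \<in> A ==> a <= b \<or> b <= a"
    and "tp (<) A t" "t < tower k"
  shows "order_type A <o omega_tower k"
proof -
  obtain \<phi> where \<phi>: "\<And>a b. a \<in> A ==> b \<in> A ==> a < b ==> \<phi> a < \<phi> b" "\<And>a. a \<in> A ==> \<phi> a < t"
    using assms(2) by (auto simp: tp_def)
  have F: "Field (order_type A) = A" by (auto simp: order_type_def Field_def)
  have F': "Field (omega_tower k) = {s. s < tower k}" by (simp add: omega_tower_eq Field_refl_rel)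
  have W: "Well_order (order_type A)"
    unfolding well_order_on_def linear_order_on_def partial_order_on_def preorder_on_def F
  proof (intro conjI)
    show "refl_on A (order_type A)" by (auto simp: refl_on_def order_type_def)
    show "trans (order_type A)" by (auto simp: trans_def order_type_def)
    show "antisym (order_type A)" by (auto simp: antisym_def order_type_def)
    show "total_on A (order_type A)" using total by (auto simp: total_on_def order_type_def)
    have "\<phi> a < \<phi> b" if "(a, b) \<in> order_type A - Id" for a b
      using \<phi>(1)[of a b] that by (simp add: order_type_def less_le[of a b])
    then have "order_type A - Id \<subseteq> inv_image {(s, t). s < t} \<phi>" by (intro subsetI) (auto simp only: in_inv_image split_paired_all mem_Collect_eq case_prod_conv)
    then show "wf (order_type A - Id)" using wf_subset wf_inv_image[OF wf_tree_less] by blast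
  qed (auto simp: order_type_def)
  have W': "Well_order (omega_tower k)"
    unfolding well_order_on_def linear_order_on_def partial_order_on_def preorder_on_def F'
  proof (intro conjI)
    have "omega_tower k - Id \<subseteq> {(s, t). s < t}" by (auto simp: omega_tower_eq)
    then show "wf (omega_tower k - Id)" using wf_subset[OF wf_tree_less] by blast
  qed (auto simp: refl_on_def trans_def antisym_def total_on_def omega_tower_eq)
  show ?thesis
  proof (rule ccontr)
    assume "\<not> ?thesis"
    then have "(omega_tower k, order_type A) \<in> ordLeq" using ordLess_or_ordLeq[OF W W'] by blast
    then obtain f where f: "embed (omega_tower k) (order_type A) f" by (auto simp: ordLeq_def)
    have fA: "f s \<in> A" if "s < tower k" for s
      using embed_in_Field[OF f, of s] that by (simp add: F F')
    have inj: "inj_on f {s. s < tower k}" using embed_inj_on[OF W' f] by (simp add: F')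
    have comp: "f r < f s" if "r < s" "s < tower k" for r s
    proof -
      have "(f r, f s) \<in> order_type A"
        using embed_compat[OF f] that by (auto simp: compat_def omega_tower_eq)
      moreover have "f r ~= f s"
        using inj_onD[OF inj, of r s] that less_trans[OF that] by auto
      ultimately show ?thesis by (auto simp: order_type_def less_le)
    qed
    have ge: "s <= \<phi> (f s)" if "s < tower k" for s
      using that
    proof (induction s rule: less_induct)
      case (less s)
      show ?case
      proof (rule ccontr)
        assume "\<not> ?thesis"
        then have lt: "\<phi> (f s) < s" by simp
        then have lt': "\<phi> (f s) < tower k" using less.prems by simp
        have "\<phi> (f s) <= \<phi> (f (\<phi> (f s)))" using less.IH[OF lt lt'] .
        moreover have "\<phi> (f (\<phi> (f s))) < \<phi> (f s)"
          using \<phi>(1) comp[OF lt less.prems] fA lt' less.prems by blast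
        ultimately show False by simp
      qed
    qed
    show False using ge[OF assms(3)] \<phi>(2)[OF fA[OF assms(3)]] by simp
  qed
qed

section \<open>Well-ordered sets and finite covers\<close>

definition wo :: "'a :: linorder set => bool" where
  "wo A \<longleftrightarrow> (\<forall>B\<subseteq>A. B ~= {} --> (\<exists>m\<in>B. \<forall>b\<in>B. m <= b))"

lemma wo_subset: "wo A ==> B \<subseteq> A ==> wo B"
  unfolding wo_def by (meson subset_trans)

lemma wo_min: "wo A ==> B \<subseteq> A ==> B ~= {} ==> \<exists>m\<in>B. \<forall>b\<in>B. m <= b"
  by (simp add: wo_def)

lemma not_wo: "\<not> wo A ==> \<exists>C. C \<subseteq> A \<and> C ~= {} \<and> \<not> (\<exists>m\<in>C. \<forall>b\<in>C. m <= b)"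
  by (auto simp only: wo_def not_all not_imp)

lemma wo_obtain_min:
  assumes "wo A" "B \<subseteq> A" "B ~= {}"
  obtains m where "m \<in> B" "\<And>b. b \<in> B ==> m <= b"
proof -
  have "\<exists>m\<in>B. \<forall>b\<in>B. m <= b" using assms(1)[unfolded wo_def, rule_format, OF assms(2,3)] .
  then show thesis using that by (elim bexE) (rule that, assumption, erule bspec)
qed

lemma wo_obtain_arg_min:
  assumes "wo (f ` I)" "I ~= {}"
  obtains i where "i \<in> I" "\<And>j. j \<in> I ==> f i <= f j"
  proof -
  have "f ` I ~= {}" using assms(2) by simp
  from wo_obtain_min[OF assms(1) subset_refl this] obtain m where
    "m \<in> f ` I" "\<And>b. b \<in> f ` I ==> m <= b" by blast
  then show thesis using that by auto
qed

lemma wo_induct [consumes 2, case_names less]: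
  assumes "wo A" "a \<in> A" "\<And>a. a \<in> A ==> (\<And>b. b \<in> A ==> b < a ==> P b) ==> P a"
  shows "P a"
proof (rule ccontr)
  assume "\<not> P a"
  then have "{b \<in> A. \<not> P b} ~= {}" using assms(2) by blast
  from wo_obtain_min[OF assms(1) Collect_subset this] obtain m
    where m: "m \<in> {b \<in> A. \<not> P b}" "\<And>b. b \<in> {b \<in> A. \<not> P b} ==> m <= b" by blast
  have "P m"
  proof (rule assms(3))
    show "m \<in> A" using m(1) by simp
    show "P b" if "b \<in> A" "b < m" for b
      using m(2)[of b] that leD[of m b] by auto
  qed
  then show False using m(1) by simp
qed

lemma wo_image_mono:
  assumes "wo A" "\<And>a b. a \<in> A ==> b \<in> A ==> a <= b ==> f a <= f b"
  shows "wo (f ` A)"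
  unfolding wo_def
proof (intro allI impI)
  fix B assume B: "B \<subseteq> f ` A" "B ~= {}"
  then have "{a \<in> A. f a \<in> B} ~= {}" by blast
  then obtain m where "m \<in> {a \<in> A. f a \<in> B}" "\<And>a. a \<in> {a \<in> A. f a \<in> B} ==> m <= a"
    using wo_obtain_min[OF assms(1), of "{a \<in> A. f a \<in> B}"] by blast
  then show "\<exists>m\<in>B. \<forall>b\<in>B. m <= b"
    using assms(2) B by (intro bexI[of _ "f m"]) auto
qed

lemma wo_finite_Union:
  assumes "finite F" "\<And>A. A \<in> F ==> wo A"
  shows "wo (\<Union>F)"
  using assms
proof (induction rule: finite_induct)
  case empty
  then show ?case by (simp add: wo_def)
next
  case (insert A F)
  have 1: "wo A" "wo (\<Union>F)" using insert by auto
  have "wo (A \<union> \<Union>F)"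
    unfolding wo_def
  proof (intro allI impI)
    fix B assume B: "B \<subseteq> A \<union> \<Union>F" "B ~= {}"
    show "\<exists>m\<in>B. \<forall>b\<in>B. m <= b"
    proof (cases "B \<inter> A = {} \<or> B \<inter> \<Union>F = {}")
      case True
      then have "B \<subseteq> A \<or> B \<subseteq> \<Union>F" using B by blast
      then show ?thesis using 1 B unfolding wo_def by blast
    next
      case False
      obtain m where m: "m \<in> B \<inter> A" "\<And>b. b \<in> B \<inter> A ==> m <= b"
        using wo_obtain_min[OF 1(1), of "B \<inter> A"] False by blast
      obtain n where n: "n \<in> B \<inter> \<Union>F" "\<And>b. b \<in> B \<inter> \<Union>F ==> n <= b"
        using wo_obtain_min[OF 1(2), of "B \<inter> \<Union>F"] False by blast
      show ?thesis
      proof (intro bexI[of _ "min m n"] ballI)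
        show "min m n \<in> B" using m n by (auto simp: min_def)
        fix b assume "b \<in> B"
        then show "min m n <= b" using B m(2) n(2) by (auto simp: min_le_iff_disj)
      qed
    qed
  qed
  then show ?case by simp
qed

lemma wo_Un: "wo A ==> wo B ==> wo (A \<union> B)"
  using wo_finite_Union[of "{A, B}"] by auto

text \<open>
  Each peeling step removes a good piece \<open>J\<close> and leaves only indices with values of \<open>b\<close> below some
  \<open>b i0\<close>. By induction over the well-ordered set of values this stops after finitely many steps.
\<close>

lemma finite_cover_peel:
  assumes "wo (b ` I)"
    and peel: "\<And>I'. I' \<subseteq> I ==> I' ~= {} ==> \<exists>i0\<in>I'. \<exists>J\<subseteq>I'. G J \<and> (\<forall>i\<in>I' - J. b i < b i0)"
  shows "\<exists>F. finite F \<and> I = \<Union>F \<and> (\<forall>J\<in>F. G J)"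
proof -
  let ?C = "\<lambda>I. \<exists>F. finite F \<and> I = \<Union>F \<and> (\<forall>J\<in>F. G J)"
  have step: "?C I'" if h: "I' \<subseteq> I" "\<And>i0 I''. i0 \<in> I' ==> I'' \<subseteq> I ==> (\<And>i. i \<in> I'' ==> b i < b i0) ==> ?C I''" for I'
  proof (cases "I' = {}")
    case True
    then show ?thesis by (intro exI[of _ "{}"]) auto
  next
    case False
    then obtain i0 J where J: "i0 \<in> I'" "J \<subseteq> I'" "G J" "\<And>i. i \<in> I' - J ==> b i < b i0"
      using peel[OF h(1)] by metis
    then obtain F where "finite F" "I' - J = \<Union>F" "\<forall>J\<in>F. G J"
      using h(2)[of i0 "I' - J"] h(1) by auto
    then show ?thesis using J by (intro exI[of _ "insert J F"]) auto
  qed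
  have "\<forall>I'\<subseteq>I. (\<forall>i\<in>I'. b i < \<beta>) --> ?C I'" if "\<beta> \<in> b ` I" for \<beta>
    using assms(1) that
  proof (induction rule: wo_induct)
    case (less \<beta>)
    show ?case
    proof (intro allI impI)
      fix I' assume I': "I' \<subseteq> I" "\<forall>i\<in>I'. b i < \<beta>"
      show "?C I'"
      proof (rule step[OF I'(1)])
        fix i0 I'' assume "i0 \<in> I'" "I'' \<subseteq> I" "\<And>i. i \<in> I'' ==> b i < b i0"
        then show "?C I''"
          using less.IH[of "b i0", THEN spec, of I''] I' by (simp add: subset_iff)
      qed
    qed
  qed
  note * = this
  have **: "?C I''" if "i0 \<in> I" "I'' \<subseteq> I" "\<And>i. i \<in> I'' ==> b i < b i0" for i0 I''
  proof -
    have "b i0 \<in> b ` I" using that(1) by simp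
    then have "\<forall>I'\<subseteq>I. (\<forall>i\<in>I'. b i < b i0) --> ?C I'" by (rule *)
    from this[rule_format, OF that(2)] that(3) show ?thesis by simp
  qed
  show ?thesis by (rule step[OF subset_refl **])
qed

text \<open>
  Dickson's lemma for pairs: among pairs with minimal first coordinate, those with large second
  coordinate have larger values, and the remaining ones have smaller second coordinates.
\<close>

lemma wo_image2:
  assumes "wo (fst ` C)" "wo (snd ` C)"
    "\<And>a b c d. (a, b) \<in> C ==> (c, d) \<in> C ==> a <= c ==> b <= d ==> f a b <= f c d"
  shows "wo ((\<lambda>(a, b). f a b) ` C)"
  unfolding wo_def
proof (intro allI impI)
  let ?f = "\<lambda>(a, b). f a b"
  let ?G = "\<lambda>J. \<exists>m\<in>J. \<forall>p\<in>J. ?f m <= ?f p"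
  fix B assume B: "B \<subseteq> ?f ` C" "B ~= {}"
  define C' where "C' = {p \<in> C. ?f p \<in> B}"
  have BC': "B = ?f ` C'" using B by (auto simp: C'_def)
  have "\<exists>F. finite F \<and> C' = \<Union>F \<and> (\<forall>J\<in>F. ?G J)"
  proof (rule finite_cover_peel[where b = snd])
    show "wo (snd ` C')" using assms(2) by (rule wo_subset) (auto simp: C'_def)
    fix I' assume I': "I' \<subseteq> C'" "I' ~= {}"
    have "wo (fst ` I')" using assms(1) by (rule wo_subset) (use I' in \<open>auto simp: C'_def\<close>)
    from wo_obtain_arg_min[OF this I'(2)] obtain p where p: "p \<in> I'" "\<And>q. q \<in> I' ==> fst p <= fst q"
      by blast
    have "?f p <= ?f q" if "q \<in> I'" "\<not> snd q < snd p" for q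
      using assms(3)[of "fst p" "snd p" "fst q" "snd q"] p(1) p(2)[OF that(1)] that I'(1)
      by (auto simp: C'_def case_prod_unfold not_less)
    note le = this
    define J where "J = {q \<in> I'. \<not> snd q < snd p}"
    have "?G J" using le p(1) by (intro bexI[of _ p]) (simp_all add: J_def)
    then show "\<exists>i0\<in>I'. \<exists>J\<subseteq>I'. ?G J \<and> (\<forall>i\<in>I' - J. snd i < snd i0)"
      using p(1) by (intro bexI[of _ p] exI[of _ J]) (auto simp: J_def)
  qed
  then obtain F where F: "finite F" "C' = \<Union>F" "\<And>J. J \<in> F ==> ?G J" by blast
  then obtain m where m: "\<And>J. J \<in> F ==> m J \<in> J \<and> (\<forall>p\<in>J. ?f (m J) <= ?f p)" by metis
  have "F ~= {}" using B BC' F by auto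
  then have "Min ((\<lambda>J. ?f (m J)) ` F) \<in> (\<lambda>J. ?f (m J)) ` F" using F(1) by (intro Min_in) auto
  then obtain J where J: "J \<in> F" "Min ((\<lambda>J. ?f (m J)) ` F) = ?f (m J)" by blast
  show "\<exists>m\<in>B. \<forall>b\<in>B. m <= b"
  proof (intro bexI[of _ "?f (m J)"] ballI)
    show "?f (m J) \<in> B" using BC' F(2) m J(1) by blast
    fix b assume "b \<in> B"
    then obtain p J' where p: "p \<in> J'" "J' \<in> F" "b = ?f p" using BC' F(2) by blast
    have "?f (m J) <= ?f (m J')" unfolding J(2)[symmetric] using F(1) p(2) by (intro Min_le) auto
    also have "\<dots> <= b" using m p by blast
    finally show "?f (m J) <= b" .
  qed
qed

section \<open>Domination in ordered fields\<close>

text \<open>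
  Archimedean comparison: \<open>dom\<close> is \<open>O\<close>, \<open>ll\<close> is \<open>o\<close> and \<open>asy\<close> is \<open>\<Theta>\<close> for elements of an ordered
  field.
\<close>

definition dom :: "'k :: linordered_field => 'k => bool" (infix "\<preceq>" 50) where
  "a \<preceq> b \<longleftrightarrow> (\<exists>n::nat. \<bar>a\<bar> <= of_nat n * \<bar>b\<bar>)"

definition ll :: "'k :: linordered_field => 'k => bool" (infix "\<lless>" 50) where
  "a \<lless> b \<longleftrightarrow> \<not> b \<preceq> a"

definition asy :: "'k :: linordered_field => 'k => bool" (infix "\<asymp>" 50) where
  "a \<asymp> b \<longleftrightarrow> a \<preceq> b \<and> b \<preceq> a"

lemma domI: "\<bar>a\<bar> <= of_nat n * \<bar>b\<bar> ==> a \<preceq> b"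
  by (auto simp: dom_def)

lemma domI_nonneg: "0 <= a ==> 0 <= b ==> a <= of_nat n * b ==> a \<preceq> b"
  by (rule domI[of _ n]) simp

lemma dom_le: "0 <= a ==> a <= b ==> a \<preceq> b"
  by (rule domI[of _ 1]) simp

lemma dom_refl [simp]: "a \<preceq> a"
  by (rule domI[of _ 1]) simp

lemma domE:
  assumes "a \<preceq> b" "0 <= b"
  obtains n :: nat where "a <= of_nat n * b"
  using assms by (auto simp: dom_def abs_le_iff)

lemma domE1:
  assumes "a \<preceq> b" "0 <= b"
  obtains n :: nat where "a <= of_nat n * b" "n \<ge> 1"
proof -
  obtain n :: nat where n: "a <= of_nat n * b" using assms by (rule domE)
  have "of_nat n * b <= of_nat (Suc n) * b" using assms(2) by (intro mult_right_mono) auto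
  then show ?thesis using n that[of "Suc n"] by auto
qed

lemma dom_trans [trans]: "a \<preceq> b ==> b \<preceq> c ==> a \<preceq> c"
proof -
  assume "a \<preceq> b" "b \<preceq> c"
  then obtain m n :: nat where "\<bar>a\<bar> <= of_nat m * \<bar>b\<bar>" "\<bar>b\<bar> <= of_nat n * \<bar>c\<bar>" by (auto simp: dom_def)
  then have "\<bar>a\<bar> <= of_nat m * (of_nat n * \<bar>c\<bar>)"
    by (meson mult_left_mono of_nat_0_le_iff order_trans)
  then show ?thesis by (intro domI[of _ "m * n"]) (simp add: mult.assoc)
qed

lemma ll_dom_trans [trans]: "a \<lless> b ==> b \<preceq> c ==> a \<lless> c"
  unfolding ll_def using dom_trans by blast

lemma dom_ll_trans [trans]: "a \<preceq> b ==> b \<lless> c ==> a \<lless> c"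
  unfolding ll_def using dom_trans by blast

lemma ll_irrefl [simp]: "\<not> a \<lless> a"
  by (simp add: ll_def)

lemma ll_iff: "a \<lless> b \<longleftrightarrow> (\<forall>n::nat. of_nat n * \<bar>a\<bar> < \<bar>b\<bar>)"
  by (auto simp: ll_def dom_def not_le)

lemma llD: "a \<lless> b ==> 0 <= b ==> of_nat n * a < b"
proof -
  assume "a \<lless> b" "0 <= b"
  then have "of_nat n * \<bar>a\<bar> < b" by (simp add: ll_iff)
  moreover have "of_nat n * a <= of_nat n * \<bar>a\<bar>" by (intro mult_left_mono) auto
  ultimately show ?thesis by simp
qed

lemma ll_less: "a \<lless> b ==> 0 <= b ==> a < b"
  using llD[of a b 1] by simp

lemma ll_imp_dom: "a \<lless> b ==> a \<preceq> b"
  unfolding ll_iff by (rule domI[of _ 1]) (metis less_imp_le mult_1 of_nat_1)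

lemma ll_trans [trans]: "a \<lless> b ==> b \<lless> c ==> a \<lless> c"
  using ll_imp_dom dom_ll_trans by blast

lemma dom_zero_left [simp]: "0 \<preceq> a"
  by (rule domI[of _ 0]) simp

lemma dom_add: "a \<preceq> c ==> b \<preceq> c ==> a + b \<preceq> c"
proof -
  assume "a \<preceq> c" "b \<preceq> c"
  then obtain m n :: nat where "\<bar>a\<bar> <= of_nat m * \<bar>c\<bar>" "\<bar>b\<bar> <= of_nat n * \<bar>c\<bar>" by (auto simp: dom_def)
  then show ?thesis
    by (intro domI[of _ "m + n"]) (auto simp: distrib_right intro: order_trans[OF abs_triangle_ineq])
qed

lemma dom_mult: "a \<preceq> b ==> c \<preceq> d ==> a * c \<preceq> b * d"
proof -
  assume "a \<preceq> b" "c \<preceq> d"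
  then obtain m n :: nat where "\<bar>a\<bar> <= of_nat m * \<bar>b\<bar>" "\<bar>c\<bar> <= of_nat n * \<bar>d\<bar>" by (auto simp: dom_def)
  then have "\<bar>a\<bar> * \<bar>c\<bar> <= (of_nat m * \<bar>b\<bar>) * (of_nat n * \<bar>d\<bar>)" by (intro mult_mono) auto
  then show ?thesis by (intro domI[of _ "m * n"]) (simp add: abs_mult ac_simps)
qed

lemma dom_mult_iff [simp]: "c ~= 0 ==> a * c \<preceq> b * c \<longleftrightarrow> a \<preceq> b"
proof
  assume "c ~= 0" "a * c \<preceq> b * c"
  then have "a * c * inverse c \<preceq> b * c * inverse c" using dom_mult dom_refl by blast
  then show "a \<preceq> b" using \<open>c ~= 0\<close> by (simp add: mult.assoc)
qed (simp add: dom_mult)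

lemma ll_mult_iff [simp]: "c ~= 0 ==> a * c \<lless> b * c \<longleftrightarrow> a \<lless> b"
  by (simp add: ll_def)

lemma asy_refl [simp]: "a \<asymp> a"
  by (simp add: asy_def)

lemma asy_sym: "a \<asymp> b ==> b \<asymp> a"
  by (simp add: asy_def)

lemma asy_trans [trans]: "a \<asymp> b ==> b \<asymp> c ==> a \<asymp> c"
  unfolding asy_def using dom_trans by blast

lemma asy_mult: "a \<asymp> b ==> c \<asymp> d ==> a * c \<asymp> b * d"
  unfolding asy_def using dom_mult by blast

lemma asy_inverse: "a \<asymp> b ==> a ~= 0 ==> b ~= 0 ==> inverse a \<asymp> inverse b"
proof -
  assume "a \<asymp> b" "a ~= 0" "b ~= 0"
  then have "a * (inverse a * inverse b) \<asymp> b * (inverse a * inverse b)" by (intro asy_mult) auto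
  moreover have "a * (inverse a * inverse b) = inverse b" "b * (inverse a * inverse b) = inverse a"
    using \<open>a ~= 0\<close> \<open>b ~= 0\<close> by (simp_all add: field_simps)
  ultimately show ?thesis by (simp add: asy_sym)
qed

lemma asy_divide: "a \<asymp> b ==> c \<asymp> d ==> c ~= 0 ==> d ~= 0 ==> a / c \<asymp> b / d"
  unfolding divide_inverse by (intro asy_mult asy_inverse)

lemma asy_ll1: "a \<asymp> b ==> b \<lless> c ==> a \<lless> c" and asy_ll2: "a \<lless> b ==> b \<asymp> c ==> a \<lless> c"
  and asy_dom2: "a \<preceq> b ==> b \<asymp> c ==> a \<preceq> c"
  unfolding asy_def by (blast intro: dom_ll_trans ll_dom_trans dom_trans)+

lemma asy_cases: "a \<lless> b \<or> a \<asymp> b \<or> b \<lless> a"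
  by (auto simp: asy_def ll_def)

lemma ll_zero_left [simp]: "0 \<lless> a \<longleftrightarrow> a ~= 0"
  by (auto simp: ll_iff)

lemma not_ll_zero [simp]: "\<not> a \<lless> 0"
  by (simp add: ll_def)

lemma of_nat_dom_one [simp]: "of_nat n \<preceq> 1"
  by (rule domI[of _ n]) simp

lemma dom_of_nat_mult: "of_nat n * a \<preceq> a"
  by (rule domI[of _ n]) (simp add: abs_mult)

text \<open>
  The order at resolution \<open>\<sigma>\<close>: elements at a distance of order \<open>\<sigma>\<close> are not distinguished.
\<close>

definition lt :: "'k :: linordered_field => 'k => 'k => bool" where
  "lt \<sigma> a b \<longleftrightarrow> a < b \<and> \<sigma> \<lless> b - a"

lemma lt_trans: "lt \<sigma> a b ==> lt \<sigma> b c ==> lt \<sigma> a c"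
  by (auto simp: lt_def) (erule ll_dom_trans, rule dom_le, auto)

lemma transp_on_lt [simp]: "transp_on X (lt \<sigma>)"
  unfolding transp_on_def using lt_trans by blast

lemma transp_on_lt_image [simp]: "transp_on X (\<lambda>a b. lt \<sigma> (f a) (f b))"
  unfolding transp_on_def using lt_trans by blast

lemma lt_irrefl [simp]: "\<not> lt \<sigma> a a"
  by (simp add: lt_def)

lemma transp_on_ll [simp]: "transp_on X (\<lless>)"
  unfolding transp_on_def using ll_trans by blast

lemma lt_add_cases: "lt \<sigma> (a + b) (c + d) ==> lt \<sigma> a c \<or> lt \<sigma> b d"
proof (rule ccontr)
  assume L: "lt \<sigma> (a + b) (c + d)" and N: "\<not> (lt \<sigma> a c \<or> lt \<sigma> b d)"
  have *: "\<exists>e. q - p <= e \<and> 0 <= e \<and> e \<preceq> \<sigma>" if "\<not> lt \<sigma> p q" for p q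
  proof (cases "p < q")
    case True
    then show ?thesis using that by (intro exI[of _ "q - p"]) (auto simp: lt_def ll_def)
  next
    case False
    then show ?thesis by (intro exI[of _ 0]) auto
  qed
  obtain e where e: "c - a <= e" "0 <= e" "e \<preceq> \<sigma>" using *[of a c] N by blast
  obtain e' where e': "d - b <= e'" "0 <= e'" "e' \<preceq> \<sigma>" using *[of b d] N by blast
  have "c + d - (a + b) \<preceq> e + e'" using L e e' by (intro dom_le) (auto simp: lt_def)
  also have "e + e' \<preceq> \<sigma>" using e e' dom_add by blast
  finally show False using L by (simp add: lt_def ll_def)
qed

text \<open>
  Peel off the indices with values of \<open>a\<close> within a multiple of \<open>\<eta>\<close> of the minimum. The bound on
  the sums confines \<open>b\<close> there as well, and on the remaining indices \<open>a\<close> is so large that \<open>b\<close> must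
  lie below its value at the minimum of \<open>a\<close>.
\<close>

lemma box_cover:
  fixes a b :: "'i => 'k :: linordered_field"
  assumes "wo (a ` I)" "wo (b ` I)" and "0 <= \<eta>"
    and K: "\<And>i j. i \<in> I ==> j \<in> I ==> a i + b i - (a j + b j) <= of_nat K * \<eta>"
  shows "\<exists>F. finite F \<and> I = \<Union>F \<and>
    (\<forall>J\<in>F. \<exists>K'::nat. \<forall>i\<in>J. \<forall>j\<in>J. a i - a j <= of_nat K' * \<eta> \<and> b i - b j <= of_nat K' * \<eta>)"
proof (rule finite_cover_peel[OF assms(2)])
  fix I' assume I': "I' \<subseteq> I" "I' ~= {}"
  have "wo (a ` I')" using assms(1) by (rule wo_subset) (use I' in auto)
  from wo_obtain_arg_min[OF this I'(2)] obtain i0 where i0: "i0 \<in> I'" "\<And>j. j \<in> I' ==> a i0 <= a j" by blast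
  define J where "J = {i \<in> I'. \<exists>n::nat. a i - a i0 <= of_nat n * \<eta>}"
  have "i0 \<in> J" using i0 by (auto simp: J_def intro!: exI[of _ 0])
  have J: "J \<subseteq> I'" by (auto simp: J_def)
  have "wo (b ` J)" using assms(2) by (rule wo_subset) (use I' J in auto)
  from wo_obtain_arg_min[OF this] \<open>i0 \<in> J\<close> obtain i1 where i1: "i1 \<in> J" "\<And>j. j \<in> J ==> b i1 <= b j" by blast
  from i1(1) obtain K1 :: nat where K1: "a i1 - a i0 <= of_nat K1 * \<eta>" by (auto simp: J_def)
  have "b i0 - b i1 <= (a i1 - a i0) + of_nat K * \<eta>"
    using K[of i0 i1] i0 i1 I' J by (auto simp: algebra_simps subset_iff)
  then have *: "b i0 - b i1 <= of_nat (K1 + K) * \<eta>" using K1 by (simp add: algebra_simps)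
  have "a i - a j <= of_nat (K1 + 2 * K) * \<eta> \<and> b i - b j <= of_nat (K1 + 2 * K) * \<eta>" if "i \<in> J" "j \<in> J" for i j
  proof -
    have "a i + b i - (a i0 + b i0) <= of_nat K * \<eta>" using K that J I' i0 by blast
    moreover have "a i0 <= a i" "a i0 <= a j" "b i1 <= b i" "b i1 <= b j" using i0 i1 that J by auto
    ultimately show ?thesis using * by (auto simp: algebra_simps)
  qed
  moreover have "b i < b i0" if "i \<in> I' - J" for i
  proof -
    have "of_nat K * \<eta> < a i - a i0" using that by (auto simp: J_def not_le)
    moreover have "a i + b i - (a i0 + b i0) <= of_nat K * \<eta>" using K that I' i0 by blast
    ultimately show ?thesis by simp
  qed
  ultimately show "\<exists>i0\<in>I'. \<exists>J\<subseteq>I'. (\<exists>K'::nat. \<forall>i\<in>J. \<forall>j\<in>J. a i - a j <= of_nat K' * \<eta> \<and> b i - b j <= of_nat K' * \<eta>)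
      \<and> (\<forall>i\<in>I' - J. b i < b i0)"
    using i0(1) J by blast
qed

text \<open>
  The multiplicative counterpart of \<open>box_cover\<close>, for the logarithms \<open>h \<cdot> ln f\<close> of powers: the two
  products on the right are the first-order changes of \<open>h \<cdot> l\<close> when one factor varies, measured at
  the minimal pair.
\<close>

lemma power_cover:
  fixes h l :: "'i => 'k :: linordered_field"
  assumes "wo (h ` I)" "wo (l ` I)"
    and pos: "\<And>i. i \<in> I ==> 0 < h i" "\<And>i. i \<in> I ==> 0 < l i"
    and K: "\<And>i j. i \<in> I ==> j \<in> I ==> h i * l i - h j * l j <= M"
  shows "\<exists>F. finite F \<and> I = \<Union>F \<and> (\<forall>J\<in>F. \<exists>i0\<in>J. \<forall>i\<in>J. h i0 <= h i \<and> l i0 <= l i \<and>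
           (h i - h i0) * l i0 <= M \<and> h i0 * (l i - l i0) <= M)"
proof (rule finite_cover_peel[OF assms(1)])
  fix I' assume I': "I' \<subseteq> I" "I' ~= {}"
  have "wo (l ` I')" using assms(2) by (rule wo_subset) (use I' in auto)
  from wo_obtain_arg_min[OF this I'(2)] obtain i0 where i0: "i0 \<in> I'" "\<And>j. j \<in> I' ==> l i0 <= l j" by blast
  define J where "J = {i \<in> I'. h i0 <= h i}"
  have "h i0 <= h i \<and> l i0 <= l i \<and> (h i - h i0) * l i0 <= M \<and> h i0 * (l i - l i0) <= M" if "i \<in> J" for i
  proof -
    have i: "i \<in> I" "h i0 <= h i" "l i0 <= l i" using that i0 I' by (auto simp: J_def)
    have "h i * l i0 <= h i * l i" "h i0 * l i <= h i * l i"
      using i pos[of i] by (auto intro: mult_left_mono mult_right_mono simp: less_imp_le)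
    moreover have "h i * l i - h i0 * l i0 <= M" using K i(1) i0(1) I' by blast
    ultimately show ?thesis using i by (simp add: algebra_simps)
  qed
  moreover have "i0 \<in> J" using i0 by (simp add: J_def)
  ultimately show "\<exists>i0\<in>I'. \<exists>J\<subseteq>I'. (\<exists>i0\<in>J. \<forall>i\<in>J. h i0 <= h i \<and> l i0 <= l i \<and>
           (h i - h i0) * l i0 <= M \<and> h i0 * (l i - l i0) <= M) \<and> (\<forall>i\<in>I' - J. h i < h i0)"
    using i0(1) by (intro bexI[of _ i0] exI[of _ J]) (auto simp: J_def)
qed

section \<open>Ordered fields with logarithms and Skolem elements\<close>

inductive_set prods :: "'k :: linordered_field set => 'k set" for X where
  one: "1 \<in> prods X"
| mult: "u \<in> X ==> q \<in> prods X ==> u * q \<in> prods X"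

lemma prods_mult: "p \<in> prods X ==> q \<in> prods X ==> p * q \<in> prods X"
  by (induction rule: prods.induct) (auto simp: mult.assoc intro: prods.intros)

lemma prods_base: "u \<in> X ==> u \<in> prods X"
  using prods.mult[OF _ prods.one, of u X] by simp

lemma prods_mono: "X \<subseteq> Y ==> prods X \<subseteq> prods Y"
proof
  fix q assume "q \<in> prods X" "X \<subseteq> Y"
  then show "q \<in> prods Y" by (induction rule: prods.induct) (auto intro: prods.intros)
qed

text \<open>
  \<open>S\<close> are the Skolem elements; \<open>Dom\<close> is the set of positive elements whose logarithm exists in the
  field. The last axiom is the gap: an infinite element of \<open>Dom\<close> is much larger than \<open>lg x\<close>. It
  keeps \<open>lg x\<close> itself out of \<open>Dom\<close>.
\<close>

locale skolem_field =
  fixes Dom S :: "'k :: linordered_field set" and lg :: "'k => 'k" and pw :: "'k => 'k => 'k" and x :: 'k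
  assumes Dom_pos: "a \<in> Dom ==> 0 < a"
    and Dom_add: "a \<in> Dom ==> b \<in> Dom ==> a + b \<in> Dom"
    and Dom_mult: "a \<in> Dom ==> b \<in> Dom ==> a * b \<in> Dom"
    and Dom_divide: "a \<in> Dom ==> b \<in> Dom ==> a / b \<in> Dom"
    and Dom_pw: "a \<in> Dom ==> pw a b \<in> Dom"
    and lg_mult: "a \<in> Dom ==> b \<in> Dom ==> lg (a * b) = lg a + lg b"
    and lg_le: "a \<in> Dom ==> lg a <= a - 1"
    and lg_pw: "a \<in> Dom ==> lg (pw a b) = b * lg a"
    and S_Dom: "S \<subseteq> Dom"
    and S_one: "1 \<in> S"
    and S_x: "x \<in> S"
    and S_add: "f \<in> S ==> g \<in> S ==> f + g \<in> S"
    and S_mult: "f \<in> S ==> g \<in> S ==> f * g \<in> S"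
    and S_pw: "f \<in> S ==> g \<in> S ==> pw f g \<in> S"
    and S_induct [consumes 1, case_names one x add mult pw]:
      "f \<in> S ==> R 1 ==> R x ==>
       (\<And>f g. f \<in> S ==> g \<in> S ==> R f ==> R g ==> R (f + g)) ==>
       (\<And>f g. f \<in> S ==> g \<in> S ==> R f ==> R g ==> R (f * g)) ==>
       (\<And>f g. f \<in> S ==> g \<in> S ==> R f ==> R g ==> R (pw f g)) ==> R f"
    and S_discrete: "f \<in> S ==> g \<in> S ==> f < g ==> f + 1 <= g"
    and x_infinite: "1 \<lless> x"
    and gap: "a \<in> Dom ==> 1 \<lless> a ==> lg x \<lless> a"
begin

lemma SD: "f \<in> S ==> f \<in> Dom"
  using S_Dom by blast

lemma one_Dom [simp]: "1 \<in> Dom"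
  using S_one SD by blast

lemma lg_one [simp]: "lg 1 = 0"
  using lg_mult[of 1 1] by simp

lemma lg_divide:
  assumes "a \<in> Dom" "b \<in> Dom"
  shows "lg (a / b) = lg a - lg b"
proof -
  have "lg (a / b * b) = lg (a / b) + lg b" using assms Dom_divide lg_mult by blast
  then show ?thesis using Dom_pos[OF assms(2)] by simp
qed

text \<open>
  With its companion below this is the mean value estimate for the logarithm, derived from
  \<open>lg a \<le> a - 1\<close> alone.
\<close>

lemma lg_diff_le:
  assumes "a \<in> Dom" "b \<in> Dom"
  shows "lg b - lg a <= (b - a) / a"
proof -
  have "lg (b / a) <= b / a - 1" using assms Dom_divide lg_le by blast
  then show ?thesis using Dom_pos[OF assms(1)] lg_divide[OF assms(2,1)] by (simp add: diff_divide_distrib)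
qed

lemma lg_diff_ge:
  assumes "a \<in> Dom" "b \<in> Dom"
  shows "(b - a) / b <= lg b - lg a"
proof -
  have "lg a - lg b <= (a - b) / b" using assms lg_diff_le by blast
  then show ?thesis by (simp add: diff_divide_distrib)
qed

lemma lg_strict_mono:
  assumes "a \<in> Dom" "b \<in> Dom" "a < b"
  shows "lg a < lg b"
proof -
  have "0 < (b - a) / b" using assms Dom_pos by simp
  also have "\<dots> <= lg b - lg a" using assms lg_diff_ge by blast
  finally show ?thesis by simp
qed

lemma lg_less_iff: "a \<in> Dom ==> b \<in> Dom ==> lg a < lg b \<longleftrightarrow> a < b"
  using lg_strict_mono by (metis less_asym neqE)

lemma lg_le_iff: "a \<in> Dom ==> b \<in> Dom ==> lg a <= lg b \<longleftrightarrow> a <= b"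
  using lg_less_iff by (metis not_less)

lemma lg_eq_iff: "a \<in> Dom ==> b \<in> Dom ==> lg a = lg b \<longleftrightarrow> a = b"
  using lg_le_iff by (metis order_eq_iff)

lemma two_S [simp]: "2 \<in> S"
  using S_add[OF S_one S_one] by simp

lemma two_Dom [simp]: "2 \<in> Dom"
  using two_S SD by blast

lemma lg_two: "1 / 2 <= lg 2"
  using lg_diff_ge[of 1 2] by simp

lemma lg_ge_half: "a \<in> Dom ==> 2 <= a ==> 1 / 2 <= lg a"
  using lg_two lg_le_iff[of 2 a] by (auto intro: order_trans)

lemma lg_nonneg: "a \<in> Dom ==> 1 <= a ==> 0 <= lg a"
  using lg_le_iff[of 1 a] by simp

lemma lg_ge_halfD: "a \<in> Dom ==> 0 <= lg a ==> 1 <= a"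
  using lg_le_iff[of 1 a] by simp

lemma lg_power: "a \<in> Dom ==> a ^ n \<in> Dom \<and> lg (a ^ n) = of_nat n * lg a"
  by (induction n) (auto simp: Dom_mult lg_mult algebra_simps)

lemma of_nat_le_lg_power: "(4::'k) ^ n \<in> Dom" "of_nat n <= lg (4 ^ n)"
proof -
  have four: "(4::'k) \<in> Dom" using Dom_mult[OF two_Dom two_Dom] by simp
  have "lg (2 * 2) = lg 2 + lg 2" by (intro lg_mult) auto
  then have "1 <= lg 4" using lg_two by simp
  then show "(4::'k) ^ n \<in> Dom" "of_nat n <= lg (4 ^ n)"
    using lg_power[OF four, of n] mult_left_mono[of 1 "lg 4" "of_nat n"] by simp_all
qed

lemma of_nat_S: "0 < n ==> of_nat n \<in> S"
proof (induction n)
  case (Suc n)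
  then show ?case
    using S_add[OF S_one, of "of_nat n"] S_one by (cases "n = 0") (auto simp: add.commute)
qed simp

lemma S_ge_one: "f \<in> S ==> 1 <= f"
proof (induction rule: S_induct)
  case x
  then show ?case using llD[OF x_infinite, of 1] Dom_pos[OF SD[OF S_x]] by simp
next
  case (mult f g)
  then show ?case using mult_mono[of 1 f 1 g] by simp
next
  case (pw f g)
  then have "0 <= lg (pw f g)" using lg_nonneg SD by (simp add: lg_pw)
  then show ?case using lg_ge_halfD Dom_pw SD pw by blast
qed auto

lemma S_pos: "f \<in> S ==> 0 < f"
  using S_ge_one less_le_trans zero_less_one by blast

lemma S_ge_two: "f \<in> S ==> f ~= 1 ==> 2 <= f"
  using S_ge_one[of f] S_discrete[OF S_one, of f] by (cases "f = 1") auto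

lemma infinite_nat_less: "1 \<lless> a ==> 0 <= a ==> of_nat n < a"
  using llD[of 1 a n] by simp

lemma infinite_ge: "1 \<lless> a ==> 0 <= a ==> numeral n < a"
  using infinite_nat_less[of a "numeral n"] by simp

lemma infiniteI: "(\<And>n::nat. of_nat n < a) ==> 1 \<lless> a"
  by (auto simp: ll_iff intro: less_le_trans[OF _ abs_ge_self])

lemma lg_infinite: "a \<in> Dom ==> 1 \<lless> a ==> 1 \<lless> lg a"
proof (rule infiniteI)
  fix n :: nat
  assume a: "a \<in> Dom" "1 \<lless> a"
  have "of_nat n <= lg (4 ^ n)" by (rule of_nat_le_lg_power)
  also have "(4::'k) ^ n < a" using infinite_nat_less[of a "4 ^ n"] a Dom_pos by (simp add: less_imp_le)
  then have "lg (4 ^ n) < lg a" using lg_less_iff of_nat_le_lg_power(1) a by blast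
  finally show "of_nat n < lg a" .
qed

lemma lg_infiniteD: "a \<in> Dom ==> 1 \<lless> lg a ==> 0 <= lg a ==> 1 \<lless> a"
proof (rule infiniteI)
  fix n :: nat
  assume "a \<in> Dom" "1 \<lless> lg a" "0 <= lg a"
  then show "of_nat n < a" using infinite_nat_less[of "lg a" n] lg_le[of a] by simp
qed

lemma ll_divide_iff: "0 < a ==> 0 < b ==> a \<lless> b \<longleftrightarrow> 1 \<lless> b / a"
  using ll_mult_iff[of a 1 "b / a"] by simp

text \<open>
  The logarithm is an order isomorphism from growth classes to elements at resolution one.
\<close>

lemma ll_lg_iff:
  assumes "a \<in> Dom" "b \<in> Dom"
  shows "a \<lless> b \<longleftrightarrow> lt 1 (lg a) (lg b)"
proof
  assume "a \<lless> b"
  then have "1 \<lless> b / a" using ll_divide_iff Dom_pos assms by blast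
  then have "1 \<lless> lg b - lg a" using lg_infinite[of "b / a"] Dom_divide lg_divide assms by metis
  moreover have "a < b" using ll_less[OF \<open>a \<lless> b\<close>] Dom_pos[OF assms(2)] by simp
  ultimately show "lt 1 (lg a) (lg b)" using lg_strict_mono assms by (simp add: lt_def)
next
  assume "lt 1 (lg a) (lg b)"
  then have "1 \<lless> lg (b / a)" "0 <= lg (b / a)" using lg_divide assms by (auto simp: lt_def)
  then have "1 \<lless> b / a" using lg_infiniteD[of "b / a"] Dom_divide assms by blast
  then show "a \<lless> b" using ll_divide_iff Dom_pos assms by blast
qed

lemma dom_lgE:
  assumes "a \<in> Dom" "b \<in> Dom" "a \<preceq> b"
  obtains n :: nat where "lg a <= lg b + of_nat n"
proof -
  obtain n :: nat where n: "a <= of_nat n * b" "n \<ge> 1"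
    using domE1[OF assms(3)] Dom_pos[OF assms(2)] by (metis less_imp_le)
  have nD: "of_nat n \<in> Dom" using n of_nat_S SD by simp
  have "lg a <= lg (of_nat n * b)" using n assms nD Dom_mult by (simp add: lg_le_iff)
  also have "\<dots> = lg (of_nat n) + lg b" using nD assms by (simp add: lg_mult)
  also have "lg (of_nat n :: 'k) <= of_nat n" using lg_le[OF nD] by (simp add: order_trans)
  finally show ?thesis using that[of n] by (simp add: add.commute)
qed

definition U :: "'k set" where
  "U = insert x {pw f g |f g. f \<in> S \<and> 2 <= f \<and> g \<in> S \<and> 1 \<lless> g}"

text \<open>
  The quotients \<open>f^g / f = f^(g-1)\<close> are included because the derivative of \<open>f^g\<close> with respect to
  the base is \<open>g \<cdot> f^g / f\<close>. Such factors relate the scale of a power to the scale of its base,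
  and multiplication by them has to preserve the set of products.
\<close>

definition U' :: "'k set" where
  "U' = U \<union> {pw f g / f |f g. f \<in> S \<and> 2 <= f \<and> g \<in> S \<and> 1 \<lless> g}"

definition P :: "'k set" where "P = prods U"

definition Q :: "'k set" where "Q = prods U'"

lemma P_one: "1 \<in> P" and Q_one: "1 \<in> Q"
  by (simp_all add: P_def Q_def prods.one)

lemma P_mult: "p \<in> P ==> q \<in> P ==> p * q \<in> P"
  by (simp add: P_def prods_mult)

lemma Q_mult: "p \<in> Q ==> q \<in> Q ==> p * q \<in> Q"
  by (simp add: Q_def prods_mult)

lemma P_Q: "P \<subseteq> Q"
  unfolding P_def Q_def by (rule prods_mono) (auto simp: U'_def)

lemma U_S: "U \<subseteq> S"
  by (auto simp: U_def S_x S_pw)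

lemma P_S: "P \<subseteq> S"
proof
  fix p assume "p \<in> P"
  then show "p \<in> S" unfolding P_def
    by (induction rule: prods.induct) (use U_S S_one S_mult in auto)
qed

lemma U'_Q: "u \<in> U' ==> u \<in> Q"
  by (simp add: Q_def prods_base)

lemma pw_infinite:
  assumes "f \<in> Dom" "2 <= f" "1 \<lless> h" "0 <= h"
  shows "1 \<lless> pw f h"
proof (rule lg_infiniteD)
  have "1 / 2 <= lg f" using lg_ge_half assms by blast
  then have "h * (1 / 2) <= h * lg f" using assms(4) by (intro mult_left_mono) auto
  then have "h * (1 / 2) \<preceq> lg (pw f h)" using assms by (intro dom_le) (auto simp: lg_pw)
  moreover have "h \<preceq> h * (1 / 2)" using assms by (intro domI_nonneg[of _ _ 2]) auto
  ultimately show "1 \<lless> lg (pw f h)" using assms(3) by (meson ll_dom_trans)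
  show "0 <= lg (pw f h)" using assms lg_ge_half[of f] by (simp add: lg_pw)
qed (use assms Dom_pw in blast)

lemma pwd_eq:
  assumes "f \<in> Dom"
  shows "pw f g / f = pw f (g - 1)"
  using assms Dom_pw Dom_divide lg_eq_iff[of "pw f g / f" "pw f (g - 1)"]
  by (simp add: lg_divide lg_pw algebra_simps)

lemma infinite_minus_one:
  assumes "1 \<lless> g" "0 <= g"
  shows "1 \<lless> g - 1" "0 < g - 1" "g - 1 \<asymp> g"
proof -
  have *: "of_nat n < g - 1" for n :: nat using infinite_nat_less[OF assms, of "Suc n"] by simp
  show "1 \<lless> g - 1" by (rule infiniteI[OF *])
  show "0 < g - 1" using *[of 0] by simp
  have "2 < g" using infinite_nat_less[OF assms, of 2] by simp
  then show "g - 1 \<asymp> g" unfolding asy_def by (intro conjI domI_nonneg[of _ _ 2]) auto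
qed

lemma U'_cases:
  assumes "u \<in> U'"
  obtains "u = x" | f g e where "u = pw f (g - e)" "f \<in> S" "2 <= f" "g \<in> S" "1 \<lless> g" "e = 0 \<or> e = 1 \<and> u \<notin> U"
proof -
  consider "u = x" | f g where "u = pw f g" "f \<in> S" "2 <= f" "g \<in> S" "1 \<lless> g"
    | f g where "u = pw f g / f" "u \<notin> U" "f \<in> S" "2 <= f" "g \<in> S" "1 \<lless> g"
    using assms unfolding U'_def U_def by blast
  then show thesis
  proof cases
    case 2
    then show thesis using that(2)[of f g 0] by simp
  next
    case 3
    then show thesis using that(2)[of f g 1] pwd_eq[OF SD[OF 3(3)]] by simp
  qed (use that in blast)
qed

lemma U'_infinite: "u \<in> U' ==> 1 \<lless> u"
proof (erule U'_cases)
  fix f g e assume *: "u = pw f (g - e)" "f \<in> S" "2 <= f" "g \<in> S" "1 \<lless> g" "e = 0 \<or> e = 1 \<and> u \<notin> U"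
  then show ?thesis
    using infinite_minus_one[of g] S_pos[of g] pw_infinite[of f "g - e"] SD[of f] by (auto simp: less_imp_le)
qed (simp add: x_infinite)

lemma U'_Dom: "U' \<subseteq> Dom"
  using U_S S_Dom Dom_pw Dom_divide SD by (auto simp: U'_def)

lemma Q_Dom: "Q \<subseteq> Dom"
proof
  fix q assume "q \<in> Q"
  then show "q \<in> Dom" unfolding Q_def
    by (induction rule: prods.induct) (use U'_Dom Dom_mult in auto)
qed

lemma QD: "q \<in> Q ==> q \<in> Dom" and PS: "p \<in> P ==> p \<in> S" and PQ: "p \<in> P ==> p \<in> Q"
  using Q_Dom P_S P_Q by auto

lemma U'_ge_one: "u \<in> U' ==> 1 < u"
  using infinite_nat_less[of u 1] U'_infinite[of u] U'_Dom Dom_pos[of u] by auto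

lemma Q_ge_one: "q \<in> Q ==> 1 <= q"
  unfolding Q_def
proof (induction rule: prods.induct)
  case (mult u q)
  then show ?case using U'_ge_one[of u] mult_mono[of 1 u 1 q] by simp
qed simp

lemma Q_pos: "q \<in> Q ==> 0 < q"
  using Dom_pos QD by blast

text \<open>
  By discreteness a bounded Skolem element cannot lie strictly between consecutive integers.
\<close>

lemma S_bounded_nat:
  assumes "f \<in> S" "f \<preceq> 1"
  obtains n :: nat where "0 < n" "f = of_nat n"
proof -
  obtain N :: nat where N: "f <= of_nat N" using assms(2) domE[of f 1] by auto
  define n where "n = (GREATEST n. of_nat n <= f)"
  have b: "n <= N" if "of_nat n <= f" for n :: nat
    using order_trans[OF that N] by simp
  have n: "of_nat n <= f" unfolding n_def using b GreatestI_nat[of "\<lambda>n. of_nat n <= f" 0 N] S_pos[OF assms(1)] by simp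
  have max: "\<not> of_nat (Suc n) <= f"
    using Greatest_le_nat[of "\<lambda>n. of_nat n <= f" "Suc n" N] b unfolding n_def by fastforce
  have "n ~= 0" using max S_ge_one[OF assms(1)] by (cases n) auto
  moreover have "f = of_nat n"
  proof (rule ccontr)
    assume "f ~= of_nat n"
    then have "of_nat n < f" using n by simp
    then have "of_nat n + 1 <= f" using S_discrete[OF of_nat_S assms(1)] \<open>n ~= 0\<close> by simp
    then show False using max by (simp add: add.commute)
  qed
  ultimately show thesis using that by simp
qed

lemma sum_list_P_mult:
  assumes "xs ~= []" "set xs \<subseteq> P" "ys ~= []" "set ys \<subseteq> P"
  shows "\<exists>zs. zs ~= [] \<and> set zs \<subseteq> P \<and> sum_list xs * sum_list ys = sum_list zs"
proof -
  have s: "sum_list xs * b = sum_list (map (\<lambda>a. a * b) xs)" for b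
    by (simp add: sum_list_mult_const)
  have "sum_list (concat (map (\<lambda>b. map (\<lambda>a. a * b) xs) zs)) = sum_list xs * sum_list zs" for zs
    by (induction zs) (simp_all add: s[symmetric] distrib_left)
  then show ?thesis
    using assms by (intro exI[of _ "concat (map (\<lambda>b. map (\<lambda>a. a * b) xs) ys)"]) (auto intro: P_mult)
qed

text \<open>
  Products of sums are expanded; a power with bounded exponent is an iterated product, since
  bounded exponents are positive integers, and any other power is itself a generator or equal to
  one.
\<close>

lemma S_sum_list:
  assumes "f \<in> S"
  shows "\<exists>xs. xs ~= [] \<and> set xs \<subseteq> P \<and> f = sum_list xs"
  using assms
proof (induction rule: S_induct)
  case one
  then show ?case by (intro exI[of _ "[1]"]) (simp add: P_one)
next
  case x
  then show ?case by (intro exI[of _ "[x]"]) (simp add: P_def prods_base U_def)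
next
  case (add f g)
  then obtain xs ys where "xs ~= []" "set xs \<subseteq> P" "f = sum_list xs" "set ys \<subseteq> P" "g = sum_list ys" by blast
  then show ?case by (intro exI[of _ "xs @ ys"]) simp
next
  case (mult f g)
  then show ?case using sum_list_P_mult by metis
next
  case (pw f g)
  show ?case
  proof (cases "1 \<lless> g")
    case True
    show ?thesis
    proof (cases "f = 1")
      case True
      then have "pw f g = 1" using lg_eq_iff[of "pw f g" 1] Dom_pw[of f g] lg_pw[of f g] by simp
      then show ?thesis by (intro exI[of _ "[1]"]) (simp add: P_one)
    next
      case False
      then have "pw f g \<in> P"
        using \<open>1 \<lless> g\<close> pw S_ge_two[of f] by (auto simp: P_def U_def intro: prods_base)
      then show ?thesis by (intro exI[of _ "[pw f g]"]) simp
    qed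
  next
    case False
    then have "g \<preceq> 1" by (simp add: ll_def)
    then obtain n where n: "0 < n" "g = of_nat n" using S_bounded_nat[OF pw(2)] by blast
    have "pw f g = f ^ n"
      using lg_eq_iff[of "pw f g" "f ^ n"] Dom_pw[of f g] lg_pw[of f g] lg_power[of f n] SD[OF pw(1)] n by simp
    moreover have "\<exists>xs. xs ~= [] \<and> set xs \<subseteq> P \<and> f ^ n = sum_list xs" for n
    proof (induction n)
      case 0
      then show ?case by (intro exI[of _ "[1]"]) (simp add: P_one)
    next
      case (Suc n)
      then show ?case using pw(3) sum_list_P_mult unfolding power_Suc by metis
    qed
    ultimately show ?thesis by simp
  qed
qed

lemma sum_list_S: "set xs \<subseteq> P ==> sum_list xs \<in> insert 0 S"
  by (induction xs) (auto simp: S_add PS)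

text \<open>
  The largest summand dominates the finitely many others.
\<close>

lemma leading_summand:
  assumes "f \<in> S"
  obtains c r where "c \<in> P" "r \<in> insert 0 S" "f = c + r" "f \<preceq> c" "c \<preceq> f"
proof -
  obtain xs where xs: "xs ~= []" "set xs \<subseteq> P" "f = sum_list xs" using S_sum_list[OF assms] by blast
  define c where "c = Max (set xs)"
  have c: "c \<in> set xs" "\<And>y. y \<in> set xs ==> y <= c" using xs(1) by (auto simp: c_def)
  obtain ys zs where yz: "xs = ys @ c # zs" using c(1) by (meson split_list)
  define r where "r = sum_list (ys @ zs)"
  have r: "r \<in> insert 0 S" unfolding r_def using xs(2) yz by (intro sum_list_S) auto
  have f: "f = c + r" using xs yz by (simp add: r_def)
  have cP: "c \<in> P" using c xs by blast
  have "sum_list xs <= of_nat (length xs) * c" using c(2)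
    by (induction xs) (auto simp: algebra_simps add_mono)
  then have "f \<preceq> c" using xs S_pos[OF assms] S_pos[OF PS[OF cP]]
    by (intro domI_nonneg[of _ _ "length xs"]) auto
  moreover have "c \<preceq> f" using r f S_pos[OF PS[OF cP]] S_pos by (intro dom_le) (auto simp: less_imp_le)
  ultimately show thesis using that cP r f by blast
qed

text \<open>
  The factor with the largest logarithm dominates the logarithm of the product.
\<close>

lemma leading_factor:
  assumes "q \<in> Q" "q ~= 1"
  obtains u p where "u \<in> U'" "p \<in> Q" "q = u * p" "lg q \<preceq> lg u" "lg u <= lg q"
proof -
  have "\<exists>n::nat. q = 1 \<or> (\<exists>u\<in>U'. \<exists>p\<in>Q. q = u * p \<and> lg q <= of_nat n * lg u)"
    using assms(1) unfolding Q_def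
  proof (induction rule: prods.induct)
    case (mult v q)
    then obtain n :: nat where IH: "q = 1 \<or> (\<exists>u\<in>U'. \<exists>p\<in>prods U'. q = u * p \<and> lg q <= of_nat n * lg u)" by blast
    have vD: "v \<in> Dom" "q \<in> Dom" using mult U'_Dom Q_Dom by (auto simp: Q_def)
    show ?case
    proof (cases "q = 1")
      case True
      then have "v * q = v * 1" "lg (v * q) <= of_nat 1 * lg v" by simp_all
      then show ?thesis using mult(1) prods.one by blast
    next
      case False
      then obtain u p where up: "u \<in> U'" "p \<in> prods U'" "q = u * p" "lg q <= of_nat n * lg u" using IH by blast
      have pD: "u \<in> Dom" "p \<in> Dom" using up U'_Dom Q_Dom by (auto simp: Q_def)
      show ?thesis
      proof (cases "lg v <= lg u")
        case True
        have "v * q = u * (v * p)" using up by simp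
        moreover have "v * p \<in> prods U'" using up mult prods.mult by blast
        moreover have "lg (v * q) <= of_nat (Suc n) * lg u"
          using True up(4) vD by (simp add: lg_mult algebra_simps)
        ultimately show ?thesis using up(1) by blast
      next
        case False
        then have "of_nat n * lg u <= of_nat n * lg v" by (intro mult_left_mono) auto
        then have "lg (v * q) <= of_nat (Suc n) * lg v"
          using up(4) vD by (simp add: lg_mult algebra_simps)
        then show ?thesis using mult by blast
      qed
    qed
  qed simp
  then obtain n :: nat and u p where up: "u \<in> U'" "p \<in> Q" "q = u * p" "lg q <= of_nat n * lg u"
    using assms(2) by blast
  have D: "u \<in> Dom" "p \<in> Dom" "q \<in> Dom" using up assms U'_Dom QD by auto
  have "0 <= lg q" "0 <= lg p" "0 <= lg u"
    using lg_nonneg D Q_ge_one[of p] Q_ge_one[of q] U'_ge_one[of u] up assms by auto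
  then have "lg q \<preceq> lg u" using up(4) by (intro domI_nonneg[of _ _ n]) auto
  moreover have "lg u <= lg q" using up(3) D \<open>0 <= lg p\<close> by (simp add: lg_mult)
  ultimately show thesis using that up by blast
qed

lemma Q_le_P: "q \<in> Q ==> \<exists>p\<in>P. q <= p"
  unfolding Q_def
proof (induction rule: prods.induct)
  case one
  then show ?case using P_one by blast
next
  case (mult u q)
  then obtain p where p: "p \<in> P" "q <= p" by blast
  obtain v where v: "v \<in> U" "u <= v"
  proof (cases "u \<in> U")
    case False
    then obtain f g where "u = pw f g / f" "f \<in> S" "2 <= f" "g \<in> S" "1 \<lless> g"
      using mult(1) by (auto simp: U'_def)
    moreover have "pw f g / f <= pw f g" if "f \<in> S" "g \<in> S" for f g
      using S_ge_one[OF that(1)] S_pos[OF S_pw[OF that]] by (simp add: divide_le_eq mult_le_cancel_left1)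
    ultimately show thesis using that[of "pw f g"] by (auto simp: U_def)
  qed (use that in blast)
  have "u * q <= v * p" using p v U'_ge_one[OF mult(1)] Q_pos[of q] mult(2)
    by (intro mult_mono) (auto simp: Q_def less_imp_le)
  moreover have "v * p \<in> P" using p v by (auto simp: P_def intro: prods.mult)
  ultimately show ?case by blast
qed

section \<open>The well-ordering of Skolem elements\<close>

text \<open>
  A common calculus that produces both the Skolem elements and the products of generators, with
  the number of steps as index. In every rule with premises the arguments are at most the result;
  this is why exponents \<open>b - 1\<close> occur only for bases and exponents that are at least two.
\<close>

inductive built :: "nat => 'k => bool" where
  "built 0 1"
| "built 0 x"
| "built m a ==> built n b ==> built (Suc (m + n)) (a + b)"
| "built m a ==> built n b ==> built (Suc (m + n)) (a * b)"
| "built m a ==> built n b ==> 2 <= a ==> built (Suc (m + n)) (pw a b)"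
| "built m a ==> built n b ==> 2 <= a ==> 2 <= b ==> built (Suc (m + n)) (pw a (b - 1))"

definition V :: "'k set" where "V = {a. \<exists>n. built n a}"

lemma pw_ge_one: "a \<in> Dom ==> 1 <= a ==> 0 <= b ==> 1 <= pw a b"
  using lg_nonneg[of a] lg_ge_halfD[of "pw a b"] Dom_pw[of a b] by (simp add: lg_pw)

lemma built_Dom: "built n a ==> a \<in> Dom \<and> 1 <= a"
proof (induction rule: built.induct)
  case 2
  then show ?case using S_x SD S_ge_one by blast
next
  case (4 m a n b)
  then show ?case using mult_mono[of 1 a 1 b] by (auto simp: Dom_mult)
qed (auto simp: Dom_add Dom_pw pw_ge_one)

lemma lg_le_half:
  assumes "b \<in> Dom"
  shows "lg b <= lg 2 + (b - 2) / 2"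
  using lg_diff_le[OF two_Dom assms] by linarith

lemma le_pw:
  assumes "a \<in> Dom" "b \<in> Dom" "2 <= a"
  shows "1 <= b ==> b <= pw a b" "2 <= b ==> b <= pw a (b - 1)"
proof -
  have half: "1 / 2 <= lg 2" "lg 2 <= lg a" using lg_two lg_le_iff[of 2 a] assms by auto
  show "b <= pw a b" if "1 <= b"
  proof -
    have "lg b <= lg 2 + (b - 2) / 2" using assms lg_le_half by blast
    also have "\<dots> <= lg 2 + (b - 1) * (1 / 2)" by simp
    also have "\<dots> <= lg 2 + (b - 1) * lg 2" using half that by (intro add_left_mono mult_left_mono) auto
    also have "\<dots> = b * lg 2" by (simp add: algebra_simps)
    also have "\<dots> <= b * lg a" using half that by (intro mult_left_mono) auto
    finally show ?thesis using assms Dom_pw lg_le_iff[of b "pw a b"] by (simp add: lg_pw)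
  qed
  show "b <= pw a (b - 1)" if "2 <= b"
  proof -
    have "lg b <= lg 2 + (b - 2) / 2" using assms lg_le_half by blast
    also have "\<dots> = lg 2 + (b - 2) * (1 / 2)" by simp
    also have "\<dots> <= lg 2 + (b - 2) * lg 2" using half that by (intro add_left_mono mult_left_mono) auto
    also have "\<dots> = (b - 1) * lg 2" by (simp add: algebra_simps)
    also have "\<dots> <= (b - 1) * lg a" using half that by (intro mult_left_mono) auto
    finally show ?thesis using assms Dom_pw lg_le_iff[of b "pw a (b - 1)"] by (simp add: lg_pw)
  qed
qed

lemma base_le_pw:
  assumes "a \<in> Dom" "1 <= a" "1 <= b"
  shows "a <= pw a b"
proof -
  have "1 * lg a <= b * lg a" using assms lg_nonneg by (intro mult_right_mono) auto
  then show ?thesis using assms Dom_pw lg_le_iff[of a "pw a b"] by (simp add: lg_pw)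
qed

lemma pw_mono:
  assumes "a \<in> Dom" "c \<in> Dom" "1 <= a" "a <= c" "0 <= b" "b <= d"
  shows "pw a b <= pw c d"
proof -
  have "b * lg a <= d * lg c" using assms lg_nonneg[of a] lg_le_iff[of a c] by (intro mult_mono) auto
  then show ?thesis using assms Dom_pw lg_le_iff[of "pw a b" "pw c d"] by (simp add: lg_pw)
qed

text \<open>
  Nash-Williams' minimal bad sequence. A descending sequence is chosen in which every term has the
  fewest construction steps possible. The immediate arguments of its terms are at most as large
  and have fewer steps, so by minimality they lie in the part of \<open>V\<close> below which the order is
  well-founded. The terms are monotone images of pairs of such arguments, hence well-ordered,
  which contradicts the descent.
\<close>

lemma wo_V: "wo V"
proof (rule ccontr)
  assume nwo: "\<not> wo V"
  \<comment> \<open>The elements from which a descending sequence starts.\<close>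
  define B where "B = {v \<in> V. \<not> wo {w \<in> V. w <= v}}"
  define sz where "sz a = (LEAST n. built n a)" for a
  have sz: "built (sz a) a" if aV: "a \<in> V" for a
  proof -
    obtain n where "built n a" using aV by (auto simp: V_def)
    then show ?thesis unfolding sz_def by (rule LeastI)
  qed
  have sz_le: "sz a <= n" if "built n a" for a n
    unfolding sz_def using that by (rule Least_le)
  have B_I: "c \<in> B" if C: "C \<subseteq> V" "c \<in> C" "\<not> (\<exists>m\<in>C. \<forall>b\<in>C. m <= b)" for C c
  proof -
    have "\<not> wo {w \<in> V. w <= c}"
    proof
      assume w: "wo {w \<in> V. w <= c}"
      have sub: "{w \<in> C. w <= c} \<subseteq> {w \<in> V. w <= c}" "{w \<in> C. w <= c} ~= {}" using C by auto
      obtain m where m: "m \<in> {w \<in> C. w <= c}" "\<forall>b\<in>{w \<in> C. w <= c}. m <= b"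
        using wo_min[OF w sub] by blast
      have "m <= b" if "b \<in> C" for b
        using m that linear[of b c] by (cases "b <= c") auto
      then show False using C(3) m(1) by blast
    qed
    then show ?thesis using C by (auto simp: B_def)
  qed
  obtain C where C: "C \<subseteq> V" "C ~= {}" "\<not> (\<exists>m\<in>C. \<forall>b\<in>C. m <= b)" using not_wo[OF nwo] by blast
  then have "B ~= {}" using B_I by blast
  have down: "{b' \<in> B. b' < b} ~= {}" if bB: "b \<in> B" for b
  proof -
    obtain C where C: "C \<subseteq> {w \<in> V. w <= b}" "C ~= {}" "\<not> (\<exists>m\<in>C. \<forall>b\<in>C. m <= b)"
      using not_wo[of "{w \<in> V. w <= b}"] bB by (auto simp: B_def)
    then obtain c where c: "c \<in> C" by blast
    then obtain c' where c': "c' \<in> C" "c' < c" using C(3) by (meson not_le)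
    have "c' \<in> B" using B_I[of C c'] C c' by blast
    moreover have "c' < b" using C c c' by (auto intro: less_le_trans)
    ultimately show ?thesis by blast
  qed
  define s where "s = rec_nat (arg_min_on sz B) (\<lambda>_ b. arg_min_on sz {b' \<in> B. b' < b})"
  have amin: "arg_min_on sz X \<in> X \<and> (\<forall>a\<in>X. sz (arg_min_on sz X) <= sz a)" if X: "X ~= {}" for X :: "'k set"
    using X arg_min_natI[of "\<lambda>a. a \<in> X"] arg_min_nat_le[of "\<lambda>a. a \<in> X"]
    by (auto simp: arg_min_on_def)
  have s0: "s 0 = arg_min_on sz B" and sS: "s (Suc n) = arg_min_on sz {b' \<in> B. b' < s n}" for n
    by (simp_all add: s_def)
  have sB: "s n \<in> B" for n
  proof (induction n)
    case 0
    then show ?case using amin[OF \<open>B ~= {}\<close>] s0 by simp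
  next
    case (Suc n)
    then show ?case using amin[OF down[OF Suc]] sS by simp
  qed
  have s_dec: "s (Suc n) < s n" for n using amin[OF down[OF sB[of n]]] sS by simp
  \<comment> \<open>The minimality of the sequence, in the form in which it is applied to the arguments of its
    terms.\<close>
  have sub: "a \<in> V - B" if "a <= s n" "built m a" "m < sz (s n)" for a m n
  proof -
    have "sz a < sz (s n)" using sz_le[OF that(2)] that(3) by simp
    have "a \<notin> B"
    proof
      assume "a \<in> B"
      show False
      proof (cases n)
        case 0
        then show False using amin[OF \<open>B ~= {}\<close>] s0 \<open>a \<in> B\<close> \<open>sz a < sz (s n)\<close> by (auto simp: not_less[symmetric])
      next
        case (Suc k)
        then have "a < s k" using that(1) s_dec[of k] by simp
        then have "a \<in> {b' \<in> B. b' < s k}" using \<open>a \<in> B\<close> by simp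
        then have "sz (s n) <= sz a" using amin[OF down[OF sB[of k]]] sS[of k] Suc by simp
        then show False using \<open>sz a < sz (s n)\<close> by simp
      qed
    qed
    then show ?thesis using that(2) by (auto simp: V_def)
  qed
  have wG: "wo (V - B)"
    unfolding wo_def
  proof (intro allI impI)
    fix C assume C: "C \<subseteq> V - B" "C ~= {}"
    show "\<exists>m\<in>C. \<forall>b\<in>C. m <= b"
    proof (rule ccontr)
      assume "\<not> ?thesis"
      then show False using B_I[of C] C by blast
    qed
  qed
  define G where "G = (V - B) \<times> (V - B)"
  define G2 where "G2 = {(a, b) \<in> G. 2 <= a}"
  define G3 where "G3 = {(a, b) \<in> G. 2 <= a \<and> 2 <= b}"
  have VD: "a \<in> Dom" "1 <= a" if "a \<in> V" for a using that built_Dom by (auto simp: V_def)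
  have wG2: "wo (fst ` X)" "wo (snd ` X)" if "X \<subseteq> G" for X
    by (rule wo_subset[OF wG], use that in \<open>auto simp: G_def\<close>)+
  have Gs: "G \<subseteq> G" "G2 \<subseteq> G" "G3 \<subseteq> G" by (auto simp: G2_def G3_def)
  have w1: "wo ((\<lambda>(a, b). a + b) ` G)" by (rule wo_image2[OF wG2[OF Gs(1)]]) auto
  have w2: "wo ((\<lambda>(a, b). a * b) ` G)"
    by (rule wo_image2[OF wG2[OF Gs(1)]], intro mult_mono) (auto simp: G_def dest!: VD(2))
  have w3: "wo ((\<lambda>(a, b). pw a b) ` G2)"
    by (rule wo_image2[OF wG2[OF Gs(2)]], intro pw_mono) (auto simp: G_def G2_def VD dest: VD(2))
  have w4: "wo ((\<lambda>(a, b). pw a (b - 1)) ` G3)"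
    by (rule wo_image2[OF wG2[OF Gs(3)]], intro pw_mono) (auto simp: G_def G3_def VD dest: VD(2))
  have w5: "wo {1, x}" using wo_def by (metis finite.emptyI finite_insert Min_in Min_le finite_subset)
  have "range s \<subseteq> {1, x} \<union> ((\<lambda>(a, b). a + b) ` G) \<union> ((\<lambda>(a, b). a * b) ` G)
      \<union> ((\<lambda>(a, b). pw a b) ` G2) \<union> ((\<lambda>(a, b). pw a (b - 1)) ` G3)"
  proof
    fix v assume "v \<in> range s"
    then obtain n where n: "v = s n" by blast
    have "v \<in> V" using sB n by (auto simp: B_def)
    from sz[OF this] show "v \<in> {1, x} \<union> ((\<lambda>(a, b). a + b) ` G) \<union> ((\<lambda>(a, b). a * b) ` G)
      \<union> ((\<lambda>(a, b). pw a b) ` G2) \<union> ((\<lambda>(a, b). pw a (b - 1)) ` G3)"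
    proof (cases rule: built.cases)
      case (3 m a k b)
      have "a <= v" "b <= v" using 3 built_Dom[of m a] built_Dom[of k b] by auto
      then have "(a, b) \<in> G" using sub[of a n m] sub[of b n k] 3 n by (auto simp: G_def)
      then show ?thesis using 3 by auto
    next
      case (4 m a k b)
      have "a <= v" "b <= v" using 4 built_Dom[of m a] built_Dom[of k b]
        by (auto simp: mult_le_cancel_left1 mult_le_cancel_right1)
      then have "(a, b) \<in> G" using sub[of a n m] sub[of b n k] 4 n by (auto simp: G_def)
      then show ?thesis using 4 by auto
    next
      case (5 m a k b)
      have "a <= v" "b <= v"
        using 5 built_Dom[of m a] built_Dom[of k b] base_le_pw[of a b] le_pw(1)[of a b] by auto
      then have "(a, b) \<in> G2" using sub[of a n m] sub[of b n k] 5 n by (auto simp: G_def G2_def)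
      then show ?thesis using 5 by auto
    next
      case (6 m a k b)
      have "a <= v" "b <= v"
        using 6 built_Dom[of m a] built_Dom[of k b] base_le_pw[of a "b - 1"] le_pw(2)[of a b] by auto
      then have "(a, b) \<in> G3" using sub[of a n m] sub[of b n k] 6 n by (auto simp: G_def G3_def)
      then show ?thesis using 6 by auto
    qed auto
  qed
  then have "wo (range s)"
    using wo_Un[OF wo_Un[OF wo_Un[OF wo_Un[OF w5 w1] w2] w3] w4] wo_subset by blast
  then obtain m where "m \<in> range s" "\<And>b. b \<in> range s ==> m <= b"
    using wo_obtain_min[of "range s" "range s"] by auto
  then show False using s_dec by (metis not_le rangeE rangeI)
qed

lemma S_V: "S \<subseteq> V"
proof
  fix f assume "f \<in> S"
  then show "f \<in> V"
  proof (induction rule: S_induct)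
    case (pw f g)
    show ?case
    proof (cases "f = 1")
      case True
      then have "pw f g = 1" using lg_eq_iff[of "pw f g" 1] Dom_pw[of f g] lg_pw[of f g] by simp
      then show ?thesis by (auto simp: V_def intro: built.intros)
    next
      case False
      then show ?thesis using pw S_ge_two[of f] by (auto simp: V_def intro: built.intros)
    qed
  qed (auto simp: V_def intro: built.intros)
qed

lemma U'_V: "U' \<subseteq> V"
proof
  fix u assume "u \<in> U'"
  then show "u \<in> V"
  proof (cases rule: U'_cases)
    case 1
    then show ?thesis using S_V S_x by blast
  next
    case (2 f g e)
    then obtain m n where mn: "built m f" "built n g" using S_V unfolding V_def by blast
    have "2 <= g" using infinite_ge[OF 2(5), of "num.Bit0 num.One"] S_pos[OF 2(4)] by simp
    then have "built (Suc (m + n)) (pw f g)" "built (Suc (m + n)) (pw f (g - 1))"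
      using mn 2 by (auto intro: built.intros)
    then show ?thesis using 2 by (auto simp: V_def)
  qed
qed

lemma Q_V: "Q \<subseteq> V"
proof
  fix q assume "q \<in> Q"
  then show "q \<in> V" unfolding Q_def
  proof (induction rule: prods.induct)
    case (mult u q)
    then show ?case using U'_V by (auto simp: V_def intro: built.intros)
  qed (auto simp: V_def intro: built.intros)
qed

lemma wo_S: "wo S" and wo_Q: "wo Q" and wo_U': "wo U'" and wo_P: "wo P"
  using wo_subset[OF wo_V] S_V Q_V U'_V P_Q by auto

lemma wo_S0: "wo (insert 0 S)"
proof -
  have "wo {0::'k}" by (auto simp: wo_def subset_singleton_iff)
  then show ?thesis using wo_Un[OF _ wo_S, of "{0}"] by simp
qed

lemma wo_lg_image: "wo A ==> A \<subseteq> Dom ==> wo (lg ` A)"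
  by (rule wo_image_mono) (auto simp: lg_le_iff subset_iff)

end

lemma sm_cover:
  assumes cov: "\<exists>F. finite F \<and> I = \<Union>F \<and> (\<forall>J\<in>F. G J)" and "transp_on I R"
    and "\<And>J. J \<subseteq> I ==> G J ==> sm b R J"
  shows "sm b R I"
proof -
  obtain F where F: "finite F" "I = \<Union>F" "\<And>J. J \<in> F ==> G J" using cov by blast
  show ?thesis unfolding F(2)
  proof (rule sm_finite_Union[OF F(1)])
    show "transp_on (\<Union>F) R" using assms(2) F(2) by simp
    show "sm b R J" if "J \<in> F" for J
      using assms(3)[of J] F(2,3) that by blast
  qed
qed

context skolem_field
begin

section \<open>Counting Skolem elements by the growth classes of products\<close>

text \<open>
  The scales between \<open>\<sigma>\<close> and \<open>\<rho>\<close> contain few classes of products. In the second alternative the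
  class of \<open>\<rho>\<close> is left out of the count: the elements of size exactly \<open>\<rho>\<close> are handled by
  subtracting leading products finitely often. The first alternative is the only one available for
  \<open>b = 0\<close>, where the class of \<open>\<rho>\<close> must be excluded too.
\<close>

definition cond :: "tree => 'k => 'k => bool" where
  "cond b \<sigma> \<rho> \<longleftrightarrow> (\<forall>q\<in>Q. \<not> (\<sigma> \<lless> q \<and> q \<preceq> \<rho>)) \<or>
     (\<exists>d<b. tp (\<lless>) {q \<in> Q. \<sigma> \<lless> q \<and> q \<lless> \<rho>} d)"

text \<open>
  Multiplication by an element of \<open>Q\<close> maps \<open>Q\<close> into itself and shifts all scales by the same
  factor.
\<close>

lemma cond_transfer:
  assumes c: "cond b \<sigma>' \<rho>'" and w: "w' \<in> Q" "w \<asymp> w'"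
    and s: "\<sigma>' \<asymp> \<sigma> * w" and r: "\<rho>' \<asymp> \<rho> * w"
  shows "cond b \<sigma> \<rho>"
proof -
  have w': "w' ~= 0" using Q_pos[OF w(1)] by simp
  have ww: "a * w \<asymp> a * w'" for a using w(2) by (rule asy_mult[OF asy_refl])
  have s': "\<sigma>' \<asymp> \<sigma> * w'" and r': "\<rho>' \<asymp> \<rho> * w'"
    by (rule asy_trans[OF s ww], rule asy_trans[OF r ww])
  have 1: "\<sigma>' \<lless> q * w'" if "\<sigma> \<lless> q" for q
    using s' by (rule asy_ll1) (simp add: that w')
  have 2: "q * w' \<preceq> \<rho>'" if "q \<preceq> \<rho>" for q
    by (rule asy_dom2[OF _ asy_sym[OF r']]) (simp add: that w')
  have 3: "q * w' \<lless> \<rho>'" if "q \<lless> \<rho>" for q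
    by (rule asy_ll2[OF _ asy_sym[OF r']]) (simp add: that w')
  have 4: "q * w' \<in> Q" if "q \<in> Q" for q using that w Q_mult by blast
  from c show ?thesis unfolding cond_def
  proof (elim disjE exE conjE)
    assume "\<forall>q\<in>Q. \<not> (\<sigma>' \<lless> q \<and> q \<preceq> \<rho>')"
    then have "\<forall>q\<in>Q. \<not> (\<sigma> \<lless> q \<and> q \<preceq> \<rho>)" using 1 2 4 by blast
    then show "(\<forall>q\<in>Q. \<not> (\<sigma> \<lless> q \<and> q \<preceq> \<rho>)) \<or> (\<exists>d<b. tp (\<lless>) {q \<in> Q. \<sigma> \<lless> q \<and> q \<lless> \<rho>} d)" ..
  next
    fix d assume d: "d < b" "tp (\<lless>) {q \<in> Q. \<sigma>' \<lless> q \<and> q \<lless> \<rho>'} d"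
    have "tp (\<lless>) {q \<in> Q. \<sigma> \<lless> q \<and> q \<lless> \<rho>} d"
      by (rule tp_image[OF d(2), where g = "\<lambda>q. q * w'"]) (use 1 3 4 w' in auto)
    then show "(\<forall>q\<in>Q. \<not> (\<sigma> \<lless> q \<and> q \<preceq> \<rho>)) \<or> (\<exists>d<b. tp (\<lless>) {q \<in> Q. \<sigma> \<lless> q \<and> q \<lless> \<rho>} d)"
      using d(1) by blast
  qed
qed

lemma cond_cong: "cond b \<sigma>' \<rho>' ==> \<sigma>' \<asymp> \<sigma> ==> \<rho>' \<asymp> \<rho> ==> cond b \<sigma> \<rho>"
  using cond_transfer[of b \<sigma>' \<rho>' 1 1 \<sigma> \<rho>] Q_one by simp

text \<open>
  The claims estimate the differences of Skolem elements (\<open>claimA\<close>) and of logarithms of products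
  (\<open>claimB\<close>). A change of \<open>lg c\<close> by \<open>\<tau>\<close> corresponds to a change of \<open>c\<close> by \<open>\<tau> \<cdot> c\<close>, which explains
  the condition in \<open>claimB\<close>. The bound \<open>s\<close> is the induction parameter.
\<close>

definition claimA :: "'k => bool" where
  "claimA s \<longleftrightarrow> (\<forall>b \<sigma> \<rho> D K. D \<subseteq> insert 0 S --> (\<forall>f\<in>D. f < s) --> 0 < \<sigma> --> 0 < \<rho> -->
     (\<forall>f\<in>D. \<forall>f'\<in>D. f' - f <= of_nat K * \<rho>) --> cond b \<sigma> \<rho> --> sm b (lt \<sigma>) D)"

definition claimB :: "'k => bool" where
  "claimB s \<longleftrightarrow> (\<forall>b \<tau> \<eta> E K. E \<subseteq> P --> (\<forall>c\<in>E. c < s) --> 0 < \<tau> --> 0 < \<eta> --> \<eta> \<preceq> 1 -->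
     (\<forall>c\<in>E. \<forall>c'\<in>E. lg c' - lg c <= of_nat K * \<eta>) --> (\<forall>c\<in>E. cond b (\<tau> * c) (\<eta> * c)) -->
     sm b (\<lambda>c c'. lt \<tau> (lg c) (lg c')) E)"

lemma lg_le_imp_le_power:
  assumes "a \<in> Dom" "b \<in> Dom" "lg b - lg a <= of_nat n"
  shows "b <= 4 ^ n * a"
proof -
  have "lg b <= lg (4 ^ n * a)" using assms of_nat_le_lg_power[of n] by (simp add: lg_mult)
  then show ?thesis using assms of_nat_le_lg_power(1) Dom_mult lg_le_iff by blast
qed

lemma S_interval_finite:
  assumes "G \<subseteq> S" "\<And>g g'. g \<in> G ==> g' \<in> G ==> g' - g <= of_nat N"
  shows "finite G"
  using assms
proof (induction N arbitrary: G)
  case 0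
  have le: "g' <= g" if "g \<in> G" "g' \<in> G" for g g' using 0(2)[OF that] by simp
  show ?case
  proof (cases "G = {}")
    case False
    then obtain g where g: "g \<in> G" by blast
    have "G \<subseteq> {g}" using le g by (auto intro: order_antisym)
    then show ?thesis by (rule finite_subset) simp
  qed simp
next
  case (Suc N)
  show ?case
  proof (cases "G = {}")
    case False
    obtain m where m: "m \<in> G" "\<forall>g\<in>G. m <= g" using wo_min[OF wo_S Suc.prems(1) False] by blast
    have "finite (G - {m})"
    proof (rule Suc.IH)
      show "G - {m} \<subseteq> S" using Suc.prems by blast
      fix g g' assume g: "g \<in> G - {m}" "g' \<in> G - {m}"
      then have "m < g" using m by (auto simp: less_le)
      then have "m + 1 <= g" using S_discrete[of m g] Suc.prems(1) m(1) g by blast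
      moreover have "g' - m <= of_nat (Suc N)" using Suc.prems(2) m g by blast
      ultimately show "g' - g <= of_nat N" by simp
    qed
    then show ?thesis by simp
  qed simp
qed

text \<open>
  For a fixed exponent \<open>h0\<close>, a change of \<open>f\<close> by \<open>\<delta>\<close> near \<open>f0\<close> changes the logarithm \<open>h0 \<cdot> lg f\<close> of
  the power by about \<open>h0 \<cdot> \<delta> / f0\<close>. So \<open>claimA\<close> for the bases applies with the scales multiplied
  by \<open>f0 / h0\<close>.
\<close>

lemma claimA_power:
  assumes A: "claimA s" and F: "F \<subseteq> S" "\<And>f. f \<in> F ==> f < s"
    and f0: "f0 \<in> F" "\<And>f. f \<in> F ==> f0 <= f"
    and pos: "0 < h0" "0 < \<zeta>" "0 < \<tau>" and "\<zeta> \<preceq> h0"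
    and K: "\<And>f. f \<in> F ==> h0 * (lg f - lg f0) <= of_nat K * \<zeta>"
    and cond: "cond b (\<tau> * f0 / h0) (\<zeta> * f0 / h0)"
  shows "sm b (\<lambda>f f'. f < f' \<and> \<tau> \<lless> h0 * (lg f' - lg f)) F"
proof -
  have f0': "f0 \<in> S" "0 < f0" using F f0 S_pos by auto
  obtain n :: nat where n: "\<zeta> <= of_nat n * h0" using \<open>\<zeta> \<preceq> h0\<close> pos(1) by (auto elim: domE)
  have diff: "f - f0 <= of_nat (4 ^ (K * n) * K) * (\<zeta> * f0 / h0)" if f: "f \<in> F" for f
  proof -
    have fS: "f \<in> S" "0 < f" using F f S_pos by auto
    have "h0 * (lg f - lg f0) <= of_nat K * \<zeta>" using K f .
    also have "\<dots> <= of_nat K * (of_nat n * h0)" using n by (intro mult_left_mono) auto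
    finally have "h0 * (lg f - lg f0) <= h0 * of_nat (K * n)" by (simp add: ac_simps)
    then have "lg f - lg f0 <= of_nat (K * n)" using pos(1) by (simp only: mult_le_cancel_left_pos)
    then have le: "f <= 4 ^ (K * n) * f0" using lg_le_imp_le_power SD fS f0' by blast
    have "(f - f0) / f <= lg f - lg f0" using lg_diff_ge SD fS f0' by blast
    then have "h0 * ((f - f0) / f) <= of_nat K * \<zeta>"
      using K[OF f] pos(1) by (meson mult_left_mono less_imp_le order_trans)
    then have "f - f0 <= of_nat K * \<zeta> / h0 * f" using pos fS by (simp add: field_simps)
    also have "\<dots> <= of_nat K * \<zeta> / h0 * (4 ^ (K * n) * f0)"
      using le pos by (intro mult_left_mono) auto
    finally show ?thesis by (simp add: ac_simps)
  qed
  have "sm b (lt (\<tau> * f0 / h0)) F"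
  proof (rule A[unfolded claimA_def, rule_format, of F "\<tau> * f0 / h0" "\<zeta> * f0 / h0"])
    show "F \<subseteq> insert 0 S" using F by blast
    show "f < s" if "f \<in> F" for f using F that by blast
    show "0 < \<tau> * f0 / h0" "0 < \<zeta> * f0 / h0" using pos f0' by auto
    show "f' - f <= of_nat (4 ^ (K * n) * K) * (\<zeta> * f0 / h0)" if "f \<in> F" "f' \<in> F" for f f'
      using diff[OF that(2)] f0(2)[OF that(1)] by simp
    show "cond b (\<tau> * f0 / h0) (\<zeta> * f0 / h0)" by fact
  qed
  then show ?thesis
  proof (rule sm_mono)
    fix f f' assume f: "f \<in> F" "f' \<in> F" "f < f' \<and> \<tau> \<lless> h0 * (lg f' - lg f)"
    then have fS: "f \<in> S" "f' \<in> S" "0 < f" "f0 <= f" using F S_pos f0 by auto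
    have "lg f' - lg f <= (f' - f) / f" using lg_diff_le fS SD by blast
    also have "\<dots> <= (f' - f) / f0" using fS f f0' by (intro divide_left_mono) auto
    finally have "h0 * (lg f' - lg f) <= h0 * ((f' - f) / f0)"
      using pos by (intro mult_left_mono) auto
    moreover have "0 <= h0 * (lg f' - lg f)"
      using f fS lg_strict_mono[of f f'] pos SD by simp
    ultimately have "\<tau> \<lless> h0 * ((f' - f) / f0)" using f ll_dom_trans dom_le by blast
    then have "\<tau> * (f0 / h0) \<lless> h0 * ((f' - f) / f0) * (f0 / h0)" using pos f0' by (subst ll_mult_iff) auto
    then show "lt (\<tau> * f0 / h0) f f'" using f pos f0' by (simp add: lt_def)
  qed auto
qed

text \<open>
  A generator other than \<open>x\<close>, with base \<open>f\<close> and exponent \<open>h\<close>; here \<open>h\<close> is the Skolem element \<open>g\<close>,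
  or \<open>g - 1\<close> for a generator of the second kind.
\<close>

definition power_form :: "'k => 'k => 'k => 'k => bool" where
  "power_form u f g h \<longleftrightarrow> f \<in> S \<and> 2 <= f \<and> g \<in> S \<and> 1 \<lless> g \<and> 1 \<lless> h \<and> 0 < h \<and> h \<asymp> g \<and>
     u = pw f h \<and> lg u = h * lg f \<and> (u \<in> U --> h = g) \<and> g <= h + 1"

lemma sm_bounded_exponents:
  assumes "g ` J \<subseteq> S" "i0 \<in> J" and hg: "\<And>i j. i \<in> J ==> j \<in> J ==> h j - h i = g j - g i"
    and h0: "\<And>i. i \<in> J ==> h i0 <= h i \<and> h i - h i0 <= of_nat N"
  shows "sm b (\<lambda>i j. h i < h j \<and> R i j) J"
proof (rule sm_image[where R' = "(<)" and g = g and Y = "g ` J"])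
  have "finite (g ` J)"
  proof (rule S_interval_finite[OF assms(1)])
    fix a a' assume "a \<in> g ` J" "a' \<in> g ` J"
    then obtain i j where ij: "i \<in> J" "j \<in> J" "a = g i" "a' = g j" by blast
    then have "g j - g i <= h j - h i0" using hg[OF ij(1,2)] h0[OF ij(1)] by simp
    also have "\<dots> <= of_nat N" using h0[OF ij(2)] by blast
    finally show "a' - a <= of_nat N" using ij by simp
  qed
  then show "sm b (<) (g ` J)" by (rule sm_finite) auto
  fix i j assume "i \<in> J" "j \<in> J" "h i < h j \<and> R i j"
  then show "g i < g j" using hg[of i j] by simp
qed auto

text \<open>
  A difference of two values \<open>h \<cdot> lg f\<close> is the sum of a contribution of the exponents and one of
  the bases. By \<open>power_cover\<close> the generators split into finitely many families on which both
  contributions have bounded range, and by \<open>sm_product\<close> it suffices to estimate the two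
  contributions separately. Generators of the two kinds are kept apart, so that differences of
  exponents \<open>h\<close> are differences of Skolem elements \<open>g\<close>.
\<close>

lemma U'_decompose:
  assumes u: "\<And>i. i \<in> J ==> u i \<in> U'"
    and M: "\<And>i j. i \<in> J ==> j \<in> J ==> lg (u j) - lg (u i) <= M"
    and handle: "\<And>J' f g h i0. J' \<subseteq> J ==> i0 \<in> J' ==>
       (\<And>i. i \<in> J' ==> power_form (u i) (f i) (g i) (h i)) ==>
       (\<And>i j. i \<in> J' ==> j \<in> J' ==> h j - h i = g j - g i) ==>
       (\<And>i. i \<in> J' ==> h i0 <= h i \<and> f i0 <= f i \<and>
          (h i - h i0) * lg (f i0) <= M \<and> h i0 * (lg (f i) - lg (f i0)) <= M) ==>
       sm b (\<lambda>i j. h i < h j \<and> \<tau> \<lless> (h j - h i) * lg (f j)) J' \<and>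
       sm b (\<lambda>i j. f i < f j \<and> \<tau> \<lless> h i * (lg (f j) - lg (f i))) J'"
  shows "sm b (\<lambda>i j. lt \<tau> (lg (u i)) (lg (u j))) J"
proof -
  let ?R = "\<lambda>i j. lt \<tau> (lg (u i)) (lg (u j))"
  have "\<exists>f g e. u i = x \<or> (u i = pw f (g - e) \<and> f \<in> S \<and> 2 <= f \<and> g \<in> S \<and> 1 \<lless> g \<and> (e = 0 \<or> e = 1 \<and> u i \<notin> U))"
    if "i \<in> J" for i
    using u[OF that] by (rule U'_cases) blast+
  then obtain f g e where fge: "\<And>i. i \<in> J ==> u i = x \<or> (u i = pw (f i) (g i - e i) \<and> f i \<in> S \<and> 2 <= f i \<and>
      g i \<in> S \<and> 1 \<lless> g i \<and> (e i = 0 \<or> e i = 1 \<and> u i \<notin> U))" by metis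
  define Jx where "Jx = {i \<in> J. u i = x}"
  define Je where "Je e0 = {i \<in> J. u i ~= x \<and> e i = e0}" for e0
  have Je: "sm b ?R (Je e0)" if e0: "e0 = 0 \<or> e0 = 1" for e0
  proof -
    define h where "h i = g i - e0" for i
    have pf: "power_form (u i) (f i) (g i) (h i)" if "i \<in> Je e0" for i
    proof -
      have *: "u i = pw (f i) (g i - e0)" "f i \<in> S" "2 <= f i" "g i \<in> S" "1 \<lless> g i"
        "u i \<in> U --> e0 = 0"
        using that fge[of i] by (auto simp: Je_def)
      then show ?thesis
        using e0 S_pos[of "g i"] infinite_minus_one[of "g i"] SD[of "f i"]
        by (auto simp: power_form_def h_def lg_pw less_imp_le)
    qed
    note Jei = pf[unfolded power_form_def]
    have wog: "wo (g ` Je e0)" by (rule wo_subset[OF wo_S]) (use Jei in auto)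
    have "wo ((\<lambda>a. a - e0) ` (g ` Je e0))" using wog by (rule wo_image_mono) auto
    then have woh: "wo (h ` Je e0)" by (simp add: h_def image_image)
    have "wo (lg ` (f ` Je e0))"
      by (rule wo_lg_image, rule wo_subset[OF wo_S]) (use Jei SD in auto)
    then have wol: "wo ((\<lambda>i. lg (f i)) ` Je e0)" by (simp add: image_image)
    have pos: "0 < lg (f i)" if "i \<in> Je e0" for i
      using lg_ge_half[of "f i"] Jei[OF that] SD by (auto intro: less_le_trans[of 0 "1/2"])
    have cov: "\<exists>F. finite F \<and> Je e0 = \<Union>F \<and> (\<forall>J\<in>F. \<exists>i0\<in>J. \<forall>i\<in>J. h i0 <= h i \<and> lg (f i0) <= lg (f i) \<and>
           (h i - h i0) * lg (f i0) <= M \<and> h i0 * (lg (f i) - lg (f i0)) <= M)"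
    proof (rule power_cover[OF woh wol])
      fix i j assume ij: "i \<in> Je e0" "j \<in> Je e0"
      have "lg (u i) - lg (u j) <= M" using M[of j i] ij by (simp add: Je_def)
      then show "h i * lg (f i) - h j * lg (f j) <= M"
        using Jei[OF ij(1)] Jei[OF ij(2)] by metis
    qed (use Jei pos in auto)
    show ?thesis
    proof (rule sm_cover[OF cov])
      fix J' assume J': "J' \<subseteq> Je e0" and "\<exists>i0\<in>J'. \<forall>i\<in>J'. h i0 <= h i \<and> lg (f i0) <= lg (f i) \<and>
           (h i - h i0) * lg (f i0) <= M \<and> h i0 * (lg (f i) - lg (f i0)) <= M"
      then obtain i0 where i0: "i0 \<in> J'" "\<And>i. i \<in> J' ==> h i0 <= h i \<and> lg (f i0) <= lg (f i) \<and>
           (h i - h i0) * lg (f i0) <= M \<and> h i0 * (lg (f i) - lg (f i0)) <= M" by blast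
      have pf': "power_form (u i) (f i) (g i) (h i)" if "i \<in> J'" for i using pf J' that by blast
      note J'i = pf'[unfolded power_form_def]
      have h: "sm b (\<lambda>i j. h i < h j \<and> \<tau> \<lless> (h j - h i) * lg (f j)) J' \<and>
         sm b (\<lambda>i j. f i < f j \<and> \<tau> \<lless> h i * (lg (f j) - lg (f i))) J'"
      proof (rule handle[OF _ i0(1) pf'])
        show "J' \<subseteq> J" using J' by (auto simp: Je_def)
        show "h j - h i = g j - g i" for i j by (simp add: h_def)
        show "h i0 <= h i \<and> f i0 <= f i \<and> (h i - h i0) * lg (f i0) <= M \<and> h i0 * (lg (f i) - lg (f i0)) <= M"
          if "i \<in> J'" for i
          using i0(2)[OF that] J'i[OF that] J'i[OF i0(1)] lg_le_iff SD by blast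
      qed
      show "sm b ?R J'"
      proof (rule sm_product)
        show "sm b (\<lambda>i j. h i < h j \<and> \<tau> \<lless> (h j - h i) * lg (f j)) J'" using h by blast
        show "sm b (\<lambda>i j. f i < f j \<and> \<tau> \<lless> h i * (lg (f j) - lg (f i))) J'" using h by blast
        fix i j assume ij: "i \<in> J'" "j \<in> J'" "lt \<tau> (lg (u i)) (lg (u j))"
        have eq: "lg (u i) = 0 + lg (u i)"
          "lg (u j) = (h j - h i) * lg (f j) + (h i * (lg (f j) - lg (f i)) + lg (u i))"
          using J'i[OF ij(1)] J'i[OF ij(2)] by (auto simp: algebra_simps)
        have "lt \<tau> (0 + lg (u i)) ((h j - h i) * lg (f j) + (h i * (lg (f j) - lg (f i)) + lg (u i)))"
          using ij(3) unfolding eq(1)[symmetric] eq(2)[symmetric] .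
        then have "lt \<tau> 0 ((h j - h i) * lg (f j)) \<or> lt \<tau> (lg (u i)) (h i * (lg (f j) - lg (f i)) + lg (u i))"
          by (rule lt_add_cases)
        then show "(h i < h j \<and> \<tau> \<lless> (h j - h i) * lg (f j)) \<or> (f i < f j \<and> \<tau> \<lless> h i * (lg (f j) - lg (f i)))"
        proof
          assume "lt \<tau> 0 ((h j - h i) * lg (f j))"
          then show ?thesis using pos[of j] J' ij(2) by (auto simp: lt_def zero_less_mult_iff)
        next
          assume "lt \<tau> (lg (u i)) (h i * (lg (f j) - lg (f i)) + lg (u i))"
          then show ?thesis using J'i[OF ij(1)] J'i[OF ij(2)] lg_less_iff[of "f i" "f j"] SD
            by (auto simp: lt_def zero_less_mult_iff)
        qed
      qed simp
    qed simp
  qed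
  have "J = Jx \<union> (Je 0 \<union> Je 1)" using fge by (auto simp: Jx_def Je_def)
  moreover have "sm b ?R (Jx \<union> (Je 0 \<union> Je 1))"
    using Je by (intro sm_Un transp_on_lt_image) (auto intro!: sm_trivial simp: Jx_def)
  ultimately show ?thesis by simp
qed

text \<open>
  Split off a generator \<open>u\<close>, with cofactor \<open>p\<close>. The cofactors satisfy \<open>claimB\<close> below \<open>s\<close>, because
  \<open>lg u\<close> is infinite and the range of the logarithms is bounded; the condition is carried over by
  multiplication with \<open>u\<close>. For the generators the exponents differ by bounded amounts, so there
  are only finitely many, and the bases are covered by \<open>claimA\<close> below \<open>s\<close>.
\<close>

lemma claimB_step:
  assumes IH: "\<And>s'. s' \<in> S ==> s' < s ==> claimA s' \<and> claimB s'"
  shows "claimB s"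
  unfolding claimB_def
proof (intro allI impI)
  fix b \<tau> \<eta> E K
  assume E: "E \<subseteq> P" "\<forall>c\<in>E. c < s" and pos: "0 < \<tau>" "0 < \<eta>" and \<eta>1: "\<eta> \<preceq> 1"
    and K: "\<forall>c\<in>E. \<forall>c'\<in>E. lg c' - lg c <= of_nat K * \<eta>"
    and cond: "\<forall>c\<in>E. cond b (\<tau> * c) (\<eta> * c)"
  let ?R = "\<lambda>c c'. lt \<tau> (lg c) (lg c')"
  define I where "I = E - {1}"
  have "\<exists>u p. u \<in> U \<and> p \<in> P \<and> c = u * p" if "c \<in> I" for c
  proof -
    have "c \<in> prods U" "c ~= 1" using that E by (auto simp: I_def P_def)
    then show ?thesis unfolding P_def by (metis prods.cases)
  qed
  then obtain u p where up: "\<And>c. c \<in> I ==> u c \<in> U \<and> p c \<in> P \<and> c = u c * p c" by metis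
  have D: "u c \<in> Dom" "p c \<in> Dom" "u c \<in> U'" "p c \<in> S" "c \<in> S" "c \<in> Dom" if "c \<in> I" for c
    using up[OF that] U_S PS SD E that by (auto simp: U'_def I_def)
  have lgc: "lg c = lg (u c) + lg (p c)" if "c \<in> I" for c
    using up[OF that] D[OF that] lg_mult by metis
  have u_inf: "1 \<lless> lg (u c)" "0 <= lg (u c)" "0 <= lg (p c)" if "c \<in> I" for c
    using lg_infinite[OF D(1)] U'_infinite[OF D(3)] lg_nonneg[OF D(1)] U'_ge_one[OF D(3)]
      lg_nonneg[OF D(2)] S_ge_one[OF D(4)] that by (auto simp: less_imp_le)
  have big: "of_nat n * \<eta> < lg (u c)" if "c \<in> I" for c n
    using u_inf[OF that] \<eta>1 dom_ll_trans llD by blast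
  have wou: "wo ((\<lambda>c. lg (u c)) ` I)"
  proof -
    have "wo (lg ` (u ` I))" by (rule wo_lg_image, rule wo_subset[OF wo_U']) (use D in auto)
    then show ?thesis by (simp add: image_image)
  qed
  have wop: "wo ((\<lambda>c. lg (p c)) ` I)"
  proof -
    have "wo (lg ` (p ` I))" by (rule wo_lg_image, rule wo_subset[OF wo_S]) (use D in auto)
    then show ?thesis by (simp add: image_image)
  qed
  have cov: "\<exists>F. finite F \<and> I = \<Union>F \<and> (\<forall>J\<in>F. \<exists>K'::nat. \<forall>i\<in>J. \<forall>j\<in>J.
      lg (u i) - lg (u j) <= of_nat K' * \<eta> \<and> lg (p i) - lg (p j) <= of_nat K' * \<eta>)"
  proof (rule box_cover[OF wou wop])
    show "lg (u i) + lg (p i) - (lg (u j) + lg (p j)) <= of_nat K * \<eta>" if "i \<in> I" "j \<in> I" for i j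
      using K lgc[OF that(1)] lgc[OF that(2)] that unfolding I_def by (metis DiffD1)
  qed (use pos in simp)
  have "sm b ?R I"
  proof (rule sm_cover[OF cov])
    fix J assume J: "J \<subseteq> I" and "\<exists>K'::nat. \<forall>i\<in>J. \<forall>j\<in>J.
      lg (u i) - lg (u j) <= of_nat K' * \<eta> \<and> lg (p i) - lg (p j) <= of_nat K' * \<eta>"
    then obtain K' :: nat where K': "\<And>i j. i \<in> J ==> j \<in> J ==> lg (u i) - lg (u j) <= of_nat K' * \<eta>"
      "\<And>i j. i \<in> J ==> j \<in> J ==> lg (p i) - lg (p j) <= of_nat K' * \<eta>" by blast
    have JE: "c \<in> E" "c \<in> I" "c < s" "c \<in> S" if "c \<in> J" for c
      using that J E P_S by (auto simp: I_def)
    show "sm b ?R J"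
    proof (cases "J = {}")
      case False
      then obtain c1 where c1: "c1 \<in> J" by blast
      have Bp: "sm b ?R (p ` J)"
      proof -
        have B: "claimB c1" using IH[OF JE(4,3)[OF c1]] by blast
        show ?thesis
        proof (rule B[unfolded claimB_def, rule_format, where \<eta> = \<eta> and K = K'])
          show "p ` J \<subseteq> P" using up JE by auto
          show "0 < \<tau>" "0 < \<eta>" "\<eta> \<preceq> 1" by fact+
          show "q < c1" if q: "q \<in> p ` J" for q
          proof -
            obtain c where c: "c \<in> J" "q = p c" using q by blast
            have "lg (p c) < lg c1"
              using K'(2)[OF c(1) c1] big[OF JE(2)[OF c1], of K'] lgc[OF JE(2)[OF c1]] by simp
            then show ?thesis using c D(2)[OF JE(2)] D(6)[OF JE(2)] c1 lg_less_iff by blast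
          qed
          show "lg c' - lg c <= of_nat K' * \<eta>" if "c \<in> p ` J" "c' \<in> p ` J" for c c'
            using that K' by auto
          show "cond b (\<tau> * q) (\<eta> * q)" if q: "q \<in> p ` J" for q
          proof -
            obtain c where c: "c \<in> J" "q = p c" using q by blast
            have "u c \<in> Q" using D(3)[OF JE(2)[OF c(1)]] by (simp add: Q_def prods_base)
            moreover have "c = q * u c" using up[OF JE(2)[OF c(1)]] c by (simp add: mult.commute)
            then have "cond b (\<tau> * q * u c) (\<eta> * q * u c)"
              using cond JE(1)[OF c(1)] by (metis mult.assoc)
            ultimately show ?thesis by (rule cond_transfer[rotated, OF _ asy_refl asy_refl asy_refl])
          qed
        qed
      qed
      have Bu: "sm b (\<lambda>i j. lt \<tau> (lg (u i)) (lg (u j))) J"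
      proof (rule U'_decompose[where M = "of_nat K' * \<eta>"])
        show "u i \<in> U'" if "i \<in> J" for i using D JE that by blast
        show "lg (u j) - lg (u i) <= of_nat K' * \<eta>" if "i \<in> J" "j \<in> J" for i j using K' that by blast
        fix J' f g h i0
        assume J': "J' \<subseteq> J" and i0: "i0 \<in> J'"
          and pf: "\<And>i. i \<in> J' ==> power_form (u i) (f i) (g i) (h i)"
          and hg: "\<And>i j. i \<in> J' ==> j \<in> J' ==> h j - h i = g j - g i"
          and mn: "\<And>i. i \<in> J' ==> h i0 <= h i \<and> f i0 <= f i \<and>
            (h i - h i0) * lg (f i0) <= of_nat K' * \<eta> \<and> h i0 * (lg (f i) - lg (f i0)) <= of_nat K' * \<eta>"
        note fg = pf[unfolded power_form_def]
        note fg0 = fg[OF i0]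
        have lgf0: "1 / 2 <= lg (f i0)" using lg_ge_half fg0 SD by blast
        obtain n :: nat where n: "\<eta> <= of_nat n" using \<eta>1 by (auto elim: domE)
        have hh: "h i - h i0 <= of_nat (2 * K' * n)" if "i \<in> J'" for i
        proof -
          have "(h i - h i0) * (1 / 2) <= (h i - h i0) * lg (f i0)"
            using mn[OF that] lgf0 by (intro mult_left_mono) auto
          also have "\<dots> <= of_nat K' * \<eta>" using mn[OF that] by blast
          also have "\<dots> <= of_nat K' * of_nat n" using n by (intro mult_left_mono) auto
          finally show ?thesis by simp
        qed
        have h_part: "sm b (\<lambda>i j. h i < h j \<and> \<tau> \<lless> (h j - h i) * lg (f j)) J'"
          by (rule sm_bounded_exponents[OF _ i0 hg, where N = "2 * K' * n"]) (use fg mn hh in auto)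
        have hdom: "h i \<preceq> h i0" if "i \<in> J'" for i
        proof -
          have "1 \<lless> h i0" "0 < h i0" using fg0 by auto
          then have "of_nat (2 * K' * n) < h i0" using infinite_nat_less[of "h i0" "2 * K' * n"] by simp
          then show ?thesis using hh[OF that] fg[OF that] by (intro domI_nonneg[of _ _ 2]) auto
        qed
        have i0J: "i0 \<in> J" using J' i0 by blast
        have Ai0: "claimA i0" using IH[OF JE(4,3)[OF i0J]] by blast
        have "sm b (\<lambda>a a'. a < a' \<and> \<tau> \<lless> h i0 * (lg a' - lg a)) (f ` J')"
        proof (rule claimA_power[OF Ai0, where ?f0.0 = "f i0" and \<zeta> = \<eta> and K = K'])
          show "f ` J' \<subseteq> S" using fg by blast
          show "f i0 \<in> f ` J'" using i0 by blast
          show "f i0 <= a" if "a \<in> f ` J'" for a using that mn by blast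
          show "0 < h i0" "0 < \<eta>" "0 < \<tau>" using fg0 pos by auto
          show "\<eta> \<preceq> h i0" using fg0 \<eta>1 by (meson dom_trans ll_imp_dom)
          show "h i0 * (lg a - lg (f i0)) <= of_nat K' * \<eta>" if "a \<in> f ` J'" for a
            using that mn by blast
          show "a < i0" if a: "a \<in> f ` J'" for a
          proof -
            obtain i where i: "i \<in> J'" "a = f i" using a by blast
            have h2: "of_nat (2 * K' * n + 1) < h i0"
              using infinite_nat_less[of "h i0" "2 * K' * n + 1"] fg0 by simp
            have "h i0 * (lg a - lg (f i0)) <= of_nat K' * of_nat n"
              using conjunct2[OF conjunct2[OF conjunct2[OF mn[OF i(1)]]]] mult_left_mono[OF n, of "of_nat K'"] i(2)
              by simp
            also have "\<dots> <= of_nat (2 * K' * n) * lg (f i0)"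
              using mult_left_mono[OF lgf0, of "of_nat (2 * K' * n)"] by simp
            also have "\<dots> <= h i0 * (of_nat (2 * K' * n) * lg (f i0))"
            proof -
              have "1 <= h i0" using h2 by (auto intro: order_trans[of 1 "of_nat (2 * K' * n + 1)"])
              moreover have "0 <= of_nat (2 * K' * n) * lg (f i0)" using lgf0 by (auto intro: order_trans[of 0 "1/2"])
              ultimately show ?thesis by (simp add: mult_le_cancel_right1)
            qed
            finally have "lg a - lg (f i0) <= of_nat (2 * K' * n) * lg (f i0)"
              using fg0 by (simp only: mult_le_cancel_left_pos)
            then have "lg a <= of_nat (2 * K' * n + 1) * lg (f i0)" by (simp add: algebra_simps)
            also have "\<dots> < h i0 * lg (f i0)" using h2 lgf0
              by (intro mult_strict_right_mono) (auto intro: less_le_trans[of 0 "1/2"])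
            also have "\<dots> <= lg i0"
            proof -
              have "lg (u i0) = h i0 * lg (f i0)" using fg0 by blast
              then show ?thesis using lgc[OF JE(2)[OF i0J]] u_inf(3)[OF JE(2)[OF i0J]] by linarith
            qed
            finally show ?thesis
              using lg_less_iff[of a i0] SD JE(4)[OF i0J] fg[OF i(1)] i(2) by blast
          qed
          show "cond b (\<tau> * f i0 / h i0) (\<eta> * f i0 / h i0)"
          proof -
            obtain c where c: "c \<in> P" "g i0 \<preceq> c" "c \<preceq> g i0"
              using leading_summand[of "g i0"] fg0 by metis
            \<comment> \<open>The scales for the bases are those for \<open>i0\<close> divided by \<open>h i0 \<cdot> i0 / f i0\<close>. This
              factor grows like a product: replace the exponent by its leading product and absorb
              \<open>1 / f i0\<close> into the generator.\<close>
            define w' where "w' = c * (pw (f i0) (g i0) / f i0) * p i0"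
            have "pw (f i0) (g i0) / f i0 \<in> U'" using fg0 by (auto simp: U'_def)
            then have w'Q: "w' \<in> Q" unfolding w'_def
              using PQ[OF c(1)] PQ[of "p i0"] up[OF JE(2)[OF i0J]] by (blast intro: Q_mult U'_Q)
            define w where "w = h i0 / f i0 * i0"
            have U: "u i0 = pw (f i0) (g i0)"
              using up[OF JE(2)[OF i0J]] fg0 by auto
            have "w \<asymp> w'"
            proof -
              have "h i0 \<asymp> c" using fg0 c by (meson asy_def dom_trans)
              then have "h i0 * (u i0 / f i0 * p i0) \<asymp> c * (u i0 / f i0 * p i0)" by (rule asy_mult) simp
              then show ?thesis using up[OF JE(2)[OF i0J]] U
                by (simp add: w_def w'_def mult.assoc)
            qed
            have eqs: "\<tau> * i0 = \<tau> * f i0 / h i0 * w" "\<eta> * i0 = \<eta> * f i0 / h i0 * w"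
              using fg0 S_pos[of "f i0"] by (simp_all add: w_def)
            have "cond b (\<tau> * i0) (\<eta> * i0)" using cond JE(1)[OF i0J] by blast
            then show ?thesis unfolding eqs
              by (rule cond_transfer[OF _ w'Q \<open>w \<asymp> w'\<close> asy_refl asy_refl])
          qed
        qed
        then have f_part: "sm b (\<lambda>i j. f i < f j \<and> \<tau> \<lless> h i * (lg (f j) - lg (f i))) J'"
        proof (rule sm_image[where g = f])
          fix i j assume ij: "i \<in> J'" "j \<in> J'" "f i < f j \<and> \<tau> \<lless> h i * (lg (f j) - lg (f i))"
          have "h i * (lg (f j) - lg (f i)) \<preceq> h i0 * (lg (f j) - lg (f i))"
            using hdom[OF ij(1)] by (intro dom_mult) auto
          then show "f i < f j \<and> \<tau> \<lless> h i0 * (lg (f j) - lg (f i))" using ij(3) ll_dom_trans by blast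
        qed auto
        show "sm b (\<lambda>i j. h i < h j \<and> \<tau> \<lless> (h j - h i) * lg (f j)) J' \<and>
              sm b (\<lambda>i j. f i < f j \<and> \<tau> \<lless> h i * (lg (f j) - lg (f i))) J'"
          using h_part f_part by blast
      qed
      show ?thesis
      proof (rule sm_product[OF _ _ Bu])
        show "sm b (\<lambda>i j. lt \<tau> (lg (p i)) (lg (p j))) J"
          by (rule sm_image[OF Bp, where g = p]) auto
        show "lt \<tau> (lg (u i)) (lg (u j)) \<or> lt \<tau> (lg (p i)) (lg (p j))"
          if "i \<in> J" "j \<in> J" "lt \<tau> (lg i) (lg j)" for i j
          using that lgc JE(2) lt_add_cases by metis
      qed simp
    qed simp
  qed simp
  moreover have "sm b ?R (E \<inter> {1})" by (rule sm_trivial) auto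
  ultimately have "sm b ?R (I \<union> E \<inter> {1})" by (intro sm_Un) auto
  moreover have "I \<union> E \<inter> {1} = E" by (auto simp: I_def)
  ultimately show "sm b ?R E" by simp
qed

lemma S0_nonneg: "f \<in> insert 0 S ==> 0 <= f"
  using S_pos by (auto simp: less_imp_le)

text \<open>
  On a single growth class the differences of products are proportional to the differences of
  their logarithms.
\<close>

lemma claimB_set:
  assumes B: "claimB s" and C: "C \<subseteq> P" "\<And>c. c \<in> C ==> c < s" and pos: "0 < \<sigma>" "0 < \<rho>"
    and K: "\<And>c c'. c \<in> C ==> c' \<in> C ==> c' - c <= of_nat K * \<rho>"
    and dom: "\<And>c. c \<in> C ==> \<rho> \<preceq> c" "\<And>c c'. c \<in> C ==> c' \<in> C ==> c \<preceq> c'"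
    and cond: "cond b \<sigma> \<rho>"
  shows "sm b (lt \<sigma>) C"
proof (cases "C = {}")
  case False
  then obtain c0 where c0: "c0 \<in> C" "\<forall>c\<in>C. c0 <= c" using wo_min[OF wo_P C(1)] by blast
  have cS: "c \<in> S" "0 < c" "c \<in> Dom" if "c \<in> C" for c using that C PS S_pos SD by blast+
  have "sm b (\<lambda>c c'. lt (\<sigma> / c0) (lg c) (lg c')) C"
  proof (rule B[unfolded claimB_def, rule_format, where \<eta> = "\<rho> / c0" and K = K])
    show "C \<subseteq> P" by fact
    show "c < s" if "c \<in> C" for c using C that by blast
    show "0 < \<sigma> / c0" "0 < \<rho> / c0" using pos cS[OF c0(1)] by auto
    have "\<rho> / c0 * c0 \<preceq> 1 * c0" using dom(1)[OF c0(1)] cS[OF c0(1)] by simp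
    then show "\<rho> / c0 \<preceq> 1" using cS[OF c0(1)] by (subst (asm) dom_mult_iff) auto
    show "lg c' - lg c <= of_nat K * (\<rho> / c0)" if c: "c \<in> C" "c' \<in> C" for c c'
    proof -
      have "lg c' - lg c <= (c' - c) / c" using lg_diff_le cS c by blast
      also have "\<dots> <= (of_nat K * \<rho>) / c" using K[OF c] cS[OF c(1)] by (intro divide_right_mono) auto
      also have "\<dots> <= (of_nat K * \<rho>) / c0"
        using c0 c(1) cS[OF c(1)] cS[OF c0(1)] pos by (intro divide_left_mono) auto
      finally show ?thesis by simp
    qed
    show "cond b (\<sigma> / c0 * c) (\<rho> / c0 * c)" if c: "c \<in> C" for c
    proof (rule cond_cong[OF cond])
      have "c \<asymp> c0" using dom(2) c c0(1) by (simp add: asy_def)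
      then have *: "a / c0 * c \<asymp> a / c0 * c0" for a by (intro asy_mult) auto
      show "\<sigma> \<asymp> \<sigma> / c0 * c" "\<rho> \<asymp> \<rho> / c0 * c"
        using *[of \<sigma>] *[of \<rho>] cS[OF c0(1)] by (simp_all add: asy_sym)
    qed
  qed
  then show ?thesis
  proof (rule sm_mono)
    fix c c' assume c: "c \<in> C" "c' \<in> C" "lt \<sigma> c c'"
    have lt: "c < c'" "\<sigma> \<lless> c' - c" using c(3) by (auto simp: lt_def)
    have "(c' - c) / c0 \<preceq> (c' - c) / c'"
    proof -
      have "inverse c0 \<preceq> inverse c'"
      proof -
        have "c' * (inverse c0 * inverse c') \<preceq> c0 * (inverse c0 * inverse c')"
          by (rule dom_mult[OF dom(2)[OF c(2) c0(1)] dom_refl])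
        then show ?thesis using cS[OF c0(1)] cS[OF c(2)] by (simp add: field_simps)
      qed
      then show ?thesis unfolding divide_inverse by (intro dom_mult) auto
    qed
    moreover have "(c' - c) / c' \<preceq> lg c' - lg c"
      using lg_diff_ge[of c c'] cS[OF c(1)] cS[OF c(2)] lt by (intro dom_le) auto
    ultimately have *: "(c' - c) / c0 \<preceq> lg c' - lg c" by (rule dom_trans)
    have "\<sigma> * inverse c0 \<lless> (c' - c) * inverse c0" using lt cS[OF c0(1)] by (subst ll_mult_iff) auto
    then have "\<sigma> / c0 \<lless> lg c' - lg c" using * ll_dom_trans by (simp add: divide_inverse) 
    then show "lt (\<sigma> / c0) (lg c) (lg c')"
      using lt cS[OF c(1)] cS[OF c(2)] by (simp add: lt_def lg_less_iff)
  qed auto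
qed simp

text \<open>
  If all elements are much larger than the range of their differences, so are their leading
  products, and these stay within one class. The rests are smaller than the elements, hence below
  \<open>s\<close>.
\<close>

lemma claimA_step_large:
  assumes B: "claimB s" and IH: "\<And>s'. s' \<in> S ==> s' < s ==> claimA s'"
    and D: "D \<subseteq> insert 0 S" "\<And>f. f \<in> D ==> f < s" and pos: "0 < \<sigma>" "0 < \<rho>"
    and K: "\<And>f f'. f \<in> D ==> f' \<in> D ==> f' - f <= of_nat K * \<rho>" and cond: "cond b \<sigma> \<rho>"
    and large: "f0 \<in> D" "\<rho> \<lless> f0"
  shows "sm b (lt \<sigma>) D"
proof -
  have large': "\<rho> \<lless> f" if "f \<in> D" for f
  proof -
    have "of_nat n * \<rho> < f" for n :: nat
    proof -
      have "of_nat (n + K) * \<rho> < f0" using llD[OF large(2)] S0_nonneg D(1) large(1) by blast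
      then show ?thesis using K[OF that large(1)] by (simp add: algebra_simps)
    qed
    then show ?thesis using pos by (auto simp: ll_iff intro: less_le_trans[OF _ abs_ge_self])
  qed
  have DS: "f \<in> S" "0 < f" if "f \<in> D" for f
  proof -
    have "f ~= 0" using ll_less[OF large'[OF that]] pos S0_nonneg D(1) that by force
    then show "f \<in> S" using D(1) that by blast
    then show "0 < f" by (rule S_pos)
  qed
  have "\<exists>c r. c \<in> P \<and> r \<in> insert 0 S \<and> f = c + r \<and> f \<preceq> c \<and> c \<preceq> f" if "f \<in> D" for f
    using leading_summand[OF DS(1)[OF that]] by metis
  then obtain c r where cr: "\<And>f. f \<in> D ==> c f \<in> P \<and> r f \<in> insert 0 S \<and> f = c f + r f \<and> f \<preceq> c f \<and> c f \<preceq> f"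
    by metis
  have \<rho>c: "\<rho> \<lless> c f" "0 < c f" "0 <= r f" if "f \<in> D" for f
    using large'[OF that] cr[OF that] ll_dom_trans S_pos PS S0_nonneg by blast+
  have cov: "\<exists>F. finite F \<and> D = \<Union>F \<and> (\<forall>J\<in>F. \<exists>K'::nat. \<forall>i\<in>J. \<forall>j\<in>J.
      c i - c j <= of_nat K' * \<rho> \<and> r i - r j <= of_nat K' * \<rho>)"
  proof (rule box_cover)
    show "wo (c ` D)" by (rule wo_subset[OF wo_P]) (use cr in auto)
    show "wo (r ` D)" by (rule wo_subset[OF wo_S0]) (use cr in auto)
    show "0 <= \<rho>" using pos by simp
    show "c i + r i - (c j + r j) <= of_nat K * \<rho>" if "i \<in> D" "j \<in> D" for i j
      using K[OF that(2,1)] cr[OF that(1)] cr[OF that(2)] by metis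
  qed
  show ?thesis
  proof (rule sm_cover[OF cov])
    fix J assume J: "J \<subseteq> D" and "\<exists>K'::nat. \<forall>i\<in>J. \<forall>j\<in>J. c i - c j <= of_nat K' * \<rho> \<and> r i - r j <= of_nat K' * \<rho>"
    then obtain K' :: nat where K': "\<And>i j. i \<in> J ==> j \<in> J ==> c i - c j <= of_nat K' * \<rho>"
      "\<And>i j. i \<in> J ==> j \<in> J ==> r i - r j <= of_nat K' * \<rho>" by blast
    have cK: "of_nat n * \<rho> < c i" if "i \<in> J" for i n
      using llD[OF \<rho>c(1)] \<rho>c(2) J that by (meson less_imp_le subsetD)
    show "sm b (lt \<sigma>) J"
    proof (cases "J = {}")
      case False
      then obtain f1 where f1: "f1 \<in> J" by blast
      have f1': "f1 \<in> D" "f1 \<in> S" "f1 < s" using f1 J DS D by auto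
      have 1: "sm b (lt \<sigma>) (r ` J)"
      proof (rule IH[OF f1'(2,3), unfolded claimA_def, rule_format, where \<rho> = \<rho> and K = K'])
        show "r ` J \<subseteq> insert 0 S" using cr J by blast
        show "a < f1" if "a \<in> r ` J" for a
          using that K'(2)[OF _ f1] cK[OF f1, of K'] cr[OF f1'(1)] by fastforce
        show "0 < \<sigma>" "0 < \<rho>" "cond b \<sigma> \<rho>" by fact+
        show "f' - f <= of_nat K' * \<rho>" if "f \<in> r ` J" "f' \<in> r ` J" for f f' using that K' by blast
      qed
      have 2: "sm b (lt \<sigma>) (c ` J)"
      proof (rule claimB_set[OF B, where \<rho> = \<rho> and K = K'])
        show "c ` J \<subseteq> P" using cr J by blast
        show "a < s" if a: "a \<in> c ` J" for a
        proof -
          obtain f where f: "f \<in> D" "a = c f" using a J by blast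
          have "c f <= f" using cr[OF f(1)] \<rho>c(3)[OF f(1)] by (metis le_add_same_cancel1)
          then show ?thesis using D(2)[OF f(1)] f(2) by simp
        qed
        show "0 < \<sigma>" "0 < \<rho>" "cond b \<sigma> \<rho>" by fact+
        show "f' - f <= of_nat K' * \<rho>" if "f \<in> c ` J" "f' \<in> c ` J" for f f' using that K' by blast
        show "\<rho> \<preceq> a" if "a \<in> c ` J" for a using that \<rho>c J ll_imp_dom by blast
        show "a \<preceq> a'" if a: "a \<in> c ` J" "a' \<in> c ` J" for a a'
        proof -
          obtain i j where ij: "i \<in> J" "j \<in> J" "a = c i" "a' = c j" using a by blast
          have "c i <= of_nat 2 * c j" using K'(1)[OF ij(1,2)] cK[OF ij(2), of K'] by simp
          then show ?thesis using ij \<rho>c(2) J by (intro domI_nonneg[of _ _ 2]) (auto simp: less_imp_le subset_iff)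
        qed
      qed
      show ?thesis
      proof (rule sm_product)
        show "sm b (\<lambda>i j. lt \<sigma> (c i) (c j)) J" by (rule sm_image[OF 2, where g = c]) auto
        show "sm b (\<lambda>i j. lt \<sigma> (r i) (r j)) J" by (rule sm_image[OF 1, where g = r]) auto
        show "lt \<sigma> (c i) (c j) \<or> lt \<sigma> (r i) (r j)" if "i \<in> J" "j \<in> J" "lt \<sigma> i j" for i j
          using that cr J lt_add_cases by (metis subsetD)
      qed simp
    qed simp
  qed simp
qed

text \<open>
  The elements below \<open>v\<close> have differences of order \<open>v\<close>, and the classes below that of \<open>v\<close> have a
  smaller type than all those below \<open>\<rho>\<close>. So the predecessors of every \<open>v\<close> are governed by \<open>claimA\<close>
  with a smaller bound, and the residuals add up to \<open>\<omega>^(\<omega>^d)\<close>.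
\<close>

lemma tp_S_below:
  assumes IH: "\<And>s'. s' \<in> S ==> s' < s ==> claimA s'"
    and pos: "0 < \<sigma>" "0 < \<rho>"
    and d: "tp (\<lless>) {q \<in> Q. \<sigma> \<lless> q \<and> q \<lless> \<rho>} d"
  shows "tp (lt \<sigma>) {r \<in> insert 0 S. r < s \<and> r \<lless> \<rho>} (om (om d))" (is "tp _ ?R _")
proof (rule tp_residual)
  obtain \<phi> where \<phi>: "\<And>p q. p \<in> Q ==> \<sigma> \<lless> p ==> p \<lless> \<rho> ==> q \<in> Q ==> \<sigma> \<lless> q ==> q \<lless> \<rho> ==> p \<lless> q ==> \<phi> p < \<phi> q"
    "\<And>q. q \<in> Q ==> \<sigma> \<lless> q ==> q \<lless> \<rho> ==> \<phi> q < d"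
    using d unfolding tp_def by auto
  fix v assume v: "v \<in> ?R"
  show "\<exists>t < om (om d). tp (lt \<sigma>) {a \<in> ?R. lt \<sigma> a v} t"
  proof (cases "\<sigma> \<lless> v")
    case False
    have "\<not> lt \<sigma> a v" if "a \<in> ?R" for a
    proof
      assume "lt \<sigma> a v"
      then have "\<sigma> \<lless> v - a" "a < v" by (auto simp: lt_def)
      moreover have "v - a \<preceq> v" using \<open>a < v\<close> S0_nonneg[of a] that by (intro dom_le) auto
      ultimately show False using False ll_dom_trans by blast
    qed
    then have "{a \<in> ?R. lt \<sigma> a v} = {}" by blast
    then have "tp (lt \<sigma>) {a \<in> ?R. lt \<sigma> a v} 0" by (simp only: tp_empty)
    then show ?thesis using zero_less_om by blast
  next
    case True
    then have "v ~= 0" by auto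
    then have vS: "v \<in> S" "v < s" "v \<lless> \<rho>" using v by auto
    obtain c where c: "c \<in> P" "v \<preceq> c" "c \<preceq> v" using leading_summand[OF vS(1)] by metis
    have cQ: "c \<in> Q" "\<sigma> \<lless> c" "c \<lless> \<rho>"
      using PQ[OF c(1)] ll_dom_trans[OF True c(2)] dom_ll_trans[OF c(3) vS(3)] by auto
    define e where "e = \<phi> c"
    have "e < d" using \<phi>(2) cQ by (simp add: e_def)
    then have le: "e + om 0 <= d" by (rule plus_one_le_tree)
    have "sm (e + om 0) (lt \<sigma>) {a \<in> ?R. lt \<sigma> a v}"
    proof (rule IH[OF vS(1,2), unfolded claimA_def, rule_format, where \<rho> = v and K = 1])
      show "0 < v" using S_pos vS by blast
      show "a' - a <= of_nat 1 * v" if "a \<in> {a \<in> ?R. lt \<sigma> a v}" "a' \<in> {a \<in> ?R. lt \<sigma> a v}" for a a'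
        using that S0_nonneg[of a] by (auto simp: lt_def)
      have "tp (\<lless>) {q \<in> Q. \<sigma> \<lless> q \<and> q \<lless> v} e"
      proof (rule tpI[of _ _ \<phi>])
        fix p q assume "p \<in> {q \<in> Q. \<sigma> \<lless> q \<and> q \<lless> v}" "q \<in> {q \<in> Q. \<sigma> \<lless> q \<and> q \<lless> v}" "p \<lless> q"
        then show "\<phi> p < \<phi> q" using \<phi>(1) ll_trans vS(3) by blast
      next
        fix q assume q: "q \<in> {q \<in> Q. \<sigma> \<lless> q \<and> q \<lless> v}"
        then have "q \<lless> c" "q \<lless> \<rho>" using c(2) vS(3) ll_dom_trans ll_trans by blast+
        then show "\<phi> q < e" using \<phi>(1) q cQ by (simp add: e_def)
      qed
      then show "cond (e + om 0) \<sigma> v" unfolding cond_def using less_plus_om_zero by blast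
    qed (use pos in \<open>auto simp: lt_def\<close>)
    then obtain t where t: "t < om (om (e + om 0))" "tp (lt \<sigma>) {a \<in> ?R. lt \<sigma> a v} t"
      unfolding sm_def by blast
    have "om (om (e + om 0)) <= om (om d)" using le by simp
    then show ?thesis using t less_le_trans by blast
  qed
qed simp

text \<open>
  Elements of the class of \<open>\<rho>\<close> have a leading product in this class, which is at least the minimal
  one \<open>m\<close>. Subtracting it moves an element from the range up to \<open>(n + 1) \<cdot> m\<close> to the range up to
  \<open>n \<cdot> m\<close>, so that finitely many subtractions lead to the elements far below \<open>\<rho>\<close>.
\<close>

lemma claimA_step_small:
  assumes B: "claimB s" and IH: "\<And>s'. s' \<in> S ==> s' < s ==> claimA s'"
    and D: "D \<subseteq> insert 0 S" "\<And>f. f \<in> D ==> f < s" and pos: "0 < \<sigma>" "0 < \<rho>"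
    and K: "\<And>f f'. f \<in> D ==> f' \<in> D ==> f' - f <= of_nat K * \<rho>" and cond: "cond b \<sigma> \<rho>"
    and small: "\<And>f. f \<in> D ==> f \<preceq> \<rho>"
  shows "sm b (lt \<sigma>) D"
  using cond unfolding cond_def
proof (elim disjE exE conjE)
  assume no: "\<forall>q\<in>Q. \<not> (\<sigma> \<lless> q \<and> q \<preceq> \<rho>)"
  have le: "f \<preceq> \<sigma>" if fD: "f \<in> D" for f
  proof (rule ccontr)
    assume "\<not> f \<preceq> \<sigma>"
    then have "\<sigma> \<lless> f" by (simp add: ll_def)
    then have "f ~= 0" by auto
    then have "f \<in> S" using D(1) fD by blast
    then obtain c where "c \<in> P" "f \<preceq> c" "c \<preceq> f" by (rule leading_summand)
    then show False using no PQ \<open>\<sigma> \<lless> f\<close> small[OF fD] ll_dom_trans dom_trans by blast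
  qed
  show ?thesis
  proof (rule sm_trivial)
    fix f f' assume f: "f \<in> D" "f' \<in> D"
    show "\<not> lt \<sigma> f f'"
    proof
      assume "lt \<sigma> f f'"
      moreover have "f' - f \<preceq> f'" if "f < f'"
        using that S0_nonneg[of f] D(1) f by (intro dom_le) auto
      ultimately show False using le[OF f(2)] unfolding lt_def by (meson ll_dom_trans ll_irrefl)
    qed
  qed
next
  fix d assume d: "d < b" "tp (\<lless>) {q \<in> Q. \<sigma> \<lless> q \<and> q \<lless> \<rho>} d"
  define R where "R = {r \<in> insert 0 S. r < s \<and> r \<lless> \<rho>}"
  have "tp (lt \<sigma>) R (om (om d))" unfolding R_def by (rule tp_S_below[OF IH pos d(2)])
  then have smR: "sm b (lt \<sigma>) R" using d(1) unfolding sm_def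
    by (intro exI[of _ "om (om d)"]) simp
  define M where "M = {c \<in> P. c \<asymp> \<rho>}"
  have lead: "\<exists>c r. c \<in> M \<and> r \<in> insert 0 S \<and> f = c + r" if h: "f \<in> S" "f \<preceq> \<rho>" "\<not> f \<lless> \<rho>" for f
  proof -
    have "f \<asymp> \<rho>" using h by (simp add: asy_def ll_def)
    moreover obtain c r where "c \<in> P" "r \<in> insert 0 S" "f = c + r" "f \<preceq> c" "c \<preceq> f"
      using leading_summand[OF h(1)] .
    ultimately have "c \<in> M" using asy_trans by (auto simp: M_def asy_def intro: dom_trans)
    then show ?thesis using \<open>r \<in> insert 0 S\<close> \<open>f = c + r\<close> by blast
  qed
  show ?thesis
  proof (cases "M = {}")
    case True
    have "f \<in> R" if f: "f \<in> D" for f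
    proof (cases "f = 0")
      case True
      then show ?thesis using f D pos by (auto simp: R_def)
    next
      case False
      then have "f \<lless> \<rho>" using lead[of f] True small f D(1) by blast
      then show ?thesis using f D by (auto simp: R_def)
    qed
    then show ?thesis using sm_mono[OF smR, of D] by blast
  next
    case False
    have MP: "M \<subseteq> P" by (auto simp: M_def)
    obtain m where m: "m \<in> M" "\<forall>c\<in>M. m <= c" using wo_min[OF wo_P MP False] by blast
    have m0: "0 < m" using m MP PS S_pos by blast
    have m\<rho>: "m \<asymp> \<rho>" using m by (simp add: M_def)
    define Dn where "Dn n = {f \<in> insert 0 S. f < s \<and> f <= of_nat n * m}" for n :: nat
    have "sm b (lt \<sigma>) (Dn n)" for n
    proof (induction n)
      case 0
      have "Dn 0 \<subseteq> {0}" using S0_nonneg by (force simp: Dn_def)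
      then show ?case by (intro sm_trivial) (metis lt_irrefl singletonD subsetD)
    next
      case (Suc n)
      define X where "X = {f \<in> Dn (Suc n). \<not> f \<lless> \<rho>}"
      have X: "f \<in> S" "f \<preceq> \<rho>" "\<not> f \<lless> \<rho>" "f <= of_nat (Suc n) * m" "f < s" if "f \<in> X" for f
      proof -
        show "\<not> f \<lless> \<rho>" "f <= of_nat (Suc n) * m" "f < s" using that by (auto simp: X_def Dn_def)
        have "f ~= 0" using that pos by (auto simp: X_def)
        then show "f \<in> S" using that by (auto simp: X_def Dn_def)
        then have "f \<preceq> m" using \<open>f <= of_nat (Suc n) * m\<close> m0 S_pos[of f]
          by (intro domI_nonneg[of _ _ "Suc n"]) auto
        then show "f \<preceq> \<rho>" using m\<rho> asy_dom2 by blast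
      qed
      obtain c r where cr: "\<And>f. f \<in> X ==> c f \<in> M \<and> r f \<in> insert 0 S \<and> f = c f + r f"
        using lead X by metis
      have c0: "m <= c f" "0 <= r f" if "f \<in> X" for f using cr[OF that] m S0_nonneg by auto
      have rDn: "r f \<in> Dn n" if "f \<in> X" for f
        using cr[OF that] c0[OF that] X[OF that] m0 by (auto simp: Dn_def algebra_simps)
      have rS: "sm b (\<lambda>i j. lt \<sigma> (r i) (r j)) X"
        by (rule sm_image[OF Suc.IH, where g = r]) (use rDn in auto)
      obtain k :: nat where k: "m <= of_nat k * \<rho>" using m\<rho> pos by (auto simp: asy_def elim: domE)
      have cS: "sm b (lt \<sigma>) (c ` X)"
      proof (rule claimB_set[OF B, where \<rho> = \<rho> and K = "Suc n * k"])
        show "c ` X \<subseteq> P" using cr MP by blast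
        have cf: "c f <= f" if "f \<in> X" for f using cr[OF that] c0[OF that] by (metis le_add_same_cancel1)
        show "a < s" if "a \<in> c ` X" for a using that cf X(5) by (auto intro: le_less_trans)
        show "0 < \<sigma>" "0 < \<rho>" "cond b \<sigma> \<rho>" by fact+
        show "\<rho> \<preceq> a" if "a \<in> c ` X" for a using that cr by (auto simp: M_def asy_def)
        show "a \<preceq> a'" if "a \<in> c ` X" "a' \<in> c ` X" for a a'
        proof -
          have "a \<asymp> \<rho>" "a' \<asymp> \<rho>" using that cr by (auto simp: M_def)
          then show ?thesis unfolding asy_def using dom_trans by blast
        qed
        show "a' - a <= of_nat (Suc n * k) * \<rho>" if "a \<in> c ` X" "a' \<in> c ` X" for a a'
        proof -
          from that obtain f f' where f: "f \<in> X" "f' \<in> X" "a = c f" "a' = c f'" by blast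
          have "a' - a <= c f'" using f c0(1)[OF f(1)] m0 by simp
          also have "\<dots> <= f'" using cf f by blast
          also have "\<dots> <= of_nat (Suc n) * m" using X f by blast
          also have "\<dots> <= of_nat (Suc n) * (of_nat k * \<rho>)" using k by (intro mult_left_mono) auto
          finally show ?thesis by (simp only: of_nat_mult mult.assoc)
        qed
      qed
      have "sm b (lt \<sigma>) X"
      proof (rule sm_product)
        show "sm b (\<lambda>i j. lt \<sigma> (c i) (c j)) X" by (rule sm_image[OF cS, where g = c]) auto
        show "sm b (\<lambda>i j. lt \<sigma> (r i) (r j)) X" by (rule rS)
        show "lt \<sigma> (c i) (c j) \<or> lt \<sigma> (r i) (r j)" if "i \<in> X" "j \<in> X" "lt \<sigma> i j" for i j
          using that cr lt_add_cases by metis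
      qed simp
      then have "sm b (lt \<sigma>) (R \<union> X)" using smR by (intro sm_Un) auto
      moreover have "Dn (Suc n) \<subseteq> R \<union> X" by (auto simp: X_def R_def Dn_def)
      ultimately show ?case by (rule sm_mono) auto
    qed
    moreover have "\<exists>n. D \<subseteq> Dn n"
    proof (cases "D = {}")
      case False
      then obtain f0 where f0: "f0 \<in> D" by blast
      obtain n0 :: nat where n0: "f0 <= of_nat n0 * \<rho>" using small[OF f0] pos by (auto elim: domE)
      obtain k :: nat where k: "\<rho> <= of_nat k * m" using m\<rho> m0 by (auto simp: asy_def elim: domE)
      have "f <= of_nat ((n0 + K) * k) * m" if "f \<in> D" for f
      proof -
        have "f <= of_nat (n0 + K) * \<rho>" using K[OF f0 that] n0 by (simp add: algebra_simps)
        also have "\<dots> <= of_nat (n0 + K) * (of_nat k * m)" using k by (intro mult_left_mono) auto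
        finally show ?thesis by (simp only: of_nat_mult mult.assoc)
      qed
      then show ?thesis using D by (intro exI[of _ "(n0 + K) * k"]) (auto simp: Dn_def)
    qed simp
    ultimately show ?thesis using sm_mono by blast
  qed
qed

text \<open>
  Either all elements of \<open>D\<close> are at most of order \<open>\<rho>\<close>, or one of them is much larger than \<open>\<rho>\<close> and
  then all are.
\<close>

lemma claims:
  assumes "s \<in> S"
  shows "claimA s \<and> claimB s"
  using wo_S assms
proof (induction s rule: wo_induct)
  case (less s)
  have B: "claimB s" using less.IH by (intro claimB_step) auto
  have "claimA s" unfolding claimA_def
  proof (intro allI impI)
    fix b \<sigma> \<rho> D K
    assume "D \<subseteq> insert 0 S" "\<forall>f\<in>D. f < s" "0 < \<sigma>" "0 < \<rho>" "\<forall>f\<in>D. \<forall>f'\<in>D. f' - f <= of_nat K * \<rho>"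
      "cond b \<sigma> \<rho>"
    then show "sm b (lt \<sigma>) D"
      using claimA_step_large[OF B, of D \<sigma> \<rho> K b] claimA_step_small[OF B, of D \<sigma> \<rho> K b] less.IH
      by (metis ll_def)
  qed
  then show ?case using B by blast
qed

section \<open>Counting growth classes of products\<close>

text \<open>
  The conditions under which \<open>claimA\<close> controls the logarithms \<open>h \<cdot> lg f\<close> of generators at
  resolution one and with range \<open>\<zeta>\<close>: a unit change of the logarithm is a change of the base by
  \<open>f / h\<close>, or a change of the exponent by \<open>1 / lg f\<close>.
\<close>

definition hyps :: "'k => tree => bool" where
  "hyps \<eta> b0 \<longleftrightarrow>
     (\<forall>f\<in>S. \<forall>h\<in>S. \<forall>\<zeta>. 1 \<lless> h --> 0 < \<zeta> --> \<zeta> \<preceq> \<eta> --> cond b0 (f / h) (\<zeta> * f / h)) \<and>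
     (\<forall>f\<in>S. \<forall>\<zeta>. 2 <= f --> 0 < \<zeta> --> \<zeta> \<preceq> \<eta> --> lg f \<lless> \<zeta> --> cond b0 (1 / lg f) (\<zeta> / lg f))"

text \<open>
  The generators with logarithm far below \<open>\<zeta>\<close> have few growth classes of logarithms. As in \<open>cond\<close>,
  the class of \<open>\<zeta>\<close> is left out. The offset \<open>b0\<close> accounts for the bases and exponents of a single
  generator.
\<close>

definition condz :: "tree => tree => 'k => bool" where
  "condz b0 b \<zeta> \<longleftrightarrow> (\<forall>u\<in>U'. \<not> lg u \<lless> \<zeta>) \<or>
     (\<exists>d. b0 + d < b \<and> tp (\<lambda>u v. lg u \<lless> lg v) {u \<in> U'. lg u \<lless> \<zeta>} d)"

text \<open>
  The analogue of \<open>claimA\<close> one logarithm higher: products take the role of sums, and growth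
  classes that of elements.
\<close>

definition claimC :: "'k => tree => 'k => bool" where
  "claimC \<eta> b0 s \<longleftrightarrow> (\<forall>b \<zeta> E K. b0 <= b --> E \<subseteq> Q --> (\<forall>q\<in>E. q < s) --> 0 < \<zeta> --> 1 \<preceq> \<zeta> --> \<zeta> \<preceq> \<eta> -->
     (\<forall>q\<in>E. \<forall>q'\<in>E. lg q' - lg q <= of_nat K * \<zeta>) --> condz b0 b \<zeta> --> sm b (\<lless>) E)"

lemma sm_weaken: "sm b R X ==> b <= b' ==> sm b' R X"
  using sm_mono[of b R X X R b'] by blast

lemma condz_mono:
  assumes "condz b0 b \<zeta>" "\<zeta>' \<preceq> \<zeta>"
  shows "condz b0 b \<zeta>'"
proof -
  have sub: "{u \<in> U'. lg u \<lless> \<zeta>'} \<subseteq> {u \<in> U'. lg u \<lless> \<zeta>}"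
    using assms(2) ll_dom_trans by blast
  show ?thesis using assms(1) unfolding condz_def
  proof (elim disjE exE conjE)
    assume "\<forall>u\<in>U'. \<not> lg u \<lless> \<zeta>"
    then show "(\<forall>u\<in>U'. \<not> lg u \<lless> \<zeta>') \<or> (\<exists>d. b0 + d < b \<and> tp (\<lambda>u v. lg u \<lless> lg v) {u \<in> U'. lg u \<lless> \<zeta>'} d)"
      using sub by blast
  next
    fix d assume d: "b0 + d < b" "tp (\<lambda>u v. lg u \<lless> lg v) {u \<in> U'. lg u \<lless> \<zeta>} d"
    have "tp (\<lambda>u v. lg u \<lless> lg v) {u \<in> U'. lg u \<lless> \<zeta>'} d"
      by (rule tp_mono[OF d(2) sub]) auto
    then show "(\<forall>u\<in>U'. \<not> lg u \<lless> \<zeta>') \<or> (\<exists>d. b0 + d < b \<and> tp (\<lambda>u v. lg u \<lless> lg v) {u \<in> U'. lg u \<lless> \<zeta>'} d)"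
      using d(1) by blast
  qed
qed

lemma condz_less:
  assumes "condz b0 b \<zeta>" "u \<in> U'" "lg u \<lless> \<zeta>"
  shows "b0 < b"
proof -
  obtain d where "b0 + d < b" using assms unfolding condz_def by blast
  moreover have "b0 <= b0 + d" using add_left_mono[OF zero_le_tree[of d], of b0] by simp
  ultimately show ?thesis by simp
qed

text \<open>
  The contributions of exponents and bases to the logarithm of a generator are estimated by
  \<open>claimA\<close>, unless the range \<open>\<zeta>\<close> is so large that the bases themselves vary over several growth
  classes.
\<close>

lemma claimC_U:
  assumes hy: "hyps \<eta> b0" and IH: "\<And>s'. s' \<in> Q ==> s' < s ==> claimC \<eta> b0 s'"
    and sQ: "s \<in> Q" and u: "\<And>i. i \<in> J ==> u i \<in> U'" "\<And>i. i \<in> J ==> u i < s"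
    and bb: "b0 <= b" and \<zeta>: "0 < \<zeta>" "1 \<preceq> \<zeta>" "\<zeta> \<preceq> \<eta>"
    and K: "\<And>i j. i \<in> J ==> j \<in> J ==> lg (u j) - lg (u i) <= of_nat K * \<zeta>"
    and dom: "\<And>i. i \<in> J ==> \<zeta> \<preceq> lg (u i)" and cz: "condz b0 b \<zeta>"
  shows "sm b (\<lambda>i j. lt 1 (lg (u i)) (lg (u j))) J"
proof (rule U'_decompose[where M = "of_nat K * \<zeta>", OF u(1) K], assumption, assumption, assumption)
  fix J' f g h i0
  assume J': "J' \<subseteq> J" and i0: "i0 \<in> J'"
    and pf: "\<And>i. i \<in> J' ==> power_form (u i) (f i) (g i) (h i)"
    and hg: "\<And>i j. i \<in> J' ==> j \<in> J' ==> h j - h i = g j - g i"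
    and mn: "\<And>i. i \<in> J' ==> h i0 <= h i \<and> f i0 <= f i \<and>
      (h i - h i0) * lg (f i0) <= of_nat K * \<zeta> \<and> h i0 * (lg (f i) - lg (f i0)) <= of_nat K * \<zeta>"
  note fg = pf[unfolded power_form_def]
  define h0 where "h0 = h i0"
  define f0 where "f0 = f i0"
  define l0 where "l0 = lg f0"
  obtain p where p: "p \<in> P" "s <= p" using Q_le_P[OF sQ] by blast
  have pS: "p \<in> S" "p \<in> Dom" using p PS SD by blast+
  have fS: "f i \<in> S" "f i \<in> Dom" "2 <= f i" "0 < f i" "0 < h i" "1 \<lless> h i" "1 / 2 <= lg (f i)" "g i \<in> S" "1 \<lless> g i"
    "h i \<asymp> g i" if "i \<in> J'" for i
    using fg[OF that] SD S_pos lg_ge_half by auto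
  have lgu: "lg (u i) = h i * lg (f i)" if "i \<in> J'" for i using fg[OF that] by blast
  have i0': "f0 \<in> S" "f0 \<in> Dom" "2 <= f0" "0 < f0" "0 < h0" "1 \<lless> h0" "1 / 2 <= l0" "0 < l0"
    using fS[OF i0] by (auto simp: h0_def f0_def l0_def)
  have mn': "h0 <= h i" "f0 <= f i" "(h i - h0) * l0 <= of_nat K * \<zeta>" "h0 * (lg (f i) - l0) <= of_nat K * \<zeta>"
    if "i \<in> J'" for i
    using mn[OF that] by (auto simp: h0_def f0_def l0_def)
  have "\<zeta> \<preceq> h0 * l0" using dom[of i0] i0 J' lgu[OF i0] by (auto simp: h0_def f0_def l0_def)
  then obtain n :: nat where n: "\<zeta> <= of_nat n * (h0 * l0)" using i0' by (auto elim: domE)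
  have Kn: "of_nat K * \<zeta> <= of_nat (K * n) * (h0 * l0)"
    using mult_left_mono[OF n, of "of_nat K"] by (simp add: mult.assoc)
  have lgf: "lg (f i) <= of_nat (1 + K * n) * l0" if "i \<in> J'" for i
  proof -
    have "h0 * (lg (f i) - l0) <= h0 * (of_nat (K * n) * l0)"
      using mn'(4)[OF that] Kn by (simp add: ac_simps)
    then have "lg (f i) - l0 <= of_nat (K * n) * l0" using i0' by (simp only: mult_le_cancel_left_pos)
    then show ?thesis by (simp add: algebra_simps)
  qed
  have hh: "h i <= of_nat (1 + K * n) * h0" if "i \<in> J'" for i
  proof -
    have "l0 * (h i - h0) <= l0 * (of_nat (K * n) * h0)"
      using mn'(3)[OF that] Kn by (simp add: ac_simps)
    then have "h i - h0 <= of_nat (K * n) * h0" using i0' by (simp only: mult_le_cancel_left_pos)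
    then show ?thesis by (simp add: algebra_simps)
  qed
  have hdom: "h i \<preceq> h0" "lg (f i) \<preceq> l0" if "i \<in> J'" for i
    using hh[OF that] lgf[OF that] fS[OF that] i0'
    by (auto intro!: domI_nonneg[of _ _ "1 + K * n"] simp: less_imp_le intro: order_trans[of 0 "1/2"])
  have fp: "f i < p" if "i \<in> J'" for i
  proof -
    have "1 < h i" using infinite_nat_less[of "h i" 1] fS[OF that] by simp
    then have "f i <= u i" using base_le_pw[of "f i" "h i"] fS[OF that] fg[OF that] by auto
    then show ?thesis using u(2)[of i] that J' p by auto
  qed
  have h_part: "sm b (\<lambda>i j. h i < h j \<and> 1 \<lless> (h j - h i) * lg (f j)) J'"
  \<comment> \<open>If the logarithm of the base is at least of order \<open>\<zeta>\<close>, the exponents vary by a bounded amount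
    only and are finitely many.\<close>
  proof (cases "\<zeta> \<preceq> l0")
    case True
    then obtain k :: nat where k: "\<zeta> <= of_nat k * l0" using i0' by (auto elim: domE)
    have hk: "h i - h0 <= of_nat (K * k)" if "i \<in> J'" for i
    proof -
      have "l0 * (h i - h0) <= of_nat K * \<zeta>" using mn'(3)[OF that] by (simp add: mult.commute)
      also have "\<dots> <= of_nat K * (of_nat k * l0)" using k by (intro mult_left_mono) auto
      also have "\<dots> = l0 * of_nat (K * k)" by (simp add: ac_simps)
      finally show ?thesis using i0' by (simp only: mult_le_cancel_left_pos)
    qed
    show ?thesis
      by (rule sm_bounded_exponents[OF _ i0 hg, where N = "K * k"]) (use fS mn' hk in \<open>auto simp: h0_def\<close>)
  next
    case False
    then have lz: "l0 \<lless> \<zeta>" by (simp add: ll_def)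
    have "sm b0 (lt (1 / l0)) (g ` J')"
    proof -
      have "p + p + 1 \<in> S" using S_add pS S_one by blast
      then have "claimA (p + p + 1)" using claims by blast
      then show ?thesis
      proof (rule claimA_def[THEN iffD1, rule_format, where \<rho> = "\<zeta> / l0" and K = K])
        show "g ` J' \<subseteq> insert 0 S" using fS by blast
        show "0 < 1 / l0" "0 < \<zeta> / l0" using i0' \<zeta> by auto
        show "cond b0 (1 / l0) (\<zeta> / l0)"
          using hy lz i0' \<zeta> unfolding hyps_def l0_def by blast
        show "a < p + p + 1" if a: "a \<in> g ` J'" for a
        proof -
          obtain i where i: "i \<in> J'" "a = g i" using a by blast
          have "u i < p" "u i \<in> Dom" using u i(1) J' p U'_Dom by (auto intro: less_le_trans)
          then have "lg (u i) < p - 1" using lg_le[OF pS(2)] lg_strict_mono[of "u i" p] pS by (meson less_le_trans)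
          moreover have "h i * (1 / 2) <= h i * lg (f i)" using fS[OF i(1)] by (intro mult_left_mono) auto
          ultimately have "h i < 2 * p - 2" using lgu[OF i(1)] by simp
          moreover have "g i <= h i + 1" using fg[OF i(1)] by blast
          ultimately show ?thesis using i by simp
        qed
        show "a' - a <= of_nat K * (\<zeta> / l0)" if a: "a \<in> g ` J'" "a' \<in> g ` J'" for a a'
        proof -
          obtain i j where ij: "i \<in> J'" "j \<in> J'" "a = g i" "a' = g j" using a by blast
          have "g j - g i = h j - h i" using hg ij by simp
          also have "\<dots> <= h j - h0" using mn'(1)[OF ij(1)] by simp
          also have "\<dots> <= of_nat K * \<zeta> / l0" using mn'(3)[OF ij(2)] i0' by (simp add: pos_le_divide_eq)
          finally show ?thesis using ij by simp
        qed
      qed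
    qed
    then have "sm b (lt (1 / l0)) (g ` J')" using bb by (rule sm_weaken)
    then show ?thesis
    proof (rule sm_image[where g = g])
      fix i j assume ij: "i \<in> J'" "j \<in> J'" "h i < h j \<and> 1 \<lless> (h j - h i) * lg (f j)"
      have "(h j - h i) * lg (f j) \<preceq> (h j - h i) * l0" using hdom(2)[OF ij(2)] by (intro dom_mult) auto
      then have "1 / l0 * l0 \<lless> (h j - h i) * l0" using ij(3) i0' ll_dom_trans by auto
      then have "1 / l0 \<lless> h j - h i" using i0' by (subst (asm) ll_mult_iff) auto
      then show "lt (1 / l0) (g i) (g j)" using ij(3) hg[OF ij(1,2)] by (simp add: lt_def)
    qed auto
  qed
  have H1: "cond b0 (a / h0) (\<zeta>' * a / h0)" if "a \<in> S" "0 < \<zeta>'" "\<zeta>' \<preceq> \<eta>" for a \<zeta>'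
  proof -
    have "cond b0 (a / g i0) (\<zeta>' * a / g i0)"
      using hy that fS[OF i0] unfolding hyps_def by blast
    moreover have "c / g i0 \<asymp> c / h0" for c
      using fS[OF i0] S_pos[of "g i0"] i0' by (intro asy_divide) (auto simp: h0_def asy_sym)
    ultimately show ?thesis by (metis cond_cong)
  qed
  have "sm b (\<lambda>i j. lt 1 (h0 * lg (f i)) (h0 * lg (f j))) J'"
  \<comment> \<open>If the exponent is at least of order \<open>\<zeta>\<close>, the bases stay in one class and \<open>claimA_power\<close>
    applies. Otherwise the bases change class; the classes of their leading products are counted
    by the induction hypothesis with range \<open>\<zeta> / h0\<close>, and the bases within one class by \<open>claimA\<close>.\<close>
  proof (cases "\<zeta> \<preceq> h0")
    case True
    have "claimA p" using claims pS by blast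
    then have "sm b0 (\<lambda>a a'. a < a' \<and> 1 \<lless> h0 * (lg a' - lg a)) (f ` J')"
    proof (rule claimA_power[where ?f0.0 = f0 and \<zeta> = \<zeta> and K = K])
      show "f ` J' \<subseteq> S" using fS by blast
      show "a < p" if "a \<in> f ` J'" for a using that fp by blast
      show "f0 \<in> f ` J'" using i0 by (simp add: f0_def)
      show "f0 <= a" if "a \<in> f ` J'" for a using that mn' by blast
      show "0 < h0" "0 < \<zeta>" "\<zeta> \<preceq> h0" "0 < (1::'k)" using i0' \<zeta> True by auto
      show "h0 * (lg a - lg f0) <= of_nat K * \<zeta>" if "a \<in> f ` J'" for a
        using that mn'(4) by (auto simp: l0_def)
      show "cond b0 (1 * f0 / h0) (\<zeta> * f0 / h0)" using H1[OF i0'(1) \<zeta>(1,3)] by simp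
    qed
    then have "sm b (\<lambda>a a'. a < a' \<and> 1 \<lless> h0 * (lg a' - lg a)) (f ` J')" using bb by (rule sm_weaken)
    then show ?thesis
    proof (rule sm_image[where g = f])
      fix i j assume ij: "i \<in> J'" "j \<in> J'" "lt 1 (h0 * lg (f i)) (h0 * lg (f j))"
      then show "f i < f j \<and> 1 \<lless> h0 * (lg (f j) - lg (f i))"
        using i0' lg_less_iff[of "f i" "f j"] fS by (auto simp: lt_def right_diff_distrib)
    qed auto
  next
    case False
    then have hz: "h0 \<lless> \<zeta>" by (simp add: ll_def)
    have gz: "g i0 \<lless> \<zeta>" using hz fS[OF i0] by (metis asy_ll1 asy_sym h0_def)
    have b0b: "b0 < b"
    proof (rule condz_less[OF cz])
      show "pw 2 (g i0) \<in> U'" 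
      proof -
        have "g i0 \<in> S \<and> 1 \<lless> g i0" "2 \<in> S" using fS[OF i0] two_S by auto
        then have "pw 2 (g i0) \<in> U" unfolding U_def
            by (intro insertI2 CollectI exI[of _ 2] exI[of _ "g i0"] conjI refl) auto
        then show ?thesis unfolding U'_def by blast
      qed
      have "lg (pw 2 (g i0)) = g i0 * lg 2" by (simp add: lg_pw)
      moreover have "lg 2 \<preceq> 1" using lg_le[OF two_Dom] lg_two by (intro dom_le) auto
      then have "g i0 * lg 2 \<preceq> g i0 * 1" by (intro dom_mult) auto
      ultimately show "lg (pw 2 (g i0)) \<lless> \<zeta>" using gz dom_ll_trans by simp
    qed
    define \<zeta>' where "\<zeta>' = \<zeta> / h0"
    have \<zeta>': "0 < \<zeta>'" "1 \<lless> \<zeta>'" "\<zeta>' <= \<zeta>"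
    proof -
      show "0 < \<zeta>'" using \<zeta> i0' by (simp add: \<zeta>'_def)
      have "1 * h0 \<lless> \<zeta>' * h0" using hz i0' by (simp add: \<zeta>'_def)
      then show "1 \<lless> \<zeta>'" using i0' by (subst (asm) ll_mult_iff) auto
      have "1 <= h0" using infinite_nat_less[of h0 1] i0' by simp
      then show "\<zeta>' <= \<zeta>" using \<zeta> i0' by (simp add: \<zeta>'_def divide_le_eq mult_le_cancel_left1)
    qed
    have \<zeta>'\<eta>: "\<zeta>' \<preceq> \<zeta>" "\<zeta>' \<preceq> \<eta>" using \<zeta>' \<zeta> dom_le[of \<zeta>' \<zeta>] dom_trans by (auto simp: less_imp_le)
    have "\<exists>c. c \<in> P \<and> a \<preceq> c \<and> c \<preceq> a \<and> c <= a" if "a \<in> S" for a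
    proof -
      from leading_summand[OF that] obtain c r where
        "c \<in> P" "r \<in> insert 0 S" "a = c + r" "a \<preceq> c" "c \<preceq> a" by metis
      then show ?thesis using S0_nonneg[of r] by auto
    qed
    then obtain c where c: "\<And>a. a \<in> S ==> c a \<in> P \<and> a \<preceq> c a \<and> c a \<preceq> a \<and> c a <= a" by metis
    have cf: "c (f i) \<in> P" "c (f i) \<in> Dom" "f i \<preceq> c (f i)" "c (f i) \<preceq> f i" "c (f i) <= f i" "c (f i) \<in> Q"
      if "i \<in> J'" for i
    proof -
      have "c (f i) \<in> P \<and> f i \<preceq> c (f i) \<and> c (f i) \<preceq> f i \<and> c (f i) <= f i" using c fS(1)[OF that] by simp
      then show "c (f i) \<in> P" "f i \<preceq> c (f i)" "c (f i) \<preceq> f i" "c (f i) <= f i" by simp_all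
      then show "c (f i) \<in> Dom" "c (f i) \<in> Q" using PS SD PQ by simp_all
    qed
    have uQ: "u i0 \<in> Q" "u i0 < s" using u i0 J' U'_Q by blast+
    have "sm b (\<lless>) ((\<lambda>i. c (f i)) ` J')"
    proof (rule IH[OF uQ, unfolded claimC_def, rule_format, where \<zeta> = \<zeta>' and K = "K + 1"])
      show "b0 <= b" "0 < \<zeta>'" "\<zeta>' \<preceq> \<eta>" using bb \<zeta>' \<zeta>'\<eta> by auto
      show "1 \<preceq> \<zeta>'" using \<zeta>' ll_imp_dom by blast
      show "condz b0 b \<zeta>'" using cz \<zeta>'\<eta>(1) by (rule condz_mono)
      show "(\<lambda>i. c (f i)) ` J' \<subseteq> Q" using cf by blast
      show "q < u i0" if q: "q \<in> (\<lambda>i. c (f i)) ` J'" for q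
      proof -
        obtain i where i: "i \<in> J'" "q = c (f i)" using q by blast
        have "lg (f i) <= of_nat (1 + K * n) * l0" using lgf i by blast
        also have "\<dots> < h0 * l0" using infinite_nat_less[of h0 "1 + K * n"] i0'
          by (intro mult_strict_right_mono) auto
        also have "\<dots> = lg (u i0)" using lgu[OF i0] by (simp add: h0_def l0_def f0_def)
        finally have "f i < u i0" using lg_less_iff[of "f i" "u i0"] fS[OF i(1)] QD[OF uQ(1)] by simp
        then show ?thesis using cf[OF i(1)] i by simp
      qed
      show "lg q' - lg q <= of_nat (K + 1) * \<zeta>'"
        if q: "q \<in> (\<lambda>i. c (f i)) ` J'" "q' \<in> (\<lambda>i. c (f i)) ` J'" for q q'
      proof -
        obtain i j where ij: "i \<in> J'" "j \<in> J'" "q = c (f i)" "q' = c (f j)" using q by blast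
        have ci: "c (f i) \<in> Dom" "f i \<preceq> c (f i)" "c (f j) \<in> Dom" "c (f j) <= f j"
          using cf ij by simp_all
        obtain k :: nat where k: "lg (f i) <= lg (c (f i)) + of_nat k"
          using dom_lgE[OF fS(2)[OF ij(1)] ci(1,2)] by blast
        have "of_nat k < \<zeta>'" using infinite_nat_less[of \<zeta>' k] \<zeta>' by simp
        moreover have "lg (c (f j)) <= lg (f j)" using ci lg_le_iff[of "c (f j)" "f j"] fS[OF ij(2)] by simp
        moreover have "lg (f j) - l0 <= of_nat K * \<zeta>'"
          using mn'(4)[OF ij(2)] i0' by (simp add: \<zeta>'_def pos_le_divide_eq mult.commute)
        moreover have "l0 <= lg (f i)" using mn'(2)[OF ij(1)] lg_le_iff[of f0 "f i"] fS[OF ij(1)] i0' by (simp add: l0_def)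
        ultimately show ?thesis using k ij by (simp add: algebra_simps)
      qed
    qed
    then have R1: "sm b (\<lambda>i j. f i \<lless> f j) J'"
    proof (rule sm_image[where g = "\<lambda>i. c (f i)"])
      fix i j assume ij: "i \<in> J'" "j \<in> J'" "f i \<lless> f j"
      have "c (f i) \<preceq> f i" "f j \<preceq> c (f j)" using cf ij by simp_all
      then show "c (f i) \<lless> c (f j)" using ij(3) dom_ll_trans ll_dom_trans by blast
    qed auto
    \<comment> \<open>Steps within a class, at the resolution that is visible in the logarithm.\<close>
    define R where "R i j \<longleftrightarrow> f i < f j \<and> f j \<preceq> f i \<and> f i / h0 \<lless> f j - f i" for i j
    have "tp R J' (om (om b0))"
    proof (rule tp_residual)
      show "transp_on J' R"
      proof (rule transp_onI)
        fix i j k assume ijk: "i \<in> J'" "j \<in> J'" "k \<in> J'" "R i j" "R j k"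
        then have "f j - f i \<preceq> f k - f i" by (intro dom_le) (auto simp: R_def)
        then show "R i k" using ijk unfolding R_def using dom_trans ll_dom_trans by (meson less_trans)
      qed
      fix j assume j: "j \<in> J'"
      have "claimA p" using claims pS by blast
      then have "sm b0 (lt (f j / h0)) (f ` {i \<in> J'. R i j})"
      proof (rule claimA_def[THEN iffD1, rule_format, where \<rho> = "f j" and K = 1])
        show "f ` {i \<in> J'. R i j} \<subseteq> insert 0 S" using fS by blast
        show "a < p" if "a \<in> f ` {i \<in> J'. R i j}" for a using that fp by blast
        show "0 < f j / h0" "0 < f j" using fS[OF j] i0' by auto
        show "a' - a <= of_nat 1 * f j" if "a \<in> f ` {i \<in> J'. R i j}" "a' \<in> f ` {i \<in> J'. R i j}" for a a'
        proof -
          have "a' < f j" "0 < a" using that fS by (auto simp: R_def)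
          then show ?thesis by simp
        qed
        have "g i0 \<preceq> \<eta>" using gz \<zeta>(3) ll_dom_trans ll_imp_dom by blast
        moreover have "0 < g i0" using fS[OF i0] S_pos by blast
        ultimately have "cond b0 (f j / h0) (g i0 * f j / h0)" using H1[OF fS(1)[OF j]] by blast
        moreover have "g i0 * (f j / h0) \<asymp> h0 * (f j / h0)"
          using fS[OF i0] by (intro asy_mult) (auto simp: h0_def asy_sym)
        then have "g i0 * f j / h0 \<asymp> f j" using i0' by simp
        ultimately show "cond b0 (f j / h0) (f j)" using cond_cong asy_refl by blast
      qed
      then have "sm b0 R {i \<in> J'. R i j}"
      proof (rule sm_image[where g = f])
        fix a a' assume a: "a \<in> {i \<in> J'. R i j}" "a' \<in> {i \<in> J'. R i j}" "R a a'"
        have "f j / h0 \<preceq> f a / h0" using a i0' unfolding divide_inverse by (intro dom_mult) (auto simp: R_def)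
        then show "lt (f j / h0) (f a) (f a')" using a(3) dom_ll_trans by (auto simp: R_def lt_def)
      qed auto
      then show "\<exists>t < om (om b0). tp R {i \<in> J'. R i j} t" by (simp only: sm_def)
    qed
    then have R2: "sm b R J'" using b0b unfolding sm_def by (intro exI[of _ "om (om b0)"]) simp
    show ?thesis
    proof (rule sm_product[OF _ _ R1 R2])
      fix i j assume ij: "i \<in> J'" "j \<in> J'" "lt 1 (h0 * lg (f i)) (h0 * lg (f j))"
      have lt: "f i < f j" "1 \<lless> h0 * (lg (f j) - lg (f i))"
        using ij(3) i0' lg_less_iff[of "f i" "f j"] fS ij(1,2) by (auto simp: lt_def right_diff_distrib)
      have "lg (f j) - lg (f i) <= (f j - f i) / f i" using lg_diff_le fS ij by blast
      then have "h0 * (lg (f j) - lg (f i)) \<preceq> h0 * ((f j - f i) / f i)"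
        using i0' lt lg_strict_mono[of "f i" "f j"] fS ij by (intro dom_le mult_left_mono mult_nonneg_nonneg) auto
      then have "1 \<lless> h0 * ((f j - f i) / f i)" using lt ll_dom_trans by blast
      then have "1 * (f i / h0) \<lless> h0 * ((f j - f i) / f i) * (f i / h0)"
        using i0' fS[OF ij(1)] by (subst ll_mult_iff) auto
      then have "f i / h0 \<lless> f j - f i" using i0' fS[OF ij(1)] by simp
      then show "f i \<lless> f j \<or> R i j" using lt by (auto simp: R_def ll_def)
    qed simp
  qed
  then have f_part: "sm b (\<lambda>i j. f i < f j \<and> 1 \<lless> h i * (lg (f j) - lg (f i))) J'"
  proof (rule sm_mono)
    fix i j assume ij: "i \<in> J'" "j \<in> J'" "f i < f j \<and> 1 \<lless> h i * (lg (f j) - lg (f i))"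
    have "h i * (lg (f j) - lg (f i)) \<preceq> h0 * (lg (f j) - lg (f i))"
      using hdom(1)[OF ij(1)] by (intro dom_mult) auto
    then have "1 \<lless> h0 * (lg (f j) - lg (f i))" using ij(3) ll_dom_trans by blast
    then show "lt 1 (h0 * lg (f i)) (h0 * lg (f j))"
      using ij i0' lg_strict_mono[of "f i" "f j"] fS by (auto simp: lt_def right_diff_distrib)
  qed auto
  show "sm b (\<lambda>i j. h i < h j \<and> 1 \<lless> (h j - h i) * lg (f j)) J' \<and>
        sm b (\<lambda>i j. f i < f j \<and> 1 \<lless> h i * (lg (f j) - lg (f i))) J'"
    using h_part f_part by blast
qed

lemma lg_nonneg_Q: "q \<in> Q ==> 0 <= lg q"
  using lg_nonneg QD Q_ge_one by blast

lemma lg_infinite_U': "u \<in> U' ==> u \<in> Q \<and> u \<in> Dom \<and> 1 \<lless> lg u \<and> 0 < lg u"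
proof -
  assume u: "u \<in> U'"
  have a: "u \<in> Q" "u \<in> Dom" "1 \<lless> u" using u U'_Q U'_Dom U'_infinite by blast+
  then have "1 \<lless> lg u" using lg_infinite by blast
  moreover have "0 < lg u" using lg_strict_mono[of 1 u] a U'_ge_one[OF u] QD Q_one by simp
  ultimately show ?thesis using a by blast
qed

text \<open>
  Leading factor and cofactor play the parts of leading product and rest in \<open>claimA_step_large\<close>.
\<close>

lemma claimC_step_large:
  assumes hy: "hyps \<eta> b0" and IH: "\<And>s'. s' \<in> Q ==> s' < s ==> claimC \<eta> b0 s'"
    and sQ: "s \<in> Q" and bb: "b0 <= b" and EQ: "E \<subseteq> Q" and Es: "\<And>q. q \<in> E ==> q < s"
    and \<zeta>: "0 < \<zeta>" "1 \<preceq> \<zeta>" "\<zeta> \<preceq> \<eta>"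
    and K: "\<And>q q'. q \<in> E ==> q' \<in> E ==> lg q' - lg q <= of_nat K * \<zeta>"
    and cz: "condz b0 b \<zeta>" and large: "\<And>q. q \<in> E ==> \<zeta> \<lless> lg q"
  shows "sm b (\<lless>) E"
proof -
  have "\<exists>u p. u \<in> U' \<and> p \<in> Q \<and> q = u * p \<and> lg q \<preceq> lg u \<and> lg u <= lg q" if "q \<in> E" for q
  proof -
    have "q \<in> Q" "q ~= 1" using that EQ large[OF that] by auto
    then show ?thesis using leading_factor by metis
  qed
  then obtain u p where up: "\<And>q. q \<in> E ==> u q \<in> U' \<and> p q \<in> Q \<and> q = u q * p q \<and> lg q \<preceq> lg (u q) \<and> lg (u q) <= lg q"
    by metis
  have lgq: "lg q = lg (u q) + lg (p q)" if "q \<in> E" for q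
    using lg_mult[of "u q" "p q"] up[OF that] U'_Dom QD by (metis subsetD)
  have cov: "\<exists>F. finite F \<and> E = \<Union>F \<and> (\<forall>J\<in>F. \<exists>K'::nat. \<forall>i\<in>J. \<forall>j\<in>J.
      lg (u i) - lg (u j) <= of_nat K' * \<zeta> \<and> lg (p i) - lg (p j) <= of_nat K' * \<zeta>)"
  proof (rule box_cover)
    have "wo (lg ` u ` E)" using up U'_Dom by (intro wo_lg_image wo_subset[OF wo_U']) blast+
    then show "wo ((\<lambda>q. lg (u q)) ` E)" by (simp add: image_image)
    have "wo (lg ` p ` E)" using up Q_Dom by (intro wo_lg_image wo_subset[OF wo_Q]) blast+
    then show "wo ((\<lambda>q. lg (p q)) ` E)" by (simp add: image_image)
    show "0 <= \<zeta>" using \<zeta> by simp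
    show "lg (u i) + lg (p i) - (lg (u j) + lg (p j)) <= of_nat K * \<zeta>" if "i \<in> E" "j \<in> E" for i j
      using K[OF that(2,1)] lgq[OF that(1)] lgq[OF that(2)] by simp
  qed
  show ?thesis
  proof (rule sm_cover[OF cov])
    fix J assume J: "J \<subseteq> E" and "\<exists>K'::nat. \<forall>i\<in>J. \<forall>j\<in>J.
      lg (u i) - lg (u j) <= of_nat K' * \<zeta> \<and> lg (p i) - lg (p j) <= of_nat K' * \<zeta>"
    then obtain K' :: nat where K': "\<And>i j. i \<in> J ==> j \<in> J ==> lg (u i) - lg (u j) <= of_nat K' * \<zeta>"
      "\<And>i j. i \<in> J ==> j \<in> J ==> lg (p i) - lg (p j) <= of_nat K' * \<zeta>" by blast
    have uJ: "u i \<in> U'" "p i \<in> Q" "\<zeta> \<lless> lg (u i)" "u i < s" if "i \<in> J" for i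
    proof -
      have i: "i \<in> E" using that J by blast
      show 1: "u i \<in> U'" "p i \<in> Q" using up[OF i] by simp_all
      show "\<zeta> \<lless> lg (u i)" using up[OF i] large[OF i] ll_dom_trans by blast
      have "u i * 1 <= u i * p i" using 1 Q_ge_one[of "p i"] U'_ge_one[of "u i"] by (intro mult_left_mono) auto
      then show "u i < s" using up[OF i] Es[OF i] by auto
    qed
    show "sm b (\<lless>) J"
    proof (cases "J = {}")
      case False
      then obtain q0 where q0: "q0 \<in> J" by blast
      have q0': "q0 \<in> E" "q0 \<in> Q" "q0 < s" using q0 J EQ Es by auto
      have 1: "sm b (\<lambda>i j. lt 1 (lg (u i)) (lg (u j))) J"
      proof (rule claimC_U[OF hy IH sQ uJ(1) uJ(4) bb \<zeta> _ _ cz])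
        show "lg (u j) - lg (u i) <= of_nat K' * \<zeta>" if "i \<in> J" "j \<in> J" for i j
          using K'(1) that by blast
        show "\<zeta> \<preceq> lg (u i)" if "i \<in> J" for i using uJ(3)[OF that] ll_imp_dom by blast
      qed
      have "sm b (\<lless>) (p ` J)"
      proof (rule IH[OF q0'(2,3), unfolded claimC_def, rule_format, where \<zeta> = \<zeta> and K = K'])
        show "p ` J \<subseteq> Q" using uJ by blast
        show "lg q' - lg q <= of_nat K' * \<zeta>" if "q \<in> p ` J" "q' \<in> p ` J" for q q'
          using that K'(2) by blast
        show "q < q0" if q: "q \<in> p ` J" for q
        proof -
          obtain i where i: "i \<in> J" "q = p i" using q by blast
          have "of_nat K' * \<zeta> < lg (u q0)" using llD[OF uJ(3)[OF q0], of K'] \<zeta>(1)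
              lg_infinite_U'[OF uJ(1)[OF q0]] by simp
          then have "lg (p i) < lg q0" using K'(2)[OF i(1) q0] lgq[OF q0'(1)] by simp
          then show ?thesis using lg_less_iff[of "p i" q0] uJ(2)[OF i(1)] QD q0' i by simp
        qed
      qed (use bb \<zeta> cz in auto)
      then have 2: "sm b (\<lambda>i j. lt 1 (lg (p i)) (lg (p j))) J"
      proof (rule sm_image[where g = p])
        fix i j assume "i \<in> J" "j \<in> J" "lt 1 (lg (p i)) (lg (p j))"
        then show "p i \<lless> p j" using ll_lg_iff uJ(2) QD by blast
      qed auto
      show ?thesis
      proof (rule sm_product[OF _ _ 1 2])
        fix i j assume ij: "i \<in> J" "j \<in> J" "i \<lless> j"
        then have ij': "i \<in> E" "j \<in> E" using J by auto
        then have "lt 1 (lg i) (lg j)" using ij(3) ll_lg_iff EQ QD by blast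
        then show "lt 1 (lg (u i)) (lg (u j)) \<or> lt 1 (lg (p i)) (lg (p j))"
          using lt_add_cases lgq ij' by metis
      qed simp
    qed (simp add: sm_empty)
  qed simp
qed

text \<open>
  As in \<open>tp_S_below\<close>: a product \<open>q\<close> has the range \<open>lg q\<close>, which is of the order of the logarithm
  of its leading factor, and fewer generators lie below that one.
\<close>

lemma claimC_step_below:
  assumes IH: "\<And>s'. s' \<in> Q ==> s' < s ==> claimC \<eta> b0 s'"
    and \<zeta>: "0 < \<zeta>" "\<zeta> \<preceq> \<eta>" and cz: "condz b0 b \<zeta>"
  shows "sm b (\<lless>) {q \<in> Q. q < s \<and> lg q \<lless> \<zeta>}" (is "sm b _ ?R")
  using cz unfolding condz_def
proof (elim disjE exE conjE)
  assume no: "\<forall>u\<in>U'. \<not> lg u \<lless> \<zeta>"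
  have "q = 1" if h: "q \<in> ?R" for q
  proof (rule ccontr)
    assume "q ~= 1"
    then obtain u p where u: "u \<in> U'" "lg u <= lg q" using leading_factor[of q] h by blast
    then have "lg u \<preceq> lg q" using lg_infinite_U'[OF u(1)] by (intro dom_le) auto
    then have "lg u \<lless> \<zeta>" using h dom_ll_trans by blast
    then show False using no u(1) by blast
  qed
  then show ?thesis by (intro sm_trivial) (metis ll_irrefl)
next
  fix d assume d: "b0 + d < b" "tp (\<lambda>u v. lg u \<lless> lg v) {u \<in> U'. lg u \<lless> \<zeta>} d"
  then obtain \<phi> where \<phi>: "\<And>u v. u \<in> U' ==> v \<in> U' ==> lg u \<lless> \<zeta> ==> lg v \<lless> \<zeta> ==> lg u \<lless> lg v ==> \<phi> u < \<phi> v"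
    "\<And>u. u \<in> U' ==> lg u \<lless> \<zeta> ==> \<phi> u < d"
    unfolding tp_def by blast
  have "tp (\<lless>) ?R (om (om (b0 + d)))"
  proof (rule tp_residual)
    fix q assume q: "q \<in> ?R"
    show "\<exists>t < om (om (b0 + d)). tp (\<lless>) {r \<in> ?R. r \<lless> q} t"
    proof (cases "q = 1")
      case True
      have "{r \<in> ?R. r \<lless> q} = {}"
      proof -
        have "\<not> r \<lless> q" if "r \<in> Q" for r using Q_ge_one[OF that] True dom_le[of 1 r] by (simp add: ll_def)
        then show ?thesis by blast
      qed
      then show ?thesis by (intro exI[of _ "om 0"]) (auto simp: less_om_iff tp_def)
    next
      case False
      then obtain v p where v: "v \<in> U'" "lg q \<preceq> lg v" "lg v <= lg q" using leading_factor[of q] q by blast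
      have v': "0 < lg v" "1 \<lless> lg v" using lg_infinite_U'[OF v(1)] by auto
      have "lg v \<preceq> lg q" using v' v by (intro dom_le) auto
      then have vz: "lg v \<lless> \<zeta>" using q dom_ll_trans by blast
      define e where "e = \<phi> v"
      have e: "e < d" using \<phi>(2)[OF v(1) vz] by (simp add: e_def)
      obtain n where n: "lg q <= of_nat n * lg v" using domE[OF v(2)] v' by auto
      have be: "b0 + e + om 0 <= b0 + d"
        using plus_one_le_tree[OF e] by (simp add: add.assoc)
      have "sm (b0 + e + om 0) (\<lless>) {r \<in> ?R. r \<lless> q}"
      proof (rule IH[of q, unfolded claimC_def, rule_format, where \<zeta> = "lg v" and K = n])
        show "q \<in> Q" "q < s" using q by auto
        show "b0 <= b0 + e + om 0" using add_left_mono[OF zero_le_tree[of "e + om 0"], of b0] by (simp add: add.assoc)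
        show "{r \<in> ?R. r \<lless> q} \<subseteq> Q" by blast
        show "0 < lg v" "1 \<preceq> lg v" using v' ll_imp_dom by auto
        show "lg v \<preceq> \<eta>" using vz \<zeta>(2) ll_dom_trans ll_imp_dom by blast
        show "r < q" if "r \<in> {r \<in> ?R. r \<lless> q}" for r
          using that ll_less[of r q] Q_pos[of q] q by simp
        show "lg r' - lg r <= of_nat n * lg v" if r: "r \<in> {r \<in> ?R. r \<lless> q}" "r' \<in> {r \<in> ?R. r \<lless> q}" for r r'
        proof -
          have "r' < q" using r ll_less[of r' q] Q_pos[of q] q by simp
          then have "lg r' <= lg q" using lg_strict_mono[of r' q] r q QD by (auto intro: less_imp_le)
          moreover have "0 <= lg r" using lg_nonneg_Q r by blast
          ultimately show ?thesis using n by simp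
        qed
        show "condz b0 (b0 + e + om 0) (lg v)"
          unfolding condz_def
        proof (intro disjI2 exI[of _ e] conjI)
          show "b0 + e < b0 + e + om 0" using add_strict_left_mono[OF zero_less_om[of 0], of "b0 + e"] by (simp only: add_0_right)
          show "tp (\<lambda>u v. lg u \<lless> lg v) {u \<in> U'. lg u \<lless> lg v} e"
          proof (rule tpI[where \<phi> = \<phi>])
            fix a c assume "a \<in> {u \<in> U'. lg u \<lless> lg v}" "c \<in> {u \<in> U'. lg u \<lless> lg v}" "lg a \<lless> lg c"
            then show "\<phi> a < \<phi> c" using \<phi>(1) vz ll_trans by blast
          next
            fix a assume a: "a \<in> {u \<in> U'. lg u \<lless> lg v}"
            then have "lg a \<lless> \<zeta>" using vz ll_trans by blast
            then show "\<phi> a < e" using \<phi>(1)[of a v] a v(1) vz by (simp add: e_def)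
          qed
        qed
      qed
      then obtain t where t: "t < om (om (b0 + e + om 0))" "tp (\<lless>) {r \<in> ?R. r \<lless> q} t" by (auto simp: sm_def)
      have "om (om (b0 + e + om 0)) <= om (om (b0 + d))" using be by simp
      then show ?thesis using t by (meson less_le_trans)
    qed
  qed simp
  then show ?thesis using d(1) unfolding sm_def by (intro exI[of _ "om (om (b0 + d))"]) simp
qed

text \<open>
  A product whose logarithm is of order \<open>\<zeta>\<close> has a factor with logarithm of order \<open>\<zeta>\<close>, at least the
  minimal value \<open>m\<close>. Dividing by it lowers the logarithm by at least \<open>m\<close>, so finitely many
  divisions lead to logarithms far below \<open>\<zeta>\<close>.
\<close>

lemma claimC_step_small:
  assumes hy: "hyps \<eta> b0" and IH: "\<And>s'. s' \<in> Q ==> s' < s ==> claimC \<eta> b0 s'"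
    and sQ: "s \<in> Q" and bb: "b0 <= b" and EQ: "E \<subseteq> Q" and Es: "\<And>q. q \<in> E ==> q < s"
    and \<zeta>: "0 < \<zeta>" "1 \<preceq> \<zeta>" "\<zeta> \<preceq> \<eta>"
    and K: "\<And>q q'. q \<in> E ==> q' \<in> E ==> lg q' - lg q <= of_nat K * \<zeta>"
    and cz: "condz b0 b \<zeta>" and small: "\<And>q. q \<in> E ==> lg q \<preceq> \<zeta>"
  shows "sm b (\<lless>) E"
proof (cases "E = {}")
  case True
  then show ?thesis by (simp add: sm_empty)
next
  case False
  define R where "R = {q \<in> Q. q < s \<and> lg q \<lless> \<zeta>}"
  have smR: "sm b (\<lless>) R" unfolding R_def using IH \<zeta>(1,3) cz by (rule claimC_step_below)
  define M where "M = {u \<in> U'. lg u \<asymp> \<zeta>}"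
  have lead: "q \<in> R \<or> (\<exists>u p. u \<in> M \<and> p \<in> Q \<and> q = u * p \<and> lg u <= lg q)"
    if q: "q \<in> Q" "q < s" "lg q \<preceq> \<zeta>" for q
  proof (cases "lg q \<lless> \<zeta>")
    case True
    then show ?thesis using q by (simp add: R_def)
  next
    case False
    then have zq: "\<zeta> \<preceq> lg q" by (simp add: ll_def)
    have "q ~= 1"
    proof
      assume "q = 1"
      then have "\<zeta> = 0" using zq by (auto simp: dom_def)
      then show False using \<zeta> by simp
    qed
    then obtain u p where u: "u \<in> U'" "p \<in> Q" "q = u * p" "lg q \<preceq> lg u" "lg u <= lg q" using leading_factor q by blast
    have "lg u \<preceq> lg q" using lg_infinite_U'[OF u(1)] u by (intro dom_le) auto
    then have "u \<in> M" using u q zq dom_trans by (auto simp: M_def asy_def)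
    then show ?thesis using u by blast
  qed
  obtain q0 where q0: "q0 \<in> E" using False by blast
  show ?thesis
  proof (cases "M = {}")
    case True
    then have "E \<subseteq> R" using lead EQ Es small by blast
    then show ?thesis using sm_mono[OF smR, of E "(\<lless>)" b] by simp
  next
    case MF: False
    have "wo (lg ` M)" by (intro wo_lg_image wo_subset[OF wo_U']) (use U'_Dom in \<open>auto simp: M_def\<close>)
    then obtain u0 where u0: "u0 \<in> M" "\<And>u. u \<in> M ==> lg u0 <= lg u" using wo_obtain_arg_min MF by metis
    define m where "m = lg u0"
    have m: "0 < m" "m \<preceq> \<zeta>" "\<zeta> \<preceq> m" using u0 lg_infinite_U'[of u0] by (auto simp: m_def M_def asy_def)
    define D where "D n = {q \<in> Q. q < s \<and> lg q <= of_nat n * m}" for n :: nat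
    have Dz: "lg q \<preceq> \<zeta>" if "q \<in> D n" for q n
    proof -
      have "lg q \<preceq> m" using that lg_nonneg_Q m by (intro domI_nonneg[of _ _ n]) (auto simp: D_def)
      then show ?thesis using m dom_trans by blast
    qed
    have "sm b (\<lless>) (D n)" for n
    proof (induction n)
      case 0
      have "D 0 \<subseteq> R"
      proof
        fix q assume q: "q \<in> D 0"
        then have "lg q = 0" using lg_nonneg_Q[of q] by (auto simp: D_def)
        moreover have "0 \<lless> \<zeta>" using \<zeta> by (simp add: ll_def dom_def)
        ultimately show "q \<in> R" using q by (simp add: R_def D_def)
      qed
      then show ?case using sm_mono[OF smR, of "D 0" "(\<lless>)" b] by simp
    next
      case (Suc n)
      define J where "J = D (Suc n) - R"
      have "\<exists>u p. u \<in> M \<and> p \<in> Q \<and> q = u * p \<and> lg u <= lg q" if "q \<in> J" for q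
        using that lead[of q] Dz[of q "Suc n"] by (auto simp: J_def D_def)
      then obtain u p where up: "\<And>q. q \<in> J ==> u q \<in> M \<and> p q \<in> Q \<and> q = u q * p q \<and> lg (u q) <= lg q" by metis
      have JQ: "q \<in> Q" "q < s" "lg q <= of_nat (Suc n) * m" if "q \<in> J" for q using that by (auto simp: J_def D_def)
      have uM: "u q \<in> M" "u q \<in> U'" "p q \<in> Q" "m <= lg (u q)" if "q \<in> J" for q
        using up[OF that] u0(2)[of "u q"] by (auto simp: M_def m_def)
      have lgq: "lg q = lg (u q) + lg (p q)" if "q \<in> J" for q
      proof -
        have "u q \<in> Dom" "p q \<in> Dom" using uM[OF that] lg_infinite_U' QD by blast+
        then have "lg (u q * p q) = lg (u q) + lg (p q)" by (rule lg_mult)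
        then show ?thesis using up[OF that] by simp
      qed
      have us: "u q < s" "p q < s" if "q \<in> J" for q
      proof -
        have 1: "1 <= p q" "1 < u q" using uM[OF that] Q_ge_one U'_ge_one by blast+
        then have "u q * 1 <= u q * p q" "1 * p q <= u q * p q" by (intro mult_left_mono mult_right_mono; simp)+
        then show "u q < s" "p q < s" using up[OF that] JQ(2)[OF that] by auto
      qed
      obtain k :: nat where k: "m <= of_nat k * \<zeta>" using m \<zeta> by (auto elim: domE)
      have 1: "sm b (\<lambda>i j. lt 1 (lg (u i)) (lg (u j))) J"
      proof (rule claimC_U[OF hy IH sQ uM(2) us(1) bb \<zeta> _ _ cz])
        show "lg (u j) - lg (u i) <= of_nat (Suc n * k) * \<zeta>" if "i \<in> J" "j \<in> J" for i j
        proof -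
          have "lg (u j) <= of_nat (Suc n) * m" using up[OF that(2)] JQ(3)[OF that(2)] by simp
          also have "\<dots> <= of_nat (Suc n) * (of_nat k * \<zeta>)" using k by (intro mult_left_mono) auto
          also have "\<dots> = of_nat (Suc n * k) * \<zeta>" by (simp only: of_nat_mult mult.assoc)
          finally have "lg (u j) <= of_nat (Suc n * k) * \<zeta>" .
          moreover have "0 <= lg (u i)" using uM(4)[OF that(1)] m by simp
          ultimately show ?thesis by (metis diff_mono diff_zero)
        qed
        show "\<zeta> \<preceq> lg (u i)" if "i \<in> J" for i using uM(1)[OF that] by (simp add: M_def asy_def)
      qed
      have 2: "sm b (\<lambda>i j. lt 1 (lg (p i)) (lg (p j))) J"
      proof (rule sm_image[OF Suc.IH, where g = p])
        fix i assume i: "i \<in> J"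
        have "lg (p i) <= of_nat n * m"
          using JQ(3)[OF i] lgq[OF i] uM(4)[OF i] by (simp add: algebra_simps)
        then show "p i \<in> D n" using uM(3)[OF i] us(2)[OF i] by (simp add: D_def)
      next
        fix i j assume "i \<in> J" "j \<in> J" "lt 1 (lg (p i)) (lg (p j))"
        then show "p i \<lless> p j" using ll_lg_iff uM(3) QD by blast
      qed simp
      have "sm b (\<lless>) J"
      proof (rule sm_product[OF _ _ 1 2])
        fix i j assume ij: "i \<in> J" "j \<in> J" "i \<lless> j"
        then have "lt 1 (lg i) (lg j)" using ij(3) ll_lg_iff JQ QD by blast
        then show "lt 1 (lg (u i)) (lg (u j)) \<or> lt 1 (lg (p i)) (lg (p j))"
          using lt_add_cases lgq ij by metis
      qed simp
      then have "sm b (\<lless>) (J \<union> R)" using smR by (intro sm_Un) simp_all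
      then show ?case using sm_mono[of b "(\<lless>)" "J \<union> R" "D (Suc n)" "(\<lless>)" b] by (auto simp: J_def)
    qed
    moreover have "\<exists>n. E \<subseteq> D n"
    proof -
      obtain k :: nat where k: "lg q0 <= of_nat k * \<zeta>" using small[OF q0] \<zeta> by (auto elim: domE)
      obtain l :: nat where l: "\<zeta> <= of_nat l * m" using m by (auto elim: domE)
      have "E \<subseteq> D ((k + K) * l)"
      proof
        fix q assume q: "q \<in> E"
        have "lg q <= of_nat (k + K) * \<zeta>" using K[OF q0 q] k by (simp add: algebra_simps)
        also have "\<dots> <= of_nat (k + K) * (of_nat l * m)" using l by (intro mult_left_mono) auto
        also have "\<dots> = of_nat ((k + K) * l) * m" by (simp only: of_nat_mult mult.assoc)
        finally show "q \<in> D ((k + K) * l)" using q EQ Es by (auto simp: D_def)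
      qed
      then show ?thesis by blast
    qed
    ultimately show ?thesis using sm_mono[of b "(\<lless>)" _ E "(\<lless>)" b] by blast
  qed
qed

lemma claimC_all:
  assumes hy: "hyps \<eta> b0" and "s \<in> Q"
  shows "claimC \<eta> b0 s"
  using wo_Q assms(2)
proof (induction rule: wo_induct)
  case (less s)
  show ?case unfolding claimC_def
  proof (intro allI impI)
    fix b \<zeta> E K
    assume bb: "b0 <= b" and E: "E \<subseteq> Q" "\<forall>q\<in>E. q < s" and \<zeta>: "0 < \<zeta>" "1 \<preceq> \<zeta>" "\<zeta> \<preceq> \<eta>"
      and K: "\<forall>q\<in>E. \<forall>q'\<in>E. lg q' - lg q <= of_nat K * \<zeta>" and cz: "condz b0 b \<zeta>"
    show "sm b (\<lless>) E"
    proof (cases "\<exists>q0\<in>E. \<zeta> \<lless> lg q0")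
      case True
      then obtain q0 where q0: "q0 \<in> E" "\<zeta> \<lless> lg q0" by blast
      have "\<zeta> \<lless> lg q" if "q \<in> E" for q
      proof (rule ccontr)
        assume "\<not> \<zeta> \<lless> lg q"
        then have "lg q + of_nat K * \<zeta> \<preceq> \<zeta>"
          using \<zeta> by (intro dom_add) (auto simp: ll_def intro: domI[of _ K])
        moreover have "lg q0 \<preceq> lg q + of_nat K * \<zeta>"
        proof (rule dom_le)
          show "0 <= lg q0" using lg_nonneg_Q q0 E by blast
          have "lg q0 - lg q <= of_nat K * \<zeta>" using K that q0 by blast
          then show "lg q0 <= lg q + of_nat K * \<zeta>" by simp
        qed
        ultimately show False using q0(2) dom_trans by (auto simp: ll_def)
      qed
      then show ?thesis
        using claimC_step_large[OF hy less.IH less.hyps bb E(1) _ \<zeta> _ cz] E(2) K by blast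
    next
      case False
      then have "lg q \<preceq> \<zeta>" if "q \<in> E" for q using that by (simp add: ll_def)
      then show ?thesis
        using claimC_step_small[OF hy less.IH less.hyps bb E(1) _ \<zeta> _ cz] E(2) K by blast
    qed
  qed
qed

section \<open>Climbing the tower\<close>

lemma lg_x_pos: "0 < lg x" "1 \<lless> lg x" "x \<in> Dom" "0 < x"
  using lg_infinite_U'[of x] SD[OF S_x] Dom_pos by (auto simp: U'_def U_def)

lemma lg_S_cases:
  assumes f: "f \<in> S" "2 <= f"
  shows "lg f \<asymp> 1 \<or> (\<exists>c\<in>P. c <= f \<and> c ~= 1 \<and> lg f \<asymp> lg c)"
proof (cases "f \<preceq> 1")
  case True
  have "lg f <= f - 1" "1 / 2 <= lg f" using f lg_le lg_ge_half SD by blast+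
  moreover have "1 \<preceq> lg f" using f lg_ge_half[of f] SD by (intro domI_nonneg[of _ _ 2]) auto
  moreover have "lg f \<preceq> f" using calculation f by (intro dom_le) auto
  ultimately show ?thesis using True dom_trans unfolding asy_def by blast
next
  case False
  then have inf: "1 \<lless> f" by (simp add: ll_def)
  obtain c r where c: "c \<in> P" "r \<in> insert 0 S" "f = c + r" "f \<preceq> c" "c \<preceq> f"
    using leading_summand[OF f(1)] by blast
  have cD: "c \<in> Dom" "f \<in> Dom" using c(1) f PS SD by blast+
  have cinf: "1 \<lless> c" using inf c(4) ll_dom_trans by blast
  have l: "1 \<lless> lg c" using lg_infinite cD cinf by blast
  have c1: "1 <= c" using c(1) PQ Q_ge_one by blast
  then have lc: "0 <= lg c" using lg_nonneg cD by blast
  obtain k :: nat where k: "lg f <= lg c + of_nat k" using dom_lgE[OF cD(2,1) c(4)] by blast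
  have "c <= f" using c(2,3) S0_nonneg by auto
  then have le: "lg c <= lg f" using lg_le_iff cD by blast
  have "of_nat k < lg c" using infinite_nat_less[OF l lc] .
  then have "lg f \<preceq> lg c" using k le lc by (intro domI_nonneg[of _ _ 2]) auto
  moreover have "lg c \<preceq> lg f" using le lc by (intro dom_le)
  moreover have "c ~= 1" using cinf by auto
  ultimately show ?thesis using c(1) \<open>c <= f\<close> unfolding asy_def by blast
qed

text \<open>
  The logarithm of a product is of the order of that of its leading generator, which is \<open>lg x\<close> or
  \<open>h \<cdot> lg f\<close>. The exponent grows like its leading product, and \<open>lg f\<close> is of order one or of the
  order of \<open>lg c\<close> for a smaller product \<open>c\<close>. Unfolding this ends with one or \<open>lg x\<close>.
\<close>

lemma lg_Q_asy:
  assumes "q \<in> Q" "q ~= 1"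
  shows "\<exists>v\<in>P. lg q \<asymp> v \<or> lg q \<asymp> v * lg x"
  using wo_Q assms
proof (induction rule: wo_induct)
  case (less q)
  obtain u p where u: "u \<in> U'" "p \<in> Q" "q = u * p" "lg q \<preceq> lg u" "lg u <= lg q"
    using leading_factor less by blast
  have uD: "u \<in> Dom" "q \<in> Dom" "0 < lg u" using lg_infinite_U'[OF u(1)] less.hyps QD by blast+
  have uq: "lg q \<asymp> lg u" using u uD by (auto simp: asy_def intro: dom_le)
  have "\<exists>v\<in>P. lg u \<asymp> v \<or> lg u \<asymp> v * lg x"
    using u(1)
  proof (cases rule: U'_cases)
    case 1
    have "1 \<in> P" by (simp add: P_def prods.one)
    then show ?thesis using 1 by (intro bexI[of _ 1]) auto
  next
    case (2 f g e)
    have fD: "f \<in> Dom" "0 < lg f" "0 <= g" using 2 SD lg_ge_half[of f] S_pos[of g] by auto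
    have g1: "g - e \<asymp> g" "1 < g - e"
    proof -
      have "of_nat 2 < g" using infinite_nat_less 2 fD by blast
      then show "1 < g - e" using 2 by auto
      have "g - e \<preceq> g" using \<open>of_nat 2 < g\<close> 2 by (intro dom_le) auto
      moreover have "g \<preceq> g - e" using \<open>of_nat 2 < g\<close> 2 by (intro domI_nonneg[of _ _ 2]) auto
      ultimately show "g - e \<asymp> g" by (simp add: asy_def)
    qed
    have lgu: "lg u = (g - e) * lg f" using lg_pw[OF fD(1)] 2 by simp
    have fq: "f < q"
    proof -
      have "1 * lg f < (g - e) * lg f" using g1 fD by (intro mult_strict_right_mono) auto
      then have "lg f < lg q" using lgu u(5) by simp
      then show ?thesis using lg_less_iff uD fD by blast
    qed
    obtain c' r where c': "c' \<in> P" "g \<preceq> c'" "c' \<preceq> g" using leading_summand[OF \<open>g \<in> S\<close>] by metis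
    have "\<exists>v\<in>P. lg f \<asymp> v \<or> lg f \<asymp> v * lg x"
      using lg_S_cases[OF \<open>f \<in> S\<close> \<open>2 <= f\<close>]
    proof (elim disjE bexE conjE)
      assume "lg f \<asymp> 1"
      then show ?thesis by (intro bexI[of _ 1]) (auto simp: P_def prods.one)
    next
      fix c assume c: "c \<in> P" "c <= f" "c ~= 1" "lg f \<asymp> lg c"
      then have "c \<in> Q" "c < q" using PQ fq by auto
      then show ?thesis using less.IH[of c] c asy_trans by blast
    qed
    then obtain v where v: "v \<in> P" "lg f \<asymp> v \<or> lg f \<asymp> v * lg x" by blast
    have gc: "g - e \<asymp> c'" using g1 c' asy_trans by (auto simp: asy_def intro: dom_trans)
    have "lg u \<asymp> c' * v \<or> lg u \<asymp> c' * v * lg x"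
      using v(2) asy_mult[OF gc] lgu by (metis mult.assoc)
    then show ?thesis using P_mult c'(1) v(1) by blast
  qed
  then show ?case using uq asy_trans by blast
qed

lemma lg_asy_P_large:
  assumes "a \<asymp> v \<or> a \<asymp> v * lg x" "v \<in> P" "1 \<lless> a"
  shows "lg x \<preceq> a"
  using assms(1)
proof
  assume a: "a \<asymp> v"
  have "1 \<lless> v" using a assms(3) asy_ll2 by blast
  moreover have "v \<in> Dom" using assms(2) PS SD by blast
  ultimately have "lg x \<lless> v" using gap by blast
  then show ?thesis using a by (metis asy_def ll_dom_trans ll_imp_dom)
next
  assume a: "a \<asymp> v * lg x"
  have "1 <= v" using assms(2) PQ Q_ge_one by blast
  then have "1 * lg x <= v * lg x" using lg_x_pos by (intro mult_right_mono) auto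
  then have "lg x \<preceq> v * lg x" using lg_x_pos by (intro dom_le) auto
  then show ?thesis using a dom_trans unfolding asy_def by blast
qed

lemma lg_U'_large: "u \<in> U' ==> lg x \<preceq> lg u"
proof -
  assume u: "u \<in> U'"
  have "u \<in> Q" "u ~= 1" "1 \<lless> lg u" using lg_infinite_U'[OF u] U'_ge_one[OF u] by auto
  then show ?thesis using lg_Q_asy lg_asy_P_large by blast
qed

text \<open>
  The count is uniform in the lower end of the interval, so that conditions may be rescaled and
  only the ratio \<open>d\<close> matters.
\<close>

definition few :: "'k => tree => bool" where
  "few d \<delta> \<longleftrightarrow> (\<forall>\<sigma> \<rho>. 0 < \<sigma> --> 0 < \<rho> --> \<rho> \<preceq> d * \<sigma> --> tp (\<lless>) {q \<in> Q. \<sigma> \<lless> q \<and> q \<lless> \<rho>} \<delta>)"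

text \<open>
  The elements of an interval of ratio \<open>d\<close> have logarithms that differ by at most \<open>lg d\<close>.
\<close>

lemma few_of_claimC:
  assumes hy: "hyps \<eta> b0" and bb: "b0 <= b" and cz: "condz b0 b \<eta>" and \<eta>: "0 < \<eta>" "1 \<preceq> \<eta>"
    and d: "d \<in> S" "lg d \<preceq> \<eta>"
  shows "few d (om (om b))"
  unfolding few_def
proof (intro allI impI)
  fix \<sigma> \<rho> assume \<sigma>: "0 < \<sigma>" "0 < \<rho>" "\<rho> \<preceq> d * \<sigma>"
  define E where "E = {q \<in> Q. \<sigma> \<lless> q \<and> q \<lless> \<rho>}"
  have "sm b (\<lless>) E"
  proof (cases "E = {}")
    case False
    then obtain q0 where q0: "q0 \<in> E" by blast
    have dp: "0 < d" "d \<in> Dom" using d S_pos SD by auto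
    have E: "q \<in> Q" "q \<in> Dom" "0 < q" if "q \<in> E" for q using that QD Q_pos by (auto simp: E_def)
    have less: "q < d * q'" if q: "q \<in> E" "q' \<in> E" for q q'
    proof -
      have "\<sigma> \<preceq> q'" using q ll_imp_dom by (auto simp: E_def)
      then have "d * \<sigma> \<preceq> d * q'" by (intro dom_mult) auto
      then have "\<rho> \<preceq> d * q'" using \<sigma>(3) dom_trans by blast
      then have "q \<lless> d * q'" using q(1) ll_dom_trans by (auto simp: E_def)
      then show ?thesis using ll_less[of q "d * q'"] dp E(3)[OF q(2)] by simp
    qed
    obtain c r where c: "c \<in> P" "d \<preceq> c" using leading_summand[OF d(1)] by blast
    have cQ: "c \<in> Q" "0 < c" using c PQ Q_pos by blast+
    obtain K :: nat where K: "lg d <= of_nat K * \<eta>" using d(2) \<eta> by (auto elim: domE)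
    have sQ: "c * q0 \<in> Q" using Q_mult cQ E[OF q0] by blast
    show ?thesis
    proof (rule claimC_all[OF hy sQ, unfolded claimC_def, rule_format, where \<zeta> = \<eta> and K = K])
      show "E \<subseteq> Q" by (auto simp: E_def)
      show "q < c * q0" if q: "q \<in> E" for q
      proof -
        have "\<sigma> \<preceq> q0" using q0 ll_imp_dom by (auto simp: E_def)
        then have "d * \<sigma> \<preceq> c * q0" using c(2) by (intro dom_mult) auto
        then have "\<rho> \<preceq> c * q0" using \<sigma>(3) dom_trans by blast
        then have "q \<lless> c * q0" using q ll_dom_trans by (auto simp: E_def)
        then show ?thesis using ll_less[of q "c * q0"] cQ E(3)[OF q0] by simp
      qed
      show "lg q' - lg q <= of_nat K * \<eta>" if q: "q \<in> E" "q' \<in> E" for q q'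
      proof -
        have "lg q' < lg (d * q)"
          using less[OF q(2,1)] lg_strict_mono Dom_mult dp E q by simp
        then show ?thesis using lg_mult dp E(2)[OF q(1)] K by simp
      qed
    qed (use bb \<eta> cz in auto)
  qed simp
  then obtain t where "t < om (om b)" "tp (\<lless>) E t" by (auto simp: sm_def)
  then show "tp (\<lless>) {q \<in> Q. \<sigma> \<lless> q \<and> q \<lless> \<rho>} (om (om b))"
    using tp_mono[of "(\<lless>)" E t E "(\<lless>)" "om (om b)"] by (simp add: E_def)
qed

text \<open>
  Both conditions on generators ask for products in intervals of ratio at most \<open>\<eta>\<close>. For the
  logarithms this holds because they grow like \<open>v\<close> or \<open>v \<cdot> lg x\<close>; the two kinds contribute \<open>\<delta>\<close>
  each, and the two additional ones turn the bounds into strict ones.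
\<close>

lemma few_step:
  assumes few: "few \<eta> \<delta>" and \<eta>: "0 < \<eta>" "1 \<preceq> \<eta>" and d: "d \<in> S" "lg d \<preceq> \<eta>"
  shows "few d (om (om (\<delta> + om 0 + (\<delta> + \<delta>) + om 0)))"
proof (rule few_of_claimC[OF _ _ _ \<eta> d])
  have tp: "tp (\<lless>) {q \<in> Q. \<sigma> \<lless> q \<and> q \<lless> \<rho>} \<delta>" if "0 < \<sigma>" "0 < \<rho>" "\<rho> \<preceq> \<eta> * \<sigma>" for \<sigma> \<rho>
    using few that unfolding few_def by blast
  have less: "\<delta> < \<delta> + om 0" by (rule less_plus_om_zero)
  show "hyps \<eta> (\<delta> + om 0)"
    unfolding hyps_def
  proof (intro conjI ballI allI impI)
    fix f h \<zeta> assume h: "f \<in> S" "h \<in> S" "1 \<lless> h" "0 < \<zeta>" "\<zeta> \<preceq> \<eta>"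
    have "tp (\<lless>) {q \<in> Q. f / h \<lless> q \<and> q \<lless> \<zeta> * f / h} \<delta>"
    proof (rule tp)
      show "0 < f / h" "0 < \<zeta> * f / h" using h S_pos by auto
      have "\<zeta> * (f / h) \<preceq> \<eta> * (f / h)" using h by (intro dom_mult) auto
      then show "\<zeta> * f / h \<preceq> \<eta> * (f / h)" by simp
    qed
    then show "cond (\<delta> + om 0) (f / h) (\<zeta> * f / h)" using less unfolding cond_def by blast
  next
    fix f \<zeta> assume h: "f \<in> S" "2 <= f" "0 < \<zeta>" "\<zeta> \<preceq> \<eta>" "lg f \<lless> \<zeta>"
    have l: "0 < lg f" using lg_ge_half[of f] h SD by auto
    have "tp (\<lless>) {q \<in> Q. 1 / lg f \<lless> q \<and> q \<lless> \<zeta> / lg f} \<delta>"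
    proof (rule tp)
      show "0 < 1 / lg f" "0 < \<zeta> / lg f" using h l by auto
      have "\<zeta> * (1 / lg f) \<preceq> \<eta> * (1 / lg f)" using h by (intro dom_mult) auto
      then show "\<zeta> / lg f \<preceq> \<eta> * (1 / lg f)" by simp
    qed
    then show "cond (\<delta> + om 0) (1 / lg f) (\<zeta> / lg f)" using less unfolding cond_def by blast
  qed
  show "\<delta> + om 0 <= \<delta> + om 0 + (\<delta> + \<delta>) + om 0"
    using add_left_mono[OF zero_le_tree[of "\<delta> + \<delta> + om 0"], of "\<delta> + om 0"] by (simp add: add.assoc)
  show "condz (\<delta> + om 0) (\<delta> + om 0 + (\<delta> + \<delta>) + om 0) \<eta>"
    unfolding condz_def
  proof (intro disjI2 exI conjI)
    show "\<delta> + om 0 + (\<delta> + \<delta>) < \<delta> + om 0 + (\<delta> + \<delta>) + om 0" by (rule less_plus_om_zero)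
    define A where "A = {u \<in> U'. lg u \<lless> \<eta> \<and> (\<exists>v\<in>P. lg u \<asymp> v)}"
    define B where "B = {u \<in> U'. lg u \<lless> \<eta> \<and> (\<exists>v\<in>P. lg u \<asymp> v * lg x)}"
    have AB: "{u \<in> U'. lg u \<lless> \<eta>} = A \<union> B"
    proof -
      have "\<exists>v\<in>P. lg u \<asymp> v \<or> lg u \<asymp> v * lg x" if u: "u \<in> U'" for u
        using lg_Q_asy[of u] lg_infinite_U'[OF u] U'_ge_one[OF u] by auto
      then show ?thesis unfolding A_def B_def by blast
    qed
    have "\<forall>u\<in>A. \<exists>v. v \<in> P \<and> lg u \<asymp> v" unfolding A_def by blast
    then obtain v where v: "\<And>u. u \<in> A ==> v u \<in> P \<and> lg u \<asymp> v u" by metis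
    have "\<forall>u\<in>B. \<exists>v. v \<in> P \<and> lg u \<asymp> v * lg x" unfolding B_def by blast
    then obtain w where w: "\<And>u. u \<in> B ==> w u \<in> P \<and> lg u \<asymp> w u * lg x" by metis
    have trs: "transp_on X (\<lambda>u v. lg u \<lless> lg v)" for X
      unfolding transp_on_def using ll_trans by blast
    have "tp (\<lambda>u v. lg u \<lless> lg v) A \<delta>"
    proof (rule tp_image[where g = v])
      show "tp (\<lless>) {q \<in> Q. 1 \<lless> q \<and> q \<lless> \<eta>} \<delta>" by (rule tp) (use \<eta> in auto)
      fix u assume u: "u \<in> A"
      have "1 \<lless> lg u" "lg u \<lless> \<eta>" using u lg_infinite_U' by (auto simp: A_def)
      moreover have "v u \<in> Q" "lg u \<asymp> v u" using v[OF u] PQ by auto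
      ultimately show "v u \<in> {q \<in> Q. 1 \<lless> q \<and> q \<lless> \<eta>}" using asy_ll2 asy_ll1 asy_sym by blast
    next
      fix u u' assume u: "u \<in> A" "u' \<in> A" "lg u \<lless> lg u'"
      have "lg u \<asymp> v u" "lg u' \<asymp> v u'" using v u by auto
      then show "v u \<lless> v u'" using u(3) asy_ll1 asy_ll2 asy_sym by blast
    qed simp
    moreover have "tp (\<lambda>u v. lg u \<lless> lg v) B \<delta>"
    proof (rule tp_image[where g = w])
      show "tp (\<lless>) {q \<in> Q. 1 / lg x \<lless> q \<and> q \<lless> \<eta> / lg x} \<delta>"
        by (rule tp) (use \<eta> lg_x_pos in auto)
      fix u assume u: "u \<in> B"
      have wu: "w u \<in> Q" "lg u \<asymp> w u * lg x" "1 <= w u" using w[OF u] PQ Q_ge_one by auto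
      have "lg u \<lless> \<eta>" using u by (simp add: B_def)
      then have "w u * lg x \<lless> \<eta>" by (rule asy_ll1[OF asy_sym[OF wu(2)]])
      then have "w u * lg x \<lless> \<eta> / lg x * lg x" using lg_x_pos by simp
      then have 1: "w u \<lless> \<eta> / lg x" using lg_x_pos by (subst (asm) ll_mult_iff) auto
      have "1 / lg x * lg x \<lless> 1 * lg x" using lg_x_pos by simp
      then have "1 / lg x \<lless> 1" using lg_x_pos by (subst (asm) ll_mult_iff) auto
      moreover have "1 \<preceq> w u" using wu(3) by (intro dom_le) auto
      ultimately have "1 / lg x \<lless> w u" using ll_dom_trans by blast
      then show "w u \<in> {q \<in> Q. 1 / lg x \<lless> q \<and> q \<lless> \<eta> / lg x}" using 1 wu(1) by blast
    next
      fix u u' assume u: "u \<in> B" "u' \<in> B" "lg u \<lless> lg u'"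
      have "lg u \<asymp> w u * lg x" "lg u' \<asymp> w u' * lg x" using w u by auto
      then have "w u * lg x \<lless> w u' * lg x" using u(3) asy_ll1 asy_ll2 asy_sym by blast
      then show "w u \<lless> w u'" using lg_x_pos by (subst (asm) ll_mult_iff) auto
    qed simp
    ultimately show "tp (\<lambda>u v. lg u \<lless> lg v) {u \<in> U'. lg u \<lless> \<eta>} (\<delta> + \<delta>)"
      unfolding AB by (intro tp_union trs)
  qed
qed

lemma not_between_gap: "a \<in> Dom ==> 1 \<lless> a ==> a \<preceq> \<zeta> ==> \<zeta> \<preceq> lg x ==> False"
  using gap dom_trans by (meson ll_def)

text \<open>
  All the intervals of products that occur are empty by the gap: a quotient of elements of \<open>Dom\<close>
  that is infinite is much larger than \<open>lg x\<close>.
\<close>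

lemma few_base:
  assumes d: "d \<in> S" "lg d \<preceq> lg x"
  shows "few d (om (om 0))"
proof (rule few_of_claimC[OF _ _ _ _ _ d])
  show "0 < lg x" "1 \<preceq> lg x" using lg_x_pos ll_imp_dom by auto
  show "condz 0 0 (lg x)" unfolding condz_def using lg_U'_large by (auto simp: ll_def)
  show "hyps (lg x) 0"
    unfolding hyps_def
  proof (intro conjI ballI allI impI)
    fix f h \<zeta> assume h: "f \<in> S" "h \<in> S" "1 \<lless> h" "0 < \<zeta>" "\<zeta> \<preceq> lg x"
    have fh: "0 < f / h" "f / h \<in> Dom" using h S_pos SD Dom_divide by auto
    have "\<not> (f / h \<lless> q \<and> q \<preceq> \<zeta> * f / h)" if q: "q \<in> Q" for q
    proof
      assume "f / h \<lless> q \<and> q \<preceq> \<zeta> * f / h"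
      then have "1 * (f / h) \<lless> q / (f / h) * (f / h)" "q / (f / h) * (f / h) \<preceq> \<zeta> * (f / h)" using fh by auto
      then have "1 \<lless> q / (f / h)" "q / (f / h) \<preceq> \<zeta>"
        using fh by (metis ll_mult_iff less_irrefl, metis dom_mult_iff less_irrefl)
      then show False using not_between_gap[of "q / (f / h)" \<zeta>] Dom_divide fh q QD h by blast
    qed
    then show "cond 0 (f / h) (\<zeta> * f / h)" unfolding cond_def by blast
  next
    fix f \<zeta> assume h: "f \<in> S" "2 <= f" "0 < \<zeta>" "\<zeta> \<preceq> lg x" "lg f \<lless> \<zeta>"
    have lf: "lg f \<lless> lg x" using h ll_dom_trans by blast
    have "lg f \<asymp> 1"
      using lg_S_cases[OF h(1,2)]
    proof (elim disjE bexE conjE)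
      fix c assume c: "c \<in> P" "c ~= 1" "lg f \<asymp> lg c"
      obtain v where v: "v \<in> P" "lg f \<asymp> v \<or> lg f \<asymp> v * lg x"
        using lg_Q_asy[of c] c PQ asy_trans by blast
      have "\<not> 1 \<lless> lg f" using lg_asy_P_large[OF v(2,1)] lf by (auto simp: ll_def)
      moreover have "1 \<preceq> lg f" using lg_ge_half[of f] h SD by (intro domI_nonneg[of _ _ 2]) auto
      ultimately show "lg f \<asymp> 1" by (auto simp: asy_def ll_def)
    qed
    then have "1 / lg f \<asymp> 1 / 1" "\<zeta> / lg f \<asymp> \<zeta> / 1"
      using lg_ge_half[of f] h SD by (intro asy_divide; auto)+
    then have "\<not> (1 / lg f \<lless> q \<and> q \<preceq> \<zeta> / lg f)" if q: "q \<in> Q" for q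
      using not_between_gap[of q \<zeta>] q QD h asy_ll1 asy_dom2 asy_sym by (metis div_by_1)
    then show "cond 0 (1 / lg f) (\<zeta> / lg f)" unfolding cond_def by blast
  qed
qed simp

lemma tower_add: "s < tower (Suc k) ==> t < tower (Suc k) ==> s + t < tower (Suc k)"
  by (simp add: plus_less_om)

lemma one_less_tower: "om 0 < tower (Suc (Suc k))"
  by simp

lemma few_tower_step:
  assumes "\<delta> < tower (Suc (Suc k))" "few \<eta> \<delta>" "0 < \<eta>" "1 \<preceq> \<eta>" "d \<in> S" "lg d \<preceq> \<eta>"
  shows "\<exists>\<delta>'<tower (Suc (Suc (Suc (Suc k)))). few d \<delta>'"
proof -
  have "\<delta> + om 0 + (\<delta> + \<delta>) + om 0 < tower (Suc (Suc k))"
    using assms(1) one_less_tower tower_add by presburger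
  then have "om (om (\<delta> + om 0 + (\<delta> + \<delta>) + om 0)) < tower (Suc (Suc (Suc (Suc k))))" by simp
  then show ?thesis using few_step[OF assms(2-6)] by blast
qed

lemma x_pw_le:
  assumes "a \<in> S" "b \<in> S" "2 <= a" "x * a <= b"
  shows "x * pw 2 a <= pw 2 b"
proof -
  have D: "x \<in> Dom" "pw 2 a \<in> Dom" "pw 2 b \<in> Dom" using lg_x_pos Dom_pw by auto
  have x1: "1 < x" using infinite_nat_less[OF x_infinite, of 1] lg_x_pos by simp
  have "1 * (x - 1) <= (lg 2 * a) * (x - 1)"
  proof (intro mult_right_mono)
    have "1 / 2 * 2 <= lg 2 * a" using lg_two assms(3) by (intro mult_mono) auto
    then show "1 <= lg 2 * a" by simp
  qed (use x1 in auto)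
  then have "lg x + a * lg 2 <= lg 2 * (x * a)" using lg_le[OF D(1)] by (simp add: algebra_simps)
  also have "\<dots> <= lg 2 * b" using lg_two assms(4) by (intro mult_left_mono) auto
  finally have "lg (x * pw 2 a) <= lg (pw 2 b)"
    using lg_mult[OF D(1,2)] by (simp add: lg_pw mult.commute)
  then show ?thesis using lg_le_iff Dom_mult D by blast
qed

text \<open>
  Here \<open>e k\<close> and \<open>d k\<close> are the iterated exponentials of \<open>x^m\<close> and \<open>x^(m+1)\<close>. Since Skolem elements
  differ by at least one, they are compared at the resolution \<open>1 / x\<close>, which is much smaller than
  one. The interval from \<open>1 / x\<close> to \<open>e 3\<close> has a ratio \<open>x \<cdot> e 3\<close> instead of \<open>e 3\<close>; the extra factor
  is absorbed by the larger exponent \<open>m + 1\<close>.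
\<close>

theorem skolem_tower_bound:
  fixes m :: nat
  assumes "0 < m"
  shows "\<exists>t<tower 10. tp (<) {f \<in> S. f < pw 2 (pw 2 (pw 2 (x ^ m)))} t"
proof -
  define e where "e k = ((pw 2 ^^ k) (x ^ m))" for k
  define d where "d k = ((pw 2 ^^ k) (x ^ Suc m))" for k
  have xS: "x ^ n \<in> S" "lg (x ^ n) = of_nat n * lg x" if "0 < n" for n
  proof -
    show "lg (x ^ n) = of_nat n * lg x" using lg_power lg_x_pos by blast
    show "x ^ n \<in> S" using that by (induction n rule: nat_induct_non_zero) (auto simp: S_x S_mult)
  qed
  have eS: "e k \<in> S" and dS: "d k \<in> S" for k
    using xS(1)[of m] xS(1)[of "Suc m"] assms by (induction k) (auto simp: e_def d_def S_pw)
  have x1: "2 < x" using infinite_nat_less[OF x_infinite, of 2] lg_x_pos by simp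
  have e2: "2 <= e k \<and> x * e k <= d k" for k
  proof (induction k)
    case 0
    have "x ^ 1 <= x ^ m" using x1 assms by (intro power_increasing) auto
    then show ?case using x1 by (simp add: e_def d_def)
  next
    case (Suc k)
    have "2 <= pw 2 (e k)" using base_le_pw[of 2 "e k"] Suc by auto
    then show ?case using Suc x_pw_le[OF eS dS, of k k] by (simp add: e_def d_def)
  qed
  have d1: "0 < d k" "1 \<preceq> d k" for k
    using S_pos[OF dS] S_ge_one[OF dS[of k]] by (auto intro: dom_le)
  have lgd: "lg (d (Suc k)) \<preceq> d k" for k
  proof -
    have "lg (d (Suc k)) = d k * lg 2" by (simp add: d_def lg_pw)
    moreover have "lg 2 \<preceq> 1" using lg_le[OF two_Dom] lg_two by (intro dom_le) auto
    then have "d k * lg 2 \<preceq> d k * 1" by (intro dom_mult) auto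
    ultimately show ?thesis by simp
  qed
  have "\<exists>\<delta><tower (2 * k + 2). few (d k) \<delta>" for k
  proof (induction k)
    case 0
    have "lg (d 0) \<preceq> lg x" using xS(2)[of "Suc m"] dom_of_nat_mult[of "Suc m" "lg x"] by (simp add: d_def)
    then have "few (d 0) (om (om 0))" using few_base dS by blast
    moreover have "om (om 0) < tower (2 * 0 + 2)" by (simp add: numeral_2_eq_2)
    ultimately show ?case by blast
  next
    case (Suc k)
    then obtain \<delta> where "\<delta> < tower (Suc (Suc (2 * k)))" "few (d k) \<delta>" by auto
    from few_tower_step[OF this d1 dS lgd] show ?case by simp
  qed
  from this[of 3] obtain \<delta> where \<delta>: "\<delta> < tower 8" "few (d 3) \<delta>" by auto
  define D where "D = {f \<in> S. f < e 3}"
  have "claimA (e 3)" using claims eS by blast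
  then have "sm (\<delta> + om 0) (lt (1 / x)) D"
  proof (rule claimA_def[THEN iffD1, rule_format, where \<rho> = "e 3" and K = 1])
    show "cond (\<delta> + om 0) (1 / x) (e 3)"
      unfolding cond_def
    proof (intro disjI2 exI[of _ \<delta>] conjI)
      show "\<delta> < \<delta> + om 0" by (rule less_plus_om_zero)
      have "e 3 <= d 3 * (1 / x)" using e2[of 3] x1 by (simp add: pos_le_divide_eq mult.commute)
      then have "e 3 \<preceq> d 3 * (1 / x)" using e2[of 3] by (intro dom_le) auto
      then show "tp (\<lless>) {q \<in> Q. 1 / x \<lless> q \<and> q \<lless> e 3} \<delta>"
        using \<delta>(2) x1 e2[of 3] unfolding few_def by (auto elim!: allE impE)
    qed
    show "f' - f <= of_nat 1 * e 3" if "f \<in> D" "f' \<in> D" for f f'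
    proof -
      have "f' < e 3" "0 < f" using that S_pos by (auto simp: D_def)
      then show ?thesis by simp
    qed
  qed (use x1 e2[of 3] in \<open>auto simp: D_def\<close>)
  then obtain t where t: "t < om (om (\<delta> + om 0))" "tp (lt (1 / x)) D t" by (auto simp: sm_def)
  have "tp (<) D t"
  proof (rule tp_mono[OF t(2)])
    fix f g assume fg: "f \<in> D" "g \<in> D" "f < g"
    then have "1 <= g - f" using S_discrete[of f g] by (simp add: D_def algebra_simps)
    then have "1 \<preceq> g - f" by (intro dom_le) auto
    moreover have "1 / x * x \<lless> 1 * x" using x1 x_infinite by simp
    then have "1 / x \<lless> 1" using x1 by (subst (asm) ll_mult_iff) auto
    ultimately show "lt (1 / x) f g" using fg(3) ll_dom_trans by (auto simp: lt_def)
  qed auto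
  moreover have "t < tower 10"
  proof -
    have "\<delta> + om 0 < tower 8" using \<delta>(1) tower_add[of \<delta> 7 "om 0"] one_less_tower[of 6] by (simp add: eval_nat_numeral)
    then have "om (om (\<delta> + om 0)) < tower 10" by (simp add: eval_nat_numeral)
    then show ?thesis using t(1) by simp
  qed
  ultimately show ?thesis by (auto simp: D_def e_def eval_nat_numeral)
qed

end

section \<open>Rates of growth of real functions\<close>

abbreviation ev :: "(real => bool) => bool" (binder "EV " 10) where
  "ev A \<equiv> eventually A at_top"

abbreviation sim :: "(real => real) => (real => real) => bool" where
  "sim F G \<equiv> F \<in> \<Theta>(G)"

text \<open>
  The functions allowed in the Hardy field omit all rates between constants and exponentials. With
  \<open>t = ln (ln x)\<close>, \<open>exp (c * t)\<close> is a power of \<open>ln x\<close>.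
\<close>

definition large :: "(real => real) => bool" where
  "large F \<longleftrightarrow> (\<exists>c>0. EV t. exp (c * t) <= \<bar>F t\<bar>)"

definition tiny :: "(real => real) => bool" where
  "tiny F \<longleftrightarrow> (\<exists>c>0. EV t. \<bar>F t\<bar> <= exp (- c * t))"

definition good :: "(real => real) => bool" where
  "good F \<longleftrightarrow> sim (\<lambda>_. 1) F \<or> large F \<or> (EV t. F t ~= 0) \<and> tiny F"

lemma simI: "0 < C ==> (EV t. \<bar>F t\<bar> <= C * \<bar>G t\<bar> \<and> \<bar>G t\<bar> <= C * \<bar>F t\<bar>) ==> sim F G"
proof -
  assume C: "0 < C" "EV t. \<bar>F t\<bar> <= C * \<bar>G t\<bar> \<and> \<bar>G t\<bar> <= C * \<bar>F t\<bar>"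
  have "EV t. 1 / C * norm (G t) <= norm (F t) \<and> norm (F t) <= C * norm (G t)"
    using C(2) by eventually_elim (use C(1) in \<open>simp add: field_simps\<close>)
  then show ?thesis using C(1) by (intro bigthetaI'[of "1 / C" C]) auto
qed

lemma simE:
  assumes "sim F G"
  obtains C where "0 < C" "EV t. \<bar>F t\<bar> <= C * \<bar>G t\<bar> \<and> \<bar>G t\<bar> <= C * \<bar>F t\<bar>"
proof -
  obtain c where c: "0 < c" "EV t. norm (F t) <= c * norm (G t)"
    using landau_o.bigE[OF bigthetaD1[OF assms]] .
  obtain d where d: "0 < d" "EV t. norm (G t) <= d * norm (F t)"
    using landau_o.bigE[OF bigthetaD1[OF assms[unfolded bigtheta_sym[of F]]]] .
  have "EV t. \<bar>F t\<bar> <= (c + d) * \<bar>G t\<bar> \<and> \<bar>G t\<bar> <= (c + d) * \<bar>F t\<bar>"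
    using c(2) d(2)
  proof eventually_elim
    case (elim t)
    have "0 <= d * \<bar>G t\<bar>" "0 <= c * \<bar>F t\<bar>" using c d by auto
    then show ?case using elim by (simp add: distrib_right)
  qed
  then show thesis using c(1) d(1) by (intro that[of "c + d"]) auto
qed

lemma sim_sym: "sim F G ==> sim G F"
  using bigtheta_sym by blast

lemmas sim_trans = landau_theta.trans
  and sim_mult = landau_theta.mult
  and sim_inverse = bigtheta_inverse[THEN iffD2]

lemma sim_power: "sim F G ==> sim (\<lambda>t. F t ^ k) (\<lambda>t. G t ^ k)"
  by (induction k) (simp_all add: sim_mult)

lemma sim_ev_eq: "(EV t. F t = G t) ==> sim F G"
  by (rule bigthetaI_cong)

lemma ev_exp_ge:
  assumes "0 < c"
  shows "EV t. C <= exp (c * t)"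
  using eventually_ge_at_top[of "(C - 1) / c"]
proof eventually_elim
  case (elim t)
  then have "C - 1 <= c * t" using assms by (simp add: divide_le_eq mult.commute)
  then show ?case using exp_ge_add_one_self[of "c * t"] by linarith
qed

lemma ev_exp_le:
  assumes "0 < c" "0 < C"
  shows "EV t. exp (- c * t) <= C"
  using ev_exp_ge[OF assms(1), of "1 / C"]
  by eventually_elim (use assms in \<open>simp add: exp_minus field_simps\<close>)

lemma large_ge: "large F ==> EV t. K <= \<bar>F t\<bar>"
  unfolding large_def
proof (elim exE conjE)
  fix c assume c: "0 < c" "EV t. exp (c * t) <= \<bar>F t\<bar>"
  show ?thesis using ev_exp_ge[OF c(1), of K] c(2) by eventually_elim linarith
qed

lemma tiny_le: "tiny F ==> 0 < K ==> EV t. \<bar>F t\<bar> <= K"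
  unfolding tiny_def
proof (elim exE conjE)
  fix c assume K: "0 < K" and c: "0 < c" "EV t. \<bar>F t\<bar> <= exp (- c * t)"
  show ?thesis using ev_exp_le[OF c(1) K] c(2) by eventually_elim linarith
qed

lemma large_sim:
  assumes "large F" "sim F G"
  shows "large G"
proof -
  obtain c where c: "0 < c" "EV t. exp (c * t) <= \<bar>F t\<bar>" using assms(1) by (auto simp: large_def)
  obtain C where C: "0 < C" "EV t. \<bar>F t\<bar> <= C * \<bar>G t\<bar> \<and> \<bar>G t\<bar> <= C * \<bar>F t\<bar>" using assms(2) by (rule simE)
  have "EV t. exp (c / 2 * t) <= \<bar>G t\<bar>"
    using c(2) C(2) ev_exp_ge[OF half_gt_zero[OF c(1)], of C]
  proof eventually_elim
    case (elim t)
    have "C * exp (c / 2 * t) <= exp (c / 2 * t) * exp (c / 2 * t)" using elim by (intro mult_right_mono) auto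
    also have "\<dots> = exp (c * t)" by (simp flip: exp_add)
    finally have "C * exp (c / 2 * t) <= C * \<bar>G t\<bar>" using elim by linarith
    then show ?case using C(1) by simp
  qed
  then show ?thesis unfolding large_def using c(1) by (intro exI[of _ "c / 2"]) simp
qed

lemma tiny_sim:
  assumes "tiny F" "sim F G"
  shows "tiny G"
proof -
  obtain c where c: "0 < c" "EV t. \<bar>F t\<bar> <= exp (- c * t)" using assms(1) by (auto simp: tiny_def)
  obtain C where C: "0 < C" "EV t. \<bar>F t\<bar> <= C * \<bar>G t\<bar> \<and> \<bar>G t\<bar> <= C * \<bar>F t\<bar>" using assms(2) by (rule simE)
  have "0 < 1 / C" "0 < c / 2" using C c by auto
  from ev_exp_le[OF this(2,1)] c(2) C(2) have "EV t. \<bar>G t\<bar> <= exp (- (c / 2) * t)"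
  proof eventually_elim
    case (elim t)
    have "exp (- (c / 2) * t) * exp (- (c / 2) * t) <= 1 / C * exp (- (c / 2) * t)" using elim by (intro mult_right_mono) auto
    moreover have "exp (- (c / 2) * t) * exp (- (c / 2) * t) = exp (- c * t)" by (simp flip: exp_add)
    ultimately have "C * \<bar>F t\<bar> <= C * (1 / C * exp (- (c / 2) * t))" using elim C(1) by (intro mult_left_mono) auto
    then show ?case using elim C(1) by simp
  qed
  then show ?thesis unfolding tiny_def using c(1) by (intro exI[of _ "c / 2"]) simp
qed

lemma sim_nz: "sim F G ==> (EV t. F t ~= 0) ==> EV t. G t ~= 0"
proof (elim simE)
  fix C assume "EV t. F t ~= 0" "EV t. \<bar>F t\<bar> <= C * \<bar>G t\<bar> \<and> \<bar>G t\<bar> <= C * \<bar>F t\<bar>"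
  then show ?thesis by eventually_elim auto
qed

lemma good_nz: "good F ==> EV t. F t ~= 0"
  unfolding good_def
proof (elim disjE conjE)
  assume "sim (\<lambda>_. 1) F"
  then show ?thesis by (rule sim_nz) simp
next
  assume "large F"
  from large_ge[OF this, of 1] show ?thesis by eventually_elim auto
qed

lemma good_sim: "good F ==> sim F G ==> good G"
  unfolding good_def using sim_trans large_sim tiny_sim sim_nz by blast

lemma good_const: "c ~= 0 ==> good (\<lambda>_. c)"
  by (simp add: good_def)

lemma abs_le_of_power_le:
  fixes x a :: real
  assumes "\<bar>x ^ k\<bar> <= a ^ k" "0 <= a" "0 < k"
  shows "\<bar>x\<bar> <= a"
  using assms power_strict_mono[of a "\<bar>x\<bar>" k] by (auto simp: power_abs not_less[symmetric])

lemma le_abs_of_le_power: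
  fixes x a :: real
  assumes "a ^ k <= \<bar>x ^ k\<bar>" "0 < k"
  shows "a <= \<bar>x\<bar>"
  using assms power_strict_mono[of "\<bar>x\<bar>" a k] by (auto simp: power_abs not_less[symmetric])

lemma good_power:
  assumes "good (\<lambda>t. F t ^ k)" "0 < k"
  shows "good F"
proof -
  have ek: "exp (d / real k * t) ^ k = exp (d * t)" for d t
    using assms(2) by (simp flip: exp_of_nat_mult)
  from assms(1) consider "sim (\<lambda>_. 1) (\<lambda>t. F t ^ k)" | "large (\<lambda>t. F t ^ k)"
    | "EV t. F t ^ k ~= 0" "tiny (\<lambda>t. F t ^ k)" unfolding good_def by blast
  then show ?thesis
  proof cases
    case 1
    then obtain C where C: "0 < C" "EV t. \<bar>1\<bar> <= C * \<bar>F t ^ k\<bar> \<and> \<bar>F t ^ k\<bar> <= C * \<bar>1 :: real\<bar>" by (rule simE)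
    define D where "D = max 1 C"
    have D: "1 <= D" "C <= D" "D <= D ^ k" using assms(2) power_increasing[of 1 k D] by (auto simp: D_def)
    have "EV t. \<bar>1\<bar> <= D * \<bar>F t\<bar> \<and> \<bar>F t\<bar> <= D * \<bar>1 :: real\<bar>"
      using C(2)
    proof eventually_elim
      case (elim t)
      have "C * \<bar>F t ^ k\<bar> <= D ^ k * \<bar>F t ^ k\<bar>" using D by (intro mult_right_mono) auto
      then have "(1 / D) ^ k <= \<bar>F t ^ k\<bar>" "\<bar>F t ^ k\<bar> <= D ^ k"
        using elim D by (auto simp: power_divide divide_le_eq mult.commute)
      then have "1 / D <= \<bar>F t\<bar>" "\<bar>F t\<bar> <= D"
        using le_abs_of_le_power[of "1 / D" k "F t"] abs_le_of_power_le[of "F t" k D] assms(2) D by simp_all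
      then show ?case using D by (simp add: divide_le_eq mult.commute)
    qed
    then have "sim (\<lambda>_. 1) F" using D by (intro simI[of D]) auto
    then show ?thesis by (simp add: good_def)
  next
    case 2
    then obtain c where c: "0 < c" "EV t. exp (c * t) <= \<bar>F t ^ k\<bar>" by (auto simp: large_def)
    from c(2) have "EV t. exp (c / real k * t) <= \<bar>F t\<bar>"
      by eventually_elim (rule le_abs_of_le_power[OF _ assms(2)], simp only: ek)
    then have "large F" unfolding large_def using c(1) assms(2) by (intro exI[of _ "c / real k"]) simp
    then show ?thesis by (simp add: good_def)
  next
    case 3
    then obtain c where c: "0 < c" "EV t. \<bar>F t ^ k\<bar> <= exp (- c * t)" by (auto simp: tiny_def)
    from c(2) have "EV t. \<bar>F t\<bar> <= exp (- c / real k * t)"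
      by eventually_elim (rule abs_le_of_power_le[OF _ _ assms(2)], simp_all only: ek exp_ge_zero)
    then have "tiny F" unfolding tiny_def using c(1) assms(2) by (intro exI[of _ "c / real k"]) simp
    moreover have "EV t. F t ~= 0" using 3(1) by eventually_elim (use assms(2) in auto)
    ultimately show ?thesis by (simp add: good_def)
  qed
qed

lemma good_cases:
  assumes "good F"
  shows "(\<exists>C>0. EV t. \<bar>F t\<bar> <= C) \<or> (\<exists>C>0. EV t. C <= \<bar>F t\<bar>)"
  using assms unfolding good_def
proof (elim disjE conjE)
  assume "sim (\<lambda>_. 1) F"
  then obtain C where C: "0 < C" "EV t. \<bar>1\<bar> <= C * \<bar>F t\<bar> \<and> \<bar>F t\<bar> <= C * \<bar>1 :: real\<bar>" by (rule simE)
  from C(2) have "EV t. \<bar>F t\<bar> <= C" by eventually_elim simp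
  then show ?thesis using C(1) by blast
qed (use large_ge[of F 1] tiny_le[of F 1] zero_less_one in blast)+

section \<open>A maximal Hardy field without slow elements\<close>

abbreviation hasd :: "(real => real) => (real => real) => bool" where
  "hasd F F' \<equiv> (EV t. (F has_real_derivative F' t) (at t))"

lemma germ_of_eq_iff: "germ_of F = germ_of G \<longleftrightarrow> (EV t. F t = G t)"
  by (rule germ.abs_eq_iff)

lemma germ_of_rep: "germ_of (rep_germ g) = g"
  using Quotient3_germ by (rule Quotient3_abs_rep)

lemma ev_threshold:
  assumes "ev A"
  obtains T where "\<And>t. T < t ==> A t"
  using assms unfolding eventually_at_top_dense by blast

lemma ev_nhds:
  assumes "ev A"
  shows "EV t. \<forall>\<^sub>F u in nhds t. A u"
proof -
  obtain T where T: "\<And>t. T < t ==> A t" using ev_threshold[OF assms] by blast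
  have "\<forall>\<^sub>F u in nhds t. A u" if "T < t" for t
  proof -
    have "\<forall>\<^sub>F u in nhds t. u \<in> {T<..}" using that by (intro eventually_nhds_in_open) auto
    then show ?thesis by (rule eventually_mono) (use T in auto)
  qed
  then show ?thesis using eventually_gt_at_top[of T] by (rule eventually_mono[rotated])
qed

lemma hasd_cong:
  assumes "hasd F F'" "EV t. F t = G t" "EV t. F' t = G' t"
  shows "hasd G G'"
  using assms(1) ev_nhds[OF assms(2)] assms(3)
proof eventually_elim
  case (elim t)
  then show ?case using DERIV_cong_ev[of t t F G "F' t" "G' t"] by simp
qed

lemma const_sign:
  fixes F :: "real => real"
  assumes cont: "ev (isCont F)" and nz: "EV t. F t ~= 0"
  shows "(EV t. 0 < F t) \<or> (EV t. F t < 0)"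
proof -
  obtain T where T: "\<And>t. T < t ==> isCont F t \<and> F t ~= 0"
    using ev_threshold[OF eventually_conj[OF cont nz]] by blast
  have nocross: False if "T < a" "a < b" "F a * F b < 0" for a b
  proof -
    have c: "\<forall>t. a <= t \<and> t <= b --> isCont F t" using T that by auto
    have "\<exists>t. a <= t \<and> t <= b \<and> F t = 0"
    proof (cases "F a < 0")
      case True
      then show ?thesis using IVT[of F a 0 b] c that by (auto simp: mult_less_0_iff)
    next
      case False
      then show ?thesis using IVT2[of F b 0 a] c that by (auto simp: mult_less_0_iff)
    qed
    then show False using T that by force
  qed
  have same: "0 < F (T + 1) * F t" if "T + 1 < t" for t
    
  proof -
    have "\<not> F (T + 1) * F t < 0" using nocross[of "T + 1" t] that by auto
    moreover have "F (T + 1) * F t ~= 0" using T[of "T + 1"] T[of t] that by simp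
    ultimately show ?thesis by linarith
  qed
  show ?thesis
  proof (cases "0 < F (T + 1)")
    case True
    have "EV t. 0 < F t"
      using eventually_gt_at_top[of "T + 1"] by (rule eventually_mono) (use same True in \<open>simp add: zero_less_mult_iff\<close>)
    then show ?thesis by blast
  next
    case False
    have "EV t. F t < 0"
      using eventually_gt_at_top[of "T + 1"] by (rule eventually_mono) (use same False in \<open>auto simp: zero_less_mult_iff\<close>)
    then show ?thesis by blast
  qed
qed

lemma hasd_cont: "hasd F F' ==> ev (isCont F)"
  by (erule eventually_mono) (rule DERIV_isCont)

text \<open>
  Hardy fields, as sets of germs closed under field operations and differentiation, all of whose
  nonzero elements have one of the admitted rates of growth. Since \<open>H\<close> contains the real
  constants, negatives are covered by products.
\<close>

definition HF :: "germ set => bool" where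
  "HF H \<longleftrightarrow> (\<forall>c. germ_of (\<lambda>_. c) \<in> H) \<and>
     (\<forall>F G. germ_of F \<in> H --> germ_of G \<in> H -->
        germ_of (\<lambda>t. F t + G t) \<in> H \<and> germ_of (\<lambda>t. F t * G t) \<in> H) \<and>
     (\<forall>F. germ_of F \<in> H --> (EV t. F t = 0) \<or> good F \<and> germ_of (\<lambda>t. inverse (F t)) \<in> H) \<and>
     (\<forall>F. germ_of F \<in> H --> (\<exists>F'. germ_of F' \<in> H \<and> hasd F F'))"

lemma HF_constD: "HF H ==> germ_of (\<lambda>_. c) \<in> H"
  and HF_addD: "HF H ==> germ_of F \<in> H ==> germ_of G \<in> H ==> germ_of (\<lambda>t. F t + G t) \<in> H"
  and HF_multD: "HF H ==> germ_of F \<in> H ==> germ_of G \<in> H ==> germ_of (\<lambda>t. F t * G t) \<in> H"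
  and HF_casesD: "HF H ==> germ_of F \<in> H ==> (EV t. F t = 0) \<or> good F \<and> germ_of (\<lambda>t. inverse (F t)) \<in> H"
  and HF_derivD: "HF H ==> germ_of F \<in> H ==> \<exists>F'. germ_of F' \<in> H \<and> hasd F F'"
  by (simp_all add: HF_def)

lemma HF_const: "HF (range (\<lambda>c. germ_of (\<lambda>_. c)))"
proof -
  let ?H = "range (\<lambda>c. germ_of (\<lambda>_. c))"
  have iff: "germ_of F \<in> ?H \<longleftrightarrow> (\<exists>c. (EV t. F t = c))" for F
    by (auto simp: image_iff germ_of_eq_iff)
  show ?thesis unfolding HF_def
  proof (intro conjI allI impI)
    fix F G assume "germ_of F \<in> ?H" "germ_of G \<in> ?H"
    then obtain c d where c: "EV t. F t = c" "EV t. G t = d" unfolding iff by blast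
    have "EV t. F t + G t = c + d" "EV t. F t * G t = c * d" using c by (eventually_elim, simp)+
    then show "germ_of (\<lambda>t. F t + G t) \<in> ?H" "germ_of (\<lambda>t. F t * G t) \<in> ?H" unfolding iff by blast+
  next
    fix F assume "germ_of F \<in> ?H"
    then obtain c where c: "EV t. F t = c" unfolding iff by blast
    show "(EV t. F t = 0) \<or> good F \<and> germ_of (\<lambda>t. inverse (F t)) \<in> ?H"
    proof (cases "c = 0")
      case False
      have "sim (\<lambda>_. c) F" using c by (intro sim_ev_eq) (auto elim: eventually_mono)
      then have "good F" using good_const[OF False] good_sim by blast
      moreover have "EV t. inverse (F t) = inverse c" using c by eventually_elim simp
      ultimately show ?thesis unfolding iff by blast
    qed (use c in simp)
    have "hasd F (\<lambda>_. 0)"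
      by (rule hasd_cong[of "\<lambda>_. c" "\<lambda>_. 0"]) (use c in \<open>auto elim: eventually_mono\<close>)
    then show "\<exists>F'. germ_of F' \<in> ?H \<and> hasd F F'" by (intro exI[of _ "\<lambda>_. 0"]) auto
  qed auto
qed

lemma ex_maximal_HF: "\<exists>M. HF M \<and> (\<forall>H. HF H --> M \<subseteq> H --> H = M)"
proof -
  have "\<exists>M\<in>Collect HF. \<forall>X\<in>Collect HF. M \<subseteq> X --> X = M"
  proof (rule subset_Zorn_nonempty)
    show "Collect HF ~= {}" using HF_const by blast
    fix \<C> assume \<C>: "\<C> ~= {}" "subset.chain (Collect HF) \<C>"
    have hf: "HF H" if "H \<in> \<C>" for H using \<C>(2) that by (auto simp: subset_chain_def)
    have lin: "\<exists>H\<in>\<C>. g \<in> H \<and> h \<in> H" if gh: "g \<in> \<Union>\<C>" "h \<in> \<Union>\<C>" for g h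
    proof -
      obtain G H where "G \<in> \<C>" "H \<in> \<C>" "g \<in> G" "h \<in> H" using gh by blast
      moreover have "G \<subseteq> H \<or> H \<subseteq> G" using \<C>(2) calculation by (auto simp: subset_chain_def)
      ultimately show ?thesis by blast
    qed
    have "HF (\<Union>\<C>)" unfolding HF_def
    proof (intro conjI allI impI)
      fix c show "germ_of (\<lambda>_. c) \<in> \<Union>\<C>" using \<C>(1) hf by (auto simp: HF_def)
    next
      fix F G assume "germ_of F \<in> \<Union>\<C>" "germ_of G \<in> \<Union>\<C>"
      then obtain H where H: "H \<in> \<C>" "germ_of F \<in> H" "germ_of G \<in> H" using lin by blast
      then show "germ_of (\<lambda>t. F t + G t) \<in> \<Union>\<C>" "germ_of (\<lambda>t. F t * G t) \<in> \<Union>\<C>"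
        using HF_addD[OF hf[OF H(1)] H(2,3)] HF_multD[OF hf[OF H(1)] H(2,3)] H(1) by blast+
    next
      fix F assume "germ_of F \<in> \<Union>\<C>"
      then obtain H where H: "H \<in> \<C>" "germ_of F \<in> H" by blast
      show "(EV t. F t = 0) \<or> good F \<and> germ_of (\<lambda>t. inverse (F t)) \<in> \<Union>\<C>"
        "\<exists>F'. germ_of F' \<in> \<Union>\<C> \<and> hasd F F'"
        using HF_casesD[OF hf[OF H(1)] H(2)] HF_derivD[OF hf[OF H(1)] H(2)] H(1) by blast+
    qed
    then show "\<Union>\<C> \<in> Collect HF" by simp
  qed
  then show ?thesis by blast
qed

definition max_HF :: "germ set" where
  "max_HF = (SOME M. HF M \<and> (\<forall>H. HF H --> M \<subseteq> H --> H = M))"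

lemma HF_max: "HF max_HF" and max_HF_maximal: "HF H ==> max_HF \<subseteq> H ==> H = max_HF"
  using someI_ex[OF ex_maximal_HF] unfolding max_HF_def by blast+

typedef hf = max_HF
  using HF_max unfolding HF_def by blast

definition In :: "(real => real) => bool" where
  "In F \<longleftrightarrow> germ_of F \<in> max_HF"

definition mk :: "(real => real) => hf" where
  "mk F = Abs_hf (germ_of F)"

text \<open>
  Choosing the zero function to represent the zero germ makes \<open>ap 0\<close> a simplification rule and
  lets coefficients vanish identically in polynomials.
\<close>

definition ap :: "hf => real => real" where
  "ap a = (if Rep_hf a = germ_of (\<lambda>_. 0) then (\<lambda>_. 0) else rep_germ (Rep_hf a))"

lemma germ_of_ap: "germ_of (ap a) = Rep_hf a"
  by (simp add: ap_def germ_of_rep)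

lemma In_ap [simp]: "In (ap a)"
  by (simp add: In_def germ_of_ap Rep_hf)

lemma mk_ap [simp]: "mk (ap a) = a"
  by (simp add: mk_def germ_of_ap Rep_hf_inverse)

lemma ap_mk: "In F ==> (EV t. ap (mk F) t = F t)"
  unfolding germ_of_eq_iff[symmetric] by (simp add: germ_of_ap mk_def In_def Abs_hf_inverse)

lemma hf_eq_iff: "a = b \<longleftrightarrow> (EV t. ap a t = ap b t)"
  unfolding germ_of_eq_iff[symmetric] by (simp add: germ_of_ap Rep_hf_inject)

lemma In_cong: "(EV t. F t = G t) ==> In F \<longleftrightarrow> In G"
  unfolding In_def using germ_of_eq_iff by metis

lemma In_const: "In (\<lambda>_. c)"
  and In_add: "In F ==> In G ==> In (\<lambda>t. F t + G t)"
  and In_mult: "In F ==> In G ==> In (\<lambda>t. F t * G t)"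
  and In_cases: "In F ==> (EV t. F t = 0) \<or> good F \<and> In (\<lambda>t. inverse (F t))"
  and In_deriv: "In F ==> \<exists>F'. In F' \<and> hasd F F'"
  using HF_constD[OF HF_max] HF_addD[OF HF_max] HF_multD[OF HF_max] HF_casesD[OF HF_max] HF_derivD[OF HF_max]
  unfolding In_def by simp_all

lemma In_uminus: "In F ==> In (\<lambda>t. - F t)"
  using In_mult[OF In_const[of "-1"], of F] by simp

lemma In_diff: "In F ==> In G ==> In (\<lambda>t. F t - G t)"
  using In_add[of F "\<lambda>t. - G t"] In_uminus by simp

lemma In_good: "In F ==> \<not> (EV t. F t = 0) ==> good F"
  using In_cases by blast

lemma In_inverse:
  assumes "In F"
  shows "In (\<lambda>t. inverse (F t))"
proof (cases "EV t. F t = 0")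
  case True
  then have "EV t. inverse (F t) = 0" by eventually_elim simp
  then show ?thesis using In_cong[of "\<lambda>t. inverse (F t)" "\<lambda>_. 0"] In_const by simp
qed (use In_cases assms in blast)

lemma In_cont: "In F ==> ev (isCont F)"
  using In_deriv hasd_cont by blast

lemma In_sign: "In F ==> (EV t. F t = 0) \<or> (EV t. 0 < F t) \<or> (EV t. F t < 0)"
  using const_sign In_cont In_good good_nz by blast

instantiation hf :: "{zero, one, plus, times, uminus, minus, inverse, abs, sgn, ord}"
begin

definition "0 = mk (\<lambda>_. 0)"
definition "1 = mk (\<lambda>_. 1)"
definition "a + b = mk (\<lambda>t. ap a t + ap b t)"
definition "a * b = mk (\<lambda>t. ap a t * ap b t)"
definition "- a = mk (\<lambda>t. - ap a t)"
definition "a - b = mk (\<lambda>t. ap a t - ap b t)"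
definition "inverse a = mk (\<lambda>t. inverse (ap a t))"
definition "a div b = mk (\<lambda>t. ap a t / ap b t)"
definition "a < b \<longleftrightarrow> (EV t. ap a t < ap b t)"
definition "a <= b \<longleftrightarrow> (EV t. ap a t <= ap b t)"
definition "\<bar>a\<bar> = (if a < (0 :: hf) then - a else a)"
definition "sgn a = (if a = (0 :: hf) then 0 else if 0 < a then 1 else - 1)"

instance ..

end

lemmas hf_less_def = less_hf_def and hf_le_def = less_eq_hf_def

lemma ap_zero [simp]: "ap 0 = (\<lambda>_. 0)"
proof -
  have "EV t. ap 0 t = 0" unfolding zero_hf_def by (rule ap_mk[OF In_const])
  then have "germ_of (ap 0) = germ_of (\<lambda>_. 0)" by (simp add: germ_of_eq_iff)
  then have "Rep_hf 0 = germ_of (\<lambda>_. 0)" by (simp only: germ_of_ap)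
  then show ?thesis by (simp add: ap_def)
qed

lemma ev_one: "EV t. ap 1 t = 1"
  and ev_add: "EV t. ap (a + b) t = ap a t + ap b t"
  and ev_mult: "EV t. ap (a * b) t = ap a t * ap b t"
  and ev_uminus: "EV t. ap (- a) t = - ap a t"
  and ev_diff: "EV t. ap (a - b) t = ap a t - ap b t"
  and ev_inverse: "EV t. ap (inverse a) t = inverse (ap a t)"
  and ev_divide: "EV t. ap (a / b) t = ap a t / ap b t"
  unfolding one_hf_def plus_hf_def times_hf_def uminus_hf_def minus_hf_def inverse_hf_def divide_hf_def
  by (rule ap_mk, simp_all add: In_const In_add In_mult In_uminus In_diff In_inverse divide_inverse)+

lemma hf_zero_iff: "a = 0 \<longleftrightarrow> (EV t. ap a t = 0)"
  by (simp add: hf_eq_iff)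

lemma hf_good: "a ~= 0 ==> good (ap a)"
  using In_good[OF In_ap] by (simp add: hf_zero_iff)

lemma hf_nz: "a ~= 0 ==> (EV t. ap a t ~= 0)"
  using hf_good good_nz by blast

instance hf :: field
proof
  fix a b c :: hf
  show "a + b + c = a + (b + c)" unfolding hf_eq_iff
    using ev_add[of "a + b" c] ev_add[of a b] ev_add[of a "b + c"] ev_add[of b c] by eventually_elim simp
  show "a + b = b + a" unfolding hf_eq_iff using ev_add[of a b] ev_add[of b a] by eventually_elim simp
  show "0 + a = a" unfolding hf_eq_iff using ev_add[of 0 a] by eventually_elim simp
  show "- a + a = 0" unfolding hf_eq_iff using ev_add[of "- a" a] ev_uminus[of a] by eventually_elim simp
  show "a - b = a + - b" unfolding hf_eq_iff
    using ev_add[of a "- b"] ev_uminus[of b] ev_diff[of a b] by eventually_elim simp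
  show "a * b * c = a * (b * c)" unfolding hf_eq_iff
    using ev_mult[of "a * b" c] ev_mult[of a b] ev_mult[of a "b * c"] ev_mult[of b c] by eventually_elim simp
  show "a * b = b * a" unfolding hf_eq_iff using ev_mult[of a b] ev_mult[of b a] by eventually_elim simp
  show "1 * a = a" unfolding hf_eq_iff using ev_mult[of 1 a] ev_one by eventually_elim simp
  show "(a + b) * c = a * c + b * c" unfolding hf_eq_iff
    using ev_mult[of "a + b" c] ev_add[of a b] ev_add[of "a * c" "b * c"] ev_mult[of a c] ev_mult[of b c]
    by eventually_elim (simp add: distrib_right)
  show "(0 :: hf) ~= 1"
  proof
    assume "(0 :: hf) = 1"
    then have "EV t. False" using ev_one by (simp del: ap_zero) (use ap_zero in \<open>auto elim: eventually_mono\<close>)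
    then show False by simp
  qed
  show "inverse (0 :: hf) = 0" unfolding hf_eq_iff using ev_inverse[of 0] by eventually_elim simp
  show "a / b = a * inverse b" unfolding hf_eq_iff
    using ev_divide[of a b] ev_inverse[of b] ev_mult[of a "inverse b"] by eventually_elim (simp add: divide_inverse)
  show "inverse a * a = 1" if "a ~= 0" unfolding hf_eq_iff
    using ev_mult[of "inverse a" a] ev_inverse[of a] ev_one hf_nz[OF that] by eventually_elim simp
qed

lemma hf_trichotomy: "a < b \<or> a = b \<or> b < (a :: hf)"
proof -
  have "(EV t. ap (a - b) t = 0) \<or> (EV t. 0 < ap (a - b) t) \<or> (EV t. ap (a - b) t < 0)"
    by (rule In_sign) simp
  then show ?thesis
  proof (elim disjE)
    assume "EV t. ap (a - b) t = 0"
    then have "a = b" unfolding hf_eq_iff using ev_diff[of a b] by eventually_elim simp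
    then show ?thesis by simp
  next
    assume "EV t. 0 < ap (a - b) t"
    then have "b < a" unfolding hf_less_def using ev_diff[of a b] by eventually_elim simp
    then show ?thesis by simp
  next
    assume "EV t. ap (a - b) t < 0"
    then have "a < b" unfolding hf_less_def using ev_diff[of a b] by eventually_elim simp
    then show ?thesis by simp
  qed
qed

lemma hf_less_imp_le: "a < b ==> a <= (b :: hf)"
  unfolding hf_less_def hf_le_def by (erule eventually_mono) simp

lemma hf_less_le_contr: "a < b ==> b <= (a :: hf) ==> False"
proof -
  assume "a < b" "b <= a"
  then have "EV t. ap a t < ap b t" "EV t. ap b t <= ap a t" by (simp_all add: hf_less_def hf_le_def)
  then have "EV t. False" by eventually_elim simp
  then show False by simp
qed

instance hf :: linordered_field
proof
  fix a b c :: hf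
  show "a < b \<longleftrightarrow> a <= b \<and> \<not> b <= a"
  proof -
    have "b <= b" by (simp add: hf_le_def)
    then show ?thesis
      using hf_trichotomy[of a b] hf_less_imp_le[of a b] hf_less_imp_le[of b a] hf_less_le_contr[of a b] by auto
  qed
  show "a <= a" by (simp add: hf_le_def)
  show "a <= c" if "a <= b" "b <= c" using that unfolding hf_le_def by eventually_elim simp
  show "a = b" if "a <= b" "b <= a" using that unfolding hf_le_def hf_eq_iff by eventually_elim simp
  show "a <= b \<or> b <= a" using hf_trichotomy[of a b] hf_less_imp_le by (auto simp: hf_le_def)
  show "c + a <= c + b" if "a <= b" using that ev_add[of c a] ev_add[of c b]
    unfolding hf_le_def by eventually_elim simp
  show "c * a < c * b" if "a < b" "0 < c" using that ev_mult[of c a] ev_mult[of c b]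
    unfolding hf_less_def by eventually_elim simp
  show "\<bar>a\<bar> = (if a < 0 then - a else a)" by (rule abs_hf_def)
  show "sgn a = (if a = 0 then 0 else if 0 < a then 1 else - 1)" by (rule sgn_hf_def)
qed

lemma hf_not_less_ev: "\<not> a < b ==> (EV t. ap b t <= ap a t)"
  by (simp add: not_less flip: hf_le_def)

definition Dr :: "hf => hf" where
  "Dr a = mk (SOME F'. In F' \<and> hasd (ap a) F')"

lemma hasd_Dr: "hasd (ap a) (ap (Dr a))"
proof -
  define F where "F = (SOME F'. In F' \<and> hasd (ap a) F')"
  have F: "In F \<and> hasd (ap a) F"
    using someI_ex[OF In_deriv[OF In_ap, of a]] by (simp add: F_def)
  then have "EV t. ap (mk F) t = F t" using ap_mk by blast
  then have "EV t. F t = ap (mk F) t" by eventually_elim simp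
  then show ?thesis unfolding Dr_def F_def[symmetric]
    using hasd_cong[of "ap a" F "ap a" "ap (mk F)"] F by simp
qed

text \<open>
  The form in which maximality is used: whatever lies in an extension lies in the field.
\<close>

lemma hf_maximal:
  assumes "HF H" "\<And>a. germ_of (ap a) \<in> H" "germ_of F \<in> H"
  shows "In F"
proof -
  have "max_HF \<subseteq> H"
  proof
    fix g assume "g \<in> max_HF"
    then have "Rep_hf (Abs_hf g) = g" by (rule Abs_hf_inverse)
    then show "g \<in> H" using assms(2)[of "Abs_hf g"] by (simp add: germ_of_ap)
  qed
  then have "H = max_HF" using max_HF_maximal assms(1) by blast
  then show ?thesis using assms(3) by (simp add: In_def)
qed

definition cst :: "real => hf" where "cst c = mk (\<lambda>_. c)"

lemma ev_cst: "EV t. ap (cst c) t = c"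
  unfolding cst_def by (rule ap_mk[OF In_const])

lemma ev_of_nat: "EV t. ap (of_nat n) t = of_nat n"
proof (induction n)
  case (Suc n)
  then show ?case using ev_add[of 1 "of_nat n"] ev_one by eventually_elim simp
qed simp

lemma ev_abs: "EV t. ap \<bar>a\<bar> t = \<bar>ap a t\<bar>"
proof (cases "a < 0")
  case True
  then have "EV t. ap a t < 0" by (simp add: hf_less_def)
  then show ?thesis using ev_uminus[of a] by eventually_elim (simp add: abs_hf_def True)
next
  case False
  then have "EV t. 0 <= ap a t" using hf_not_less_ev[of a 0] by simp
  then show ?thesis by eventually_elim (simp add: abs_hf_def False)
qed

lemma ev_power: "EV t. ap (a ^ n) t = ap a t ^ n"
proof (induction n)
  case (Suc n)
  then show ?case using ev_mult[of a "a ^ n"] by eventually_elim simp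
qed (simp add: ev_one)

section \<open>Polynomials over the Hardy field and simple extensions\<close>

lemma Dr_unique: "hasd (ap a) F ==> (EV t. ap (Dr a) t = F t)"
proof -
  assume h: "hasd (ap a) F"
  show ?thesis using hasd_Dr[of a] h by eventually_elim (rule DERIV_unique)
qed

lemma Dr_eqI: "hasd (ap a) F ==> (EV t. ap b t = F t) ==> Dr a = b"
proof -
  assume h: "hasd (ap a) F" "EV t. ap b t = F t"
  show ?thesis unfolding hf_eq_iff using Dr_unique[OF h(1)] h(2) by eventually_elim simp
qed

lemma Dr_zero [simp]: "Dr 0 = 0"
  by (rule Dr_eqI[where F = "\<lambda>_. 0"]) auto

definition pe :: "hf poly => real => real poly" where
  "pe p t = map_poly (\<lambda>c. ap c t) p"

lemma coeff_pe [simp]: "coeff (pe p t) i = ap (coeff p i) t"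
  by (simp add: pe_def coeff_map_poly)

lemma pe_0 [simp]: "pe 0 t = 0"
  by (simp add: pe_def)

lemma pe_pCons [simp]: "pe (pCons a p) t = pCons (ap a t) (pe p t)"
  by (simp add: pe_def map_poly_pCons)

lemma ev_pe_add: "EV t. pe (p + q) t = pe p t + pe q t"
proof (induction p q rule: poly_induct2)
  case (pCons a p b q)
  then show ?case using ev_add[of a b] by eventually_elim simp
qed simp

lemma ev_pe_smult: "EV t. pe (smult a p) t = smult (ap a t) (pe p t)"
proof (induction p)
  case (pCons b p)
  from pCons.IH show ?case using ev_mult[of a b] by eventually_elim simp
qed simp

lemma ev_pe_mult: "EV t. pe (p * q) t = pe p t * pe q t"
proof (induction p)
  case (pCons a p)
  from pCons.IH show ?case using ev_pe_add[of "smult a q" "pCons 0 (p * q)"] ev_pe_smult[of a q]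
    by eventually_elim simp
qed simp

lemma ev_pe_pderiv: "EV t. pe (pderiv p) t = pderiv (pe p t)"
proof (induction p)
  case (pCons a p)
  from pCons.IH show ?case using ev_pe_add[of p "pCons 0 (pderiv p)"]
    by eventually_elim (simp add: pderiv_pCons)
qed simp

lemma ev_pe_poly: "EV t. ap (poly p b) t = poly (pe p t) (ap b t)"
proof (induction p)
  case (pCons a p)
  from pCons.IH show ?case using ev_add[of a "b * poly p b"] ev_mult[of b "poly p b"] by eventually_elim simp
qed simp

lemma ev_pe_nz: "p ~= 0 ==> (EV t. pe p t ~= 0 \<and> degree (pe p t) = degree p)"
proof -
  assume "p ~= 0"
  then have "EV t. ap (lead_coeff p) t ~= 0" by (intro hf_nz) simp
  then show ?thesis
  proof eventually_elim
    case (elim t)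
    then have c: "coeff (pe p t) (degree p) ~= 0" by simp
    moreover have "degree (pe p t) <= degree p"
      by (rule degree_le) (simp add: coeff_eq_0)
    moreover have "pe p t ~= 0" using c by fastforce
    ultimately show ?case using le_degree[OF c] by simp
  qed
qed

definition Dpoly :: "hf poly => hf poly" where
  "Dpoly p = map_poly Dr p"

lemma Dpoly_pCons [simp]: "Dpoly (pCons a p) = pCons (Dr a) (Dpoly p)" and Dpoly_0 [simp]: "Dpoly 0 = 0"
  by (simp_all add: Dpoly_def map_poly_pCons)

text \<open>
  The chain rule for \<open>p(t, Y(t))\<close>: differentiate the coefficients (\<open>Dpoly\<close>) and the argument.
\<close>

lemma pe_has_derivative:
  "EV t. \<forall>Y Y'. (Y has_real_derivative Y') (at t) -->
     ((\<lambda>s. poly (pe p s) (Y s)) has_real_derivative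
       poly (pe (Dpoly p) t) (Y t) + poly (pderiv (pe p t)) (Y t) * Y') (at t)"
proof (induction p)
  case (pCons a p)
  from pCons.IH show ?case using hasd_Dr[of a]
  proof eventually_elim
    case (elim t)
    show ?case
    proof (intro allI impI)
      fix Y Y' assume Y: "(Y has_real_derivative Y') (at t)"
      have 1: "((\<lambda>s. poly (pe p s) (Y s)) has_real_derivative
         poly (pe (Dpoly p) t) (Y t) + poly (pderiv (pe p t)) (Y t) * Y') (at t)" using elim(1) Y by blast
      have "((\<lambda>s. ap a s + Y s * poly (pe p s) (Y s)) has_real_derivative
         ap (Dr a) t + (Y' * poly (pe p t) (Y t) + (poly (pe (Dpoly p) t) (Y t) + poly (pderiv (pe p t)) (Y t) * Y') * Y t)) (at t)"
        by (rule DERIV_add[OF elim(2) DERIV_mult[OF Y 1]])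
      then show "((\<lambda>s. poly (pe (pCons a p) s) (Y s)) has_real_derivative
         poly (pe (Dpoly (pCons a p)) t) (Y t) + poly (pderiv (pe (pCons a p) t)) (Y t) * Y') (at t)"
        by (simp add: pderiv_pCons algebra_simps)
    qed
  qed
qed simp

lemma pe_tendsto:
  "EV t. \<forall>Y y0 F. F <= nhds t --> (Y \<longlongrightarrow> y0) F --> ((\<lambda>s. poly (pe p s) (Y s)) \<longlongrightarrow> poly (pe p t) y0) F"
proof (induction p)
  case (pCons a p)
  from pCons.IH show ?case using hasd_Dr[of a]
  proof eventually_elim
    case (elim t)
    show ?case
    proof (intro allI impI)
      fix Y :: "real => real" and y0 and F :: "real filter" assume Y: "F <= nhds t" "(Y \<longlongrightarrow> y0) F"
      have "(ap a \<longlongrightarrow> ap a t) (nhds t)"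
        using DERIV_isCont[OF elim(2)] by (simp add: continuous_at isCont_def tendsto_at_iff_tendsto_nhds)
      then have "(ap a \<longlongrightarrow> ap a t) F" using Y(1) tendsto_mono by blast
      moreover have "((\<lambda>s. poly (pe p s) (Y s)) \<longlongrightarrow> poly (pe p t) y0) F" using elim(1) Y by blast
      ultimately have "((\<lambda>s. ap a s + Y s * poly (pe p s) (Y s)) \<longlongrightarrow> ap a t + y0 * poly (pe p t) y0) F"
        using Y(2) by (intro tendsto_intros)
      then show "((\<lambda>s. poly (pe (pCons a p) s) (Y s)) \<longlongrightarrow> poly (pe (pCons a p) t) y0) F" by simp
    qed
  qed
qed simp

definition frac_in :: "(real => real) => (real => real) => bool" where
  "frac_in y F \<longleftrightarrow> (\<exists>p q. \<not> (EV t. poly (pe q t) (y t) = 0) \<and>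
     (EV t. F t = poly (pe p t) (y t) / poly (pe q t) (y t)))"

text \<open>
  The rational functions of \<open>y\<close> form a field of germs closed under differentiation. They have
  admitted rates of growth as soon as the polynomials in \<open>y\<close> have, up to taking roots, the growth
  of elements of a group \<open>G\<close> of admitted functions. Powers are allowed because rates of growth can
  be divided by integers (\<open>good_power\<close>).
\<close>

lemma ext_in_hf:
  assumes D: "hasd y y'" "frac_in y y'"
    and G: "\<And>u. u \<in> G ==> good u" "\<And>u v. u \<in> G ==> v \<in> G ==> (\<lambda>t. u t * v t) \<in> G"
      "\<And>u. u \<in> G ==> (\<lambda>t. inverse (u t)) \<in> G"
    and V: "\<And>p. (EV t. poly (pe p t) (y t) = 0) \<or> (\<exists>k\<ge>1. \<exists>u\<in>G. sim (\<lambda>t. poly (pe p t) (y t) ^ k) u)"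
  shows "In y"
proof -
  define P where "P p t = poly (pe p t) (y t)" for p t
  define H where "H = {germ_of F | F. frac_in y F}"
  have H: "germ_of F \<in> H \<longleftrightarrow> frac_in y F" for F
  proof
    assume "germ_of F \<in> H"
    then obtain F' p q where F': "EV t. F t = F' t" "\<not> (EV t. P q t = 0)" "EV t. F' t = P p t / P q t"
      unfolding H_def frac_in_def P_def by (auto simp: germ_of_eq_iff)
    have "EV t. F t = P p t / P q t" using F'(1,3) by eventually_elim simp
    then show "frac_in y F" unfolding frac_in_def using F'(2) unfolding P_def by blast
  qed (auto simp: H_def)
  have fracI: "frac_in y F" if "\<not> (EV t. P q t = 0)" "EV t. F t = P p t / P q t" for F p q
    using that unfolding frac_in_def P_def by blast
  have fracE: "\<exists>p q. \<not> (EV t. P q t = 0) \<and> (EV t. F t = P p t / P q t)" if "frac_in y F" for F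
    using that unfolding frac_in_def P_def by blast
  have Gpow: "(\<lambda>t. u t ^ k) \<in> G" if "u \<in> G" "k \<ge> 1" for u k
    using that(2,1) by (induction k rule: dec_induct) (auto dest: G(2))
  have Pnz: "EV t. P q t ~= 0" if h: "\<not> (EV t. P q t = 0)" for q
  proof -
    obtain k u where ku: "k \<ge> 1" "u \<in> G" "sim (\<lambda>t. P q t ^ k) u"
      using V[of q] h unfolding P_def by blast
    have "good (\<lambda>t. P q t ^ k)" using good_sim[OF G(1)[OF ku(2)] sim_sym[OF ku(3)]] .
    then show ?thesis using ku(1) good_power good_nz by simp
  qed
  have nzev: "\<not> (EV t. P q t = 0)" if "EV t. P q t ~= 0" for q
  proof
    assume "EV t. P q t = 0"
    with that have "EV t. False" by eventually_elim simp
    then show False by simp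
  qed
  have ePadd: "EV t. P (p + q) t = P p t + P q t" for p q
    using ev_pe_add[of p q] unfolding P_def by eventually_elim simp
  have ePmult: "EV t. P (p * q) t = P p t * P q t" for p q
    using ev_pe_mult[of p q] unfolding P_def by eventually_elim simp
  have ePdiff: "EV t. P (p - q) t = P p t - P q t" for p q
    using ePadd[of "p - q" q] by eventually_elim simp
  have P1: "EV t. P 1 t = 1"
    using ev_one unfolding P_def one_pCons by eventually_elim simp
  have "HF H" unfolding HF_def H
  proof (intro conjI allI impI)
    fix c show "frac_in y (\<lambda>_. c)"
    proof (rule fracI[of 1 _ "[:cst c:]"])
      show "\<not> (EV t. P 1 t = 0)" by (rule nzev) (use P1 in eventually_elim, simp)
      show "EV t. c = P [:cst c:] t / P 1 t"
        using P1 ev_cst[of c] by eventually_elim (simp add: P_def)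
    qed
  next
    fix F1 F2 assume F12: "frac_in y F1" "frac_in y F2"
    obtain p1 q1 where F1: "\<not> (EV t. P q1 t = 0)" "EV t. F1 t = P p1 t / P q1 t"
      using fracE[OF F12(1)] by blast
    obtain p2 q2 where F2: "\<not> (EV t. P q2 t = 0)" "EV t. F2 t = P p2 t / P q2 t"
      using fracE[OF F12(2)] by blast
    note F = F1 F2
    have nz: "\<not> (EV t. P (q1 * q2) t = 0)"
      by (rule nzev) (use Pnz[OF F(1)] Pnz[OF F(3)] ePmult[of q1 q2] in eventually_elim, simp)
    show "frac_in y (\<lambda>t. F1 t + F2 t)"
    proof (rule fracI[OF nz, of _ "p1 * q2 + p2 * q1"])
      show "EV t. F1 t + F2 t = P (p1 * q2 + p2 * q1) t / P (q1 * q2) t"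
        using F(2,4) Pnz[OF F(1)] Pnz[OF F(3)] ePmult[of q1 q2] ePmult[of p1 q2] ePmult[of p2 q1] ePadd[of "p1 * q2" "p2 * q1"]
        by eventually_elim (simp add: field_simps)
    qed
    show "frac_in y (\<lambda>t. F1 t * F2 t)"
    proof (rule fracI[OF nz, of _ "p1 * p2"])
      show "EV t. F1 t * F2 t = P (p1 * p2) t / P (q1 * q2) t"
        using F(2,4) ePmult[of q1 q2] ePmult[of p1 p2] by eventually_elim (simp add: field_simps)
    qed
  next
    fix F assume F0: "frac_in y F"
    obtain p q where F: "\<not> (EV t. P q t = 0)" "EV t. F t = P p t / P q t" using fracE[OF F0] by blast
    show "(EV t. F t = 0) \<or> good F \<and> frac_in y (\<lambda>t. inverse (F t))"
    proof (cases "EV t. P p t = 0")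
      case True
      then have "EV t. F t = 0" using F(2) by eventually_elim simp
      then show ?thesis by blast
    next
      case False
      obtain k u where ku: "k \<ge> 1" "u \<in> G" "sim (\<lambda>t. P p t ^ k) u"
        using V[of p] False unfolding P_def by blast
      obtain l v where lv: "l \<ge> 1" "v \<in> G" "sim (\<lambda>t. P q t ^ l) v"
        using V[of q] F(1) unfolding P_def by blast
      have "sim (\<lambda>t. F t ^ (k * l)) (\<lambda>t. (P p t ^ k) ^ l * inverse ((P q t ^ l) ^ k))"
      proof (rule sim_ev_eq, use F(2) in eventually_elim)
        case (elim t)
        show ?case unfolding elim power_divide divide_inverse
          by (simp only: power_mult power_mult_distrib power_inverse flip: power_mult) (simp add: mult.commute)
      qed
      from sim_trans[OF this sim_mult[OF sim_power[OF ku(3)] sim_inverse[OF sim_power[OF lv(3)]]]]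
      have s: "sim (\<lambda>t. F t ^ (k * l)) (\<lambda>t. u t ^ l * inverse (v t ^ k))" .
      have "(\<lambda>t. u t ^ l * inverse (v t ^ k)) \<in> G"
        using ku lv by (intro G(2) G(3) Gpow)
      then have "good (\<lambda>t. F t ^ (k * l))" using G(1) s sim_sym good_sim by blast
      then have "good F" using good_power ku lv by simp
      moreover have "frac_in y (\<lambda>t. inverse (F t))"
        by (rule fracI[OF False, of _ q]) (use F(2) in eventually_elim, simp)
      ultimately show ?thesis by blast
    qed
    obtain a b where ab: "\<not> (EV t. P b t = 0)" "EV t. y' t = P a t / P b t" using fracE[OF D(2)] by blast
    have dP: "hasd (P r) (\<lambda>t. P (Dpoly r) t + P (pderiv r) t * y' t)" for r
      using pe_has_derivative[of r] D(1) ev_pe_pderiv[of r]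
      unfolding P_def by eventually_elim simp
    \<comment> \<open>Numerators of the derivatives of \<open>P p\<close> and \<open>P q\<close> over the denominator \<open>P b\<close> of \<open>y'\<close>.\<close>
    define Np where "Np = Dpoly p * b + pderiv p * a"
    define Nq where "Nq = Dpoly q * b + pderiv q * a"
    define N where "N = Np * q - p * Nq"
    have eN: "EV t. P N t = (P (Dpoly p) t * P b t + P (pderiv p) t * P a t) * P q t
        - P p t * (P (Dpoly q) t * P b t + P (pderiv q) t * P a t)"
      using ePdiff[of "Np * q" "p * Nq"] ePmult[of Np q] ePmult[of p Nq]
        ePadd[of "Dpoly p * b" "pderiv p * a"] ePadd[of "Dpoly q * b" "pderiv q * a"]
        ePmult[of "Dpoly p" b] ePmult[of "pderiv p" a] ePmult[of "Dpoly q" b] ePmult[of "pderiv q" a]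
      unfolding N_def Np_def[symmetric] Nq_def[symmetric] by eventually_elim simp
    have nz: "\<not> (EV t. P (b * (q * q)) t = 0)"
      by (rule nzev) (use Pnz[OF F(1)] Pnz[OF ab(1)] ePmult[of b "q * q"] ePmult[of q q] in eventually_elim, simp)
    have "hasd (\<lambda>t. P p t / P q t) (\<lambda>t. P N t / P (b * (q * q)) t)"
      using dP[of p] dP[of q] Pnz[OF F(1)] Pnz[OF ab(1)] ePmult[of b "q * q"] ePmult[of q q] eN ab(2)
    proof eventually_elim
      case (elim t)
      have "((\<lambda>t. P p t / P q t) has_real_derivative
         ((P (Dpoly p) t + P (pderiv p) t * y' t) * P q t - P p t * (P (Dpoly q) t + P (pderiv q) t * y' t)) / (P q t * P q t)) (at t)"
        using elim by (intro DERIV_divide) auto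
      moreover have "((P (Dpoly p) t + P (pderiv p) t * y' t) * P q t - P p t * (P (Dpoly q) t + P (pderiv q) t * y' t)) / (P q t * P q t)
         = P N t / P (b * (q * q)) t"
        using elim(3,4) by (simp add: elim(5-8) field_simps)
      ultimately show ?case by simp
    qed
    then have "hasd F (\<lambda>t. P N t / P (b * (q * q)) t)"
      by (rule hasd_cong) (use F(2) in \<open>auto simp: eq_commute\<close>)
    moreover have "frac_in y (\<lambda>t. P N t / P (b * (q * q)) t)"
      by (rule fracI[OF nz, of _ N]) simp
    ultimately show "\<exists>F'. frac_in y F' \<and> hasd F F'" by blast
  qed
  then show ?thesis
  proof (rule hf_maximal)
    have n1: "\<not> (EV t. P 1 t = 0)" by (rule nzev) (use P1 in eventually_elim, simp)
    show "germ_of (ap a) \<in> H" for a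
      unfolding H by (rule fracI[OF n1, of _ "[:a:]"]) (use P1 in eventually_elim, simp add: P_def)
    show "germ_of y \<in> H"
      unfolding H by (rule fracI[OF n1, of _ "[:0, 1:]"]) (use P1 ev_one in eventually_elim, simp add: P_def)
  qed
qed

text \<open>
  The square of \<open>p\<close> attains a minimum, and there its derivative \<open>2 p p'\<close> vanishes.
\<close>

lemma poly_abs_min:
  fixes p :: "real poly"
  assumes "0 < degree p"
  obtains m where "\<And>y. \<bar>poly p m\<bar> <= \<bar>poly p y\<bar>" "poly p m = 0 \<or> poly (pderiv p) m = 0"
proof -
  obtain a q where p: "p = pCons a q" by (cases p)
  then have "q ~= 0" using assms by auto
  then obtain r where r: "\<And>z. r <= \<bar>z\<bar> ==> \<bar>poly p 0\<bar> <= \<bar>poly p z\<bar>"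
    using poly_infinity[of q "\<bar>poly p 0\<bar>" a] p by auto
  define s where "s = max r 0"
  have "\<exists>m\<in>{-s..s}. \<forall>y\<in>{-s..s}. \<bar>poly p m\<bar> <= \<bar>poly p y\<bar>"
    by (rule continuous_attains_inf) (auto simp: s_def intro!: continuous_intros)
  then obtain m where m: "m \<in> {-s..s}" "\<And>y. y \<in> {-s..s} ==> \<bar>poly p m\<bar> <= \<bar>poly p y\<bar>" by blast
  have min: "\<bar>poly p m\<bar> <= \<bar>poly p y\<bar>" for y
  proof (cases "y \<in> {-s..s}")
    case False
    then have "r <= \<bar>y\<bar>" by (auto simp: s_def)
    moreover have "\<bar>poly p m\<bar> <= \<bar>poly p 0\<bar>" by (rule m(2)) (auto simp: s_def)
    ultimately show ?thesis using r[of y] by simp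
  qed (rule m(2))
  have "2 * poly p m * poly (pderiv p) m = 0"
  proof (rule DERIV_local_min[where d = 1])
    show "((\<lambda>y. poly p y ^ 2) has_real_derivative 2 * poly p m * poly (pderiv p) m) (at m)"
      by (auto intro!: derivative_eq_intros poly_DERIV)
    show "\<forall>y. \<bar>m - y\<bar> < 1 --> (poly p m)\<^sup>2 <= (poly p y)\<^sup>2" using min by (simp add: abs_le_square_iff)
  qed simp
  then show thesis using min that by auto
qed

definition roots_in_hf :: "nat => bool" where
  "roots_in_hf n \<longleftrightarrow> (\<forall>p. p ~= 0 --> degree p <= n -->
     (\<exists>B. finite B \<and> (EV t. \<forall>y. poly (pe p t) y = 0 --> (\<exists>b\<in>B. y = ap b t))))"

definition vgroup :: "(real => real) set => bool" where
  "vgroup G \<longleftrightarrow> (\<forall>u\<in>G. good u) \<and> (\<forall>u\<in>G. \<forall>v\<in>G. (\<lambda>t. u t * v t) \<in> G) \<and>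
     (\<forall>u\<in>G. (\<lambda>t. inverse (u t)) \<in> G) \<and> (\<forall>u. In u --> \<not> (EV t. u t = 0) --> u \<in> G)"

text \<open>
  In terms of valuations: the value of \<open>F\<close>, if it is finite, lies in the divisible hull of the
  value group of \<open>G\<close>.
\<close>

definition has_val :: "(real => real) set => (real => real) => bool" where
  "has_val G F \<longleftrightarrow> (EV t. F t = 0) \<or> (\<exists>k\<ge>1. \<exists>u\<in>G. sim (\<lambda>t. F t ^ k) u)"

lemma vgroupD:
  assumes "vgroup G"
  shows "u \<in> G ==> good u" "u \<in> G ==> v \<in> G ==> (\<lambda>t. u t * v t) \<in> G" "u \<in> G ==> (\<lambda>t. inverse (u t)) \<in> G"
    "In u ==> \<not> (EV t. u t = 0) ==> u \<in> G"
  using assms unfolding vgroup_def by simp_all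

lemma vgroup_power:
  assumes "vgroup G" "u \<in> G" "k \<ge> 1"
  shows "(\<lambda>t. u t ^ k) \<in> G"
  using assms(3,2) by (induction k rule: dec_induct) (auto intro: vgroupD(2)[OF assms(1)])

lemma has_val_cong:
  assumes "has_val G F" "EV t. F t = F' t"
  shows "has_val G F'"
  using assms(1) unfolding has_val_def
proof (elim disjE bexE exE conjE)
  assume "EV t. F t = 0"
  then have "EV t. F' t = 0" using assms(2) by eventually_elim simp
  then show "(EV t. F' t = 0) \<or> (\<exists>k\<ge>1. \<exists>u\<in>G. sim (\<lambda>t. F' t ^ k) u)" by blast
next
  fix k u assume ku: "1 <= k" "u \<in> G" "sim (\<lambda>t. F t ^ k) u"
  have "sim (\<lambda>t. F' t ^ k) (\<lambda>t. F t ^ k)"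
    by (rule sim_ev_eq) (use assms(2) in eventually_elim, simp)
  then show "(EV t. F' t = 0) \<or> (\<exists>k\<ge>1. \<exists>u\<in>G. sim (\<lambda>t. F' t ^ k) u)" using ku sim_trans by blast
qed

lemma has_val_sim:
  assumes "has_val G F" "sim F F'"
  shows "has_val G F'"
  using assms(1) unfolding has_val_def
proof (elim disjE bexE exE conjE)
  assume *: "EV t. F t = 0"
  obtain C where C: "0 < C" "EV t. \<bar>F t\<bar> <= C * \<bar>F' t\<bar> \<and> \<bar>F' t\<bar> <= C * \<bar>F t\<bar>"
    by (rule simE[OF assms(2)])
  have "EV t. F' t = 0" using * C(2) by eventually_elim simp
  then show "(EV t. F' t = 0) \<or> (\<exists>k\<ge>1. \<exists>u\<in>G. sim (\<lambda>t. F' t ^ k) u)" by blast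
next
  fix k u assume ku: "1 <= k" "u \<in> G" "sim (\<lambda>t. F t ^ k) u"
  have "sim (\<lambda>t. F' t ^ k) (\<lambda>t. F t ^ k)" using sim_power[OF sim_sym[OF assms(2)]] .
  then show "(EV t. F' t = 0) \<or> (\<exists>k\<ge>1. \<exists>u\<in>G. sim (\<lambda>t. F' t ^ k) u)" using ku sim_trans by blast
qed

lemma has_val_group: "u \<in> G ==> has_val G u"
  unfolding has_val_def by (intro disjI2 exI[of _ 1] conjI bexI[of _ u]) auto

lemma has_val_In: "vgroup G ==> In F ==> has_val G F"
  using has_val_group vgroupD(4) by (metis has_val_def)

lemma has_val_mult:
  assumes "vgroup G" "has_val G F" "has_val G F'"
  shows "has_val G (\<lambda>t. F t * F' t)"
proof (cases "(EV t. F t = 0) \<or> (EV t. F' t = 0)")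
  case True
  then have "EV t. F t * F' t = 0" by (auto elim: eventually_mono)
  then show ?thesis by (simp add: has_val_def)
next
  case False
  obtain k u where ku: "k \<ge> 1" "u \<in> G" "sim (\<lambda>t. F t ^ k) u"
    using assms(2) False unfolding has_val_def by blast
  obtain l v where lv: "l \<ge> 1" "v \<in> G" "sim (\<lambda>t. F' t ^ l) v"
    using assms(3) False unfolding has_val_def by blast
  have "sim (\<lambda>t. (F t * F' t) ^ (k * l)) (\<lambda>t. (F t ^ k) ^ l * (F' t ^ l) ^ k)"
    by (rule sim_ev_eq) (simp add: power_mult_distrib mult.commute flip: power_mult)
  from sim_trans[OF this sim_mult[OF sim_power[OF ku(3)] sim_power[OF lv(3)]]]
  have "sim (\<lambda>t. (F t * F' t) ^ (k * l)) (\<lambda>t. u t ^ l * v t ^ k)" .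
  moreover have "(\<lambda>t. u t ^ l * v t ^ k) \<in> G"
    using ku lv assms(1) vgroup_power vgroupD(2)[OF assms(1)] by blast
  moreover have "k * l \<ge> 1" using ku lv by simp
  ultimately show ?thesis unfolding has_val_def by blast
qed

lemma power_le_imp_le_const:
  fixes a b C :: real
  assumes "a ^ k <= C * b ^ k" "1 <= k" "0 <= b" "1 <= C"
  shows "a <= C * b"
proof (rule ccontr)
  assume "\<not> a <= C * b"
  then have "(C * b) ^ k < a ^ k" using assms by (intro power_strict_mono) auto
  moreover have "C * b ^ k <= C ^ k * b ^ k"
    using assms power_increasing[of 1 k C] by (intro mult_right_mono) auto
  ultimately show False using assms(1) by (simp add: power_mult_distrib)
qed

text \<open>
  When a sum is not smaller than one of its summands there is no cancellation. Its growth is then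
  that of the larger summand, and the summands are comparable because \<open>G\<close> consists of admitted
  functions.
\<close>

lemma has_val_dominating_sum:
  assumes G: "vgroup G" and A: "In A" and B: "has_val G B" and le: "EV t. \<bar>A t\<bar> <= \<bar>A t + B t\<bar>"
  shows "has_val G (\<lambda>t. A t + B t)"
proof (cases "(EV t. A t = 0) \<or> (EV t. B t = 0)")
  case True
  then show ?thesis
  proof
    assume "EV t. A t = 0"
    then have "EV t. B t = A t + B t" by eventually_elim simp
    then show ?thesis by (rule has_val_cong[OF B])
  next
    assume "EV t. B t = 0"
    then have "EV t. A t = A t + B t" by eventually_elim simp
    then show ?thesis by (rule has_val_cong[OF has_val_In[OF G A]])
  qed
next
  case False
  obtain k u where ku: "k \<ge> 1" "u \<in> G" "sim (\<lambda>t. B t ^ k) u"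
    using B False unfolding has_val_def by blast
  define a where "a = (\<lambda>t. A t ^ k)"
  have AG: "A \<in> G" using False A vgroupD(4)[OF G] by blast
  have aG: "a \<in> G" using vgroup_power[OF G AG ku(1)] by (simp add: a_def)
  obtain D where D: "0 < D" "EV t. \<bar>B t ^ k\<bar> <= D * \<bar>u t\<bar> \<and> \<bar>u t\<bar> <= D * \<bar>B t ^ k\<bar>"
    by (rule simE[OF ku(3)])
  have "good (\<lambda>t. u t * inverse (a t))"
    using vgroupD(1)[OF G vgroupD(2)[OF G ku(2) vgroupD(3)[OF G aG]]] .
  then consider C where "0 < C" "EV t. \<bar>u t * inverse (a t)\<bar> <= C" | C where "0 < C" "EV t. C <= \<bar>u t * inverse (a t)\<bar>"
    using good_cases by blast
  then show ?thesis
  proof cases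
    case 1
    define C' where "C' = max 1 (D * C)"
    have "EV t. \<bar>B t\<bar> <= C' * \<bar>A t\<bar>"
      using 1(2) D(2) good_nz[OF vgroupD(1)[OF G aG]]
    proof eventually_elim
      case (elim t)
      have "\<bar>u t\<bar> <= C * \<bar>a t\<bar>" using elim(1,3) by (simp add: abs_mult abs_inverse field_simps)
      then have "D * \<bar>u t\<bar> <= D * (C * \<bar>a t\<bar>)" using D(1) by (intro mult_left_mono) auto
      then have "\<bar>B t\<bar> ^ k <= (D * C) * \<bar>A t\<bar> ^ k" using elim(2) by (simp add: a_def power_abs mult.assoc)
      also have "\<dots> <= C' * \<bar>A t\<bar> ^ k" by (intro mult_right_mono) (auto simp: C'_def)
      finally show ?case using ku(1) by (rule power_le_imp_le_const) (auto simp: C'_def)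
    qed
    then have "EV t. \<bar>A t\<bar> <= (1 + C') * \<bar>A t + B t\<bar> \<and> \<bar>A t + B t\<bar> <= (1 + C') * \<bar>A t\<bar>"
      using le
    proof eventually_elim
      case (elim t)
      have "0 <= C' * \<bar>A t + B t\<bar>" by (simp add: C'_def)
      moreover have "\<bar>A t + B t\<bar> <= \<bar>A t\<bar> + C' * \<bar>A t\<bar>" using elim by linarith
      ultimately show ?case using elim(2) by (simp add: distrib_right)
    qed
    then have "sim A (\<lambda>t. A t + B t)" by (rule simI[rotated]) (simp add: C'_def)
    then show ?thesis using has_val_In[OF G A] has_val_sim by blast
  next
    case 2
    define C' where "C' = max 1 (D / C)"
    have "EV t. \<bar>A t\<bar> <= C' * \<bar>B t\<bar>"
      using 2(2) D(2) good_nz[OF vgroupD(1)[OF G aG]]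
    proof eventually_elim
      case (elim t)
      have "C * \<bar>a t\<bar> <= \<bar>u t\<bar>" using elim(1,3) by (simp add: abs_mult abs_inverse field_simps)
      then have "C * \<bar>A t\<bar> ^ k <= D * \<bar>B t\<bar> ^ k" using elim(2) by (simp add: a_def power_abs)
      then have "\<bar>A t\<bar> ^ k <= (D / C) * \<bar>B t\<bar> ^ k" using 2(1) by (simp add: field_simps)
      also have "\<dots> <= C' * \<bar>B t\<bar> ^ k" by (intro mult_right_mono) (auto simp: C'_def)
      finally show ?case using ku(1) by (rule power_le_imp_le_const) (auto simp: C'_def)
    qed
    then have "EV t. \<bar>B t\<bar> <= (2 + C') * \<bar>A t + B t\<bar> \<and> \<bar>A t + B t\<bar> <= (2 + C') * \<bar>B t\<bar>"
      using le
    proof eventually_elim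
      case (elim t)
      have c: "0 <= C' * \<bar>A t + B t\<bar>" by (simp add: C'_def)
      have "\<bar>B t\<bar> <= 2 * \<bar>A t + B t\<bar>" using elim(2) abs_triangle_ineq4[of "A t + B t" "A t"] by simp
      moreover have "\<bar>A t + B t\<bar> <= C' * \<bar>B t\<bar> + \<bar>B t\<bar>" using elim(1) abs_triangle_ineq[of "A t" "B t"] by simp
      ultimately show ?case using c by (simp add: distrib_right)
    qed
    then have "sim B (\<lambda>t. A t + B t)" by (rule simI[rotated]) (simp add: C'_def)
    then show ?thesis using B has_val_sim by blast
  qed
qed

text \<open>
  Write \<open>p(y) = p(\<beta>) + (y - \<beta>) \<cdot> q(y)\<close> with \<open>\<beta>\<close> chosen so that \<open>|p(\<beta>)|\<close> is minimal among all real
  values of \<open>p\<close>. Then the sum dominates its first summand, and \<open>q\<close> has smaller degree. A minimum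
  is attained at a root of \<open>p\<close> or of its derivative, hence at an element of the field by
  assumption.
\<close>

lemma has_val_poly:
  assumes rc: "roots_in_hf n" and G: "vgroup G" and base: "\<And>\<beta>. has_val G (\<lambda>t. y t - ap \<beta> t)"
    and "degree p <= n"
  shows "has_val G (\<lambda>t. poly (pe p t) (y t))"
  using assms(4)
proof (induction "degree p" arbitrary: p rule: less_induct)
  case less
  show ?case
  proof (cases "degree p = 0")
    case True
    then obtain a where p: "p = [:a:]" by (metis degree_eq_zeroE)
    show ?thesis using has_val_In[OF G In_ap[of a]] by (simp add: p)
  next
    case False
    have pnz: "p ~= 0" "pderiv p ~= 0" using False by (auto simp: pderiv_eq_0_iff)
    have dd: "degree (pderiv p) <= n" using less.prems by (simp add: degree_pderiv)
    obtain B1 where B1: "finite B1" "EV t. \<forall>y. poly (pe p t) y = 0 --> (\<exists>b\<in>B1. y = ap b t)"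
      using rc pnz(1) less.prems unfolding roots_in_hf_def by blast
    obtain B2 where B2: "finite B2" "EV t. \<forall>y. poly (pe (pderiv p) t) y = 0 --> (\<exists>b\<in>B2. y = ap b t)"
      using rc pnz(2) dd unfolding roots_in_hf_def by blast
    define B where "B = B1 \<union> B2"
    have fB: "finite B" using B1 B2 by (simp add: B_def)
    have minB: "EV t. \<exists>b\<in>B. \<forall>y. \<bar>poly (pe p t) (ap b t)\<bar> <= \<bar>poly (pe p t) y\<bar>"
      using B1(2) B2(2) ev_pe_pderiv[of p] ev_pe_nz[OF pnz(1)]
    proof eventually_elim
      case (elim t)
      have "0 < degree (pe p t)" using elim(4) False by simp
      from poly_abs_min[OF this] obtain m where m: "\<And>y. \<bar>poly (pe p t) m\<bar> <= \<bar>poly (pe p t) y\<bar>"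
        "poly (pe p t) m = 0 \<or> poly (pderiv (pe p t)) m = 0" by blast
      then have "\<exists>b\<in>B. m = ap b t" using elim(1-3) by (auto simp: B_def)
      then show ?case using m(1) by auto
    qed
    have "B ~= {}"
    proof
      assume "B = {}"
      then have "EV t. False" using minB by simp
      then show False by simp
    qed
    define \<beta> where "\<beta> = arg_min_on (\<lambda>b. \<bar>poly p b\<bar>) B"
    have \<beta>: "\<beta> \<in> B" "\<And>b. b \<in> B ==> \<bar>poly p \<beta>\<bar> <= \<bar>poly p b\<bar>"
      using arg_min_if_finite[OF fB \<open>B ~= {}\<close>, of "\<lambda>b. \<bar>poly p b\<bar>"] arg_min_least[OF fB \<open>B ~= {}\<close>]
      by (auto simp: \<beta>_def)
    have "EV t. \<forall>b\<in>B. ap \<bar>poly p \<beta>\<bar> t <= ap \<bar>poly p b\<bar> t"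
      using \<beta>(2) by (intro eventually_ball_finite fB) (simp add: hf_le_def)
    moreover have "EV t. \<forall>b\<in>B. ap \<bar>poly p b\<bar> t = \<bar>poly (pe p t) (ap b t)\<bar>"
    proof (intro eventually_ball_finite fB ballI)
      fix b show "EV t. ap \<bar>poly p b\<bar> t = \<bar>poly (pe p t) (ap b t)\<bar>"
        using ev_abs[of "poly p b"] ev_pe_poly[of p b] by eventually_elim simp
    qed
    ultimately have min: "EV t. \<forall>y. \<bar>poly (pe p t) (ap \<beta> t)\<bar> <= \<bar>poly (pe p t) y\<bar>"
      using minB
    proof eventually_elim
      case (elim t)
      then obtain b where b: "b \<in> B" "\<And>y. \<bar>poly (pe p t) (ap b t)\<bar> <= \<bar>poly (pe p t) y\<bar>" by blast
      have "\<bar>poly (pe p t) (ap \<beta> t)\<bar> <= \<bar>poly (pe p t) (ap b t)\<bar>" using elim(1,2) b(1) \<beta>(1) by auto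
      then show ?case using b(2) order_trans by blast
    qed
    define q where "q = synthetic_div p \<beta>"
    have q: "p = [:- \<beta>, 1:] * q + [:poly p \<beta>:]" using synthetic_div_correct'[of \<beta> p] by (simp add: q_def)
    have dq: "degree q < degree p" using False by (simp add: q_def degree_synthetic_div)
    have IH: "has_val G (\<lambda>t. poly (pe q t) (y t))" using less.hyps[OF dq] dq less.prems by simp
    define A where "A = ap (poly p \<beta>)"
    define Bf where "Bf t = (y t - ap \<beta> t) * poly (pe q t) (y t)" for t
    have eq: "EV t. A t + Bf t = poly (pe p t) (y t)"
    proof -
      have "EV t. pe p t = pe ([:- \<beta>, 1:] * q) t + pe [:poly p \<beta>:] t"
        using ev_pe_add[of "[:- \<beta>, 1:] * q" "[:poly p \<beta>:]"] q by simp
      then show ?thesis using ev_pe_mult[of "[:- \<beta>, 1:]" q] ev_one ev_uminus[of \<beta>]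
      proof eventually_elim
        case (elim t)
        have "poly (pe p t) (y t) = poly (pe [:- \<beta>, 1:] t * pe q t) (y t) + A t"
          unfolding elim(1,2) by (simp add: A_def)
        then show ?case using elim(3,4) by (simp add: Bf_def algebra_simps)
      qed
    qed
    have "has_val G (\<lambda>t. A t + Bf t)"
    proof (rule has_val_dominating_sum[OF G])
      show "In A" by (simp add: A_def)
      show "has_val G Bf" unfolding Bf_def using has_val_mult[OF G base[of \<beta>] IH] .
      show "EV t. \<bar>A t\<bar> <= \<bar>A t + Bf t\<bar>"
        using eq min ev_pe_poly[of p \<beta>] by eventually_elim (simp add: A_def)
    qed
    then show ?thesis using eq by (rule has_val_cong)
  qed
qed

lemma ext_in_hf_val:
  assumes "hasd y y'" "frac_in y y'" "vgroup G" "\<And>p. has_val G (\<lambda>t. poly (pe p t) (y t))"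
  shows "In y"
  by (rule ext_in_hf[OF assms(1,2) vgroupD(1-3)[OF assms(3)]]) (use assms(4) in \<open>simp_all add: has_val_def\<close>)

section \<open>Roots of polynomials over the Hardy field\<close>

lemma ev_hf_pos: "0 < a ==> (EV t. 0 < ap a t)"
  by (simp add: hf_less_def)

lemma ev_hf_nat_mult_le: "a <= of_nat n * b ==> (EV t. ap a t <= real n * ap b t)"
proof -
  assume "a <= of_nat n * b"
  then have "EV t. ap a t <= ap (of_nat n * b) t" by (simp add: hf_le_def)
  then show ?thesis using ev_mult[of "of_nat n" b] ev_of_nat[of n] by eventually_elim simp
qed

lemma ev_hf_ll: "a \<lless> b ==> 0 < a ==> 0 < b ==> 0 < C ==> (EV t. C * ap a t < ap b t)"
proof -
  assume ab: "a \<lless> b" "0 < a" "0 < b" "0 < C"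
  obtain n :: nat where n: "C <= real n" using real_arch_simple by blast
  have "of_nat n * a < b" using llD[OF ab(1)] ab(3) by simp
  then have "EV t. ap (of_nat n * a) t < ap b t" by (simp add: hf_less_def)
  then show ?thesis using ev_mult[of "of_nat n" a] ev_of_nat[of n] ev_hf_pos[OF ab(2)]
  proof eventually_elim
    case (elim t)
    have "C * ap a t <= real n * ap a t" using n elim(4) by (intro mult_right_mono) auto
    then show ?case using elim(1-3) by simp
  qed
qed

text \<open>
  A continuous function that is at each time comparable to one of finitely many elements of the
  field stays comparable to one of them: to move from one growth class to another it would have to
  pass through the space between the classes.
\<close>

lemma select_class:
  assumes "finite A" "\<forall>a\<in>A. 0 < a" and f: "ev (isCont f)" "EV t. 0 < f t"
    and "1 <= C" "EV t. \<exists>a\<in>A. ap a t <= C * f t \<and> f t <= C * ap a t"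
  shows "\<exists>a\<in>A. sim f (ap a)"
  using assms(1,2,5,6)
proof (induction A arbitrary: C rule: finite_induct)
  case empty
  then show ?case by simp
next
  case (insert a0 A)
  have a0: "0 < a0" and A: "\<forall>a\<in>A. 0 < a" using insert.prems by auto
  note near = insert.prems(3) and C = insert.prems(2)
  show ?case
  proof (cases "\<exists>a\<in>A. a0 \<asymp> a")
    case True
    then obtain a where a: "a \<in> A" "a0 \<asymp> a" by blast
    have ap: "0 < a" using a A by blast
    obtain n1 :: nat where n1: "a0 <= of_nat n1 * a" "n1 \<ge> 1" using a ap domE1[of a0 a] by (auto simp: asy_def)
    obtain n2 :: nat where n2: "a <= of_nat n2 * a0" "n2 \<ge> 1" using a a0 domE1[of a a0] by (auto simp: asy_def)
    define C' where "C' = C * (real n1 * real n2)"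
    have Cn: "C <= C'" "C * real n1 <= C'" "C * real n2 <= C'"
    proof -
      have r: "1 <= real n1" "1 <= real n2" using n1 n2 by auto
      then have "1 <= real n1 * real n2" "real n1 * 1 <= real n1 * real n2" "1 * real n2 <= real n1 * real n2"
        using mult_mono[of 1 "real n1" 1 "real n2"] by (simp, intro mult_left_mono, auto intro: mult_right_mono)
      then show "C <= C'" "C * real n1 <= C'" "C * real n2 <= C'"
        using C mult_left_mono[of 1 "real n1 * real n2" C] mult_left_mono[of "real n1" "real n1 * real n2" C]
          mult_left_mono[of "real n2" "real n1 * real n2" C] by (simp_all add: C'_def)
    qed
    have "EV t. \<forall>a\<in>A. 0 < ap a t"
      using A by (intro eventually_ball_finite insert.hyps) (simp add: ev_hf_pos)
    then have "EV t. \<exists>a\<in>A. ap a t <= C' * f t \<and> f t <= C' * ap a t"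
      using near ev_hf_nat_mult_le[OF n1(1)] ev_hf_nat_mult_le[OF n2(1)] f(2)
    proof eventually_elim
      case (elim t)
      have pos: "0 < ap a t" using elim(1) a by blast
      from elim(2) obtain b where b: "b \<in> insert a0 A" "ap b t <= C * f t" "f t <= C * ap b t" by blast
      show ?case
      proof (cases "b = a0")
        case True
        have "ap a t <= real n2 * (C * f t)" using elim(4) b(2) True by (meson mult_left_mono of_nat_0_le_iff order_trans)
        also have "\<dots> <= C' * f t" using mult_right_mono[OF Cn(3), of "f t"] elim(5) by (simp add: ac_simps)
        finally have 1: "ap a t <= C' * f t" .
        have "f t <= C * (real n1 * ap a t)" using b(3) True elim(3) C by (meson mult_left_mono order_trans zero_le_one)
        also have "\<dots> <= C' * ap a t" using mult_right_mono[OF Cn(2), of "ap a t"] pos by (simp add: ac_simps)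
        finally show ?thesis using 1 a by blast
      next
        case False
        then have "b \<in> A" using b by blast
        moreover have "C * f t <= C' * f t" "C * ap b t <= C' * ap b t"
          using Cn(1) elim(1,5) \<open>b \<in> A\<close> by (auto intro!: mult_right_mono)
        ultimately show ?thesis using b by (meson order_trans)
      qed
    qed
    moreover have "1 <= C'" using Cn(1) C by simp
    ultimately show ?thesis using insert.IH[OF A] by blast
  next
    case False
    have sep: "EV t. \<forall>a\<in>A. (2 * C * C) * ap a t < ap a0 t \<or> (2 * C * C) * ap a0 t < ap a t"
    proof (intro eventually_ball_finite insert.hyps ballI)
      fix a assume a: "a \<in> A"
      have C2: "0 < 2 * C * C" "0 < a" using C a A by auto
      from False a asy_cases[of a a0] have "a \<lless> a0 \<or> a0 \<lless> a" using asy_sym by blast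
      then show "EV t. (2 * C * C) * ap a t < ap a0 t \<or> (2 * C * C) * ap a0 t < ap a t"
      proof
        assume "a \<lless> a0"
        from ev_hf_ll[OF this C2(2) a0 C2(1)] show ?thesis by (rule eventually_mono) simp
      next
        assume "a0 \<lless> a"
        from ev_hf_ll[OF this a0 C2(2) C2(1)] show ?thesis by (rule eventually_mono) simp
      qed
    qed
    have away: "EV t. (ap a0 t <= C * f t \<and> f t <= C * ap a0 t) \<or>
       ((2 * C * f t < ap a0 t \<or> 2 * C * ap a0 t < f t) \<and> (\<exists>a\<in>A. ap a t <= C * f t \<and> f t <= C * ap a t))"
      using sep near
    proof eventually_elim
      case (elim t)
      from elim(2) obtain b where b: "b \<in> insert a0 A" "ap b t <= C * f t" "f t <= C * ap b t" by blast
      show ?case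
      proof (cases "b = a0")
        case False
        then have bA: "b \<in> A" using b by blast
        have "2 * C * f t < ap a0 t \<or> 2 * C * ap a0 t < f t"
          using elim(1)[rule_format, OF bA]
        proof
          assume "(2 * C * C) * ap b t < ap a0 t"
          moreover have "2 * C * f t <= 2 * C * (C * ap b t)" using b C by (intro mult_left_mono) auto
          ultimately show ?thesis by (simp add: mult.assoc)
        next
          assume "(2 * C * C) * ap a0 t < ap b t"
          then have "C * (2 * C * ap a0 t) < C * f t" using b by (simp add: ac_simps)
          then show ?thesis using C by simp
        qed
        then show ?thesis using bA b by blast
      qed (use b in blast)
    qed
    \<comment> \<open>The barriers \<open>a0 / (2 * C)\<close> and \<open>2 * C * a0\<close> are never met, so by continuity the function is
      eventually always below, above or between them.\<close>
    define h1 where "h1 t = 2 * C * f t - ap a0 t" for t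
    define h2 where "h2 t = f t - 2 * C * ap a0 t" for t
    have cont: "ev (isCont h1)" "ev (isCont h2)"
      using f(1) In_cont[OF In_ap[of a0]] unfolding h1_def h2_def
      by (eventually_elim, intro continuous_intros; simp)+
    have nz: "EV t. h1 t ~= 0" "EV t. h2 t ~= 0"
    proof -
      have p: "EV t. 0 < ap a0 t" using a0 by (rule ev_hf_pos)
      show "EV t. h1 t ~= 0"
        using away p f(2)
      proof eventually_elim
        case (elim t)
        have "f t < 2 * C * f t" "ap a0 t < 2 * C * ap a0 t" "0 < C * f t" using elim C by auto
        moreover have "2 * C * (2 * C * ap a0 t) = 2 * C * f t ==> 2 * C * ap a0 t = f t" using C by simp
        moreover have "2 * C * ap a0 t < f t ==> ap a0 t < 2 * C * f t" using calculation by linarith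
        ultimately show ?case using elim(1) by (auto simp: h1_def)
      qed
      show "EV t. h2 t ~= 0"
        using away p f(2)
      proof eventually_elim
        case (elim t)
        have "f t < 2 * C * f t" "ap a0 t < 2 * C * ap a0 t" "0 < C * ap a0 t" using elim C by auto
        moreover have "2 * C * f t < ap a0 t ==> f t < 2 * C * ap a0 t" using calculation by linarith
        ultimately show ?case using elim(1) by (auto simp: h2_def)
      qed
    qed
    have rest: "\<exists>a\<in>insert a0 A. sim f (ap a)" if h: "EV t. \<not> (ap a0 t <= C * f t \<and> f t <= C * ap a0 t)"
    proof -
      have "EV t. \<exists>a\<in>A. ap a t <= C * f t \<and> f t <= C * ap a t" using away h by eventually_elim blast
      then show ?thesis using insert.IH[OF A C] by blast
    qed
    have p: "EV t. 0 < ap a0 t" using a0 by (rule ev_hf_pos)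
    consider "EV t. h1 t < 0" | "EV t. 0 < h2 t" | "EV t. 0 < h1 t" "EV t. h2 t < 0"
      using const_sign[OF cont(1) nz(1)] const_sign[OF cont(2) nz(2)] by blast
    then show ?thesis
    proof cases
      case 1
      have "EV t. \<not> (ap a0 t <= C * f t \<and> f t <= C * ap a0 t)"
        using 1 f(2)
      proof eventually_elim
        case (elim t)
        have "0 < C * f t" using elim(2) C by simp
        then show ?case using elim(1) by (simp add: h1_def)
      qed
      then show ?thesis by (rule rest)
    next
      case 2
      have "EV t. \<not> (ap a0 t <= C * f t \<and> f t <= C * ap a0 t)"
        using 2 p
      proof eventually_elim
        case (elim t)
        have "0 < C * ap a0 t" using elim(2) C by simp
        then show ?case using elim(1) by (simp add: h2_def)
      qed
      then show ?thesis by (rule rest)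
    next
      case 3
      have "EV t. \<bar>f t\<bar> <= 2 * C * \<bar>ap a0 t\<bar> \<and> \<bar>ap a0 t\<bar> <= 2 * C * \<bar>f t\<bar>"
        using 3 p f(2) by eventually_elim (simp add: h1_def h2_def)
      then have "sim f (ap a0)" by (rule simI[rotated]) (use C in \<open>simp\<close>)
      then show ?thesis by blast
    qed
  qed
qed

text \<open>
  In a vanishing sum the largest term must be compensated by a second term of comparable size.
\<close>

lemma two_large_terms:
  fixes c :: "nat => real"
  assumes "(\<Sum>i\<le>n. c i) = 0" "c n ~= 0"
  shows "\<exists>i j. i < j \<and> j <= n \<and> c i ~= 0 \<and> c j ~= 0 \<and> \<bar>c i\<bar> <= real (Suc n) * \<bar>c j\<bar> \<and> \<bar>c j\<bar> <= real (Suc n) * \<bar>c i\<bar>"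
proof -
  define m where "m = Max ((\<lambda>i. \<bar>c i\<bar>) ` {..n})"
  have "m \<in> (\<lambda>i. \<bar>c i\<bar>) ` {..n}" unfolding m_def by (intro Max_in) auto
  then obtain i where i: "i <= n" "m = \<bar>c i\<bar>" by auto
  have le: "\<bar>c j\<bar> <= m" if "j <= n" for j unfolding m_def using that by (intro Max_ge) auto
  have m0: "0 < m" using le[of n] assms(2) by simp
  have "\<exists>j. j <= n \<and> j ~= i \<and> m <= real (Suc n) * \<bar>c j\<bar>"
  proof (rule ccontr)
    assume no: "\<not> (\<exists>j. j <= n \<and> j ~= i \<and> m <= real (Suc n) * \<bar>c j\<bar>)"
    have "\<bar>c j\<bar> <= m / real (Suc n)" if "j \<in> {..n} - {i}" for j
    proof -
      have "\<not> m <= real (Suc n) * \<bar>c j\<bar>" using no that by auto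
      then show ?thesis by (simp add: field_simps)
    qed
    then have "(\<Sum>j\<in>{..n}-{i}. \<bar>c j\<bar>) <= real (card ({..n}-{i})) * (m / real (Suc n))"
      by (intro sum_bounded_above) auto
    also have "\<dots> < m" using i m0 by (simp add: field_simps)
    finally have "\<bar>\<Sum>j\<in>{..n}-{i}. c j\<bar> < m" using sum_abs[of c "{..n}-{i}"] by linarith
    moreover have "(\<Sum>j\<le>n. c j) = c i + (\<Sum>j\<in>{..n}-{i}. c j)" using i by (intro sum.remove) auto
    ultimately show False using assms(1) i(2) by linarith
  qed
  then obtain j where j: "j <= n" "j ~= i" "m <= real (Suc n) * \<bar>c j\<bar>" by blast
  have cj: "c j ~= 0" using j(3) m0 by auto
  have "1 * m <= real (Suc n) * m" using m0 by (intro mult_right_mono) auto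
  then have "\<bar>c j\<bar> <= real (Suc n) * \<bar>c i\<bar>" using le[OF j(1)] i by simp
  moreover have "\<bar>c i\<bar> <= real (Suc n) * \<bar>c j\<bar>" using j(3) i by simp
  moreover have "c i ~= 0" using m0 i by auto
  ultimately show ?thesis using i j cj by (cases "i < j") (metis, metis linorder_neqE_nat)
qed

lemma power_two_sided:
  fixes a b C :: real
  assumes "0 <= a" "0 <= b" "1 <= C" "a <= C * b" "e <= N"
  shows "a ^ e <= C ^ N * b ^ e"
proof -
  have "a ^ e <= (C * b) ^ e" using assms by (intro power_mono) auto
  also have "\<dots> <= C ^ N * b ^ e" using assms
    by (auto simp: power_mult_distrib intro!: mult_right_mono power_increasing)
  finally show ?thesis .
qed

text \<open>
  At each time two terms \<open>c_i w^i\<close> and \<open>c_j w^j\<close> of the equation have comparable size, so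
  \<open>w^(j-i)\<close> is comparable to the quotient of the coefficients. Raising to a common power \<open>n!\<close>
  makes these statements comparable for different pairs, and \<open>select_class\<close> picks one pair.
\<close>

lemma root_value:
  assumes q: "q ~= 0" and root: "EV t. poly (pe q t) (w t) = 0" and w: "EV t. w t ~= 0" "ev (isCont w)"
  shows "\<exists>a. a ~= 0 \<and> sim (\<lambda>t. w t ^ fact (degree q)) (ap a)"
proof -
  define n where "n = degree q"
  define N :: nat where "N = fact n"
  define I where "I = {(i, j). i < j \<and> j <= n \<and> coeff q i ~= 0 \<and> coeff q j ~= 0}"
  define \<alpha> where "\<alpha> = (\<lambda>(i, j). \<bar>coeff q i / coeff q j\<bar> ^ (N div (j - i)))"
  have "I \<subseteq> {..n} \<times> {..n}" by (auto simp: I_def)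
  then have fI: "finite I" using finite_subset by blast
  define M where "M = real (Suc n)"
  have M: "1 <= M" by (simp add: M_def)
  have coeffs: "EV t. \<forall>p\<in>I. ap (\<alpha> p) t = \<bar>ap (coeff q (fst p)) t / ap (coeff q (snd p)) t\<bar> ^ (N div (snd p - fst p))"
  proof (intro eventually_ball_finite fI ballI)
    fix p assume "p \<in> I"
    obtain i j where p: "p = (i, j)" by (cases p)
    show "EV t. ap (\<alpha> p) t = \<bar>ap (coeff q (fst p)) t / ap (coeff q (snd p)) t\<bar> ^ (N div (snd p - fst p))"
      using ev_power[of "\<bar>coeff q i / coeff q j\<bar>" "N div (j - i)"] ev_abs[of "coeff q i / coeff q j"] ev_divide[of "coeff q i" "coeff q j"]
      by eventually_elim (simp add: p \<alpha>_def)
  qed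
  have cnz: "EV t. \<forall>i\<in>{..n}. coeff q i = 0 \<or> ap (coeff q i) t ~= 0"
  proof (intro eventually_ball_finite ballI)
    fix i show "EV t. coeff q i = 0 \<or> ap (coeff q i) t ~= 0"
      by (cases "coeff q i = 0") (use hf_nz in auto)
  qed simp
  have "\<exists>a\<in>\<alpha> ` I. sim (\<lambda>t. \<bar>w t\<bar> ^ N) (ap a)"
  proof (rule select_class[where C = "M ^ N"])
    show "finite (\<alpha> ` I)" using fI by simp
    show "\<forall>a\<in>\<alpha> ` I. 0 < a" by (auto simp: \<alpha>_def I_def)
    show "ev (isCont (\<lambda>t. \<bar>w t\<bar> ^ N))" using w(2) by eventually_elim (intro continuous_intros)
    show "EV t. 0 < \<bar>w t\<bar> ^ N" using w(1) by eventually_elim simp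
    show "1 <= M ^ N" using M by (rule one_le_power)
    show "EV t. \<exists>a\<in>\<alpha> ` I. ap a t <= M ^ N * \<bar>w t\<bar> ^ N \<and> \<bar>w t\<bar> ^ N <= M ^ N * ap a t"
      using root w(1) coeffs cnz ev_pe_nz[OF q]
    proof eventually_elim
      case (elim t)
      define c where "c i = ap (coeff q i) t * w t ^ i" for i
      have "(\<Sum>i\<le>n. c i) = 0" using elim(1,5) by (simp add: poly_altdef c_def n_def)
      moreover have "coeff q n ~= 0" using q by (simp add: n_def)
      then have "c n ~= 0" using elim(2,4) by (auto simp: c_def)
      ultimately obtain i j where ij: "i < j" "j <= n" "c i ~= 0" "c j ~= 0" "\<bar>c i\<bar> <= M * \<bar>c j\<bar>" "\<bar>c j\<bar> <= M * \<bar>c i\<bar>"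
        unfolding M_def using two_large_terms by blast
      have cc: "ap (coeff q i) t ~= 0" "ap (coeff q j) t ~= 0" using ij by (auto simp: c_def)
      then have I: "(i, j) \<in> I" using ij by (auto simp: I_def)
      define r where "r = \<bar>ap (coeff q i) t / ap (coeff q j) t\<bar>"
      define d where "d = j - i"
      have d: "0 < d" "d <= n" "j = i + d" using ij by (auto simp: d_def)
      have wi: "0 < \<bar>w t\<bar> ^ i" using elim(2) by simp
      have "\<bar>ap (coeff q i) t\<bar> * \<bar>w t\<bar> ^ i <= (M * \<bar>ap (coeff q j) t\<bar> * \<bar>w t\<bar> ^ d) * \<bar>w t\<bar> ^ i"
        using ij(5) by (simp add: c_def d(3) power_add abs_mult power_abs ac_simps)
      then have "\<bar>ap (coeff q i) t\<bar> <= M * \<bar>ap (coeff q j) t\<bar> * \<bar>w t\<bar> ^ d" using wi by (simp only: mult_le_cancel_right_pos)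
      then have r1: "r <= M * \<bar>w t\<bar> ^ d" using cc by (simp add: r_def abs_divide divide_le_eq ac_simps)
      have "(\<bar>ap (coeff q j) t\<bar> * \<bar>w t\<bar> ^ d) * \<bar>w t\<bar> ^ i <= (M * \<bar>ap (coeff q i) t\<bar>) * \<bar>w t\<bar> ^ i"
        using ij(6) by (simp add: c_def d(3) power_add abs_mult power_abs ac_simps)
      then have "\<bar>ap (coeff q j) t\<bar> * \<bar>w t\<bar> ^ d <= M * \<bar>ap (coeff q i) t\<bar>" using wi by (simp only: mult_le_cancel_right_pos)
      then have r2: "\<bar>w t\<bar> ^ d <= M * r" using cc by (simp add: r_def abs_divide le_divide_eq ac_simps)
      define e where "e = N div d"
      have "d dvd N" unfolding N_def using d by (intro dvd_fact) auto
      then have eN: "d * e = N" "e <= N" by (auto simp: e_def)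
      have wN: "\<bar>w t\<bar> ^ N = (\<bar>w t\<bar> ^ d) ^ e" by (simp flip: eN(1) power_mult)
      have re: "ap (\<alpha> (i, j)) t = r ^ e" using elim(3)[rule_format, OF I] by (simp add: r_def e_def d_def)
      have "r ^ e <= M ^ N * \<bar>w t\<bar> ^ N" "\<bar>w t\<bar> ^ N <= M ^ N * r ^ e" unfolding wN
        using r1 r2 M eN(2) by (auto intro!: power_two_sided simp: r_def)
      then show ?case using I re by (intro bexI[of _ "\<alpha> (i, j)"]) auto
    qed
  qed
  then obtain a where a: "a \<in> \<alpha> ` I" "sim (\<lambda>t. \<bar>w t\<bar> ^ N) (ap a)" by blast
  have "sim (\<lambda>t. w t ^ N) (\<lambda>t. \<bar>w t\<bar> ^ N)" by (rule simI[of 1]) (simp_all add: power_abs)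
  then have "sim (\<lambda>t. w t ^ N) (ap a)" using a(2) sim_trans by blast
  moreover have "a ~= 0" using a(1) by (auto simp: \<alpha>_def I_def)
  ultimately show ?thesis by (auto simp: N_def n_def)
qed

lemma ev_pe_pcompose: "EV t. pe (pcompose p r) t = pcompose (pe p t) (pe r t)"
proof (induction p)
  case (pCons a p)
  from pCons.IH show ?case
    using ev_pe_add[of "[:a:]" "r * pcompose p r"] ev_pe_mult[of r "pcompose p r"]
    by eventually_elim (simp add: pcompose_pCons)
qed simp

lemma poly_no_zero_same_sign:
  fixes p :: "real poly"
  assumes "\<And>y. y \<in> S ==> poly p y ~= 0" "u \<in> S" "v \<in> S" "{u..v} \<subseteq> S" "{v..u} \<subseteq> S"
  shows "0 < poly p u * poly p v"
proof (rule ccontr)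
  assume "\<not> 0 < poly p u * poly p v"
  moreover have nz: "poly p u ~= 0" "poly p v ~= 0" using assms by auto
  ultimately have neg: "poly p u * poly p v < 0" by (simp add: less_le not_less)
  then have "u ~= v" by (metis not_square_less_zero)
  then consider "u < v" | "v < u" by linarith
  then show False
  proof cases
    case 1
    then obtain x where x: "u < x" "x < v" "poly p x = 0" using poly_IVT[OF 1 neg] by blast
    then have "x \<in> S" using subsetD[OF assms(4), of x] by simp
    then show False using assms(1) x by blast
  next
    case 2
    then obtain x where x: "v < x" "x < u" "poly p x = 0" using poly_IVT[OF 2] neg by (auto simp: mult.commute)
    then have "x \<in> S" using subsetD[OF assms(5), of x] by simp
    then show False using assms(1) x by blast
  qed
qed

lemma poly_unique_root:
  fixes p :: "real poly"
  assumes crit: "\<And>y. l < y ==> y < r ==> poly (pderiv p) y ~= 0"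
    and "l <= y1" "y1 < y2" "y2 <= r" "poly p y1 = 0" "poly p y2 = 0"
  shows False
proof -
  obtain x where x: "x > y1" "x < y2" "poly p y2 - poly p y1 = (y2 - y1) * poly (pderiv p) x"
    using poly_MVT[OF \<open>y1 < y2\<close>] by blast
  then have "poly (pderiv p) x = 0" using assms by simp
  then show False using crit[of x] x assms by auto
qed

lemma poly_root_sign_change:
  fixes p :: "real poly"
  assumes crit: "\<And>y. l < y ==> y < r ==> poly (pderiv p) y ~= 0"
    and y: "l < y" "y < r" "poly p y = 0" and uv: "l <= u" "u < y" "y < v" "v <= r"
  shows "poly p u * poly p v < 0"
proof -
  obtain x1 where x1: "x1 > u" "x1 < y" "poly p y - poly p u = (y - u) * poly (pderiv p) x1"
    using poly_MVT[OF uv(2)] by blast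
  obtain x2 where x2: "x2 > y" "x2 < v" "poly p v - poly p y = (v - y) * poly (pderiv p) x2"
    using poly_MVT[OF uv(3)] by blast
  have "0 < poly (pderiv p) x1 * poly (pderiv p) x2"
    by (rule poly_no_zero_same_sign[of "{l<..<r}"]) (use crit x1 x2 y uv in auto)
  then have "0 < ((y - u) * (v - y)) * (poly (pderiv p) x1 * poly (pderiv p) x2)" using uv by simp
  moreover have "poly p u * poly p v = - (((y - u) * (v - y)) * (poly (pderiv p) x1 * poly (pderiv p) x2))"
  proof -
    have "poly p u = - ((y - u) * poly (pderiv p) x1)" "poly p v = (v - y) * poly (pderiv p) x2"
      using x1(3) x2(3) y(3) by linarith+
    then show ?thesis by (simp only: mult_minus_left mult_minus_right ac_simps)
  qed
  ultimately show ?thesis by linarith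
qed

text \<open>
  The implicit function theorem for a simple root that is the only root between \<open>b1\<close> and \<open>b2\<close>: a
  sign change of \<open>p\<close> around the root persists for nearby parameters, which gives continuity, and
  the mean value theorem gives the derivative.
\<close>

lemma implicit_root_derivative:
  fixes z b1 b2 :: "real => real"
  assumes crit: "EV t. \<forall>y. b1 t < y \<and> y < b2 t --> poly (pderiv (pe p t)) y ~= 0"
    and b: "ev (isCont b1)" "ev (isCont b2)"
    and z: "EV t. b1 t < z t \<and> z t < b2 t \<and> poly (pe p t) (z t) = 0"
  shows "hasd z (\<lambda>t. - poly (pe (Dpoly p) t) (z t) / poly (pe (pderiv p) t) (z t))"
proof -
  have "EV t. (\<forall>y. b1 t < y \<and> y < b2 t --> poly (pderiv (pe p t)) y ~= 0) \<and>
      b1 t < z t \<and> z t < b2 t \<and> poly (pe p t) (z t) = 0 \<and> pe (pderiv p) t = pderiv (pe p t)"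
    using crit z ev_pe_pderiv[of p] by eventually_elim blast
  from ev_nhds[OF this] show ?thesis
    using b pe_tendsto[of p] pe_tendsto[of "pderiv p"] pe_has_derivative[of p]
  proof eventually_elim
    case (elim t0)
    define A where "A t \<longleftrightarrow> (\<forall>y. b1 t < y \<and> y < b2 t --> poly (pderiv (pe p t)) y ~= 0) \<and>
      b1 t < z t \<and> z t < b2 t \<and> poly (pe p t) (z t) = 0 \<and> pe (pderiv p) t = pderiv (pe p t)" for t
    have A: "\<forall>\<^sub>F t in nhds t0. A t" using elim(1) by (simp add: A_def)
    then have A0: "A t0" by (rule eventually_nhds_x_imp_x)
    define z0 where "z0 = z t0"
    have z0: "b1 t0 < z0" "z0 < b2 t0" "poly (pe p t0) z0 = 0" using A0 by (auto simp: A_def z0_def)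
    have at: "at t0 <= nhds t0" by (simp add: at_within_def)
    have Aat: "\<forall>\<^sub>F t in at t0. A t" using A at filter_leD by blast
    have contz: "(z \<longlongrightarrow> z0) (at t0)"
    proof (rule tendstoI)
      fix \<epsilon> :: real assume "0 < \<epsilon>"
      define m where "m = min \<epsilon> (min (z0 - b1 t0) (b2 t0 - z0))"
      have m: "0 < m" "m <= \<epsilon>" "m <= z0 - b1 t0" "m <= b2 t0 - z0" using \<open>0 < \<epsilon>\<close> z0 by (auto simp: m_def)
      define \<delta> where "\<delta> = m / 2"
      have \<delta>: "0 < \<delta>" "\<delta> < \<epsilon>" "b1 t0 < z0 - \<delta>" "z0 + \<delta> < b2 t0"
        using m unfolding \<delta>_def by linarith+
      define u where "u = z0 - \<delta>"
      define v where "v = z0 + \<delta>"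
      have sgn: "poly (pe p t0) u * poly (pe p t0) v < 0"
        by (rule poly_root_sign_change[of "b1 t0" "b2 t0" _ z0]) (use A0 z0 \<delta> in \<open>auto simp: A_def u_def v_def\<close>)
      have t1: "((\<lambda>s. poly (pe p s) u * poly (pe p s) v) \<longlongrightarrow> poly (pe p t0) u * poly (pe p t0) v) (at t0)"
        using elim(4) at by (intro tendsto_mult) auto
      have e1: "\<forall>\<^sub>F s in at t0. poly (pe p s) u * poly (pe p s) v < 0"
        using order_tendstoD(2)[OF t1 sgn] .
      have e2: "\<forall>\<^sub>F s in at t0. b1 s < u"
        using order_tendstoD(2)[of b1 "b1 t0" "at t0" u] elim(2) \<delta> by (simp add: isCont_def u_def)
      have e3: "\<forall>\<^sub>F s in at t0. v < b2 s"
        using order_tendstoD(1)[of b2 "b2 t0" "at t0" v] elim(3) \<delta> by (simp add: isCont_def v_def)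
      show "\<forall>\<^sub>F s in at t0. dist (z s) z0 < \<epsilon>"
        using e1 e2 e3 Aat
      proof eventually_elim
        case (elim s)
        have "u < v" using \<delta> by (simp add: u_def v_def)
        from poly_IVT[OF this elim(1)] obtain y where y: "u < y" "y < v" "poly (pe p s) y = 0" by blast
        have "y = z s"
          using poly_unique_root[of "b1 s" "b2 s" "pe p s" y "z s"] poly_unique_root[of "b1 s" "b2 s" "pe p s" "z s" y]
            elim y by (auto simp: A_def) (metis less_eq_real_def linorder_neqE_linordered_idom order_less_trans)
        then show ?case using y \<delta> by (simp add: u_def v_def dist_real_def abs_less_iff)
      qed
    qed
    have mvt: "\<exists>x. \<bar>x - z0\<bar> <= \<bar>z s - z0\<bar> \<and>
        poly (pe p s) (z s) - poly (pe p s) z0 = (z s - z0) * poly (pderiv (pe p s)) x" for s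
    proof -
      consider "z s < z0" | "z s = z0" | "z0 < z s" by linarith
      then show ?thesis
      proof cases
        case 1
        from poly_MVT[OF this, of "pe p s"] obtain x where "x > z s" "x < z0"
          "poly (pe p s) z0 - poly (pe p s) (z s) = (z0 - z s) * poly (pderiv (pe p s)) x" by blast
        then show ?thesis by (intro exI[of _ x]) (auto simp: algebra_simps)
      next
        case 3
        from poly_MVT[OF this, of "pe p s"] obtain x where "x > z0" "x < z s"
          "poly (pe p s) (z s) - poly (pe p s) z0 = (z s - z0) * poly (pderiv (pe p s)) x" by blast
        then show ?thesis by (intro exI[of _ x]) auto
      qed simp
    qed
    then obtain \<xi> where \<xi>: "\<And>s. \<bar>\<xi> s - z0\<bar> <= \<bar>z s - z0\<bar>"
      "\<And>s. poly (pe p s) (z s) - poly (pe p s) z0 = (z s - z0) * poly (pderiv (pe p s)) (\<xi> s)" by metis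
    have "(\<xi> \<longlongrightarrow> z0) (at t0)"
    proof -
      have "((\<lambda>s. \<xi> s - z0) \<longlongrightarrow> 0) (at t0)"
        by (rule tendsto_0_le[where f = "\<lambda>s. z s - z0" and K = 1])
          (use \<xi>(1) contz in \<open>simp_all add: LIM_zero_iff\<close>)
      then show ?thesis by (simp add: LIM_zero_iff)
    qed
    then have q: "((\<lambda>s. poly (pe (pderiv p) s) (\<xi> s)) \<longlongrightarrow> poly (pe (pderiv p) t0) z0) (at t0)"
      using elim(5) at by blast
    have nz: "poly (pe (pderiv p) t0) z0 ~= 0" using A0 z0 by (simp add: A_def)
    have "((\<lambda>s. poly (pe p s) z0) has_real_derivative poly (pe (Dpoly p) t0) z0) (at t0)"
      using elim(6)[rule_format, of "\<lambda>_. z0" 0] by simp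
    then have num: "((\<lambda>s. (poly (pe p s) z0 - poly (pe p t0) z0) / (s - t0)) \<longlongrightarrow> poly (pe (Dpoly p) t0) z0) (at t0)"
      by (simp add: has_field_derivative_iff)
    have "((\<lambda>s. - ((poly (pe p s) z0 - poly (pe p t0) z0) / (s - t0)) / poly (pe (pderiv p) s) (\<xi> s))
        \<longlongrightarrow> - poly (pe (Dpoly p) t0) z0 / poly (pe (pderiv p) t0) z0) (at t0)"
      by (intro tendsto_divide tendsto_minus num q nz)
    moreover have "\<forall>\<^sub>F s in at t0. - ((poly (pe p s) z0 - poly (pe p t0) z0) / (s - t0)) / poly (pe (pderiv p) s) (\<xi> s)
        = (z s - z t0) / (s - t0)"
      using Aat tendsto_imp_eventually_ne[OF q nz] eventually_neq_at_within[of t0]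
    proof eventually_elim
      case (elim s)
      have "- poly (pe p s) z0 = (z s - z0) * poly (pe (pderiv p) s) (\<xi> s)"
        using \<xi>(2)[of s] elim(1) by (simp add: A_def)
      then show ?case using elim(2,3) z0(3) by (simp add: z0_def field_simps)
    qed
    ultimately have "((\<lambda>s. (z s - z t0) / (s - t0)) \<longlongrightarrow> - poly (pe (Dpoly p) t0) z0 / poly (pe (pderiv p) t0) z0) (at t0)"
      by (rule Lim_transform_eventually)
    then show ?case by (simp add: has_field_derivative_iff z0_def)
  qed
qed

lemma ev_ne_not_ev_eq: "(EV t. F t ~= c) ==> \<not> (EV t. F t = c)"
proof
  assume "EV t. F t ~= c" "EV t. F t = c"
  then have "EV t. False" by eventually_elim simp
  then show False by simp
qed

definition units :: "(real => real) set" where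
  "units = {F. In F \<and> \<not> (EV t. F t = 0)}"

lemma vgroup_units: "vgroup units"
  unfolding vgroup_def
proof (intro conjI ballI allI impI)
  fix u v assume u: "u \<in> units" and v: "v \<in> units"
  have unz: "EV t. u t ~= 0" and vnz: "EV t. v t ~= 0"
    using u v In_good good_nz by (auto simp: units_def)
  have "EV t. u t * v t ~= 0" using unz vnz by eventually_elim simp
  from ev_ne_not_ev_eq[OF this] show "(\<lambda>t. u t * v t) \<in> units" using u v In_mult unfolding units_def by blast
next
  fix u assume u: "u \<in> units"
  show g: "good u" using u In_good by (auto simp: units_def)
  have "EV t. inverse (u t) ~= 0" using good_nz[OF g] by eventually_elim simp
  from ev_ne_not_ev_eq[OF this] show "(\<lambda>t. inverse (u t)) \<in> units" using u In_inverse unfolding units_def by blast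
qed (simp add: units_def)

text \<open>
  The root generates an extension of the Hardy field: its derivative is a rational function of it
  by implicit differentiation, a difference \<open>z - \<beta>\<close> is a root of the shifted polynomial and has a
  value by \<open>root_value\<close>, and a polynomial in \<open>z\<close> can be reduced modulo \<open>p\<close> to degree at most \<open>n\<close>,
  where the roots are known by assumption.
\<close>

lemma root_between:
  assumes rc: "roots_in_hf n" and dp: "degree p = Suc n" and b12: "b1 < b2"
    and crit: "EV t. \<forall>y. ap b1 t < y \<and> y < ap b2 t --> poly (pderiv (pe p t)) y ~= 0"
    and sgn: "poly p b1 * poly p b2 < 0"
  shows "\<exists>c. (EV t. \<forall>y. ap b1 t < y \<and> y < ap b2 t \<and> poly (pe p t) y = 0 --> y = ap c t)"
proof -
  have pnz: "p ~= 0" "pderiv p ~= 0" using dp by (auto simp: pderiv_eq_0_iff)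
  define z where "z t = (SOME y. ap b1 t < y \<and> y < ap b2 t \<and> poly (pe p t) y = 0)" for t
  have lt: "EV t. ap b1 t < ap b2 t" using b12 by (simp add: hf_less_def)
  have "EV t. ap (poly p b1 * poly p b2) t < ap 0 t" using sgn unfolding hf_less_def .
  then have "EV t. poly (pe p t) (ap b1 t) * poly (pe p t) (ap b2 t) < 0"
    using ev_mult[of "poly p b1" "poly p b2"] ev_pe_poly[of p b1] ev_pe_poly[of p b2] by eventually_elim simp
  with lt have z: "EV t. ap b1 t < z t \<and> z t < ap b2 t \<and> poly (pe p t) (z t) = 0"
  proof eventually_elim
    case (elim t)
    from poly_IVT[OF elim] have "\<exists>y. ap b1 t < y \<and> y < ap b2 t \<and> poly (pe p t) y = 0" by blast
    then show ?case unfolding z_def by (rule someI_ex)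
  qed
  have uniq: "EV t. \<forall>y. ap b1 t < y \<and> y < ap b2 t \<and> poly (pe p t) y = 0 --> y = z t"
    using z crit
  proof eventually_elim
    case (elim t)
    show ?case
    proof (intro allI impI)
      fix y assume y: "ap b1 t < y \<and> y < ap b2 t \<and> poly (pe p t) y = 0"
      show "y = z t"
      proof (rule linorder_cases[of y "z t"])
        assume "y < z t"
        then show ?thesis using poly_unique_root[of "ap b1 t" "ap b2 t" "pe p t" y "z t"] elim y by auto
      next
        assume "z t < y"
        then show ?thesis using poly_unique_root[of "ap b1 t" "ap b2 t" "pe p t" "z t" y] elim y by auto
      qed
    qed
  qed
  have dz: "hasd z (\<lambda>t. - poly (pe (Dpoly p) t) (z t) / poly (pe (pderiv p) t) (z t))"
    by (rule implicit_root_derivative[OF crit _ _ z]) (rule In_cont, simp)+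
  have base: "has_val units (\<lambda>t. z t - ap \<beta> t)" for \<beta>
  proof (cases "b1 < \<beta> \<and> \<beta> < b2 \<and> poly p \<beta> = 0")
    case True
    then have "EV t. ap b1 t < ap \<beta> t" "EV t. ap \<beta> t < ap b2 t" "EV t. poly (pe p t) (ap \<beta> t) = 0"
      using ev_pe_poly[of p \<beta>] by (auto simp: hf_less_def elim: eventually_mono)
    then have "EV t. z t - ap \<beta> t = 0" using uniq by eventually_elim auto
    then show ?thesis by (simp add: has_val_def)
  next
    case False
    have ne: "EV t. z t - ap \<beta> t ~= 0"
    proof -
      from False consider "\<not> b1 < \<beta>" | "\<not> \<beta> < b2" | "poly p \<beta> ~= 0" by blast
      then show ?thesis
      proof cases
        case 1
        from hf_not_less_ev[OF this] z show ?thesis by eventually_elim auto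
      next
        case 2
        from hf_not_less_ev[OF this] z show ?thesis by eventually_elim auto
      next
        case 3
        from hf_nz[OF this] ev_pe_poly[of p \<beta>] z show ?thesis by eventually_elim auto
      qed
    qed
    define q where "q = pcompose p [:\<beta>, 1:]"
    have q0: "q ~= 0" using pcompose_eq_0[of p "[:\<beta>, 1:]"] pnz by (auto simp: q_def)
    have "EV t. poly (pe q t) (z t - ap \<beta> t) = 0"
      using ev_pe_pcompose[of p "[:\<beta>, 1:]"] ev_one z
      by eventually_elim (simp add: q_def poly_pcompose)
    moreover have "ev (isCont (\<lambda>t. z t - ap \<beta> t))"
      using hasd_cont[OF dz] In_cont[OF In_ap[of \<beta>]] by eventually_elim (intro continuous_intros)
    ultimately obtain a where a: "a ~= 0" "sim (\<lambda>t. (z t - ap \<beta> t) ^ fact (degree q)) (ap a)"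
      using root_value[OF q0 _ ne] by blast
    have "ap a \<in> units" using a(1) by (simp add: units_def flip: hf_zero_iff)
    moreover have "1 <= (fact (degree q) :: nat)" by (rule fact_ge_1)
    ultimately show ?thesis unfolding has_val_def using a(2) by blast
  qed
  have val: "has_val units (\<lambda>t. poly (pe r t) (z t))" for r
  proof -
    have "degree (r mod p) <= n" using degree_mod_less'[of p r] pnz dp by (cases "r mod p = 0") auto
    then have "has_val units (\<lambda>t. poly (pe (r mod p) t) (z t))"
      using has_val_poly[OF rc vgroup_units base] by blast
    moreover have "EV t. poly (pe (r mod p) t) (z t) = poly (pe r t) (z t)"
    proof -
      have "r = (r div p) * p + r mod p" by simp
      then have "EV t. pe r t = pe ((r div p) * p) t + pe (r mod p) t"
        using ev_pe_add[of "(r div p) * p" "r mod p"] by simp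
      then show ?thesis using ev_pe_mult[of "r div p" p] z
      proof eventually_elim
        case (elim t)
        show ?case unfolding elim(1,2) using elim(3) by simp
      qed
    qed
    ultimately show ?thesis by (rule has_val_cong)
  qed
  have "In z"
  proof (rule ext_in_hf_val[OF dz _ vgroup_units val])
    show "frac_in z (\<lambda>t. - poly (pe (Dpoly p) t) (z t) / poly (pe (pderiv p) t) (z t))"
      unfolding frac_in_def
    proof (intro exI conjI)
      have nz: "EV t. poly (pe (pderiv p) t) (z t) ~= 0"
        using crit z ev_pe_pderiv[of p] by eventually_elim auto
      show "\<not> (EV t. poly (pe (pderiv p) t) (z t) = 0)"
        by (rule ev_ne_not_ev_eq[OF nz])
      show "EV t. - poly (pe (Dpoly p) t) (z t) / poly (pe (pderiv p) t) (z t) =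
         poly (pe (smult (-1) (Dpoly p)) t) (z t) / poly (pe (pderiv p) t) (z t)"
        using ev_pe_smult[of "-1" "Dpoly p"] ev_uminus[of 1] ev_one
      proof eventually_elim
        case (elim t)
        show ?case unfolding elim(1) by (simp add: elim(2,3))
      qed
    qed
  qed
  then have "EV t. ap (mk z) t = z t" by (rule ap_mk)
  then have "EV t. \<forall>y. ap b1 t < y \<and> y < ap b2 t \<and> poly (pe p t) y = 0 --> y = ap (mk z) t"
    using uniq by eventually_elim simp
  then show ?thesis by blast
qed

lemma ev_sum: "finite I ==> (EV t. ap (\<Sum>i\<in>I. f i) t = (\<Sum>i\<in>I. ap (f i) t))"
proof (induction I rule: finite_induct)
  case (insert i I)
  from insert.IH show ?case using ev_add[of "f i" "\<Sum>i\<in>I. f i"] by eventually_elim (use insert.hyps in simp)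
qed simp

lemma real_root_bound:
  fixes p :: "real poly"
  assumes "poly p y = 0" "p ~= 0"
  shows "\<bar>y\<bar> < 2 + (\<Sum>i<degree p. \<bar>coeff p i / lead_coeff p\<bar>)" (is "_ < 2 + ?S")
proof (cases "\<bar>y\<bar> <= 1")
  case True
  moreover have "0 <= ?S" by (intro sum_nonneg) simp
  ultimately show ?thesis by linarith
next
  case False
  have "degree p ~= 0"
  proof
    assume "degree p = 0"
    then obtain a where "p = [:a:]" by (metis degree_eq_zeroE)
    then show False using assms by simp
  qed
  then obtain m where m: "degree p = Suc m" using not0_implies_Suc by blast
  have l: "lead_coeff p ~= 0" using assms by simp
  have "0 = (\<Sum>i\<le>Suc m. coeff p i * y ^ i)" using assms(1) by (simp add: poly_altdef m)
  also have "\<dots> = (\<Sum>i<Suc m. coeff p i * y ^ i) + lead_coeff p * y ^ Suc m"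
    by (simp add: m lessThan_Suc_atMost)
  finally have "y ^ Suc m = - (\<Sum>i<Suc m. coeff p i * y ^ i) / lead_coeff p" using l by (simp add: field_simps)
  then have "y ^ Suc m = - (\<Sum>i<Suc m. coeff p i / lead_coeff p * y ^ i)"
    by (simp only: sum_divide_distrib minus_divide_left[symmetric] times_divide_eq_left)
  then have "\<bar>y ^ Suc m\<bar> <= (\<Sum>i<Suc m. \<bar>coeff p i / lead_coeff p * y ^ i\<bar>)"
    by (simp only: abs_minus_cancel sum_abs)
  also have "\<dots> <= (\<Sum>i<Suc m. \<bar>coeff p i / lead_coeff p\<bar> * \<bar>y\<bar> ^ m)"
    unfolding abs_mult power_abs using False
    by (intro sum_mono mult_left_mono power_increasing) auto
  also have "\<dots> = ?S * \<bar>y\<bar> ^ m" by (simp only: m sum_distrib_right)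
  finally have "\<bar>y\<bar> * \<bar>y\<bar> ^ m <= ?S * \<bar>y\<bar> ^ m" by (simp add: abs_mult power_abs)
  then have "\<bar>y\<bar> <= ?S" using False by (simp add: mult_le_cancel_right zero_less_power)
  then show ?thesis by simp
qed

lemma hf_root_bound:
  assumes "p ~= 0"
  shows "\<exists>R. (EV t. \<forall>y. poly (pe p t) y = 0 --> \<bar>y\<bar> < ap R t)"
proof -
  define n where "n = degree p"
  define S where "S = (\<Sum>i<n. \<bar>coeff p i / lead_coeff p\<bar>)"
  have s: "EV t. \<forall>i\<in>{..<n}. ap \<bar>coeff p i / lead_coeff p\<bar> t = \<bar>ap (coeff p i) t / ap (lead_coeff p) t\<bar>"
  proof (intro eventually_ball_finite ballI)
    fix i show "EV t. ap \<bar>coeff p i / lead_coeff p\<bar> t = \<bar>ap (coeff p i) t / ap (lead_coeff p) t\<bar>"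
      using ev_abs[of "coeff p i / lead_coeff p"] ev_divide[of "coeff p i" "lead_coeff p"] by eventually_elim simp
  qed simp
  have "EV t. ap (cst 2 + S) t = 2 + (\<Sum>i<n. \<bar>ap (coeff p i) t / ap (lead_coeff p) t\<bar>)"
    using ev_add[of "cst 2" S] ev_cst[of 2] ev_sum[of "{..<n}" "\<lambda>i. \<bar>coeff p i / lead_coeff p\<bar>", folded S_def, OF finite_lessThan] s
    by eventually_elim (simp cong: sum.cong_simp)
  then have "EV t. \<forall>y. poly (pe p t) y = 0 --> \<bar>y\<bar> < ap (cst 2 + S) t"
    using ev_pe_nz[OF assms]
  proof eventually_elim
    case (elim t)
    show ?case using real_root_bound[of "pe p t"] elim by (simp add: n_def)
  qed
  then show ?thesis by blast
qed

text \<open>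
  Induction on the degree by Rolle's theorem: between consecutive critical points, which lie in
  the field by the induction hypothesis, there is at most one root. A bound \<open>R\<close> for all roots
  closes the partition at both ends.
\<close>

lemma roots_in_hf: "roots_in_hf n"
proof (induction n)
  case 0
  show ?case unfolding roots_in_hf_def
  proof (intro allI impI)
    fix p :: "hf poly" assume "p ~= 0" "degree p <= 0"
    then obtain a where p: "p = [:a:]" "a ~= 0" by (metis degree_eq_zeroE le_0_eq pCons_eq_0_iff)
    have "EV t. \<forall>y. poly (pe p t) y = 0 --> (\<exists>b\<in>{}. y = ap b t)"
      using hf_nz[OF p(2)] by eventually_elim (simp add: p)
    then show "\<exists>B. finite B \<and> (EV t. \<forall>y. poly (pe p t) y = 0 --> (\<exists>b\<in>B. y = ap b t))" by blast
  qed
next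
  case (Suc n)
  show ?case unfolding roots_in_hf_def
  proof (intro allI impI)
    fix p :: "hf poly" assume p: "p ~= 0" "degree p <= Suc n"
    show "\<exists>B. finite B \<and> (EV t. \<forall>y. poly (pe p t) y = 0 --> (\<exists>b\<in>B. y = ap b t))"
    proof (cases "degree p <= n")
      case True
      then show ?thesis using Suc.IH p(1) unfolding roots_in_hf_def by blast
    next
      case False
      then have dp: "degree p = Suc n" using p by simp
      have "pderiv p ~= 0" "degree (pderiv p) <= n" using dp by (auto simp: pderiv_eq_0_iff degree_pderiv)
      then obtain B1 where B1: "finite B1" "EV t. \<forall>y. poly (pe (pderiv p) t) y = 0 --> (\<exists>b\<in>B1. y = ap b t)"
        using Suc.IH unfolding roots_in_hf_def by blast
      obtain R where R: "EV t. \<forall>y. poly (pe p t) y = 0 --> \<bar>y\<bar> < ap R t" using hf_root_bound[OF p(1)] by blast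
      define B where "B = insert R (insert (- R) B1)"
      have fB: "finite B" using B1 by (simp add: B_def)
      have order: "EV t. \<forall>b\<in>B. \<forall>b'\<in>B. b < b' --> ap b t < ap b' t"
      proof (intro eventually_ball_finite fB ballI)
        fix b b' show "EV t. b < b' --> ap b t < ap b' t"
          by (cases "b < b'") (auto simp: hf_less_def)
      qed
      have signs: "EV t. \<forall>b\<in>B. \<forall>b'\<in>B. \<not> poly p b * poly p b' < 0 -->
          0 <= poly (pe p t) (ap b t) * poly (pe p t) (ap b' t)"
      proof (intro eventually_ball_finite fB ballI)
        fix b b' show "EV t. \<not> poly p b * poly p b' < 0 --> 0 <= poly (pe p t) (ap b t) * poly (pe p t) (ap b' t)"
        proof (cases "poly p b * poly p b' < 0")
          case False
          from hf_not_less_ev[OF this] ev_mult[of "poly p b" "poly p b'"] ev_pe_poly[of p b] ev_pe_poly[of p b']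
          show ?thesis by eventually_elim simp
        qed simp
      qed
      define I where "I = {(b, b'). b \<in> B \<and> b' \<in> B \<and> b < b' \<and> (\<forall>c\<in>B. \<not> (b < c \<and> c < b')) \<and> poly p b * poly p b' < 0}"
      have "I \<subseteq> B \<times> B" by (auto simp: I_def)
      then have fI: "finite I" using fB finite_subset by blast
      have crit: "EV t. \<forall>b\<in>B. \<forall>b'\<in>B. (\<forall>c\<in>B. \<not> (b < c \<and> c < b')) -->
          (\<forall>y. ap b t < y \<and> y < ap b' t --> poly (pderiv (pe p t)) y ~= 0)"
        using B1(2) order ev_pe_pderiv[of p]
      proof eventually_elim
        case (elim t)
        show ?case
        proof (intro ballI impI allI notI)
          fix b b' y assume b: "b \<in> B" "b' \<in> B" "\<forall>c\<in>B. \<not> (b < c \<and> c < b')" "ap b t < y \<and> y < ap b' t"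
            "poly (pderiv (pe p t)) y = 0"
          then obtain c where c: "c \<in> B1" "y = ap c t" using elim(1,3) by auto
          have cB: "c \<in> B" using c by (simp add: B_def)
          have "b < c" using elim(2) b(1,4) c cB by (metis less_asym less_irrefl linorder_neqE)
          moreover have "c < b'" using elim(2) b(2,4) c cB by (metis less_asym less_irrefl linorder_neqE)
          ultimately show False using b(3) cB by blast
        qed
      qed
      have "\<forall>i\<in>I. \<exists>c. (EV t. \<forall>y. ap (fst i) t < y \<and> y < ap (snd i) t \<and> poly (pe p t) y = 0 --> y = ap c t)"
      proof
        fix i assume iI: "i \<in> I"
        obtain b b' where i: "i = (b, b')" by (cases i)
        have b: "b \<in> B" "b' \<in> B" "b < b'" "\<forall>c\<in>B. \<not> (b < c \<and> c < b')" "poly p b * poly p b' < 0"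
          using iI unfolding i I_def by auto
        have "EV t. \<forall>y. ap b t < y \<and> y < ap b' t --> poly (pderiv (pe p t)) y ~= 0"
          using crit
        proof eventually_elim
          case (elim t)
          from elim[rule_format, OF b(1,2)] b(4) show ?case by blast
        qed
        from root_between[OF Suc.IH dp b(3) this b(5)]
        show "\<exists>c. (EV t. \<forall>y. ap (fst i) t < y \<and> y < ap (snd i) t \<and> poly (pe p t) y = 0 --> y = ap c t)"
          unfolding i fst_conv snd_conv .
      qed
      from bchoice[OF this] obtain c where
        c: "\<forall>i\<in>I. (EV t. \<forall>y. ap (fst i) t < y \<and> y < ap (snd i) t \<and> poly (pe p t) y = 0 --> y = ap (c i) t)" ..
      have cI: "EV t. \<forall>i\<in>I. \<forall>y. ap (fst i) t < y \<and> y < ap (snd i) t \<and> poly (pe p t) y = 0 --> y = ap (c i) t"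
        using c by (intro eventually_ball_finite fI)
      have "EV t. \<forall>y. poly (pe p t) y = 0 --> (\<exists>b\<in>B \<union> c ` I. y = ap b t)"
        using R order signs crit cI ev_uminus[of R]
      proof eventually_elim
        case (elim t)
        show ?case
        proof (intro allI impI)
          fix y assume y: "poly (pe p t) y = 0"
          show "\<exists>b\<in>B \<union> c ` I. y = ap b t"
          proof (cases "\<exists>b\<in>B. y = ap b t")
            case False
            define L where "L = {b \<in> B. ap b t < y}"
            define U where "U = {b \<in> B. y < ap b t}"
            have LU: "finite L" "finite U" "B = L \<union> U" using fB False by (auto simp: L_def U_def)
            have "- R \<in> L" "R \<in> U" using elim(1)[rule_format, OF y] elim(6) by (auto simp: L_def U_def B_def)
            then have ne: "L ~= {}" "U ~= {}" by auto
            define b where "b = Max L"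
            define b' where "b' = Min U"
            have b: "b \<in> L" "b' \<in> U" using Max_in[OF LU(1) ne(1)] Min_in[OF LU(2) ne(2)] by (auto simp: b_def b'_def)
            then have bB: "b \<in> B" "b' \<in> B" "ap b t < y" "y < ap b' t" by (auto simp: L_def U_def)
            have lt: "b < b'" using elim(2) bB by (metis less_asym less_trans linorder_neqE)
            have cons: "\<not> (b < d \<and> d < b')" if "d \<in> B" for d
              using that Max_ge[OF LU(1), of d] Min_le[OF LU(2), of d] LU(3) by (auto simp: b_def b'_def not_less)
            have "poly (pe p t) (ap b t) * poly (pe p t) (ap b' t) < 0"
              by (rule poly_root_sign_change[of "ap b t" "ap b' t" _ y]) (use elim(4) bB cons y in auto)
            then have "(b, b') \<in> I" using elim(3) bB lt cons by (force simp: I_def)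
            then show ?thesis using elim(5) bB y by force
          qed blast
        qed
      qed
      moreover have "finite (B \<union> c ` I)" using fB fI by simp
      ultimately show ?thesis by blast
    qed
  qed
qed

lemma has_val_all_polys:
  assumes "vgroup G" "\<And>\<beta>. has_val G (\<lambda>t. y t - ap \<beta> t)"
  shows "has_val G (\<lambda>t. poly (pe p t) (y t))"
  using has_val_poly[OF roots_in_hf assms] by blast

section \<open>Closure under exponentials and logarithms of units\<close>

lemma ev_nondecreasing:
  assumes "hasd F F'" "EV t. 0 <= F' t"
  obtains T where "\<And>a b. T < a ==> a <= b ==> F a <= F b"
proof -
  obtain T where T: "\<And>t. T < t ==> (F has_real_derivative F' t) (at t) \<and> 0 <= F' t"
    using ev_threshold[OF eventually_conj[OF assms]] by blast
  have "F a <= F b" if h: "T < a" "a <= b" for a b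
  proof (rule DERIV_nonneg_imp_nondecreasing[OF h(2)])
    fix x assume "a <= x"
    then show "\<exists>y. (F has_real_derivative y) (at x) \<and> 0 <= y" using T[of x] h by auto
  qed
  then show thesis by (rule that)
qed

lemma nondecreasing_tendsto_zero:
  assumes "hasd F F'" "EV t. 0 <= F' t" "(F \<longlongrightarrow> 0) at_top"
  shows "EV t. F t <= 0"
proof -
  obtain T where T: "\<And>a b. T < a ==> a <= b ==> F a <= F b" using ev_nondecreasing[OF assms(1,2)] by blast
  show ?thesis using eventually_gt_at_top[of T]
  proof eventually_elim
    case (elim t)
    have "EV s. F t <= F s" using eventually_ge_at_top[of t] by eventually_elim (use T elim in blast)
    then show ?case using tendsto_lowerbound[OF assms(3)] by simp
  qed
qed

lemma nondecreasing_bounded_tendsto: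
  assumes "hasd F F'" "EV t. 0 <= F' t" "EV t. F t <= K"
  shows "\<exists>L. (F \<longlongrightarrow> L) at_top"
proof -
  obtain T where T: "\<And>a b. T < a ==> a <= b ==> F a <= F b" using ev_nondecreasing[OF assms(1,2)] by blast
  obtain T' where T': "\<And>t. T' < t ==> F t <= K" using ev_threshold[OF assms(3)] by blast
  define V where "V = max T T'"
  define L where "L = Sup (F ` {V<..})"
  have bdd: "bdd_above (F ` {V<..})" using T' by (auto simp: V_def intro!: bdd_aboveI[of _ K])
  have le: "F t <= L" if "V < t" for t unfolding L_def using that bdd by (intro cSup_upper) auto
  have "(F \<longlongrightarrow> L) at_top"
  proof (rule order_tendstoI)
    fix l assume "l < L"
    then obtain t where t: "V < t" "l < F t"
      unfolding L_def using less_cSup_iff[OF _ bdd, of l] by auto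
    show "EV s. l < F s" using eventually_ge_at_top[of t]
    proof eventually_elim
      case (elim s)
      have "F t <= F s" using T[of t s] t elim by (simp add: V_def)
      then show ?case using t by simp
    qed
  next
    fix u assume u: "L < u"
    show "EV s. F s < u" using eventually_gt_at_top[of V]
      by eventually_elim (use le u in \<open>auto intro: le_less_trans\<close>)
  qed
  then show ?thesis by blast
qed

lemma small_deriv_tendsto:
  assumes F: "hasd F s" and "tiny s"
  shows "\<exists>L. (F \<longlongrightarrow> L) at_top"
proof -
  obtain c where c: "0 < c" and s: "EV t. \<bar>s t\<bar> <= exp (- c * t)" using assms(2) by (auto simp: tiny_def)
  define e where "e t = exp (- c * t) / c" for t
  have e: "(e has_real_derivative - exp (- c * t)) (at t)" for t
    unfolding e_def using c by (auto intro!: derivative_eq_intros)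
  have 1: "hasd (\<lambda>t. F t - e t) (\<lambda>t. s t + exp (- c * t))"
    using F
  proof eventually_elim
    case (elim t)
    from DERIV_diff[OF elim e[of t]] show ?case by simp
  qed
  have 2: "hasd (\<lambda>t. - (F t + e t)) (\<lambda>t. exp (- c * t) - s t)"
    using F
  proof eventually_elim
    case (elim t)
    from DERIV_minus[OF DERIV_add[OF elim e[of t]]] show ?case by simp
  qed
  have p1: "EV t. 0 <= s t + exp (- c * t)" and p2: "EV t. 0 <= exp (- c * t) - s t"
    using s by (eventually_elim, linarith)+
  obtain T where T: "\<And>a b. T < a ==> a <= b ==> - (F a + e a) <= - (F b + e b)"
    using ev_nondecreasing[OF 2 p2] by blast
  have "EV t. F t - e t <= F (T + 1) + e (T + 1)"
    using eventually_ge_at_top[of "T + 1"]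
  proof eventually_elim
    case (elim t)
    have "0 < e t" using c by (simp add: e_def)
    then show ?case using T[of "T + 1" t] elim by simp
  qed
  from nondecreasing_bounded_tendsto[OF 1 p1 this] obtain L where L: "((\<lambda>t. F t - e t) \<longlongrightarrow> L) at_top" by blast
  have "(e \<longlongrightarrow> 0) at_top"
  proof (rule tendstoI)
    fix r :: real assume "0 < r"
    then have r: "0 < c * r" "0 < c * r / 2" using c by auto
    from ev_exp_le[OF c r(2)] show "EV t. dist (e t) 0 < r"
      by eventually_elim (use c r(1) in \<open>simp add: e_def divide_less_eq mult.commute\<close>)
  qed
  then have "((\<lambda>t. (F t - e t) + e t) \<longlongrightarrow> L + 0) at_top" by (rule tendsto_add[OF L])
  then show ?thesis by auto
qed

lemma deriv_ge_linear:
  assumes "hasd F s" "EV t. c <= s t"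
  shows "\<exists>C. (EV t. c * t - C <= F t)"
proof -
  have 1: "hasd (\<lambda>t. F t - c * t) (\<lambda>t. s t - c)"
    using assms(1) by eventually_elim (auto intro!: derivative_eq_intros)
  have 2: "EV t. 0 <= s t - c" using assms(2) by eventually_elim simp
  obtain T where T: "\<And>a b. T < a ==> a <= b ==> F a - c * a <= F b - c * b"
    using ev_nondecreasing[OF 1 2] by blast
  have "EV t. c * t - (- (F (T + 1) - c * (T + 1))) <= F t"
    using eventually_ge_at_top[of "T + 1"]
  proof eventually_elim
    case (elim t)
    show ?case using T[of "T + 1" t] elim by simp
  qed
  then show ?thesis by blast
qed

lemma hf_large_or_small: "(\<exists>c>0. EV t. c <= \<bar>ap a t\<bar>) \<or> tiny (ap a)"
proof (cases "a = 0")
  case True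
  then show ?thesis by (auto simp: tiny_def intro: exI[of _ 1])
next
  case False
  from hf_good[OF this] show ?thesis unfolding good_def
  proof (elim disjE conjE)
    assume "sim (\<lambda>_. 1) (ap a)"
    then obtain C where C: "0 < C" "EV t. \<bar>1\<bar> <= C * \<bar>ap a t\<bar> \<and> \<bar>ap a t\<bar> <= C * \<bar>1 :: real\<bar>" by (rule simE)
    from C(2) have "EV t. 1 / C <= \<bar>ap a t\<bar>" by eventually_elim (use C(1) in \<open>simp add: divide_le_eq mult.commute\<close>)
    then show ?thesis using C(1) by (intro disjI1 exI[of _ "1 / C"]) simp
  qed (use large_ge[of "ap a" 1] zero_less_one in blast)+
qed

lemma hf_sign: "(EV t. 0 <= ap a t) \<or> (EV t. ap a t <= 0)"
proof (cases "a < 0")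
  case True
  then have "EV t. ap a t < 0" by (simp add: hf_less_def)
  then have "EV t. ap a t <= 0" by eventually_elim simp
  then show ?thesis by blast
qed (use hf_not_less_ev[of a 0] in simp)

text \<open>
  There is no derivative in the field that tends to zero slowly: it is bounded away from zero or
  exponentially small, and correspondingly the primitive grows at least linearly or converges.
\<close>

lemma antideriv_cases:
  assumes "hasd F (ap s)"
  shows "(\<exists>d>0. \<exists>C. (EV t. d * t - C <= F t) \<or> (EV t. F t <= - (d * t - C))) \<or>
    tiny (ap s) \<and> (\<exists>L. (F \<longlongrightarrow> L) at_top)"
  using hf_large_or_small[of s]
proof (elim disjE exE conjE)
  fix c :: real assume c: "0 < c" "EV t. c <= \<bar>ap s t\<bar>"
  from hf_sign[of s] show ?thesis
  proof
    assume "EV t. 0 <= ap s t"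
    with c(2) have "EV t. c <= ap s t" by eventually_elim simp
    from deriv_ge_linear[OF assms this] show ?thesis using c(1) by blast
  next
    assume "EV t. ap s t <= 0"
    with c(2) have p: "EV t. c <= - ap s t" by eventually_elim simp
    have "hasd (\<lambda>t. - F t) (\<lambda>t. - ap s t)" using assms by eventually_elim (rule DERIV_minus)
    from deriv_ge_linear[OF this p] obtain C where "EV t. c * t - C <= - F t" by blast
    then have "EV t. F t <= - (c * t - C)" by eventually_elim linarith
    then show ?thesis using c(1) by blast
  qed
qed (use small_deriv_tendsto[OF assms] in blast)

lemma linear_unbounded:
  assumes "0 < d" "EV t. d * t - C <= F t"
  shows "EV t. K < F t"
  using assms(2) eventually_gt_at_top[of "(K + C) / d"]
proof eventually_elim
  case (elim t)
  then have "K + C < d * t" using assms(1) by (simp add: divide_less_eq mult.commute)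
  then show ?case using elim by simp
qed

lemma bounded_antideriv:
  assumes "hasd F (ap s)" "EV t. \<bar>F t\<bar> <= K"
  shows "tiny (ap s)" "\<exists>L. (F \<longlongrightarrow> L) at_top"
proof -
  have no: False if "0 < d" "EV t. d * t - C <= \<bar>F t\<bar>" for d C
  proof -
    from linear_unbounded[OF that, of K] assms(2) have "EV t. False" by eventually_elim linarith
    then show False by simp
  qed
  have "tiny (ap s) \<and> (\<exists>L. (F \<longlongrightarrow> L) at_top)"
    using antideriv_cases[OF assms(1)]
  proof (elim disjE exE conjE)
    fix d C :: real assume d: "0 < d" "EV t. d * t - C <= F t"
    from d(2) have "EV t. d * t - C <= \<bar>F t\<bar>" by eventually_elim linarith
    then show ?thesis using no d(1) by blast
  next
    fix d C :: real assume d: "0 < d" "EV t. F t <= - (d * t - C)"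
    from d(2) have "EV t. d * t - C <= \<bar>F t\<bar>" by eventually_elim linarith
    then show ?thesis using no d(1) by blast
  qed blast
  then show "tiny (ap s)" "\<exists>L. (F \<longlongrightarrow> L) at_top" by blast+
qed

lemma tendsto_imp_bounded: "(F \<longlongrightarrow> (L :: real)) at_top ==> (EV t. \<bar>F t\<bar> <= \<bar>L\<bar> + 1)"
proof -
  assume "(F \<longlongrightarrow> L) at_top"
  then have "EV t. dist (F t) L < 1" by (rule tendstoD) simp
  then show ?thesis by eventually_elim (simp add: dist_real_def)
qed

lemma sim_const_of_tendsto:
  assumes "(F \<longlongrightarrow> L) at_top" "L ~= 0"
  shows "sim (\<lambda>_. 1) F"
proof -
  have "((\<lambda>t. F t / 1) \<longlongrightarrow> L) at_top" using assms(1) by simp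
  then show ?thesis by (rule sim_sym[OF bigthetaI_tendsto[OF assms(2)]])
qed

lemma Dr_mult: "Dr (a * b) = Dr a * b + a * Dr b"
proof (rule Dr_eqI)
  have "hasd (\<lambda>t. ap a t * ap b t) (\<lambda>t. ap (Dr a) t * ap b t + ap (Dr b) t * ap a t)"
    using hasd_Dr[of a] hasd_Dr[of b] by eventually_elim (rule DERIV_mult)
  then show "hasd (ap (a * b)) (\<lambda>t. ap (Dr a) t * ap b t + ap (Dr b) t * ap a t)"
    by (rule hasd_cong) (use ev_mult[of a b] in \<open>auto elim: eventually_mono\<close>)
  show "EV t. ap (Dr a * b + a * Dr b) t = ap (Dr a) t * ap b t + ap (Dr b) t * ap a t"
    using ev_add[of "Dr a * b" "a * Dr b"] ev_mult[of "Dr a" b] ev_mult[of a "Dr b"] by eventually_elim simp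
qed

lemma hasd_ln_abs:
  assumes "hasd u u'" "EV t. u t ~= 0" "EV t. u' t = s t * u t"
  shows "hasd (\<lambda>t. ln (u t ^ 2) / 2) s"
  using assms
proof eventually_elim
  case (elim t)
  have p: "0 < u t * u t" using elim(2) by (simp add: zero_less_mult_iff) linarith
  have "((\<lambda>t. ln (u t * u t) / 2) has_real_derivative inverse (u t * u t) * (u' t * u t + u' t * u t) / 2) (at t)"
    by (rule DERIV_cdivide[OF DERIV_chain2[OF DERIV_ln[OF p] DERIV_mult[OF elim(1) elim(1)]]])
  moreover have "u' t * u t + u' t * u t = (u t * u t) * (2 * s t)" using elim(3) by simp
  then have "inverse (u t * u t) * (u' t * u t + u' t * u t) / 2 = s t"
  proof -
    have "inverse X * (X * (2 * v)) / 2 = v" if "X ~= 0" for X v :: real using that by simp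
    then show ?thesis using p \<open>u' t * u t + u' t * u t = (u t * u t) * (2 * s t)\<close> by (metis less_irrefl)
  qed
  ultimately show ?case by (simp add: power2_eq_square)
qed

lemma abs_eq_exp_ln: "u ~= 0 ==> \<bar>u\<bar> = exp (ln (u ^ 2) / 2)" for u :: real
proof -
  assume "u ~= 0"
  then have "ln (u ^ 2) = 2 * ln \<bar>u\<bar>" using ln_realpow[of "\<bar>u\<bar>" 2] by simp
  then show ?thesis using \<open>u ~= 0\<close> by simp
qed

text \<open>
  \<open>u\<close> is, up to sign, the exponential of a primitive of \<open>s\<close>, and by \<open>antideriv_cases\<close> this
  primitive converges or is at least linear.
\<close>

lemma log_deriv_good:
  assumes "hasd u u'" "EV t. u t ~= 0" "EV t. u' t = ap s t * u t"
  shows "good u"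
proof -
  define F where "F t = ln (u t ^ 2) / 2" for t
  have F: "hasd F (ap s)" unfolding F_def using assms by (rule hasd_ln_abs)
  have uF: "EV t. \<bar>u t\<bar> = exp (F t)" using assms(2) by eventually_elim (simp add: F_def abs_eq_exp_ln)
  from antideriv_cases[OF F] show ?thesis
  proof (elim disjE exE conjE)
    fix d C :: real assume d: "0 < d" "EV t. d * t - C <= F t"
    have "EV t. d / 2 * t - C <= d / 2 * t - C" by simp
    from linear_unbounded[OF _ this, of 0] d(1) have "EV t. 0 < d / 2 * t - C" by simp
    with d(2) uF have "EV t. exp (d / 2 * t) <= \<bar>u t\<bar>" by eventually_elim simp
    then have "large u" unfolding large_def using d(1) by (intro exI[of _ "d / 2"]) simp
    then show ?thesis by (simp add: good_def)
  next
    fix d C :: real assume d: "0 < d" "EV t. F t <= - (d * t - C)"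
    have "EV t. d / 2 * t - C <= d / 2 * t - C" by simp
    from linear_unbounded[OF _ this, of 0] d(1) have "EV t. 0 < d / 2 * t - C" by simp
    with d(2) uF have "EV t. \<bar>u t\<bar> <= exp (- (d / 2) * t)" by eventually_elim simp
    then have "tiny u" unfolding tiny_def using d(1) by (intro exI[of _ "d / 2"]) simp
    then show ?thesis using assms(2) by (simp add: good_def)
  next
    fix L assume "(F \<longlongrightarrow> L) at_top"
    then have "((\<lambda>t. exp (F t)) \<longlongrightarrow> exp L) at_top" by (rule tendsto_exp)
    then have "sim (\<lambda>_. 1) (\<lambda>t. exp (F t))" by (rule sim_const_of_tendsto) simp
    moreover have "sim (\<lambda>t. exp (F t)) u"
      using uF by (intro simI[of 1]) (auto elim: eventually_mono)
    ultimately show ?thesis unfolding good_def using sim_trans by blast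
  qed
qed

text \<open>
  Write \<open>\<sigma>\<close> for the logarithmic derivative of \<open>s\<close>. It is bounded away from zero, for otherwise \<open>s\<close>
  would stay away from zero and \<open>\<rho>\<close> could not converge. Then \<open>1 / \<sigma>\<close> is bounded, so its derivative
  \<open>\<epsilon>\<close> tends to zero, and the derivative of \<open>a = s / \<sigma>\<close> is \<open>s \<cdot> (1 + \<epsilon>)\<close>. Since \<open>a\<close> and \<open>\<rho>\<close> both
  tend to zero, their ratio stays between \<open>1 / 2\<close> and \<open>3 / 2\<close>.
\<close>

lemma antideriv_value_pos:
  assumes "0 < s" and \<rho>: "hasd \<rho> (ap s)" "(\<rho> \<longlongrightarrow> 0) at_top"
  shows "\<exists>a. a ~= 0 \<and> sim \<rho> (ap a)"
proof -
  define \<sigma> where "\<sigma> = Dr s / s"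
  have s0: "s ~= 0" using assms(1) by simp
  have s_small: "\<not> (\<exists>c>0. (EV t. c <= \<bar>ap s t\<bar>))"
  proof
    assume "\<exists>c>0. (EV t. c <= \<bar>ap s t\<bar>)"
    then obtain c where c: "0 < c" "EV t. c <= \<bar>ap s t\<bar>" by blast
    from tiny_le[OF bounded_antideriv(1)[OF \<rho>(1) tendsto_imp_bounded[OF \<rho>(2)]] half_gt_zero[OF c(1)]] c(2)
    have "EV t. False" by eventually_elim (use c(1) in linarith)
    then show False by simp
  qed
  have \<sigma>s: "EV t. ap (Dr s) t = ap \<sigma> t * ap s t"
    using ev_divide[of "Dr s" s] hf_nz[OF s0] by eventually_elim (simp add: \<sigma>_def)
  have "\<exists>c>0. (EV t. c <= \<bar>ap \<sigma> t\<bar>)"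
  proof (rule ccontr)
    assume no: "\<not> ?thesis"
    then have d: "tiny (ap \<sigma>)" using hf_large_or_small by blast
    define F where "F t = ln (ap s t ^ 2) / 2" for t
    have F: "hasd F (ap \<sigma>)" unfolding F_def using hasd_Dr hf_nz[OF s0] \<sigma>s by (rule hasd_ln_abs)
    from small_deriv_tendsto[OF F d] obtain L where "(F \<longlongrightarrow> L) at_top" by blast
    then have "((\<lambda>t. exp (F t)) \<longlongrightarrow> exp L) at_top" by (rule tendsto_exp)
    then have "EV t. exp L / 2 < exp (F t)" by (rule order_tendstoD(1)) simp
    then have "EV t. exp L / 2 <= \<bar>ap s t\<bar>" using hf_nz[OF s0]
      by eventually_elim (simp add: F_def flip: abs_eq_exp_ln)
    moreover have "0 < exp L / 2" by simp
    ultimately show False using s_small by metis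
  qed
  then obtain c where c: "0 < c" "EV t. c <= \<bar>ap \<sigma> t\<bar>" by metis
  have \<sigma>0: "\<sigma> ~= 0"
  proof
    assume z: "\<sigma> = 0"
    from c(2) have "EV t. False" by eventually_elim (use c(1) z in simp)
    then show False by simp
  qed
  define \<epsilon> where "\<epsilon> = Dr (1 / \<sigma>)"
  define a where "a = s * (1 / \<sigma>)"
  have ev_inv: "EV t. ap (1 / \<sigma>) t = 1 / ap \<sigma> t" using ev_divide[of 1 \<sigma>] ev_one by eventually_elim simp
  have "EV t. \<bar>ap (1 / \<sigma>) t\<bar> <= 1 / c"
    using ev_inv c(2) by eventually_elim (use c(1) in \<open>simp add: frac_le\<close>)
  from tiny_le[OF bounded_antideriv(1)[OF hasd_Dr this], of "1 / 2"]
  have \<epsilon>: "EV t. \<bar>ap \<epsilon> t\<bar> <= 1 / 2" unfolding \<epsilon>_def by simp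
  have Da0: "Dr a = Dr s * (1 / \<sigma>) + s * \<epsilon>" unfolding a_def \<epsilon>_def by (rule Dr_mult)
  have Da: "EV t. ap (Dr a) t = ap s t + ap s t * ap \<epsilon> t"
    using ev_add[of "Dr s * (1 / \<sigma>)" "s * \<epsilon>"] ev_mult[of "Dr s" "1 / \<sigma>"] ev_mult[of s \<epsilon>] ev_inv \<sigma>s hf_nz[OF \<sigma>0]
    unfolding Da0 by eventually_elim simp
  have sp: "EV t. 0 < ap s t" using assms(1) by (simp add: hf_less_def)
  have Da_bounds: "EV t. ap s t / 2 <= ap (Dr a) t \<and> ap (Dr a) t <= 3 / 2 * ap s t"
    using Da sp \<epsilon>
  proof eventually_elim
    case (elim t)
    have "\<bar>ap s t * ap \<epsilon> t\<bar> <= ap s t * (1 / 2)" unfolding abs_mult using elim by (intro mult_mono) auto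
    then show ?case using elim(1) abs_ge_self[of "ap s t * ap \<epsilon> t"] abs_ge_minus_self[of "ap s t * ap \<epsilon> t"]
      by - (intro conjI; linarith)
  qed
  have u1: "hasd (\<lambda>t. ap a t - \<rho> t / 2) (\<lambda>t. ap (Dr a) t - ap s t / 2)"
    using hasd_Dr[of a] \<rho>(1) by eventually_elim (auto intro!: derivative_eq_intros)
  have u2: "hasd (\<lambda>t. 3 / 2 * \<rho> t - ap a t) (\<lambda>t. 3 / 2 * ap s t - ap (Dr a) t)"
    using hasd_Dr[of a] \<rho>(1) by eventually_elim (auto intro!: derivative_eq_intros)
  have p1: "EV t. 0 <= ap (Dr a) t - ap s t / 2" and p2: "EV t. 0 <= 3 / 2 * ap s t - ap (Dr a) t"
    using Da_bounds by (eventually_elim, simp)+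
  have \<rho>b: "EV t. \<bar>\<rho> t\<bar> <= 1" using tendsto_imp_bounded[OF \<rho>(2)] by simp
  have "\<exists>K. (EV t. \<bar>ap a t\<bar> <= K)"
  proof -
    obtain T1 where T1: "\<And>x y. T1 < x ==> x <= y ==> ap a x - \<rho> x / 2 <= ap a y - \<rho> y / 2"
      using ev_nondecreasing[OF u1 p1] by blast
    obtain T2 where T2: "\<And>x y. T2 < x ==> x <= y ==> 3 / 2 * \<rho> x - ap a x <= 3 / 2 * \<rho> y - ap a y"
      using ev_nondecreasing[OF u2 p2] by blast
    define T where "T = max T1 T2 + 1"
    define K where "K = \<bar>ap a T\<bar> + 2 * \<bar>\<rho> T\<bar> + 2"
    have "EV t. \<bar>ap a t\<bar> <= K" using eventually_ge_at_top[of T] \<rho>b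
    proof eventually_elim
      case (elim t)
      have "ap a T - \<rho> T / 2 <= ap a t - \<rho> t / 2" "3 / 2 * \<rho> T - ap a T <= 3 / 2 * \<rho> t - ap a t"
        using T1[of T t] T2[of T t] elim by (auto simp: T_def)
      then show ?case using elim(2) unfolding K_def by (simp add: abs_if split: if_splits)
    qed
    then show ?thesis by blast
  qed
  then obtain K where "EV t. \<bar>ap a t\<bar> <= K" by blast
  from bounded_antideriv(2)[OF hasd_Dr this] obtain L where L: "(ap a \<longlongrightarrow> L) at_top" by blast
  have "L = 0"
  proof (rule ccontr)
    assume "L ~= 0"
    from sim_const_of_tendsto[OF L this] obtain C where
      C: "0 < C" "EV t. \<bar>1\<bar> <= C * \<bar>ap a t\<bar> \<and> \<bar>ap a t\<bar> <= C * \<bar>1 :: real\<bar>" by (rule simE)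
    have "EV t. c / C <= \<bar>ap s t\<bar>"
      using C(2) c(2) ev_inv ev_mult[of s "1 / \<sigma>"] hf_nz[OF \<sigma>0]
    proof eventually_elim
      case (elim t)
      have "\<bar>ap s t\<bar> = \<bar>ap a t\<bar> * \<bar>ap \<sigma> t\<bar>" using elim(3-5) by (simp add: a_def abs_mult abs_divide)
      moreover have "(1 / C) * c <= \<bar>ap a t\<bar> * \<bar>ap \<sigma> t\<bar>"
        using elim(1,2) c(1) C(1) by (intro mult_mono) (auto simp: field_simps)
      ultimately show ?case by simp
    qed
    moreover have "0 < c / C" using c(1) C(1) by simp
    ultimately show False using s_small by metis
  qed
  then have a0: "(ap a \<longlongrightarrow> 0) at_top" using L by simp
  have "((\<lambda>t. ap a t - \<rho> t / 2) \<longlongrightarrow> 0 - 0 / 2) at_top" by (intro tendsto_intros a0 \<rho>(2)) simp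
  then have n1: "EV t. ap a t - \<rho> t / 2 <= 0" by (intro nondecreasing_tendsto_zero[OF u1 p1]) simp
  have "((\<lambda>t. 3 / 2 * \<rho> t - ap a t) \<longlongrightarrow> 3 / 2 * 0 - 0) at_top" by (intro tendsto_intros a0 \<rho>(2))
  then have n2: "EV t. 3 / 2 * \<rho> t - ap a t <= 0" by (intro nondecreasing_tendsto_zero[OF u2 p2]) simp
  have n3: "EV t. \<rho> t <= 0" 
    by (rule nondecreasing_tendsto_zero[OF \<rho>(1) _ \<rho>(2)]) (use sp in eventually_elim, simp)
  have "EV t. \<bar>\<rho> t\<bar> <= 2 * \<bar>ap a t\<bar> \<and> \<bar>ap a t\<bar> <= 2 * \<bar>\<rho> t\<bar>"
    using n1 n2 n3 by eventually_elim simp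
  then have "sim \<rho> (ap a)" by (rule simI[rotated]) simp
  moreover have "a ~= 0" using s0 \<sigma>0 by (simp add: a_def)
  ultimately show ?thesis by blast
qed

lemma antideriv_value:
  assumes "s ~= 0" and \<rho>: "hasd \<rho> (ap s)" "(\<rho> \<longlongrightarrow> 0) at_top"
  shows "\<exists>a. a ~= 0 \<and> sim \<rho> (ap a)"
proof (cases "0 < s")
  case False
  then have "0 < - s" using assms(1) by simp
  moreover have "hasd (\<lambda>t. - \<rho> t) (ap (- s))"
    using \<rho>(1) ev_uminus[of s] by eventually_elim (auto intro!: derivative_eq_intros)
  moreover have "((\<lambda>t. - \<rho> t) \<longlongrightarrow> 0) at_top" using tendsto_minus[OF \<rho>(2)] by simp
  ultimately obtain a where "a ~= 0" "sim (\<lambda>t. - \<rho> t) (ap a)" using antideriv_value_pos by blast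
  moreover have "sim \<rho> (\<lambda>t. - \<rho> t)" by (rule simI[of 1]) simp_all
  ultimately show ?thesis using sim_trans by blast
qed (use antideriv_value_pos \<rho> in blast)

lemma zero_deriv_zero:
  assumes "hasd F (\<lambda>_. 0)" "(F \<longlongrightarrow> 0) at_top"
  shows "EV t. F t = 0"
proof -
  have 1: "EV t. F t <= 0" by (rule nondecreasing_tendsto_zero[OF assms(1) _ assms(2)]) simp
  have "hasd (\<lambda>t. - F t) (\<lambda>_. 0)" using assms(1) by eventually_elim (auto intro!: derivative_eq_intros)
  moreover have "((\<lambda>t. - F t) \<longlongrightarrow> 0) at_top" using tendsto_minus[OF assms(2)] by simp
  ultimately have "EV t. - F t <= 0" by (intro nondecreasing_tendsto_zero[of "\<lambda>t. - F t" "\<lambda>_. 0"]) simp_all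
  with 1 show ?thesis by eventually_elim simp
qed

lemma antideriv_has_val:
  assumes G: "vgroup G" and D: "hasd D (ap s)" and L: "(D \<longlongrightarrow> L) at_top"
  shows "has_val G D"
proof (cases "L = 0")
  case False
  from sim_const_of_tendsto[OF L False] show ?thesis
    using has_val_sim[OF has_val_In[OF G In_const[of 1]]] by blast
next
  case True
  show ?thesis
  proof (cases "s = 0")
    case True
    then show ?thesis using zero_deriv_zero[of D] D L \<open>L = 0\<close> by (simp add: has_val_def)
  next
    case False
    then obtain a where "sim D (ap a)" using antideriv_value[OF False D] L True by blast
    then show ?thesis using has_val_sim[OF has_val_In[OF G In_ap]] sim_sym by blast
  qed
qed

text \<open>
  The nonvanishing solutions of first-order linear equations \<open>u' = s u\<close> over the field. They form
  a group of admitted functions which contains the nonzero elements of the field.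
\<close>

definition logdiff :: "(real => real) set" where
  "logdiff = {u. (EV t. u t ~= 0) \<and> (\<exists>u' s. hasd u u' \<and> (EV t. u' t = ap s t * u t))}"

lemma vgroup_logdiff: "vgroup logdiff"
  unfolding vgroup_def
proof (intro conjI ballI allI impI)
  fix u v assume "u \<in> logdiff" "v \<in> logdiff"
  then obtain u' s v' r where u: "EV t. u t ~= 0" "hasd u u'" "EV t. u' t = ap s t * u t"
    and v: "EV t. v t ~= 0" "hasd v v'" "EV t. v' t = ap r t * v t" unfolding logdiff_def by blast
  show "(\<lambda>t. u t * v t) \<in> logdiff" unfolding logdiff_def
  proof (intro CollectI conjI exI)
    show "EV t. u t * v t ~= 0" using u(1) v(1) by eventually_elim simp
    show "hasd (\<lambda>t. u t * v t) (\<lambda>t. u' t * v t + v' t * u t)"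
      using u(2) v(2) by eventually_elim (rule DERIV_mult)
    show "EV t. u' t * v t + v' t * u t = ap (s + r) t * (u t * v t)"
      using u(3) v(3) ev_add[of s r] by eventually_elim (simp add: algebra_simps)
  qed
next
  fix u assume "u \<in> logdiff"
  then obtain u' s where u: "EV t. u t ~= 0" "hasd u u'" "EV t. u' t = ap s t * u t" unfolding logdiff_def by blast
  show "good u" using u by (intro log_deriv_good)
  show "(\<lambda>t. inverse (u t)) \<in> logdiff" unfolding logdiff_def
  proof (intro CollectI conjI exI)
    show "EV t. inverse (u t) ~= 0" using u(1) by eventually_elim simp
    show "hasd (\<lambda>t. inverse (u t)) (\<lambda>t. - (inverse (u t) * u' t * inverse (u t)))"
      using u(1,2) by eventually_elim (rule DERIV_inverse'; simp)
    show "EV t. - (inverse (u t) * u' t * inverse (u t)) = ap (- s) t * inverse (u t)"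
      using u(1,3) ev_uminus[of s] by eventually_elim simp
  qed
next
  fix u assume "In u" "\<not> (EV t. u t = 0)"
  define a where "a = mk u"
  have au: "EV t. ap a t = u t" using ap_mk[OF \<open>In u\<close>] by (simp add: a_def)
  have nz: "EV t. u t ~= 0" using In_good[OF \<open>In u\<close> \<open>\<not> (EV t. u t = 0)\<close>] good_nz by blast
  show "u \<in> logdiff" unfolding logdiff_def
  proof (intro CollectI conjI exI)
    show "EV t. u t ~= 0" by (rule nz)
    show "hasd u (ap (Dr a))" by (rule hasd_cong[OF hasd_Dr au]) simp
    show "EV t. ap (Dr a) t = ap (Dr a / a) t * u t" using au ev_divide[of "Dr a" a] nz by eventually_elim simp
  qed
qed

lemma exp_minus_one_bounds:
  fixes r :: real
  assumes "\<bar>r\<bar> <= 1 / 2"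
  shows "\<bar>r\<bar> <= 2 * \<bar>exp r - 1\<bar>" "\<bar>exp r - 1\<bar> <= 2 * \<bar>r\<bar>"
proof -
  have 1: "1 + r <= exp r" "1 + - r <= exp (- r)" by (rule exp_ge_add_one_self)+
  have 2: "exp r * exp (- r) = 1" by (simp flip: exp_add)
  have 3: "exp r * (1 - r) <= 1" using mult_left_mono[OF 1(2), of "exp r"] 2 by simp
  have h: "1 / 2 <= exp r" using 1(1) assms by linarith
  have "\<bar>r\<bar> <= 2 * \<bar>exp r - 1\<bar> \<and> \<bar>exp r - 1\<bar> <= 2 * \<bar>r\<bar>"
  proof (cases "0 <= r")
    case True
    have "exp r * (1 / 2) <= exp r * (1 - r)" using assms by (intro mult_left_mono) auto
    then have "exp r * (1 / 2) <= 1" using 3 by linarith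
    then have "exp r <= 2" by simp
    then have "exp r * r <= 2 * r" using True by (intro mult_right_mono) auto
    then have "exp r - 1 <= 2 * r" using 3 by (simp add: algebra_simps)
    moreover have "\<bar>r\<bar> <= 2 * \<bar>E - 1\<bar> \<and> \<bar>E - 1\<bar> <= 2 * \<bar>r\<bar>" if "1 + r <= E" "E - 1 <= 2 * r" for E
      using that True by auto
    ultimately show ?thesis using 1(1) by blast
  next
    case False
    have "exp r * (- r) \<ge> (1 / 2) * (- r)" using False h by (intro mult_right_mono) auto
    then have "exp r - 1 <= r / 2" using 3 by (simp add: algebra_simps)
    moreover have "\<bar>r\<bar> <= 2 * \<bar>E - 1\<bar> \<and> \<bar>E - 1\<bar> <= 2 * \<bar>r\<bar>" if "1 + r <= E" "E - 1 <= r / 2" for E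
      using that False by auto
    ultimately show ?thesis using 1(1) by blast
  qed
  then show "\<bar>r\<bar> <= 2 * \<bar>exp r - 1\<bar>" "\<bar>exp r - 1\<bar> <= 2 * \<bar>r\<bar>" by blast+
qed

text \<open>
  Cancellation is possible only when \<open>r\<close> tends to one. Then \<open>r - 1\<close> grows like \<open>ln r\<close>, which tends
  to zero and has its derivative in the field.
\<close>

lemma logdiff_minus_one:
  assumes r: "r \<in> logdiff"
  shows "has_val logdiff (\<lambda>t. r t - 1)"
proof -
  note G = vgroup_logdiff
  obtain r' s where r': "EV t. r t ~= 0" "hasd r r'" "EV t. r' t = ap s t * r t" using r unfolding logdiff_def by blast
  have one: "has_val logdiff F" if "sim (\<lambda>_. 1) F" for F
    using has_val_sim[OF has_val_In[OF G In_const[of 1]] that] .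
  from vgroupD(1)[OF G r] consider "large r" | "tiny r" | "sim (\<lambda>_. 1) r" unfolding good_def by blast
  then show ?thesis
  proof cases
    case 1
    from large_ge[OF this, of 2] have "EV t. \<bar>r t\<bar> <= 2 * \<bar>r t - 1\<bar> \<and> \<bar>r t - 1\<bar> <= 2 * \<bar>r t\<bar>"
    proof eventually_elim
      case (elim t)
      show ?case using elim abs_triangle_ineq[of "r t - 1" 1] abs_triangle_ineq4[of "r t" 1] by simp
    qed
    then have "sim r (\<lambda>t. r t - 1)" by (rule simI[rotated]) simp
    then show ?thesis by (rule has_val_sim[OF has_val_group[OF r]])
  next
    case 2
    then have "EV t. \<bar>r t\<bar> <= 1 / 2" by (rule tiny_le) simp
    then have "EV t. \<bar>1\<bar> <= 2 * \<bar>r t - 1\<bar> \<and> \<bar>r t - 1\<bar> <= 2 * \<bar>1 :: real\<bar>"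
    proof eventually_elim
      case (elim t)
      show ?case using elim abs_triangle_ineq2_sym[of "1" "r t"] abs_triangle_ineq4[of "r t" 1] by simp
    qed
    then have "sim (\<lambda>_. 1) (\<lambda>t. r t - 1)" by (rule simI[rotated]) simp
    then show ?thesis by (rule one)
  next
    case 3
    then obtain C where C: "0 < C" "EV t. \<bar>1\<bar> <= C * \<bar>r t\<bar> \<and> \<bar>r t\<bar> <= C * \<bar>1 :: real\<bar>" by (rule simE)
    define c where "c = 1 / C"
    have c: "0 < c" using C(1) by (simp add: c_def)
    have unit: "EV t. c <= \<bar>r t\<bar> \<and> \<bar>r t\<bar> <= 1 / c"
      using C(2) by eventually_elim (use C(1) in \<open>simp add: c_def divide_le_eq mult.commute\<close>)
    from const_sign[OF hasd_cont[OF r'(2)] r'(1)] show ?thesis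
    proof
      assume neg: "EV t. r t < 0"
      with unit have "EV t. \<bar>1\<bar> <= (1 + 1 / c) * \<bar>r t - 1\<bar> \<and> \<bar>r t - 1\<bar> <= (1 + 1 / c) * \<bar>1 :: real\<bar>"
      proof eventually_elim
        case (elim t)
        have "0 <= 1 / c * \<bar>r t - 1\<bar>" using c by simp
        then have "\<bar>r t - 1\<bar> <= (1 + 1 / c) * \<bar>r t - 1\<bar>" by (simp add: distrib_right)
        moreover have "1 <= \<bar>r t - 1\<bar>" "\<bar>r t - 1\<bar> <= 1 + 1 / c" using elim by auto
        ultimately show ?case by simp
      qed
      then have "sim (\<lambda>_. 1) (\<lambda>t. r t - 1)" by (rule simI[rotated]) (use c in \<open>simp add: add_pos_pos\<close>)
      then show ?thesis by (rule one)
    next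
      assume pos: "EV t. 0 < r t"
      define \<rho> where "\<rho> t = ln (r t)" for t
      have r\<rho>: "EV t. r t = exp (\<rho> t)" using pos by eventually_elim (simp add: \<rho>_def)
      have d\<rho>: "hasd \<rho> (ap s)"
        using r'(2,3) pos unfolding \<rho>_def
      proof eventually_elim
        case (elim t)
        then have "((\<lambda>t. ln (r t)) has_real_derivative (inverse (r t) * r' t)) (at t)"
          by (auto intro!: derivative_eq_intros)
        moreover have "inverse (r t) * r' t = ap s t" using elim by simp
        ultimately show ?case by simp
      qed
      have "EV t. \<bar>\<rho> t\<bar> <= \<bar>ln c\<bar>"
        using unit pos
      proof eventually_elim
        case (elim t)
        have "ln c <= ln (r t)" "ln (r t) <= ln (1 / c)" using elim c by auto
        then show ?case using c by (simp add: \<rho>_def ln_div)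
      qed
      from bounded_antideriv(2)[OF d\<rho> this] obtain L where L: "(\<rho> \<longlongrightarrow> L) at_top" by blast
      show ?thesis
      proof (cases "L = 0")
        case False
        have "((\<lambda>t. exp (\<rho> t) - 1) \<longlongrightarrow> exp L - 1) at_top" by (intro tendsto_intros L)
        then have "sim (\<lambda>_. 1) (\<lambda>t. exp (\<rho> t) - 1)" by (rule sim_const_of_tendsto) (use False in simp)
        from one[OF this] show ?thesis
          by (rule has_val_cong) (use r\<rho> in \<open>auto elim: eventually_mono\<close>)
      next
        case True
        have "EV t. dist (\<rho> t) 0 < 1 / 2" using L True by (intro tendstoD) auto
        then have "EV t. \<bar>\<rho> t\<bar> <= 2 * \<bar>r t - 1\<bar> \<and> \<bar>r t - 1\<bar> <= 2 * \<bar>\<rho> t\<bar>"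
          using r\<rho> by eventually_elim (simp add: exp_minus_one_bounds)
        then have "sim \<rho> (\<lambda>t. r t - 1)" by (rule simI[rotated]) simp
        then show ?thesis by (rule has_val_sim[OF antideriv_has_val[OF G d\<rho> L]])
      qed
    qed
  qed
qed

lemma frac_in_poly: "(EV t. F t = poly (pe p t) (y t)) ==> frac_in y F"
  unfolding frac_in_def
proof (intro exI conjI)
  assume F: "EV t. F t = poly (pe p t) (y t)"
  have "EV t. poly (pe 1 t) (y t) ~= 0" using ev_one unfolding one_pCons by eventually_elim simp
  then show "\<not> (EV t. poly (pe 1 t) (y t) = 0)" by (rule ev_ne_not_ev_eq)
  show "EV t. F t = poly (pe p t) (y t) / poly (pe 1 t) (y t)"
    using F ev_one unfolding one_pCons by eventually_elim simp
qed

text \<open>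
  A difference \<open>y - \<beta>\<close> is \<open>\<beta>\<close> times \<open>y / \<beta> - 1\<close>, and the quotient belongs to \<open>logdiff\<close> again.
\<close>

lemma logdiff_In:
  assumes y: "y \<in> logdiff"
  shows "In y"
proof -
  obtain y' s where y': "EV t. y t ~= 0" "hasd y y'" "EV t. y' t = ap s t * y t" using y unfolding logdiff_def by blast
  show ?thesis
  proof (rule ext_in_hf_val[OF y'(2) _ vgroup_logdiff])
    show "frac_in y y'"
      by (rule frac_in_poly[of _ "[:0, s:]"]) (use y'(3) in eventually_elim, simp add: mult.commute)
    show "has_val logdiff (\<lambda>t. poly (pe p t) (y t))" for p
    proof (rule has_val_all_polys[OF vgroup_logdiff])
      fix \<beta>
      show "has_val logdiff (\<lambda>t. y t - ap \<beta> t)"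
      proof (cases "\<beta> = 0")
        case True
        then show ?thesis using has_val_group[OF y] by simp
      next
        case False
        have b: "ap \<beta> \<in> logdiff" using vgroupD(4)[OF vgroup_logdiff In_ap] False by (simp add: hf_zero_iff)
        have "(\<lambda>t. y t * inverse (ap \<beta> t)) \<in> logdiff"
          by (rule vgroupD(2)[OF vgroup_logdiff y vgroupD(3)[OF vgroup_logdiff b]])
        from has_val_mult[OF vgroup_logdiff has_val_group[OF b] logdiff_minus_one[OF this]] show ?thesis
          by (rule has_val_cong) (use hf_nz[OF False] in \<open>eventually_elim, simp add: right_diff_distrib\<close>)
      qed
    qed
  qed
qed

lemma In_exp: "In (\<lambda>t. exp (ap J t))"
proof (rule logdiff_In, unfold logdiff_def, intro CollectI conjI exI)
  show "hasd (\<lambda>t. exp (ap J t)) (\<lambda>t. ap (Dr J) t * exp (ap J t))"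
    using hasd_Dr[of J] by eventually_elim (auto intro!: derivative_eq_intros)
  show "EV t. ap (Dr J) t * exp (ap J t) = ap (Dr J) t * exp (ap J t)" by simp
qed simp

lemma In_exp_id: "In (\<lambda>t. exp t)"
proof (rule logdiff_In, unfold logdiff_def, intro CollectI conjI exI)
  show "hasd (\<lambda>t. exp t) (\<lambda>t. exp t)" by (auto intro!: derivative_eq_intros)
  show "EV t. exp t = ap 1 t * exp t" using ev_one by eventually_elim simp
qed simp

text \<open>
  The function \<open>a\<close> tends to a limit \<open>L\<close>; subtracting \<open>ln L\<close> makes the logarithm a primitive that
  tends to zero. Its difference with a bounded \<open>\<beta>\<close> is a convergent primitive, and an unbounded \<open>\<beta>\<close>
  simply dominates it.
\<close>

lemma In_ln_unit:
  assumes "0 < c" "EV t. c <= ap a t \<and> ap a t <= C"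
  shows "In (\<lambda>t. ln (ap a t))"
proof -
  have "EV t. \<bar>ap a t\<bar> <= C" using assms(2) by eventually_elim (use assms(1) in simp)
  from bounded_antideriv(2)[OF hasd_Dr this] obtain L where L: "(ap a \<longlongrightarrow> L) at_top" by blast
  have "EV t. c <= ap a t" using assms(2) by eventually_elim simp
  then have "c <= L" using tendsto_lowerbound[OF L] by simp
  then have L0: "0 < L" using assms(1) by simp
  define y where "y t = ln (ap a t) - ln L" for t
  define s where "s = Dr a / a"
  have dy: "hasd y (ap s)"
    using hasd_Dr[of a] assms(2) ev_divide[of "Dr a" a] unfolding y_def s_def
    by eventually_elim (use assms(1) in \<open>auto intro!: derivative_eq_intros simp: divide_inverse mult.commute\<close>)
  have "((\<lambda>t. ln (ap a t)) \<longlongrightarrow> ln L) at_top" using L0 by (intro tendsto_ln L) simp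
  then have y0: "(y \<longlongrightarrow> 0) at_top" unfolding y_def by (simp add: LIM_zero)
  note G = vgroup_logdiff
  have "In y"
  proof (rule ext_in_hf_val[OF dy _ G])
    show "frac_in y (ap s)" by (rule frac_in_poly[of _ "[:s:]"]) simp
    show "has_val logdiff (\<lambda>t. poly (pe p t) (y t))" for p
    proof (rule has_val_all_polys[OF G])
      fix \<beta>
      show "has_val logdiff (\<lambda>t. y t - ap \<beta> t)"
      proof (cases "\<exists>K. (EV t. \<bar>ap \<beta> t\<bar> <= K)")
        case True
        then obtain B where B: "(ap \<beta> \<longlongrightarrow> B) at_top" using bounded_antideriv(2)[OF hasd_Dr] by blast
        show ?thesis
        proof (rule antideriv_has_val[OF G])
          show "hasd (\<lambda>t. y t - ap \<beta> t) (ap (s - Dr \<beta>))"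
            using dy hasd_Dr[of \<beta>] ev_diff[of s "Dr \<beta>"] by eventually_elim (auto intro!: derivative_eq_intros)
          show "((\<lambda>t. y t - ap \<beta> t) \<longlongrightarrow> 0 - B) at_top" by (intro tendsto_intros y0 B)
        qed
      next
        case False
        have \<beta>0: "\<beta> ~= 0" using False by auto
        have large: "EV t. 2 <= \<bar>ap \<beta> t\<bar>"
        proof -
          have "\<not> \<bar>\<beta>\<bar> < cst 2"
          proof
            assume "\<bar>\<beta>\<bar> < cst 2"
            then have "EV t. ap \<bar>\<beta>\<bar> t < ap (cst 2) t" by (simp add: hf_less_def)
            with ev_abs[of \<beta>] ev_cst[of 2] have "EV t. \<bar>ap \<beta> t\<bar> <= 2" by eventually_elim simp
            then show False using False by blast
          qed
          from hf_not_less_ev[OF this] ev_abs[of \<beta>] ev_cst[of 2] show ?thesis by eventually_elim simp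
        qed
        have "EV t. \<bar>y t\<bar> <= 1" using tendsto_imp_bounded[OF y0] by simp
        with large have "EV t. \<bar>ap \<beta> t\<bar> <= 2 * \<bar>y t - ap \<beta> t\<bar> \<and> \<bar>y t - ap \<beta> t\<bar> <= 2 * \<bar>ap \<beta> t\<bar>"
        proof eventually_elim
          case (elim t)
          show ?case using elim abs_triangle_ineq4[of "y t" "ap \<beta> t"] abs_triangle_ineq4[of "y t" "y t - ap \<beta> t"] by simp
        qed
        then have "sim (ap \<beta>) (\<lambda>t. y t - ap \<beta> t)" by (rule simI[rotated]) simp
        then show ?thesis by (rule has_val_sim[OF has_val_In[OF G In_ap]])
      qed
    qed
  qed
  from In_add[OF this In_const[of "ln L"]] show ?thesis by (simp add: y_def)
qed

section \<open>Skolem functions as elements of the Hardy field\<close>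

definition hexp :: "hf => hf" where "hexp a = mk (\<lambda>t. exp (ap a t))"

definition hln :: "hf => hf" where "hln a = mk (\<lambda>t. ln (ap a t))"

text \<open>
  The field is not closed under logarithms: \<open>t\<close>, the logarithm of \<open>exp t\<close>, grows too slowly to be
  admitted.
\<close>

definition ldom :: "hf set" where "ldom = {a. 0 < a \<and> In (\<lambda>t. ln (ap a t))}"

definition hpow :: "hf => hf => hf" where "hpow a b = hexp (b * hln a)"

definition hx :: hf where "hx = mk (\<lambda>t. exp (exp t))"

lemma ev_hexp: "EV t. ap (hexp a) t = exp (ap a t)"
  unfolding hexp_def by (rule ap_mk[OF In_exp])

lemma ev_hln: "a \<in> ldom ==> (EV t. ap (hln a) t = ln (ap a t))"
  unfolding hln_def ldom_def by (rule ap_mk) simp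

lemma ldom_pos: "a \<in> ldom ==> 0 < a" and ev_ldom_pos: "a \<in> ldom ==> (EV t. 0 < ap a t)"
  by (auto simp: ldom_def hf_less_def)

lemma ldomI:
  assumes "EV t. 0 < ap a t" "EV t. ln (ap a t) = F t" "In F"
  shows "a \<in> ldom"
  using assms In_cong[OF assms(2)] by (simp add: ldom_def hf_less_def)

lemma hln_eqI:
  assumes "a \<in> ldom" "EV t. ln (ap a t) = ap b t"
  shows "hln a = b"
  unfolding hf_eq_iff using ev_hln[OF assms(1)] assms(2) by eventually_elim simp

lemma ldom_mult:
  assumes "a \<in> ldom" "b \<in> ldom"
  shows "a * b \<in> ldom" "hln (a * b) = hln a + hln b"
proof -
  have p: "EV t. 0 < ap (a * b) t"
    using ev_mult[of a b] ev_ldom_pos[OF assms(1)] ev_ldom_pos[OF assms(2)] by eventually_elim simp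
  have l: "EV t. ln (ap (a * b) t) = ap (hln a + hln b) t"
    using ev_mult[of a b] ev_ldom_pos[OF assms(1)] ev_ldom_pos[OF assms(2)] ev_hln[OF assms(1)] ev_hln[OF assms(2)]
      ev_add[of "hln a" "hln b"] by eventually_elim (simp add: ln_mult)
  show "a * b \<in> ldom" by (rule ldomI[OF p l]) simp
  then show "hln (a * b) = hln a + hln b" using l by (rule hln_eqI)
qed

lemma ldom_divide:
  assumes "a \<in> ldom" "b \<in> ldom"
  shows "a / b \<in> ldom"
proof -
  have p: "EV t. 0 < ap (a / b) t"
    using ev_divide[of a b] ev_ldom_pos[OF assms(1)] ev_ldom_pos[OF assms(2)] by eventually_elim simp
  have l: "EV t. ln (ap (a / b) t) = ap (hln a - hln b) t"
    using ev_divide[of a b] ev_ldom_pos[OF assms(1)] ev_ldom_pos[OF assms(2)] ev_hln[OF assms(1)] ev_hln[OF assms(2)]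
      ev_diff[of "hln a" "hln b"] by eventually_elim (simp add: ln_div)
  show ?thesis by (rule ldomI[OF p l]) simp
qed

text \<open>
  \<open>a + b = a \<cdot> (1 + b / a)\<close>, and the second factor lies between one and two.
\<close>

lemma ldom_add_le:
  assumes "a \<in> ldom" "b \<in> ldom" "b <= a"
  shows "a + b \<in> ldom"
proof -
  define c where "c = 1 + b / a"
  have c: "EV t. ap c t = 1 + ap b t / ap a t"
    using ev_add[of 1 "b / a"] ev_divide[of b a] ev_one by eventually_elim (simp add: c_def)
  have le: "EV t. ap b t <= ap a t" using assms(3) by (simp add: hf_le_def)
  have "EV t. 1 <= ap c t \<and> ap c t <= 2"
    using c le ev_ldom_pos[OF assms(1)] ev_ldom_pos[OF assms(2)] by eventually_elim simp
  then have "In (\<lambda>t. ln (ap c t))" by (rule In_ln_unit[rotated]) simp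
  moreover have "0 < c" using assms(1,2) by (auto simp: c_def dest!: ldom_pos intro!: add_pos_pos)
  ultimately have "c \<in> ldom" by (simp add: ldom_def)
  moreover have "a + b = a * c" using ldom_pos[OF assms(1)] by (simp add: c_def field_simps)
  ultimately show ?thesis using ldom_mult(1)[OF assms(1)] by simp
qed

lemma ldom_add: "a \<in> ldom ==> b \<in> ldom ==> a + b \<in> ldom"
  using ldom_add_le[of a b] ldom_add_le[of b a] by (metis add.commute linear)

lemma ldom_hexp: "hexp a \<in> ldom" "hln (hexp a) = a"
proof -
  have l: "EV t. ln (ap (hexp a) t) = ap a t" using ev_hexp[of a] by eventually_elim simp
  show "hexp a \<in> ldom" by (rule ldomI[OF _ l]) (use ev_hexp[of a] in \<open>eventually_elim, simp\<close>, simp)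
  then show "hln (hexp a) = a" using l by (rule hln_eqI)
qed

lemma hln_le: "a \<in> ldom ==> hln a <= a - 1"
  unfolding hf_le_def
proof -
  assume a: "a \<in> ldom"
  show "EV t. ap (hln a) t <= ap (a - 1) t"
    using ev_hln[OF a] ev_ldom_pos[OF a] ev_diff[of a 1] ev_one
    by eventually_elim (simp add: ln_le_minus_one)
qed

lemma ev_hpow: "a \<in> ldom ==> (EV t. ap (hpow a b) t = ap a t powr ap b t)"
proof -
  assume a: "a \<in> ldom"
  show ?thesis
    using ev_hexp[of "b * hln a"] ev_mult[of b "hln a"] ev_hln[OF a] ev_ldom_pos[OF a]
    by eventually_elim (simp add: hpow_def powr_def)
qed

lemma ev_hx: "EV t. ap hx t = exp (exp t)"
proof -
  have "In (\<lambda>t. exp (ap (mk exp) t))" by (rule In_exp)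
  moreover have "EV t. exp (ap (mk exp) t) = exp (exp t)" using ap_mk[OF In_exp_id] by eventually_elim simp
  ultimately have "In (\<lambda>t. exp (exp t))"
    using In_cong[of "\<lambda>t. exp (ap (mk exp) t)" "\<lambda>t. exp (exp t)"] by simp
  then show ?thesis unfolding hx_def by (rule ap_mk)
qed

lemma hx_ldom: "hx \<in> ldom" "EV t. ap (hln hx) t = exp t"
proof -
  have l: "EV t. ln (ap hx t) = exp t" using ev_hx by eventually_elim simp
  show "hx \<in> ldom" by (rule ldomI[OF _ l In_exp_id]) (use ev_hx in \<open>eventually_elim, simp\<close>)
  from ev_hln[OF this] l show "EV t. ap (hln hx) t = exp t" by eventually_elim simp
qed

lemma infinite_ev: "1 \<lless> a ==> 0 < a ==> (EV t. K < ap a t)"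
proof -
  assume a: "1 \<lless> a" "0 < a"
  have "EV t. (\<bar>K\<bar> + 1) * ap 1 t < ap a t" using a by (intro ev_hf_ll) auto
  then show ?thesis using ev_one by eventually_elim simp
qed

lemma ev_linear_le_exp: "0 < c ==> (EV t. 2 * t <= exp (c * t))"
proof -
  assume c: "0 < c"
  have "EV t. 4 / c <= exp (c / 2 * t)" using c by (intro ev_exp_ge) simp
  then show ?thesis using eventually_ge_at_top[of 0]
  proof eventually_elim
    case (elim t)
    have "(4 / c) * (c / 2 * t) <= exp (c / 2 * t) * exp (c / 2 * t)"
      using elim c exp_ge_add_one_self[of "c / 2 * t"] by (intro mult_mono) (linarith | simp)+
    then show ?case using c by (simp flip: exp_add)
  qed
qed

text \<open>
  The logarithm of an infinite \<open>a\<close> is infinite, hence at least \<open>exp (c * t)\<close>, and this exceeds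
  \<open>2 * t\<close>. Therefore \<open>a\<close> exceeds \<open>exp (2 * t)\<close>, the square of \<open>ln x = exp t\<close>.
\<close>

lemma hf_gap:
  assumes a: "a \<in> ldom" "1 \<lless> a"
  shows "hln hx \<lless> a"
proof -
  have ainf: "EV t. K < ap a t" for K using infinite_ev[OF a(2) ldom_pos[OF a(1)]] .
  have bounded: False if "EV t. \<bar>ap (hln a) t\<bar> <= K" for K
  proof -
    from that ev_hln[OF a(1)] ainf[of "exp K"] ev_ldom_pos[OF a(1)] have "EV t. False"
    proof eventually_elim
      case (elim t)
      then have "ap a t = exp (ap (hln a) t)" by simp
      also have "\<dots> <= exp K" using elim(1) by (simp add: abs_le_iff)
      finally show ?case using elim(3) by simp
    qed
    then show False by simp
  qed
  have "hln a ~= 0" using bounded[of 0] by auto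
  from hf_good[OF this] have "large (ap (hln a))" unfolding good_def
  proof (elim disjE conjE)
    assume "sim (\<lambda>_. 1) (ap (hln a))"
    then obtain C where "EV t. \<bar>1\<bar> <= C * \<bar>ap (hln a) t\<bar> \<and> \<bar>ap (hln a) t\<bar> <= C * \<bar>1 :: real\<bar>" by (rule simE)
    then have "EV t. \<bar>ap (hln a) t\<bar> <= C" by eventually_elim simp
    then show ?thesis using bounded by blast
  qed (use tiny_le[of "ap (hln a)" 1] zero_less_one bounded in blast)+
  then obtain c where c: "0 < c" and large: "EV t. exp (c * t) <= \<bar>ap (hln a) t\<bar>" by (auto simp: large_def)
  have main: "EV t. real n * exp t < ap a t" for n :: nat
    using large ev_hln[OF a(1)] ainf[of 1] ev_linear_le_exp[OF c] ev_exp_ge[OF zero_less_one, of "real n + 1"]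
  proof eventually_elim
    case (elim t)
    have "0 < ln (ap a t)" using elim(3) by simp
    then have "2 * t <= ln (ap a t)" using elim(1,2,4) by simp
    then have "exp (2 * t) <= ap a t" using elim(3) by (simp add: ln_ge_iff)
    moreover have "exp (2 * t) = exp t * exp t" by (simp flip: exp_add)
    moreover have "(real n + 1) * exp t <= exp t * exp t" using elim(5) by (intro mult_right_mono) auto
    ultimately show ?case by (simp add: distrib_right) (smt (verit) exp_gt_zero)
  qed
  show ?thesis unfolding ll_iff
  proof
    fix n :: nat
    have "of_nat n * hln hx < a" unfolding hf_less_def
      using main[of n] hx_ldom(2) ev_mult[of "of_nat n" "hln hx"] ev_of_nat[of n] by eventually_elim simp
    moreover have "0 <= hln hx" unfolding hf_le_def using hx_ldom(2) by eventually_elim simp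
    ultimately show "of_nat n * \<bar>hln hx\<bar> < \<bar>a\<bar>" using ldom_pos[OF a(1)] by simp
  qed
qed

lemma ev_exp_exp_iff: "(EV t. A (exp (exp t))) \<longleftrightarrow> ev A"
proof
  assume "ev A"
  moreover have "filterlim (\<lambda>t :: real. exp (exp t)) at_top at_top"
    using filterlim_compose[OF exp_at_top exp_at_top] .
  ultimately show "EV t. A (exp (exp t))" by (rule eventually_compose_filterlim)
next
  assume h: "EV t. A (exp (exp t))"
  have "filterlim (\<lambda>x :: real. ln (ln x)) at_top at_top"
    using filterlim_compose[OF ln_at_top ln_at_top] .
  with h have "EV x. A (exp (exp (ln (ln x))))" by (rule eventually_compose_filterlim)
  then show "ev A" using eventually_gt_at_top[of 1] by eventually_elim simp
qed

lemma rep_germ_ops: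
  shows "EV x. rep_germ 1 x = 1"
    and "EV x. rep_germ (germ_of F) x = F x"
    and "EV x. rep_germ (f + g) x = rep_germ f x + rep_germ g x"
    and "EV x. rep_germ (f * g) x = rep_germ f x * rep_germ g x"
    and "EV x. rep_germ (germ_powr f g) x = rep_germ f x powr rep_germ g x"
    and "f < g \<longleftrightarrow> (EV x. rep_germ f x < rep_germ g x)"
    and "f = g \<longleftrightarrow> (EV x. rep_germ f x = rep_germ g x)"
proof -
  have F: "EV x. rep_germ (germ_of F) x = F x" for F
    unfolding germ_of_eq_iff[symmetric] by (rule germ_of_rep)
  show "EV x. rep_germ (germ_of F) x = F x" by (rule F)
  show "EV x. rep_germ 1 x = 1" unfolding one_germ_def by (rule F)
  note abs = germ_of_rep[of f, symmetric] germ_of_rep[of g, symmetric]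
  have "f + g = germ_of (\<lambda>x. rep_germ f x + rep_germ g x)"
    by (subst abs(1), subst abs(2)) (rule plus_germ.abs_eq)
  then show "EV x. rep_germ (f + g) x = rep_germ f x + rep_germ g x" by (simp only: F)
  have "f * g = germ_of (\<lambda>x. rep_germ f x * rep_germ g x)"
    by (subst abs(1), subst abs(2)) (rule times_germ.abs_eq)
  then show "EV x. rep_germ (f * g) x = rep_germ f x * rep_germ g x" by (simp only: F)
  have "germ_powr f g = germ_of (\<lambda>x. rep_germ f x powr rep_germ g x)"
    by (subst abs(1), subst abs(2)) (rule germ_powr.abs_eq)
  then show "EV x. rep_germ (germ_powr f g) x = rep_germ f x powr rep_germ g x" by (simp only: F)
  show "f < g \<longleftrightarrow> (EV x. rep_germ f x < rep_germ g x)"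
    by (subst abs(1), subst abs(2)) (rule less_germ.abs_eq)
  show "f = g \<longleftrightarrow> (EV x. rep_germ f x = rep_germ g x)"
    by (subst abs(1), subst abs(2)) (rule germ_of_eq_iff)
qed

text \<open>
  The field uses the variable \<open>t\<close> with \<open>x = exp (exp t)\<close>.
\<close>

definition represents :: "hf => germ => bool" where
  "represents a f \<longleftrightarrow> a \<in> ldom \<and> (EV t. ap a t = rep_germ f (exp (exp t)))"

lemma represents_unique: "represents a f ==> represents b f ==> a = b"
  unfolding represents_def hf_eq_iff by (auto elim: eventually_elim2)

lemma represents_less_iff:
  assumes "represents a f" "represents b g"
  shows "a < b \<longleftrightarrow> f < g" "a = b \<longleftrightarrow> f = g"
proof -
  have ab: "EV t. ap a t = rep_germ f (exp (exp t)) \<and> ap b t = rep_germ g (exp (exp t))"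
    using assms unfolding represents_def by (simp add: eventually_conj)
  show "a < b \<longleftrightarrow> f < g"
    unfolding hf_less_def rep_germ_ops(6) ev_exp_exp_iff[of "\<lambda>x. rep_germ f x < rep_germ g x", symmetric]
    using ab by (intro eventually_subst) (auto elim: eventually_mono)
  show "a = b \<longleftrightarrow> f = g"
    unfolding hf_eq_iff rep_germ_ops(7) ev_exp_exp_iff[of "\<lambda>x. rep_germ f x = rep_germ g x", symmetric]
    using ab by (intro eventually_subst) (auto elim: eventually_mono)
qed

lemma ev_expI: "ev A ==> (EV t. A (exp (exp t)))"
  by (simp only: ev_exp_exp_iff)

lemma represents_one: "represents 1 1"
proof -
  have l: "EV t. ln (ap 1 t) = 0" using ev_one by eventually_elim simp
  have "1 \<in> ldom" by (rule ldomI[OF _ l In_const]) (use ev_one in \<open>eventually_elim, simp\<close>)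
  moreover have "EV t. ap 1 t = rep_germ 1 (exp (exp t))"
    using ev_one ev_expI[OF rep_germ_ops(1)] by eventually_elim simp
  ultimately show ?thesis by (simp add: represents_def)
qed

lemma represents_ident: "represents hx (germ_of (\<lambda>x. x))"
  unfolding represents_def using hx_ldom(1) ev_hx ev_expI[OF rep_germ_ops(2)[of "\<lambda>x. x"]]
  by (auto elim: eventually_elim2)

lemma represents_ops:
  assumes "represents a f" "represents b g"
  shows "represents (a + b) (f + g)" "represents (a * b) (f * g)" "represents (hpow a b) (germ_powr f g)"
proof -
  have d: "a \<in> ldom" "b \<in> ldom" using assms by (auto simp: represents_def)
  have ea: "EV t. ap a t = rep_germ f (exp (exp t))" and eb: "EV t. ap b t = rep_germ g (exp (exp t))"
    using assms by (auto simp: represents_def)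
  have "EV t. ap (a + b) t = rep_germ (f + g) (exp (exp t))"
    using ea eb ev_add[of a b] ev_expI[OF rep_germ_ops(3)[of f g]] by eventually_elim simp
  then show "represents (a + b) (f + g)" using ldom_add d by (simp add: represents_def)
  have "EV t. ap (a * b) t = rep_germ (f * g) (exp (exp t))"
    using ea eb ev_mult[of a b] ev_expI[OF rep_germ_ops(4)[of f g]] by eventually_elim simp
  then show "represents (a * b) (f * g)" using ldom_mult d by (simp add: represents_def)
  have "EV t. ap (hpow a b) t = rep_germ (germ_powr f g) (exp (exp t))"
    using ea eb ev_hpow[OF d(1), of b] ev_expI[OF rep_germ_ops(5)[of f g]] by eventually_elim simp
  then show "represents (hpow a b) (germ_powr f g)" using ldom_hexp by (simp add: represents_def hpow_def)
qed

definition skolem :: "hf set" where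
  "skolem = {a. \<exists>f\<in>Sk. represents a f}"

lemma Sk_represented: "f \<in> Sk ==> \<exists>a. represents a f"
  by (induction rule: Sk.induct) (blast intro: represents_one represents_ident represents_ops)+

text \<open>
  Sums, products and powers of positive integers are positive integers. Hence two distinct Skolem
  functions differ by at least one at all large integers.
\<close>

lemma Sk_integral:
  "f \<in> Sk ==> eventually (\<lambda>n :: nat. \<exists>k :: nat. 0 < k \<and> rep_germ f (real n) = real k) sequentially"
proof (induction rule: Sk.induct)
  case one
  from rep_germ_ops(1) filterlim_real_sequentially have "eventually (\<lambda>n. rep_germ 1 (real n) = 1) sequentially"
    by (rule eventually_compose_filterlim)
  then show ?case by eventually_elim (auto intro: exI[of _ 1])
next
  case ident
  from rep_germ_ops(2)[of "\<lambda>x. x"] filterlim_real_sequentially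
  have "eventually (\<lambda>n. rep_germ (germ_of (\<lambda>x. x)) (real n) = real n) sequentially"
    by (rule eventually_compose_filterlim)
  then show ?case using eventually_gt_at_top[of 0] by eventually_elim auto
next
  case (add f g)
  from rep_germ_ops(3)[of f g] filterlim_real_sequentially
  have "eventually (\<lambda>n. rep_germ (f + g) (real n) = rep_germ f (real n) + rep_germ g (real n)) sequentially"
    by (rule eventually_compose_filterlim)
  then show ?case using add.IH
  proof eventually_elim
    case (elim n)
    then obtain k l :: nat where "0 < k" "rep_germ f (real n) = real k" "rep_germ g (real n) = real l" by blast
    then show ?case using elim by (intro exI[of _ "k + l"]) simp
  qed
next
  case (mult f g)
  from rep_germ_ops(4)[of f g] filterlim_real_sequentially
  have "eventually (\<lambda>n. rep_germ (f * g) (real n) = rep_germ f (real n) * rep_germ g (real n)) sequentially"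
    by (rule eventually_compose_filterlim)
  then show ?case using mult.IH
  proof eventually_elim
    case (elim n)
    then obtain k l :: nat where "0 < k" "rep_germ f (real n) = real k" "0 < l" "rep_germ g (real n) = real l" by blast
    then show ?case using elim by (intro exI[of _ "k * l"]) simp
  qed
next
  case (powr f g)
  from rep_germ_ops(5)[of f g] filterlim_real_sequentially
  have "eventually (\<lambda>n. rep_germ (germ_powr f g) (real n) = rep_germ f (real n) powr rep_germ g (real n)) sequentially"
    by (rule eventually_compose_filterlim)
  then show ?case using powr.IH
  proof eventually_elim
    case (elim n)
    then obtain k l :: nat where "0 < k" "rep_germ f (real n) = real k" "rep_germ g (real n) = real l" by blast
    then show ?case using elim by (intro exI[of _ "k ^ l"]) (simp add: powr_realpow)
  qed
qed

lemma skolem_discrete: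
  assumes "a \<in> skolem" "b \<in> skolem" "a < b"
  shows "a + 1 <= b"
proof (rule ccontr)
  obtain f g where fg: "f \<in> Sk" "represents a f" "g \<in> Sk" "represents b g" using assms by (auto simp: skolem_def)
  assume "\<not> a + 1 <= b"
  then have "b < a + 1" by simp
  then have "g < f + 1" using represents_less_iff[OF fg(4) represents_ops(1)[OF fg(2) represents_one]] by simp
  then have 1: "EV x. rep_germ g x < rep_germ (f + 1) x" by (simp only: rep_germ_ops(6))
  have "f < g" using represents_less_iff(1)[OF fg(2,4)] assms(3) by simp
  then have 2: "EV x. rep_germ f x < rep_germ g x" by (simp only: rep_germ_ops(6))
  from 1 2 rep_germ_ops(3)[of f 1] rep_germ_ops(1)
  have "EV x. rep_germ f x < rep_germ g x \<and> rep_germ g x < rep_germ f x + 1" by eventually_elim simp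
  from eventually_compose_filterlim[OF this filterlim_real_sequentially] Sk_integral[OF fg(1)] Sk_integral[OF fg(3)]
  have "eventually (\<lambda>n :: nat. False) sequentially"
  proof eventually_elim
    case (elim n)
    then obtain k l :: nat where "rep_germ f (real n) = real k" "rep_germ g (real n) = real l" by blast
    then have "real k < real l" "real l < real (Suc k)" using elim(1) by auto
    then show ?case by (simp only: of_nat_less_iff)
  qed
  then show False by simp
qed

interpretation sk: skolem_field ldom skolem hln hpow hx
proof
  show "0 < a" if "a \<in> ldom" for a using that by (rule ldom_pos)
  show "a + b \<in> ldom" if "a \<in> ldom" "b \<in> ldom" for a b using that by (rule ldom_add)
  show "a * b \<in> ldom" "hln (a * b) = hln a + hln b" if "a \<in> ldom" "b \<in> ldom" for a b using that by (rule ldom_mult)+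
  show "a / b \<in> ldom" if "a \<in> ldom" "b \<in> ldom" for a b using that by (rule ldom_divide)
  show "hpow a b \<in> ldom" if "a \<in> ldom" for a b unfolding hpow_def by (rule ldom_hexp)
  show "hln a <= a - 1" if "a \<in> ldom" for a using that by (rule hln_le)
  show "hln (hpow a b) = b * hln a" if "a \<in> ldom" for a b unfolding hpow_def by (rule ldom_hexp)
  show "skolem \<subseteq> ldom" by (auto simp: skolem_def represents_def)
  show "1 \<in> skolem" unfolding skolem_def using Sk.one represents_one by blast
  show "hx \<in> skolem" unfolding skolem_def using Sk.ident represents_ident by blast
  show "a + b \<in> skolem" if "a \<in> skolem" "b \<in> skolem" for a b
    using that unfolding skolem_def using Sk.add represents_ops(1) by blast
  show "a * b \<in> skolem" if "a \<in> skolem" "b \<in> skolem" for a b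
    using that unfolding skolem_def using Sk.mult represents_ops(2) by blast
  show "hpow a b \<in> skolem" if "a \<in> skolem" "b \<in> skolem" for a b
    using that unfolding skolem_def using Sk.powr represents_ops(3) by blast
  show "R a" if a: "a \<in> skolem" and R: "R 1" "R hx"
    "\<And>f g. f \<in> skolem ==> g \<in> skolem ==> R f ==> R g ==> R (f + g)"
    "\<And>f g. f \<in> skolem ==> g \<in> skolem ==> R f ==> R g ==> R (f * g)"
    "\<And>f g. f \<in> skolem ==> g \<in> skolem ==> R f ==> R g ==> R (hpow f g)" for a R
  proof -
    have "\<exists>b. represents b f \<and> b \<in> skolem \<and> R b" if "f \<in> Sk" for f
      using that
    proof (induction rule: Sk.induct)
      case one
      then show ?case using R(1) represents_one Sk.one by (auto simp: skolem_def)
    next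
      case ident
      then show ?case using R(2) represents_ident Sk.ident by (auto simp: skolem_def)
    next
      case (add f g)
      then obtain b c where bc: "represents b f" "b \<in> skolem" "R b" "represents c g" "c \<in> skolem" "R c" by blast
      have "b + c \<in> skolem" using add.hyps represents_ops(1)[OF bc(1,4)] Sk.add unfolding skolem_def by blast
      then show ?case using R(3)[OF bc(2,5,3,6)] represents_ops(1)[OF bc(1,4)] by blast
    next
      case (mult f g)
      then obtain b c where bc: "represents b f" "b \<in> skolem" "R b" "represents c g" "c \<in> skolem" "R c" by blast
      have "b * c \<in> skolem" using mult.hyps represents_ops(2)[OF bc(1,4)] Sk.mult unfolding skolem_def by blast
      then show ?case using R(4)[OF bc(2,5,3,6)] represents_ops(2)[OF bc(1,4)] by blast
    next
      case (powr f g)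
      then obtain b c where bc: "represents b f" "b \<in> skolem" "R b" "represents c g" "c \<in> skolem" "R c" by blast
      have "hpow b c \<in> skolem" using powr.hyps represents_ops(3)[OF bc(1,4)] Sk.powr unfolding skolem_def by blast
      then show ?case using R(5)[OF bc(2,5,3,6)] represents_ops(3)[OF bc(1,4)] by blast
    qed
    then show ?thesis using a represents_unique unfolding skolem_def by blast
  qed
  show "a + 1 <= b" if "a \<in> skolem" "b \<in> skolem" "a < b" for a b using that by (rule skolem_discrete)
  show "1 \<lless> hx" unfolding ll_iff
  proof
    fix n :: nat
    have "EV t. real n + 1 <= exp (1 * t)" by (rule ev_exp_ge) simp
    then have "EV t. ap (of_nat n) t < ap hx t"
      using ev_of_nat[of n] ev_hx
    proof eventually_elim
      case (elim t)
      have "exp t + 1 <= exp (exp t)" using exp_ge_add_one_self[of "exp t"] by (simp only: add.commute)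
      then show ?case using elim by simp
    qed
    then have "of_nat n < hx" by (simp add: hf_less_def)
    then show "of_nat n * \<bar>1\<bar> < \<bar>hx\<bar>" using ldom_pos[OF hx_ldom(1)] by simp
  qed
  show "hln hx \<lless> a" if "a \<in> ldom" "1 \<lless> a" for a using that by (rule hf_gap)
qed

theorem proposition25p1:
  fixes m :: nat
  assumes "m > 0"
  shows "order_type (Sk_below (germ_of (\<lambda>x. iter_exp2 3 (x ^ m)))) <o omega_tower 10"
proof -
  define R where "R = (\<lambda>x :: real. iter_exp2 3 (x ^ m))"
  define e where "e = hpow 2 (hpow 2 (hpow 2 (hx ^ m)))"
  have two: "2 \<in> ldom" "EV t. ap 2 t = 2" using sk.two_Dom ev_of_nat[of 2] by simp_all
  have eR: "EV t. ap e t = R (exp (exp t))"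
    using ev_hpow[OF two(1), of "hpow 2 (hpow 2 (hx ^ m))"] ev_hpow[OF two(1), of "hpow 2 (hx ^ m)"]
      ev_hpow[OF two(1), of "hx ^ m"] two(2) ev_power[of hx m] ev_hx
    by eventually_elim (simp add: e_def R_def eval_nat_numeral)
  obtain t where t: "t < tower 10" "tp (<) {a \<in> skolem. a < e} t"
    using sk.skolem_tower_bound[OF assms] by (auto simp: e_def)
  obtain \<phi> where \<phi>: "\<And>f. f \<in> Sk ==> represents (\<phi> f) f" using Sk_represented by metis
  have below: "\<phi> f < e" if f: "f \<in> Sk" "f < germ_of R" for f
  proof -
    have 1: "EV x. rep_germ f x < R x"
      using f(2) rep_germ_ops(2)[of R] unfolding rep_germ_ops(6) by eventually_elim simp
    have 2: "EV t. ap (\<phi> f) t = rep_germ f (exp (exp t))" using \<phi>[OF f(1)] by (simp add: represents_def)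
    show ?thesis unfolding hf_less_def using ev_expI[OF 1] 2 eR by eventually_elim simp
  qed
  have "tp (<) (Sk_below (germ_of R)) t"
  proof (rule tp_image[OF t(2), where g = \<phi>])
    fix f assume "f \<in> Sk_below (germ_of R)"
    then show "\<phi> f \<in> {a \<in> skolem. a < e}" using \<phi> below by (auto simp: Sk_below_def skolem_def)
  next
    fix f g assume "f \<in> Sk_below (germ_of R)" "g \<in> Sk_below (germ_of R)" "f < g"
    then show "\<phi> f < \<phi> g" using represents_less_iff(1)[OF \<phi> \<phi>] by (simp add: Sk_below_def)
  qed simp
  moreover
  have "f < g \<or> f = g \<or> g < f" if "f \<in> Sk_below (germ_of R)" "g \<in> Sk_below (germ_of R)" for f g
  proof -
    have fg: "f \<in> Sk" "g \<in> Sk" using that by (auto simp: Sk_below_def)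
    show ?thesis using represents_less_iff[OF \<phi>[OF fg(1)] \<phi>[OF fg(2)]] represents_less_iff(1)[OF \<phi>[OF fg(2)] \<phi>[OF fg(1)]]
        less_linear[of "\<phi> f" "\<phi> g"] by blast
  qed
  then have "f <= g \<or> g <= f" if "f \<in> Sk_below (germ_of R)" "g \<in> Sk_below (germ_of R)" for f g
    using that by (auto simp: less_eq_germ_def)
  ultimately show ?thesis using tp_imp_ordLess[of "Sk_below (germ_of R)" t 10] t(1) by (simp add: R_def)
qed

end
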